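(* Let $\alpha_0\in\mathrm{Pic}^\circ(X)$ be a nef Cartier divisor class whose associated lattice polytope $P$ is full-dimensional. Consider an ideal $I=\langle f_1,\dots,f_n\rangle\subset S$, where $n=\dim X$ and $f_j\in S_{d_j\cdot\alpha_0}=H^0(X,\mathscr{O}_X(d_j\cdot\alpha_0))$ with $d_j\in\mathbb{N}$, such that $V_X(I)$ is a complete intersection (that is, zero-dimensional). Let $c$ be the codegree of $P$. Then, for every integer $t<c$, $\left(\sum_j d_j-t\right)\alpha_0\in\mathrm{Reg}(I)$, and $\left(\left(\sum_j d_j-(c-1)\right)\alpha_0,\ \alpha_0\right)$ is a regularity pair for $I$.
   Context: $X=X_\Sigma$ is the normal toric variety over $\mathbb{C}$ of a complete rational polyhedral fan $\Sigma$ in $N_{\mathbb R}\simeq\mathbb{R}^n$, $M$ is the dual lattice of $N$, $\rho_1,\dots,\rho_k$ are the rays with primitive generators $u_1,\dots,u_k$ and torus-invariant prime divisors $D_1,\dots,D_k$. The Cox ring is $S=\mathbb{C}[x_1,\dots,x_k]$, graded by the class group $\mathrm{Cl}(X)$ via $\deg x_i=[D_i]$, with graded pieces $S_\alpha$; $x^{\hat\sigma}=\prod_{\rho_i\notin\sigma}x_i$ and $B=\langle x^{\hat\sigma}\mid\sigma\in\Sigma\rangle$ is the irrelevant ideal. $\pi:\mathbb{C}^k\setminus\mathrm{Var}_{\mathbb{C}^k}(B)\to X$ is the Cox quotient map; for homogeneous $f$, $\mathrm{Var}_X(f)=\{\zeta\in X\mid f(x)=0\text{ for some }x\in\pi^{-1}(\zeta)\}$.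 A homogeneous ideal $I\subset S$ defines a closed subscheme $V_X(I)\subset X$, given on the chart $U_\sigma$ by $(I_{x^{\hat\sigma}})_0\subset(S_{x^{\hat\sigma}})_0\simeq\mathbb{C}[U_\sigma]$; $\mathrm{Var}_X(I)$ is its reduced variety. $V_X(I)$ is a complete intersection if $I$ can be generated by $\mathrm{codim}_XV_X(I)$ homogeneous elements. The polytope of $\alpha=[\sum a_iD_i]$ is $\{m\in M_{\mathbb R}\mid\langle u_i,m\rangle+a_i\ge0,\ i=1,\dots,k\}$ (well defined up to lattice translation). The codegree of a polytope $P$ is the smallest $c\in\mathbb{N}$ such that $c\cdot P$ contains a lattice point in its relative interior. A point $\zeta\in X$ is a basepoint of $\alpha\in\mathrm{Cl}(X)$ if $\zeta\in\mathrm{Var}_X(f)$ for all $f\in S_\alpha$; $\alpha$ is basepoint free if it has no basepoints, and $V_X(I)$-basepoint free if no point of $\mathrm{Var}_X(I)$ is a basepoint of $\alpha$. $\mathrm{Pic}^\circ(X)=\{\alpha\in\mathrm{Pic}(X)\mid\alpha\text{ basepoint free}\}$ (classes of nef Cartier divisors). For $V_X(I)$ zero-dimensional of degree $\delta^+$ (number of points counted with multiplicity), $\mathrm{Reg}(I)=\{\alpha\in\mathrm{Cl}(X)\mid\dim_{\mathbb C}(S/I)_\alpha=\delta^+,\ I_\alpha=(I:B^\infty)_\alpha,\ \alpha\text{ is }V_X(I)\text{-basepoint free}\}$. A pair $(\alpha,\alpha_0)\in\mathrm{Cl}(X)^2$ is a regularity pair if $\alpha,\alpha+\alpha_0\in\mathrm{Reg}(I)$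 and $\alpha_0$ is $V_X(I)$-basepoint free. *)

theory Defs
  imports
    "HOL-Analysis.Analysis"
    "HOL-Library.Poly_Mapping"
    "HOL-Library.Function_Algebras"
    "HOL-Algebra.Coset"
begin

text \<open>
  Conventions. A basis of \<open>N\<close> is fixed, so \<open>N\<close> and \<open>M\<close> are both \<open>int ^ 'n\<close> with the standard
  pairing, and \<open>n = CARD('n)\<close>. The rays are indexed by a finite type \<open>'k\<close>; \<open>u i\<close> is the
  primitive generator of the ray \<open>i\<close>. Rings of polynomials, Laurent polynomials and characters
  are monoid algebras \<open>G \<Rightarrow>\<^sub>0 complex\<close> over \<open>nat ^ 'k\<close>, \<open>int ^ 'k\<close> and \<open>M = int ^ 'n\<close>.
\<close>

section \<open>Fans\<close>

definition real_vec :: "int ^ 'n \<Rightarrow> real ^ 'n" where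
  "real_vec v = (\<chi> i. real_of_int (v $ i))"

definition pairing :: "int ^ 'n \<Rightarrow> int ^ 'n \<Rightarrow> int" where
  "pairing v m = (\<Sum>i\<in>UNIV. v $ i * m $ i)"

definition rational_polyhedral_cone :: "(real ^ 'n) set \<Rightarrow> bool" where
  "rational_polyhedral_cone \<sigma> \<longleftrightarrow>
     (\<exists>G :: (int ^ 'n) set. finite G \<and> \<sigma> = convex_cone hull (real_vec ` G))"

definition strongly_convex :: "(real ^ 'n) set \<Rightarrow> bool" where
  "strongly_convex \<sigma> \<longleftrightarrow> \<sigma> \<inter> uminus ` \<sigma> = {0}"

text \<open>\<open>face_of\<close> admits the empty set, which is not a face of a cone.\<close>

definition fan :: "(real ^ 'n) set set \<Rightarrow> bool" where
  "fan \<Sigma> \<longleftrightarrow> finite \<Sigma> \<and>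
     (\<forall>\<sigma>\<in>\<Sigma>. rational_polyhedral_cone \<sigma> \<and> strongly_convex \<sigma>) \<and>
     (\<forall>\<sigma>\<in>\<Sigma>. \<forall>\<tau>. \<tau> face_of \<sigma> \<and> \<tau> \<noteq> {} \<longrightarrow> \<tau> \<in> \<Sigma>) \<and>
     (\<forall>\<sigma>\<in>\<Sigma>. \<forall>\<sigma>'\<in>\<Sigma>. (\<sigma> \<inter> \<sigma>') face_of \<sigma> \<and> (\<sigma> \<inter> \<sigma>') face_of \<sigma>')"

definition complete_fan :: "(real ^ 'n) set set \<Rightarrow> bool" where
  "complete_fan \<Sigma> \<longleftrightarrow> fan \<Sigma> \<and> \<Union>\<Sigma> = UNIV"

definition rays :: "(real ^ 'n) set set \<Rightarrow> (real ^ 'n) set set" where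
  "rays \<Sigma> = {\<rho> \<in> \<Sigma>. aff_dim \<rho> = 1}"

text \<open>The primitive generator of a ray \<open>\<rho>\<close> is the generator of the semigroup \<open>\<rho> \<inter> N\<close>.\<close>

definition primitive_generator :: "int ^ 'n \<Rightarrow> (real ^ 'n) set \<Rightarrow> bool" where
  "primitive_generator v \<rho> \<longleftrightarrow> {w. real_vec w \<in> \<rho>} = {int l *s v | l :: nat. True}"

definition ray_generators :: "(real ^ 'n) set set \<Rightarrow> ('k::finite \<Rightarrow> int ^ 'n) \<Rightarrow> bool" where
  "ray_generators \<Sigma> u \<longleftrightarrow> bij_betw u UNIV {v. \<exists>\<rho>\<in>rays \<Sigma>. primitive_generator v \<rho>}"


section \<open>The toric variety of a fan\<close>

definition dual_semigroup :: "(real ^ 'n) set \<Rightarrow> (int ^ 'n) set" where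
  "dual_semigroup \<sigma> = {m. \<forall>x\<in>\<sigma>. 0 \<le> x \<bullet> real_vec m}"

text \<open>Points of \<open>U\<^sub>\<sigma>\<close> are the monoid homomorphisms from \<open>\<sigma>\<^sup>\<or> \<inter> M\<close> to the multiplicative monoid \<open>\<complex>\<close>.\<close>

definition chart :: "(real ^ 'n) set \<Rightarrow> (int ^ 'n \<Rightarrow> complex) set" where
  "chart \<sigma> = {\<gamma> \<in> extensional (dual_semigroup \<sigma>). \<gamma> 0 = 1 \<and>
     (\<forall>m\<in>dual_semigroup \<sigma>. \<forall>m'\<in>dual_semigroup \<sigma>. \<gamma> (m + m') = \<gamma> m * \<gamma> m')}"

text \<open>\<open>U\<^sub>\<sigma>\<close> and \<open>U\<^sub>\<sigma>\<^sub>'\<close> are glued along \<open>U\<^sub>\<sigma>\<^sub>\<inter>\<^sub>\<sigma>\<^sub>'\<close>, which is embedded in both by restricting homomorphisms.\<close>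

definition gluing :: "(real ^ 'n) set set \<Rightarrow>
    (((real ^ 'n) set \<times> (int ^ 'n \<Rightarrow> complex)) \<times> ((real ^ 'n) set \<times> (int ^ 'n \<Rightarrow> complex))) set" where
  "gluing \<Sigma> = {((\<sigma>, \<gamma>), (\<sigma>', \<gamma>')). \<sigma> \<in> \<Sigma> \<and> \<sigma>' \<in> \<Sigma> \<and>
     (\<exists>\<delta>\<in>chart (\<sigma> \<inter> \<sigma>'). \<gamma> = restrict \<delta> (dual_semigroup \<sigma>) \<and> \<gamma>' = restrict \<delta> (dual_semigroup \<sigma>'))}"

type_synonym 'n toric_point = "((real ^ 'n) set \<times> (int ^ 'n \<Rightarrow> complex)) set"

definition toric_variety :: "(real ^ 'n) set set \<Rightarrow> 'n toric_point set" where
  "toric_variety \<Sigma> = (SIGMA \<sigma>:\<Sigma>. chart \<sigma>) // gluing \<Sigma>"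

definition chart_points :: "(real ^ 'n) set set \<Rightarrow> (real ^ 'n) set \<Rightarrow> 'n toric_point set" where
  "chart_points \<Sigma> \<sigma> = {\<zeta> \<in> toric_variety \<Sigma>. \<exists>\<gamma>. (\<sigma>, \<gamma>) \<in> \<zeta>}"

definition chart_coord :: "(real ^ 'n) set \<Rightarrow> 'n toric_point \<Rightarrow> int ^ 'n \<Rightarrow> complex" where
  "chart_coord \<sigma> \<zeta> = (THE \<gamma>. (\<sigma>, \<gamma>) \<in> \<zeta>)"

definition chart_ring :: "(real ^ 'n) set \<Rightarrow> ((int ^ 'n) \<Rightarrow>\<^sub>0 complex) set" where
  "chart_ring \<sigma> = {g. Poly_Mapping.keys g \<subseteq> dual_semigroup \<sigma>}"

text \<open>The value at \<open>\<zeta> \<in> U\<^sub>\<sigma>\<close> of a regular function \<open>g \<in> \<complex>[U\<^sub>\<sigma>]\<close>.\<close>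

definition chart_value :: "(real ^ 'n) set \<Rightarrow> ((int ^ 'n) \<Rightarrow>\<^sub>0 complex) \<Rightarrow> 'n toric_point \<Rightarrow> complex" where
  "chart_value \<sigma> g \<zeta> =
     (\<Sum>m\<in>Poly_Mapping.keys g. Poly_Mapping.lookup g m * chart_coord \<sigma> \<zeta> m)"

definition zariski :: "(real ^ 'n) set set \<Rightarrow> 'n toric_point topology" where
  "zariski \<Sigma> = topology_generated_by
     {{\<zeta> \<in> chart_points \<Sigma> \<sigma>. chart_value \<sigma> g \<zeta> \<noteq> 0} | \<sigma> g. \<sigma> \<in> \<Sigma> \<and> g \<in> chart_ring \<sigma>}"

definition irreducible_closed :: "'a topology \<Rightarrow> 'a set \<Rightarrow> bool" where
  "irreducible_closed T Z \<longleftrightarrow> closedin T Z \<and> Z \<noteq> {} \<and>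
     (\<forall>A B. closedin T A \<and> closedin T B \<and> Z = A \<union> B \<longrightarrow> A = Z \<or> B = Z)"

definition irreducible_chain :: "'a topology \<Rightarrow> 'a set \<Rightarrow> nat \<Rightarrow> bool" where
  "irreducible_chain T Y e \<longleftrightarrow>
     (\<exists>Z. (\<forall>i\<le>e. irreducible_closed T (Z i) \<and> Z i \<subseteq> Y) \<and> (\<forall>i<e. Z i \<subset> Z (Suc i)))"

text \<open>Krull dimension of a closed subset \<open>Y\<close>; the empty set has no dimension in \<open>\<nat>\<close>.\<close>

definition has_dimension :: "'a topology \<Rightarrow> 'a set \<Rightarrow> nat \<Rightarrow> bool" where
  "has_dimension T Y e \<longleftrightarrow> irreducible_chain T Y e \<and> (\<forall>e'>e. \<not> irreducible_chain T Y e')"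


section \<open>The class group\<close>

text \<open>The group of torus-invariant Weil divisors \<open>\<Sum> a\<^sub>i D\<^sub>i\<close>; the divisor of the character \<open>\<chi>\<^sup>m\<close> is \<open>\<Sum> \<langle>u\<^sub>i, m\<rangle> D\<^sub>i\<close>.\<close>

definition torus_divisors :: "(int ^ 'k) monoid" where
  "torus_divisors = \<lparr>carrier = UNIV, monoid.mult = (+), one = 0\<rparr>"

definition char_divisor :: "('k::finite \<Rightarrow> int ^ 'n) \<Rightarrow> int ^ 'n \<Rightarrow> int ^ 'k" where
  "char_divisor u m = (\<chi> i. pairing (u i) m)"

text \<open>The elements of \<open>Cl(X)\<close> are cosets, i.e. sets of linearly equivalent torus-invariant divisors.\<close>

definition Cl :: "('k::finite \<Rightarrow> int ^ 'n) \<Rightarrow> (int ^ 'k) set monoid" where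
  "Cl u = torus_divisors Mod range (char_divisor u)"

definition divisor_class :: "('k::finite \<Rightarrow> int ^ 'n) \<Rightarrow> int ^ 'k \<Rightarrow> (int ^ 'k) set" where
  "divisor_class u a = range (char_divisor u) #>\<^bsub>torus_divisors\<^esub> a"

text \<open>A torus-invariant divisor is Cartier iff on every \<open>U\<^sub>\<sigma>\<close> it is the divisor of a character.\<close>

definition cartier :: "(real ^ 'n) set set \<Rightarrow> ('k::finite \<Rightarrow> int ^ 'n) \<Rightarrow> int ^ 'k \<Rightarrow> bool" where
  "cartier \<Sigma> u a \<longleftrightarrow>
     (\<forall>\<sigma>\<in>\<Sigma>. \<exists>m. \<forall>i. real_vec (u i) \<in> \<sigma> \<longrightarrow> a $ i = pairing (u i) m)"

definition Pic :: "(real ^ 'n) set set \<Rightarrow> ('k::finite \<Rightarrow> int ^ 'n) \<Rightarrow> (int ^ 'k) set set" where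
  "Pic \<Sigma> u = {divisor_class u a | a. cartier \<Sigma> u a}"

definition polytope_of :: "('k::finite \<Rightarrow> int ^ 'n) \<Rightarrow> int ^ 'k \<Rightarrow> (real ^ 'n) set" where
  "polytope_of u a = {m. \<forall>i. 0 \<le> real_vec (u i) \<bullet> m + real_of_int (a $ i)}"

text \<open>The bound \<open>1 \<le> c\<close> is needed: \<open>0 \<cdot> P = {0}\<close> contains a lattice point in its relative interior.\<close>

definition codegree :: "(real ^ 'n) set \<Rightarrow> nat" where
  "codegree P = (LEAST c. 1 \<le> c \<and> (\<exists>m. real_vec m \<in> rel_interior ((\<lambda>x. real c *\<^sub>R x) ` P)))"


section \<open>The Cox ring\<close>

type_synonym 'k cox = "(nat ^ 'k) \<Rightarrow>\<^sub>0 complex"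

lemma module_mult: "module ((*) :: 'a::comm_ring_1 \<Rightarrow> 'a \<Rightarrow> 'a)"
  by unfold_locales (simp_all add: algebra_simps)

definition ideal_gen :: "'a::comm_ring_1 set \<Rightarrow> 'a set" where
  "ideal_gen F = module.span (*) F"

primrec ideal_power :: "'a::comm_ring_1 set \<Rightarrow> nat \<Rightarrow> 'a set" where
  "ideal_power J 0 = UNIV"
| "ideal_power J (Suc l) = ideal_gen {a * b | a b. a \<in> J \<and> b \<in> ideal_power J l}"

definition saturation :: "'a::comm_ring_1 set \<Rightarrow> 'a set \<Rightarrow> 'a set" where
  "saturation I J = {f. \<exists>l. \<forall>b\<in>ideal_power J l. f * b \<in> I}"

definition cox_eval :: "'k::finite cox \<Rightarrow> complex ^ 'k \<Rightarrow> complex" where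
  "cox_eval f x =
     (\<Sum>e\<in>Poly_Mapping.keys f. Poly_Mapping.lookup f e * (\<Prod>i\<in>UNIV. (x $ i) ^ (e $ i)))"

text \<open>\<open>x\<^sup>e\<close> has degree \<open>[\<Sum> e\<^sub>i D\<^sub>i]\<close>, so it lies in \<open>S\<^sub>\<alpha>\<close> iff \<open>e\<close> is an element of the coset \<open>\<alpha>\<close>.\<close>

definition cox_piece :: "(int ^ 'k) set \<Rightarrow> 'k::finite cox set" where
  "cox_piece \<alpha> = {f. \<forall>e\<in>Poly_Mapping.keys f. (\<chi> i. int (e $ i)) \<in> \<alpha>}"

definition homogeneous :: "('k::finite \<Rightarrow> int ^ 'n) \<Rightarrow> 'k cox \<Rightarrow> bool" where
  "homogeneous u f \<longleftrightarrow> (\<exists>\<alpha>\<in>carrier (Cl u). f \<in> cox_piece \<alpha>)"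

definition x_hat :: "('k::finite \<Rightarrow> int ^ 'n) \<Rightarrow> (real ^ 'n) set \<Rightarrow> 'k cox" where
  "x_hat u \<sigma> = Poly_Mapping.single (\<chi> i. if real_vec (u i) \<in> \<sigma> then 0 else 1) 1"

definition irrelevant_ideal :: "(real ^ 'n) set set \<Rightarrow> ('k::finite \<Rightarrow> int ^ 'n) \<Rightarrow> 'k cox set" where
  "irrelevant_ideal \<Sigma> u = ideal_gen (x_hat u ` \<Sigma>)"

definition Var_affine :: "'k::finite cox set \<Rightarrow> (complex ^ 'k) set" where
  "Var_affine J = {x. \<forall>f\<in>J. cox_eval f x = 0}"

text \<open>In the chart \<open>U\<^sub>\<sigma>\<close> with \<open>x\<^sup>\<sigma>\<close>-hat nonzero at \<open>x\<close>, the point \<open>\<pi>(x)\<close> is the homomorphism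
  \<open>m \<mapsto> \<Prod> x\<^sub>i\<^bsup>\<langle>u\<^sub>i, m\<rangle>\<^esup>\<close> (only nonzero \<open>x\<^sub>i\<close> can occur with a negative exponent).\<close>

definition cox_local :: "('k::finite \<Rightarrow> int ^ 'n) \<Rightarrow> (real ^ 'n) set \<Rightarrow> complex ^ 'k \<Rightarrow> int ^ 'n \<Rightarrow> complex" where
  "cox_local u \<sigma> x = restrict (\<lambda>m. \<Prod>i\<in>UNIV. (x $ i) powi (pairing (u i) m)) (dual_semigroup \<sigma>)"

definition cox_quotient :: "(real ^ 'n) set set \<Rightarrow> ('k::finite \<Rightarrow> int ^ 'n) \<Rightarrow> complex ^ 'k \<Rightarrow> 'n toric_point" where
  "cox_quotient \<Sigma> u x =
     gluing \<Sigma> `` {(\<sigma>, cox_local u \<sigma> x) | \<sigma>. \<sigma> \<in> \<Sigma> \<and> cox_eval (x_hat u \<sigma>) x \<noteq> 0}"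

definition Var_section :: "(real ^ 'n) set set \<Rightarrow> ('k::finite \<Rightarrow> int ^ 'n) \<Rightarrow> 'k cox \<Rightarrow> 'n toric_point set" where
  "Var_section \<Sigma> u f = {\<zeta> \<in> toric_variety \<Sigma>.
     \<exists>x. x \<notin> Var_affine (irrelevant_ideal \<Sigma> u) \<and> cox_quotient \<Sigma> u x = \<zeta> \<and> cox_eval f x = 0}"

definition basepoint :: "(real ^ 'n) set set \<Rightarrow> ('k::finite \<Rightarrow> int ^ 'n) \<Rightarrow> (int ^ 'k) set \<Rightarrow> 'n toric_point \<Rightarrow> bool" where
  "basepoint \<Sigma> u \<alpha> \<zeta> \<longleftrightarrow> \<zeta> \<in> toric_variety \<Sigma> \<and> (\<forall>f\<in>cox_piece \<alpha>. \<zeta> \<in> Var_section \<Sigma> u f)"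

definition Pic_nef :: "(real ^ 'n) set set \<Rightarrow> ('k::finite \<Rightarrow> int ^ 'n) \<Rightarrow> (int ^ 'k) set set" where
  "Pic_nef \<Sigma> u = {\<alpha> \<in> Pic \<Sigma> u. \<forall>\<zeta>\<in>toric_variety \<Sigma>. \<not> basepoint \<Sigma> u \<alpha> \<zeta>}"


section \<open>The subscheme of a homogeneous ideal\<close>

text \<open>The localization \<open>S \<subseteq> S\<^sub>x\<^sub>\<sigma> \<subseteq> \<complex>[x\<^sub>1\<^sup>\<plusminus>, \<dots>, x\<^sub>k\<^sup>\<plusminus>]\<close> takes place in the Laurent polynomial ring, and
  \<open>\<complex>[U\<^sub>\<sigma>]\<close> is identified with the degree-zero part of \<open>S\<^sub>x\<^sub>\<sigma>\<close> by \<open>\<chi>\<^sup>m \<mapsto> \<Prod> x\<^sub>i\<^bsup>\<langle>u\<^sub>i, m\<rangle>\<^esup>\<close>.\<close>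

definition to_laurent :: "'k::finite cox \<Rightarrow> (int ^ 'k) \<Rightarrow>\<^sub>0 complex" where
  "to_laurent f =
     (\<Sum>e\<in>Poly_Mapping.keys f. Poly_Mapping.single (\<chi> i. int (e $ i)) (Poly_Mapping.lookup f e))"

definition homogenize :: "('k::finite \<Rightarrow> int ^ 'n) \<Rightarrow> ((int ^ 'n) \<Rightarrow>\<^sub>0 complex) \<Rightarrow> (int ^ 'k) \<Rightarrow>\<^sub>0 complex" where
  "homogenize u g =
     (\<Sum>m\<in>Poly_Mapping.keys g. Poly_Mapping.single (char_divisor u m) (Poly_Mapping.lookup g m))"

text \<open>\<open>g\<close> corresponds to a fraction \<open>f / (x\<^sup>\<sigma>)\<^sup>l\<close> with \<open>f \<in> I\<close>.\<close>

definition chart_ideal :: "('k::finite \<Rightarrow> int ^ 'n) \<Rightarrow> 'k cox set \<Rightarrow> (real ^ 'n) set \<Rightarrow>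
    ((int ^ 'n) \<Rightarrow>\<^sub>0 complex) set" where
  "chart_ideal u I \<sigma> = {g \<in> chart_ring \<sigma>.
     \<exists>l. \<exists>f\<in>I. to_laurent f = to_laurent (x_hat u \<sigma>) ^ l * homogenize u g}"

definition Var :: "(real ^ 'n) set set \<Rightarrow> ('k::finite \<Rightarrow> int ^ 'n) \<Rightarrow> 'k cox set \<Rightarrow> 'n toric_point set" where
  "Var \<Sigma> u I = {\<zeta> \<in> toric_variety \<Sigma>.
     \<forall>\<sigma>\<in>\<Sigma>. \<zeta> \<in> chart_points \<Sigma> \<sigma> \<longrightarrow> (\<forall>g\<in>chart_ideal u I \<sigma>. chart_value \<sigma> g \<zeta> = 0)}"

definition basepoint_free_on :: "(real ^ 'n) set set \<Rightarrow> ('k::finite \<Rightarrow> int ^ 'n) \<Rightarrow> 'k cox set \<Rightarrow> (int ^ 'k) set \<Rightarrow> bool" where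
  "basepoint_free_on \<Sigma> u I \<alpha> \<longleftrightarrow> (\<forall>\<zeta>\<in>Var \<Sigma> u I. \<not> basepoint \<Sigma> u \<alpha> \<zeta>)"

definition zero_dimensional :: "(real ^ 'n) set set \<Rightarrow> ('k::finite \<Rightarrow> int ^ 'n) \<Rightarrow> 'k cox set \<Rightarrow> bool" where
  "zero_dimensional \<Sigma> u I \<longleftrightarrow> has_dimension (zariski \<Sigma>) (Var \<Sigma> u I) 0"

text \<open>The generators form a list, since repetitions and zeros are allowed among them.\<close>

definition complete_intersection :: "(real ^ 'n) set set \<Rightarrow> ('k::finite \<Rightarrow> int ^ 'n) \<Rightarrow> 'k cox set \<Rightarrow> bool" where
  "complete_intersection \<Sigma> u I \<longleftrightarrow>
     (\<exists>F dX dV. (\<forall>f\<in>set F. homogeneous u f) \<and> I = ideal_gen (set F) \<and>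
        has_dimension (zariski \<Sigma>) (toric_variety \<Sigma>) dX \<and>
        has_dimension (zariski \<Sigma>) (Var \<Sigma> u I) dV \<and> length F + dV = dX)"

text \<open>Dimension of the quotient \<open>V / W\<close> of complex vector spaces.\<close>

definition quotient_dim :: "(complex \<Rightarrow> 'v \<Rightarrow> 'v) \<Rightarrow> 'v::ab_group_add set \<Rightarrow> 'v set \<Rightarrow> enat" where
  "quotient_dim smul V W = Sup {enat (card B) | B. finite B \<and> B \<subseteq> V \<and>
     (\<forall>r. (\<Sum>b\<in>B. smul (r b) b) \<in> W \<longrightarrow> (\<forall>b\<in>B. r b = 0))}"

text \<open>Functions that agree near \<open>\<zeta>\<close> with a fraction \<open>g / s\<close>, where \<open>g \<in> A \<sigma>\<close>, \<open>s \<in> \<complex>[U\<^sub>\<sigma>]\<close> and \<open>s \<zeta> \<noteq> 0\<close>.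
  Values away from \<open>\<zeta>\<close> are arbitrary, so that these are representatives of germs; in a quotient
  of two such spaces only the germs matter, as both contain all functions that vanish near \<open>\<zeta>\<close>.\<close>

definition germs :: "(real ^ 'n) set set \<Rightarrow> 'n toric_point \<Rightarrow>
    ((real ^ 'n) set \<Rightarrow> ((int ^ 'n) \<Rightarrow>\<^sub>0 complex) set) \<Rightarrow> ('n toric_point \<Rightarrow> complex) set" where
  "germs \<Sigma> \<zeta> A = {h. \<exists>\<sigma>\<in>\<Sigma>. \<zeta> \<in> chart_points \<Sigma> \<sigma> \<and>
     (\<exists>g\<in>A \<sigma>. \<exists>s\<in>chart_ring \<sigma>. chart_value \<sigma> s \<zeta> \<noteq> 0 \<and>
        (\<forall>\<xi>\<in>chart_points \<Sigma> \<sigma>. chart_value \<sigma> s \<xi> \<noteq> 0 \<longrightarrow>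
           h \<xi> = chart_value \<sigma> g \<xi> / chart_value \<sigma> s \<xi>))}"

text \<open>The dimension of the local ring of \<open>V\<^sub>X(I)\<close> at \<open>\<zeta>\<close>, i.e. of the local ring of \<open>X\<close> modulo the stalk of the ideal sheaf.\<close>

definition multiplicity_at :: "(real ^ 'n) set set \<Rightarrow> ('k::finite \<Rightarrow> int ^ 'n) \<Rightarrow> 'k cox set \<Rightarrow> 'n toric_point \<Rightarrow> enat" where
  "multiplicity_at \<Sigma> u I \<zeta> =
     quotient_dim (\<lambda>c h \<xi>. c * h \<xi>) (germs \<Sigma> \<zeta> chart_ring) (germs \<Sigma> \<zeta> (chart_ideal u I))"

text \<open>Only meaningful for zero-dimensional \<open>V\<^sub>X(I)\<close>, which has finitely many points.\<close>

definition scheme_degree :: "(real ^ 'n) set set \<Rightarrow> ('k::finite \<Rightarrow> int ^ 'n) \<Rightarrow> 'k cox set \<Rightarrow> enat" where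
  "scheme_degree \<Sigma> u I = (\<Sum>\<zeta>\<in>Var \<Sigma> u I. multiplicity_at \<Sigma> u I \<zeta>)"


section \<open>Regularity\<close>

definition Reg :: "(real ^ 'n) set set \<Rightarrow> ('k::finite \<Rightarrow> int ^ 'n) \<Rightarrow> 'k cox set \<Rightarrow> (int ^ 'k) set set" where
  "Reg \<Sigma> u I = {\<alpha> \<in> carrier (Cl u).
     quotient_dim (\<lambda>c. Poly_Mapping.map ((*) c)) (cox_piece \<alpha>) (I \<inter> cox_piece \<alpha>) = scheme_degree \<Sigma> u I \<and>
     I \<inter> cox_piece \<alpha> = saturation I (irrelevant_ideal \<Sigma> u) \<inter> cox_piece \<alpha> \<and>
     basepoint_free_on \<Sigma> u I \<alpha>}"

definition regularity_pair :: "(real ^ 'n) set set \<Rightarrow> ('k::finite \<Rightarrow> int ^ 'n) \<Rightarrow> 'k cox set \<Rightarrow>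
    (int ^ 'k) set \<Rightarrow> (int ^ 'k) set \<Rightarrow> bool" where
  "regularity_pair \<Sigma> u I \<alpha> \<alpha>\<^sub>0 \<longleftrightarrow> \<alpha> \<in> carrier (Cl u) \<and> \<alpha>\<^sub>0 \<in> carrier (Cl u) \<and>
     \<alpha> \<in> Reg \<Sigma> u I \<and> \<alpha> \<otimes>\<^bsub>Cl u\<^esub> \<alpha>\<^sub>0 \<in> Reg \<Sigma> u I \<and> basepoint_free_on \<Sigma> u I \<alpha>\<^sub>0"

end

theory Submission imports Defs "HOL-Computational_Algebra.Fundamental_Theorem_Algebra" begin

text \<open>The sections of the multiples of the divisor form the semigroup ring of the cone over \<open>P\<close>, and the lattice
points \<open>p\<close> of \<open>m P\<close> are its monomials of degree \<open>m\<close>. A generic triangulation of the cone shows that its Koszul homology over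
monomial parameters vanishes, and graded Nakayama transfers this to every system of parameters: \<open>f\<^sub>1, \<dots>, f\<^sub>n\<close> and a section
\<open>f\<^sub>0\<close> of degree 1 without zeros on the subvariety form a regular sequence. Counting lattice points in the half-open boxes of the
triangulation, reflected into the interior of the cone, shows that the Hilbert function of the quotient by
\<open>f\<^sub>1, \<dots>, f\<^sub>n\<close> is constant above \<open>d\<^sub>1 + \<dots> + d\<^sub>n - c\<close>. In these degrees multiplication by \<open>f\<^sub>0\<close> is
bijective on the quotient, which gives saturation, and the Chinese remainder theorem splits the quotient into the local rings of the
points, so that the constant is the degree. The points are found as characters of the section ring.\<close>

text \<open>The class is only nef, so the map from X to the toric variety of \<open>P\<close> may
  contract subvarieties, and a character of the section ring need not determine a point of X.
  Zero-dimensionality repairs this: the equations are sections of multiples of the class, so a point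
  of the subvariety in a contracted locus would bring infinitely many others with it. The codegree
  enters as the least degree of a lattice point interior to the cone over \<open>P\<close>. It makes
  the Hilbert series of the section ring a rational function of degree at most -c. Each
  \<open>f_j\<close> adds \<open>d_j\<close> to the degree and removes one of the n + 1 poles at 1;
  the single pole left after n steps means a constant Hilbert function beyond the degree. A cone
  that is not simplicial has no system of parameters made of monomials. Hence the Koszul complex is
  first taken over powers of all N generators in degree 1, where its homology stops at N - n - 1,
  and these are traded for n + 1 parameters. Countably many monomials against uncountably many
  complex numbers, and an ultrafilter on an infinite set of points, stand in for Noetherian
  arguments.\<close>

notation (input) iff (infixr "<->" 25)
notation scaleR (infixr "\<cdot>" 75)
abbreviation "dsg == dual_semigroup"
abbreviation "cval == chart_value"
abbreviation "cring == chart_ring"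
abbreviation "rv == real_vec"
abbreviation "laur == to_laurent"
abbreviation "cpts == chart_points"
abbreviation "cdiv == char_divisor"
abbreviation "tvar == toric_variety"
lemmas dsg_def = dual_semigroup_def and
 cval_def = chart_value_def and
 cring_def = chart_ring_def and
 rv_def = real_vec_def and
 laur_def = to_laurent_def and
 cpts_def = chart_points_def and
 cdiv_def = char_divisor_def and
 tvar_def = toric_variety_def

section \<open>Monoid algebras\<close>

abbreviation lkp :: "('g \<Rightarrow>\<^sub>0 'a::zero) => 'g => 'a" where "lkp == Poly_Mapping.lookup"
abbreviation msing :: "'g => 'a::zero => 'g \<Rightarrow>\<^sub>0 'a" where "msing == Poly_Mapping.single"
abbreviation pkeys :: "('g \<Rightarrow>\<^sub>0 'a::zero) => 'g set" where "pkeys == Poly_Mapping.keys"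

text \<open>Evaluation at a character (\<open>mev\<close>) and the map induced by a map of exponents
  (\<open>monmap\<close>) are both of this form, so additivity and multiplicativity are proved once
  for the two.\<close>

definition monext :: "('g => 'a => 'b) => ('g \<Rightarrow>\<^sub>0 'a::zero) => 'b::comm_monoid_add" where
 "monext ph r = (SUM w:pkeys r. ph w (lkp r w))"

lemma pm_sum_single: "r = (SUM w:pkeys r. msing w (lkp r w))"
 by (rule poly_mapping_eqI) (auto simp: lookup_sum lookup_single when_def sum.delta in_keys_iff)

lemma poly_mapping_mult_sum:
 fixes r s :: "'g::comm_monoid_add \<Rightarrow>\<^sub>0 'a::comm_semiring_1"
 shows "r * s = (SUM v:pkeys r. SUM w:pkeys s. msing (v + w) (lkp r v * lkp s w))"
proof-
 have "r * s = (SUM v:pkeys r. msing v (lkp r v)) * (SUM w:pkeys s. msing w (lkp s w))"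
  using pm_sum_single[of r] pm_sum_single[of s] by simp
 thus ?thesis by (simp add: sum_product mult_single)
qed

lemma lookup_single_mult:
 fixes r :: "'g::ab_group_add \<Rightarrow>\<^sub>0 'a::comm_semiring_1"
 shows "lkp (msing v c * r) w = c * lkp r (w - v)"
proof-
 have "msing v c * r = (SUM x:pkeys r. msing (v + x) (c * lkp r x))" by (subst pm_sum_single[of r]) (simp add: sum_distrib_left mult_single)
 hence "lkp (msing v c * r) w = (SUM x:pkeys r. if x = w - v then c * lkp r x else 0)"
  by (auto simp: lookup_sum lookup_single when_def algebra_simps intro!: sum.cong)
 thus ?thesis by (auto simp: in_keys_iff)
qed

locale monext_additive =
 fixes ph :: "'g => 'a::comm_monoid_add => 'b::comm_monoid_add"
 assumes zero: "ph w 0 = 0" and add: "ph w (x + y) = ph w x + ph w y"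
begin

lemma monext_superset:
 "finite K ==> pkeys r <= K ==> monext ph r = (SUM w:K. ph w (lkp r w))"
 unfolding monext_def by (rule sum.mono_neutral_left) (auto simp: in_keys_iff zero)

lemma monext_zero: "monext ph 0 = 0"
 by (simp add: monext_def)

lemma monext_add: "monext ph (r + s) = monext ph r + monext ph s"
proof-
 let ?K = "pkeys r Un pkeys s"
 have "monext ph (r + s) = (SUM w:?K. ph w (lkp (r + s) w))" by (rule monext_superset) (auto simp: keys_add)
 also have "... = (SUM w:?K. ph w (lkp r w)) + (SUM w:?K. ph w (lkp s w))" by (simp add: lookup_add add sum.distrib)
 finally show ?thesis by (simp add: monext_superset[of ?K])
qed

lemma monext_sum: "monext ph (sum F A) = (SUM i:A. monext ph (F i))"
 by (induction A rule: infinite_finite_induct) (auto simp: monext_zero monext_add)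

lemma monext_single: "monext ph (msing w c) = ph w c"
 by (cases "c = 0") (auto simp: monext_def zero)

end

text \<open>Multiplicativity is asked on \<open>D\<close> only: characters of a subsemigroup are
  total functions with arbitrary values elsewhere.\<close>

locale monext_multiplicative = monext_additive ph
 for ph :: "'g::comm_monoid_add => 'a::comm_semiring_1 => 'b::comm_semiring_1" +
 fixes D :: "'g set"
 assumes one: "ph 0 1 = 1"
  and mult: "v : D ==> w : D ==> ph (v + w) (x * y) = ph v x * ph w y"
begin

lemma monext_mult:
 assumes "pkeys r <= D" "pkeys s <= D"
 shows "monext ph (r * s) = monext ph r * monext ph s"
proof-
 have "monext ph (r * s) = (SUM v:pkeys r. SUM w:pkeys s. ph (v + w) (lkp r v * lkp s w))"
  by (simp add: poly_mapping_mult_sum monext_sum monext_single)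
 also have "... = (SUM v:pkeys r. SUM w:pkeys s. ph v (lkp r v) * ph w (lkp s w))" using assms by (intro sum.cong refl mult) auto
 finally show ?thesis by (simp add: sum_product monext_def)
qed

end

definition submon :: "'g::monoid_add set => bool" where
 "submon D <-> 0 : D & (ALL v:D. ALL w:D. v + w : D)"

definition monalg :: "'g set => ('g \<Rightarrow>\<^sub>0 complex) set" where
 "monalg D = {r. pkeys r <= D}"

abbreviation cst :: "complex => ('g::zero) \<Rightarrow>\<^sub>0 complex" where "cst c == msing 0 c"

lemma monalg_0: "0 : monalg D"
 by (simp add: monalg_def)

lemma monalg_add: "r : monalg D ==> s : monalg D ==> r + s : monalg D"
 using keys_add[of r s] by (auto simp: monalg_def)

lemma monalg_uminus: "r : monalg D ==> - r : monalg D"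
 by (auto simp: monalg_def in_keys_iff)

lemma monalg_diff: "r : monalg D ==> s : monalg D ==> r - s : monalg D"
 using monalg_add[of r D "- s"] monalg_uminus by auto

lemma monalg_sum: "(!!i. i : A ==> F i : monalg D) ==> sum F A : monalg D"
 by (induction A rule: infinite_finite_induct) (auto intro: monalg_0 monalg_add)

lemma monalg_single: "w : D ==> msing w c : monalg D"
 by (auto simp: monalg_def)

lemma monalg_cst: "submon D ==> cst c : monalg D"
 by (auto simp: monalg_def submon_def)

lemma monalg_1: "submon D ==> 1 : monalg D"
 using monalg_cst[of D 1] by simp

lemma monalg_mult:
 "submon D ==> r : monalg D ==> s : monalg D ==> r * s : monalg D"
proof-
 assume a: "submon D" "r : monalg D" "s : monalg D"
 have "x : D" if "x : pkeys (r * s)" for x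
 proof-
  obtain v w where "x = v + w" "v : pkeys r" "w : pkeys s" using keys_mult[of r s] `x : _` by auto
  thus ?thesis using a by (auto simp: monalg_def submon_def)
 qed
 thus "r * s : monalg D" by (auto simp: monalg_def)
qed

lemma monalg_power: "submon D ==> r : monalg D ==> r ^ k : monalg D"
 by (induction k) (auto intro: monalg_mult monalg_1)

definition mev :: "('g => complex) => ('g \<Rightarrow>\<^sub>0 complex) => complex" where
 "mev ga = monext (%w c. c * ga w)"

interpretation mev: monext_additive "%w c. c * ga w" for ga :: "'g => complex" by unfold_locales (auto simp: algebra_simps)

lemmas mev_superset = mev.monext_superset[folded mev_def]
 and mev_zero[simp] = mev.monext_zero[folded mev_def]
 and mev_add = mev.monext_add[folded mev_def]
 and mev_sum = mev.monext_sum[folded mev_def]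
 and mev_single[simp] = mev.monext_single[folded mev_def]

text \<open>The value 0 is allowed, so these are all points of the affine toric variety of
  \<open>D\<close>, not just those of its torus.\<close>

definition mchar :: "'g::comm_monoid_add set => ('g => complex) => bool" where
 "mchar D ga <-> ga 0 = 1 & (ALL v:D. ALL w:D. ga (v + w) = ga v * ga w)"

lemma mev_uminus: "mev ga (- r) = - mev ga r"
 using mev_add[of ga r "- r"] by (simp add: add_eq_0_iff)

lemma mev_diff: "mev ga (r - s) = mev ga r - mev ga s"
 using mev_add[of ga r "- s"] by (simp add: mev_uminus)

lemma mev_one: "ga 0 = 1 ==> mev ga 1 = 1"
 using mev_single[of ga 0 1] by simp

lemma mev_cong: "(!!w. w : pkeys r ==> ga w = ga' w) ==> mev ga r = mev ga' r"
 by (simp add: mev_def monext_def)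

lemma mev_mult:
 assumes "mchar D ga" "r : monalg D" "s : monalg D"
 shows "mev ga (r * s) = mev ga r * mev ga s"
proof-
 interpret monext_multiplicative "%w c. c * ga w" D using assms(1) by unfold_locales (auto simp: mchar_def)
 show ?thesis using monext_mult assms(2,3) by (simp add: mev_def monalg_def)
qed

lemma mev_power:
 assumes "mchar D ga" "submon D" "r : monalg D"
 shows "mev ga (r ^ k) = mev ga r ^ k"
 using assms by (induction k)
  (auto simp: mev_mult[of D] monalg_power mev_one mchar_def)

definition monmap :: "('g => 'h) => ('g \<Rightarrow>\<^sub>0 complex) => 'h \<Rightarrow>\<^sub>0 complex" where
 "monmap h = monext (%w c. msing (h w) c)"

interpretation monmap: monext_additive "%w c. msing (h w) (c::complex)" for h :: "'g => 'h" by unfold_locales (auto simp: single_add)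

lemmas monmap_zero[simp] = monmap.monext_zero[folded monmap_def]
 and monmap_add = monmap.monext_add[folded monmap_def]
 and monmap_sum = monmap.monext_sum[folded monmap_def]
 and monmap_single[simp] = monmap.monext_single[folded monmap_def]

definition additive_map :: "('g::comm_monoid_add => 'h::comm_monoid_add) => bool" where
 "additive_map h <-> h 0 = 0 & (ALL v w. h (v + w) = h v + h w)"

lemma monmap_one: "h 0 = 0 ==> monmap h 1 = 1"
 using monmap_single[of h 0 1] by simp

lemma monmap_mult:
 assumes "additive_map h"
 shows "monmap h (r * s) = monmap h r * monmap h s"
proof-
 interpret monext_multiplicative "%w c. msing (h w) (c::complex)" UNIV
  using assms by unfold_locales (auto simp: additive_map_def mult_single)
 show ?thesis using monext_mult by (simp add: monmap_def)
qed

lemma monmap_power: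
 assumes "additive_map h"
 shows "monmap h (r ^ k) = monmap h r ^ k"
 using assms by (induction k) (auto simp: monmap_mult monmap_one additive_map_def)

lemma lookup_monmap:
 assumes "inj h"
 shows "lkp (monmap h r) (h w) = lkp r w"
 using assms unfolding monmap_def monext_def by (auto simp: lookup_sum lookup_single when_def inj_eq in_keys_iff)

lemma keys_monmap: "pkeys (monmap h r) <= h ` pkeys r"
proof
 fix x assume "x : pkeys (monmap h r)"
 hence "(SUM w:pkeys r. lkp (msing (h w) (lkp r w)) x) ~= 0" by (simp add: in_keys_iff monmap_def monext_def lookup_sum)
 then obtain w where "w : pkeys r" "lkp (msing (h w) (lkp r w)) x ~= 0" by (meson sum.not_neutral_contains_not_neutral)
 thus "x : h ` pkeys r" by (auto simp: lookup_single when_def split: if_splits)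
qed

lemma keys_monmap_inj: "inj h ==> pkeys (monmap h r) = h ` pkeys r"
 using keys_monmap[of h r] by (auto simp: in_keys_iff lookup_monmap)

lemma monmap_inj: "inj h ==> monmap h r = monmap h s ==> r = s"
 by (metis lookup_monmap poly_mapping_eqI)

lemma mev_monmap: "mev ga (monmap h r) = mev (ga \<circ> h) r"
proof-
 have "mev ga (monmap h r) = (SUM w:pkeys r. mev ga (msing (h w) (lkp r w)))" by (simp add: monmap_def monext_def mev_sum)
 thus ?thesis by (simp add: mev_def[of "ga \<circ> h"] monext_def)
qed

text \<open>For injective \<open>h\<close> this is the retraction of \<open>monmap h\<close>; it is linear over the subalgebra of the image of \<open>h\<close>.\<close>

definition mret :: "('g => 'h) => ('h \<Rightarrow>\<^sub>0 complex) => 'g \<Rightarrow>\<^sub>0 complex" where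
 "mret h r = (SUM w:h -` pkeys r. msing w (lkp r (h w)))"

lemma lookup_mret: "inj h ==> lkp (mret h r) w = lkp r (h w)"
 using finite_vimageI[of "pkeys r" h] unfolding mret_def by (auto simp: lookup_sum lookup_single when_def in_keys_iff)

lemma mret_monmap: "inj h ==> mret h (monmap h r) = r"
 by (rule poly_mapping_eqI) (simp add: lookup_mret lookup_monmap)

lemma mret_sum:
 assumes "inj h"
 shows "mret h (sum F A) = (SUM i:A. mret h (F i))"
 by (rule poly_mapping_eqI) (simp add: assms lookup_mret lookup_sum)

text \<open>Projection formula. It converts an ideal membership in the large ring, with generators
  from the image of \<open>monmap h\<close>, into one with coefficients in the small ring.\<close>

lemma mret_monmap_mult:
 fixes h :: "'g::ab_group_add => 'h::ab_group_add"
 assumes "inj h" "additive_map h"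
 shows "mret h (s * monmap h r) = mret h s * r"
proof (rule poly_mapping_eqI)
 fix w
 have hd: "h (w - v) = h w - h v" for v
 proof-
  have "h (w - v) + h v = h ((w - v) + v)" using assms(2) by (simp only: additive_map_def)
  thus ?thesis by (simp add: algebra_simps)
 qed
 have "lkp (s * monmap h r) (h w) = (SUM v:pkeys r. lkp (msing (h v) (lkp r v) * s) (h w))"
  by (simp add: monmap_def monext_def sum_distrib_left lookup_sum mult.commute)
 also have "... = (SUM v:pkeys r. lkp (msing v (lkp r v) * mret h s) w)" by (simp add: lookup_single_mult hd lookup_mret assms(1))
 also have "... = lkp ((SUM v:pkeys r. msing v (lkp r v)) * mret h s) w" by (simp add: sum_distrib_right lookup_sum)
 finally show "lkp (mret h (s * monmap h r)) w = lkp (mret h s * r) w"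
  by (simp only: lookup_mret[OF assms(1)] pm_sum_single[symmetric] mult.commute)
qed

definition keyrestrict :: "'g set => ('g \<Rightarrow>\<^sub>0 complex) => 'g \<Rightarrow>\<^sub>0 complex" where
 "keyrestrict A r = (SUM w:pkeys r Int A. msing w (lkp r w))"

lemma lookup_keyrestrict: "lkp (keyrestrict A r) w = (if w : A then lkp r w else 0)"
 unfolding keyrestrict_def lookup_sum lookup_single when_def by (auto simp: in_keys_iff)

lemma keyrestrict_sum: "keyrestrict A (sum F B) = (SUM i:B. keyrestrict A (F i))"
 by (rule poly_mapping_eqI) (simp add: lookup_keyrestrict lookup_sum)

lemma keyrestrict_id: "pkeys r <= A ==> keyrestrict A r = r"
 by (rule poly_mapping_eqI) (auto simp: lookup_keyrestrict in_keys_iff)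

lemma keys_keyrestrict: "pkeys (keyrestrict A r) = pkeys r Int A"
 by (auto simp: in_keys_iff lookup_keyrestrict split: if_splits)

section \<open>Graded Koszul complexes\<close>

text \<open>Chains are functions of the set \<open>J\<close> of indices of the exterior generators.\<close>

definition ksgn :: "nat => nat set => 'r::comm_ring_1" where
 "ksgn b J = (- 1) ^ card {j : J. j < b}"

lemma ksgn_square [simp]: "ksgn b J * ksgn b J = 1"
 by (simp add: ksgn_def flip: power_mult_distrib)

lemma ksgn_square_left [simp]: "ksgn b J * (ksgn b J * x) = x"
 by (simp add: mult.assoc[symmetric])

lemma ksgn_empty [simp]: "ksgn b {} = 1"
 by (simp add: ksgn_def)

lemma ksgn_insert:
 assumes "finite J" "g ~: J"
 shows "ksgn b (insert g J) = (if g < b then - ksgn b J else ksgn b J)"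
proof (cases "g < b")
 case True
 hence "{j : insert g J. j < b} = insert g {j : J. j < b}" by auto
 thus ?thesis using assms True by (simp add: ksgn_def)
next
 case False
 hence "{j : insert g J. j < b} = {j : J. j < b}" by auto
 thus ?thesis using False by (simp add: ksgn_def)
qed

lemma ksgn_swap:
 assumes "finite J" "b ~: J" "g ~: J" "b ~= g"
 shows "ksgn g (insert b J) * ksgn b (insert g J) = - (ksgn b J * ksgn g J :: 'r::comm_ring_1)"
 using assms by (auto simp: ksgn_insert mult.commute)

lemma ksgn_swap':
 assumes "finite J" "b ~: J" "g ~: J" "b ~= g"
 shows "ksgn g J * ksgn b (insert g J) = - (ksgn b J * ksgn g (insert b J) :: 'r::comm_ring_1)"
 using assms by (auto simp: ksgn_insert mult.commute)

definition kdiff :: "nat set => (nat => 'r::comm_ring_1) => (nat set => 'r) => nat set => 'r" where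
 "kdiff A a z J = (SUM g:A - J. ksgn g J * a g * z (insert g J))"

text \<open>Exterior multiplication by the element with coordinates \<open>r\<close>, used as a
  homotopy.\<close>

definition kwedge :: "nat set => (nat => 'r::comm_ring_1) => (nat set => 'r) => nat set => 'r" where
 "kwedge A r z J = (SUM g:A Int J. ksgn g (J - {g}) * r g * z (J - {g}))"

text \<open>The chain z0 + e_b z1. The sign moves e_b to the front, which turns the Koszul complex
  over \<open>insert b A\<close> into the mapping cone of multiplication by \<open>a b\<close> on
  the complex over \<open>A\<close>.\<close>

definition kjoin :: "nat => (nat set => 'r::comm_ring_1) => (nat set => 'r) => nat set => 'r" where
 "kjoin b z0 z1 J = (if b : J then ksgn b (J - {b}) * z1 (J - {b}) else z0 J)"

definition ksupp :: "nat set => (nat set => 'r::comm_ring_1) => bool" where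
 "ksupp A z <-> (ALL J. z J ~= 0 --> J <= A)"

lemma ksupp_kdiff: "ksupp A z ==> ksupp A (kdiff A a z)"
 unfolding ksupp_def kdiff_def by (metis (no_types, lifting) insert_subset mult_zero_right sum.neutral)

lemma ksupp_kwedge: "ksupp A z ==> ksupp A (kwedge A r z)"
proof-
 assume *: "ksupp A z"
 have "J <= A" if nz: "kwedge A r z J ~= 0" for J
 proof-
  obtain g where g: "g : A Int J" "ksgn g (J - {g}) * r g * z (J - {g}) ~= 0"
   using nz unfolding kwedge_def by (meson sum.not_neutral_contains_not_neutral)
  hence "z (J - {g}) ~= 0" by auto
  hence "J - {g} <= A" using * by (auto simp: ksupp_def)
  thus ?thesis using g by auto
 qed
 thus ?thesis by (auto simp: ksupp_def)
qed

lemma kdiff_add: "kdiff A a (%J. y J + z J) = (%J. kdiff A a y J + kdiff A a z J)"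
 by (rule ext) (simp add: kdiff_def algebra_simps sum.distrib)

lemma kdiff_uminus: "kdiff A a (%J. - z J) = (%J. - kdiff A a z J)"
 by (rule ext) (simp add: kdiff_def sum_negf)

lemma kdiff_scale: "kdiff A a (%J. c * z J) = (%J. c * kdiff A a z J)"
 by (rule ext) (simp add: kdiff_def sum_distrib_left algebra_simps)

lemma kwedge_add: "kwedge A a (%J. y J + z J) = (%J. kwedge A a y J + kwedge A a z J)"
 by (rule ext) (simp add: kwedge_def algebra_simps sum.distrib)

lemma kwedge_uminus: "kwedge A a (%J. - z J) = (%J. - kwedge A a z J)"
 by (rule ext) (simp add: kwedge_def sum_negf)

lemma kwedge_scale: "kwedge A a (%J. c * z J) = (%J. c * kwedge A a z J)"
 by (rule ext) (simp add: kwedge_def sum_distrib_left algebra_simps)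

lemma kjoin_split:
 assumes "ksupp (insert b A) z" "b ~: A"
 obtains z0 z1 where "z = kjoin b z0 z1" "ksupp A z0" "ksupp A z1"
  "!!J. z0 J = (if b : J then 0 else z J)"
  "!!J. z1 J = (if b : J then 0 else ksgn b J * z (insert b J))"
proof-
 define z0 where "z0 J = (if b : J then 0 else z J)" for J
 define z1 where "z1 J = (if b : J then 0 else ksgn b J * z (insert b J))" for J
 have "z = kjoin b z0 z1" by (rule ext) (auto simp: kjoin_def z0_def z1_def insert_absorb)
 moreover have "ksupp A z0" using assms by (auto simp: ksupp_def z0_def)
 moreover have "ksupp A z1" unfolding ksupp_def z1_def
 proof (intro allI impI)
  fix J assume "(if b : J then 0 else ksgn b J * z (insert b J)) ~= 0"
  hence "b ~: J" "z (insert b J) ~= 0" by (auto split: if_splits)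
  thus "J <= A" using assms unfolding ksupp_def by blast
 qed
 ultimately show ?thesis using that z0_def z1_def by blast
qed

lemma kdiff_insert:
 assumes "finite A" "b ~: A"
 shows "kdiff (insert b A) a z J =
  kdiff A a z J + (if b : J then 0 else ksgn b J * a b * z (insert b J))"
proof (cases "b : J")
 case True
 hence "insert b A - J = A - J" by auto
 thus ?thesis using True by (simp add: kdiff_def)
next
 case False
 hence "insert b A - J = insert b (A - J)" by auto
 thus ?thesis using False assms by (simp add: kdiff_def)
qed

text \<open>This is d(e_b z1) = a_b z1 - e_b d(z1), the differential of the mapping cone. Adding,
  removing and dividing by an element all rest on it.\<close>

lemma kdiff_kjoin:
 assumes "finite A" "b ~: A" "ksupp A z0" "ksupp A z1"
 shows "kdiff (insert b A) a (kjoin b z0 z1) =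
  kjoin b (%J. kdiff A a z0 J + a b * z1 J) (%J. - kdiff A a z1 J)"
proof (rule ext)
 fix J
 show "kdiff (insert b A) a (kjoin b z0 z1) J =
  kjoin b (%J. kdiff A a z0 J + a b * z1 J) (%J. - kdiff A a z1 J) J"
 proof (cases "b : J")
  case True
  define K where "K = J - {b}"
  have J: "J = insert b K" "b ~: K" using True by (auto simp: K_def)
  have [simp]: "insert b K - {b} = K" using J(2) by auto
  have *: "ksgn g (insert b K) * a g * kjoin b z0 z1 (insert g (insert b K)) =
    - (ksgn b K * (ksgn g K * a g * z1 (insert g K)))" if "g : A - K" for g
  proof (cases "K <= A")
   case sub: True
   hence fin: "finite K" using assms(1) finite_subset by blast
   have ne: "b ~= g" using that assms(2) by auto
   hence "insert g (insert b K) - {b} = insert g K" using J by auto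
   hence "ksgn g (insert b K) * a g * kjoin b z0 z1 (insert g (insert b K)) =
    (ksgn g (insert b K) * ksgn b (insert g K)) * (a g * z1 (insert g K))" by (simp add: kjoin_def mult_ac)
   also have "... = - (ksgn b K * ksgn g K) * (a g * z1 (insert g K))" using that by (subst ksgn_swap[OF fin J(2) _ ne]) auto
   finally show ?thesis by (simp add: mult_ac)
  next
   case False
   have ne: "b ~= g" using that assms(2) by auto
   hence e: "insert g (insert b K) - {b} = insert g K" using J by auto
   have "z1 (insert g K) = 0" using False assms(4) by (auto simp: ksupp_def)
   thus ?thesis using e by (simp add: kjoin_def)
  qed
  have "A - J = A - K" using J assms(2) by auto
  hence "kdiff (insert b A) a (kjoin b z0 z1) J =
    (SUM g:A - K. ksgn g J * a g * kjoin b z0 z1 (insert g J))" using True by (simp add: kdiff_insert[OF assms(1,2)] kdiff_def)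
  also have "... = (SUM g:A - K. - (ksgn b K * (ksgn g K * a g * z1 (insert g K))))" using * by (intro sum.cong) (auto simp: J)
  also have "... = - (ksgn b K * kdiff A a z1 K)" by (simp add: kdiff_def sum_negf sum_distrib_left)
  finally show ?thesis using J by (simp add: kjoin_def)
 next
  case False
  have "kdiff A a (kjoin b z0 z1) J = kdiff A a z0 J" unfolding kdiff_def using False assms(2) by (intro sum.cong) (auto simp: kjoin_def)
  moreover have "kjoin b z0 z1 (insert b J) = ksgn b J * z1 J" using False by (simp add: kjoin_def)
  moreover have "ksgn b J * a b * (ksgn b J * z1 J) = a b * z1 J" using ksgn_square_left[of b J "a b * z1 J"] by (simp add: mult_ac)
  ultimately show ?thesis using False by (simp add: kdiff_insert[OF assms(1,2)]) (simp add: kjoin_def)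
 qed
qed

lemma kwedge_kjoin:
 assumes "finite A" "b ~: A" "ksupp A z0" "ksupp A z1"
 shows "kwedge (insert b A) r (kjoin b z0 z1) =
  kjoin b (kwedge A r z0) (%J. r b * z0 J - kwedge A r z1 J)"
proof (rule ext)
 fix J
 show "kwedge (insert b A) r (kjoin b z0 z1) J =
  kjoin b (kwedge A r z0) (%J. r b * z0 J - kwedge A r z1 J) J"
 proof (cases "b : J")
  case True
  define K where "K = J - {b}"
  have J: "J = insert b K" "b ~: K" using True by (auto simp: K_def)
  have i: "insert b A Int J = insert b (A Int K)" using J assms(2) by auto
  have *: "ksgn g (J - {g}) * r g * kjoin b z0 z1 (J - {g}) =
    - (ksgn b K * (ksgn g (K - {g}) * r g * z1 (K - {g})))" if "g : A Int K" for g
  proof-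
   have ne: "b ~= g" using that assms(2) by auto
   let ?M = "K - {g}"
   have M: "J - {g} = insert b ?M" "J - {g} - {b} = ?M" "K = insert g ?M" "g ~: ?M" "b ~: ?M" using J ne that by auto
   show ?thesis
   proof (cases "?M <= A")
    case sub: True
    hence fin: "finite ?M" using assms(1) finite_subset by blast
    have "ksgn g (insert b ?M) * ksgn b ?M = - (ksgn b (insert g ?M) * ksgn g ?M :: 'a)"
     using ksgn_swap'[OF fin M(4) M(5)] ne by (metis minus_equation_iff mult.commute)
    moreover have "ksgn g (J - {g}) * r g * kjoin b z0 z1 (J - {g})
      = (ksgn g (insert b ?M) * ksgn b ?M) * (r g * z1 ?M)" using M by (simp add: kjoin_def mult_ac)
    ultimately show ?thesis using M(3) by (simp add: mult_ac)
   next
    case False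
    hence "z1 ?M = 0" using assms(4) by (auto simp: ksupp_def)
    thus ?thesis using M by (simp add: kjoin_def)
   qed
  qed
  have "kwedge (insert b A) r (kjoin b z0 z1) J =
   ksgn b K * r b * z0 K + (SUM g:A Int K. ksgn g (J - {g}) * r g * kjoin b z0 z1 (J - {g}))"
   unfolding kwedge_def i using assms(1,2) J K_def by (subst sum.insert) (auto simp: kjoin_def)
  also have "(SUM g:A Int K. ksgn g (J - {g}) * r g * kjoin b z0 z1 (J - {g})) =
   - (ksgn b K * kwedge A r z1 K)" using * by (simp add: kwedge_def sum_negf sum_distrib_left)
  finally show ?thesis using True by (simp add: kjoin_def[of _ _ _ J] K_def[symmetric] algebra_simps)
 next
  case False
  hence "insert b A Int J = A Int J" by auto
  thus ?thesis using False by (simp add: kwedge_def kjoin_def)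
 qed
qed

lemma kjoin_cong_zero: "kjoin b (%J. 0) (%J. 0) = (%J. 0)"
 by (rule ext) (simp add: kjoin_def)

lemma kdiff_kdiff:
 "finite A ==> ksupp A z ==> kdiff A a (kdiff A a z) = (%J. 0)"
proof (induction A arbitrary: z rule: finite_induct)
 case empty
 thus ?case by (simp add: kdiff_def fun_eq_iff)
next
 case (insert b A)
 obtain z0 z1 where z: "z = kjoin b z0 z1" "ksupp A z0" "ksupp A z1" using kjoin_split[OF insert.prems insert.hyps(2)] by metis
 have s: "ksupp A (%J. kdiff A a z0 J + a b * z1 J)" "ksupp A (%J. - kdiff A a z1 J)"
  using ksupp_kdiff[OF z(2), of a] ksupp_kdiff[OF z(3), of a] z(3)
  unfolding ksupp_def by (metis add_0 mult_zero_right, metis neg_0_equal_iff_equal)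
 show ?case unfolding z(1) kdiff_kjoin[OF insert.hyps(1,2) z(2,3)] kdiff_kjoin[OF insert.hyps(1,2) s]
  by (simp add: kdiff_add kdiff_scale kdiff_uminus insert.IH z(2,3) kjoin_cong_zero)
qed

text \<open>Exterior multiplication is a homotopy from 0 to multiplication by the sum of the
  \<open>r j * a j\<close>, so the ideal generated by the \<open>a j\<close> annihilates the
  homology.\<close>

lemma kdiff_kwedge:
 "finite A ==> ksupp A z ==>
  kdiff A a (kwedge A r z) J + kwedge A r (kdiff A a z) J = (SUM j:A. r j * a j) * z J"
proof (induction A arbitrary: z J rule: finite_induct)
 case empty
 thus ?case by (simp add: kdiff_def kwedge_def)
next
 case (insert b A)
 obtain z0 z1 where z: "z = kjoin b z0 z1" "ksupp A z0" "ksupp A z1" using kjoin_split[OF insert.prems insert.hyps(2)] by metis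
 have s: "ksupp A (%J. kdiff A a z0 J + a b * z1 J)" "ksupp A (%J. - kdiff A a z1 J)"
  using ksupp_kdiff[OF z(2), of a] ksupp_kdiff[OF z(3), of a] z(3)
  unfolding ksupp_def by (metis add_0 mult_zero_right, metis neg_0_equal_iff_equal)
 have t: "ksupp A (kwedge A r z0)" "ksupp A (%J. r b * z0 J - kwedge A r z1 J)"
  using ksupp_kwedge[OF z(2), of r] ksupp_kwedge[OF z(3), of r] z(2) unfolding ksupp_def by (metis, metis diff_0_right mult_zero_right)
 have neg: "kdiff A a (%J. r b * z0 J - kwedge A r z1 J) =
   (%J. r b * kdiff A a z0 J - kdiff A a (kwedge A r z1) J)" using kdiff_add[of A a "%J. r b * z0 J" "%J. - kwedge A r z1 J"]
  by (simp add: kdiff_scale kdiff_uminus)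
 let ?c = "SUM j:A. r j * a j"
 have c: "(SUM j:insert b A. r j * a j) = ?c + r b * a b" using insert.hyps by simp
 have I0: "kdiff A a (kwedge A r z0) K = ?c * z0 K - kwedge A r (kdiff A a z0) K" for K
  using insert.IH[OF z(2), of K] by (simp add: algebra_simps)
 have I1: "kdiff A a (kwedge A r z1) K = ?c * z1 K - kwedge A r (kdiff A a z1) K" for K
  using insert.IH[OF z(3), of K] by (simp add: algebra_simps)
 show ?case unfolding z(1) kdiff_kjoin[OF insert.hyps(1,2) z(2,3)] kwedge_kjoin[OF insert.hyps(1,2) s]
   kwedge_kjoin[OF insert.hyps(1,2) z(2,3)] kdiff_kjoin[OF insert.hyps(1,2) t] c neg
  by (simp add: kwedge_add kwedge_scale kwedge_uminus kjoin_def I0 I1 algebra_simps)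
qed

section \<open>Koszul homology of graded rings: adding, removing and dividing by elements\<close>

locale nonneg_graded =
 fixes R :: "int => 'r::comm_ring_1 set"
 assumes R_zero [simp]: "0 : R m"
  and R_add: "r : R m ==> s : R m ==> r + s : R m"
  and R_uminus: "r : R m ==> - r : R m"
  and R_mult: "r : R l ==> s : R m ==> r * s : R (l + m)"
  and R_one: "1 : R 0"
  and R_neg: "m < 0 ==> R m = {0}"
begin

lemma R_diff: "r : R m ==> s : R m ==> r - s : R m"
 using R_add[of r m "- s"] R_uminus by simp

lemma R_sum: "(!!i. i : A ==> F i : R m) ==> sum F A : R m"
 by (induction A rule: infinite_finite_induct) (auto intro: R_add)

lemma R_mult': "r : R l ==> s : R m ==> k = l + m ==> r * s : R k"
 using R_mult by blast

lemma R_power: "r : R m ==> r ^ k : R (int k * m)"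
 by (induction k) (auto simp: R_one algebra_simps intro!: R_mult')

lemma R_ksgn: "r : R m ==> ksgn b J * r : R m"
 by (cases "even (card {j : J. j < b})") (auto simp: ksgn_def R_uminus)

text \<open>\<open>D\<close> is the total degree: the basis element of \<open>J\<close> counts with
  degree \<open>sum dg J\<close>, so that the differential preserves \<open>D\<close>. Fixing
  \<open>D\<close> is what makes graded Nakayama an induction on an integer.\<close>

definition kchain :: "nat set => (nat => int) => nat => int => (nat set => 'r) set" where
 "kchain A dg i D = {z. ALL J. z J : R (D - sum dg J) & (z J ~= 0 --> J <= A & card J = i)}"

definition kvanish :: "nat set => (nat => 'r) => (nat => int) => nat => bool" where
 "kvanish A a dg d <-> (ALL i>d. ALL D. ALL z:kchain A dg i D. kdiff A a z = (%J. 0) -->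
   (EX y:kchain A dg (Suc i) D. kdiff A a y = z))"

lemma kchain_ksupp: "z : kchain A dg i D ==> ksupp A z"
 by (auto simp: kchain_def ksupp_def)

lemma kchain_zero: "(%J. 0) : kchain A dg i D"
 by (simp add: kchain_def)

lemma kchain_add:
 assumes "y : kchain A dg i D" "z : kchain A dg i D"
 shows "(%J. y J + z J) : kchain A dg i D"
 using assms unfolding kchain_def mem_Collect_eq by (metis R_add add_0)

lemma kchain_uminus: "z : kchain A dg i D ==> (%J. - z J) : kchain A dg i D"
 by (auto simp: kchain_def R_uminus)

lemma kchain_scale:
 assumes "r : R m" "z : kchain A dg i D" "D' = m + D"
 shows "(%J. r * z J) : kchain A dg i D'"
proof-
 have "r * z J : R (D' - sum dg J)" for J using assms by (intro R_mult'[of r m "z J" "D - sum dg J"]) (auto simp: kchain_def)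
 thus ?thesis using assms(2) unfolding kchain_def mem_Collect_eq by (metis mult_zero_right)
qed

lemma kchain_kdiff:
 assumes "finite A" "z : kchain A dg (Suc i) D" "!!g. g : A ==> a g : R (dg g)"
 shows "kdiff A a z : kchain A dg i D"
 unfolding kchain_def
proof (intro CollectI allI conjI impI)
 fix J
 show "kdiff A a z J : R (D - sum dg J)" unfolding kdiff_def
 proof (rule R_sum)
  fix g assume g: "g : A - J"
  show "ksgn g J * a g * z (insert g J) : R (D - sum dg J)"
  proof (cases "J <= A")
   case True
   hence "finite J" using assms(1) finite_subset by blast
   hence e: "dg g + (D - sum dg (insert g J)) = D - sum dg J" using g by simp
   have "z (insert g J) : R (D - sum dg (insert g J))" using assms(2) by (auto simp: kchain_def)
   from R_mult[OF assms(3)[of g] this] show ?thesis using g R_ksgn e by (simp add: mult.assoc)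
  next
   case False
   hence "z (insert g J) = 0" using assms(2) by (auto simp: kchain_def)
   thus ?thesis by simp
  qed
 qed
 assume "kdiff A a z J ~= 0"
 then obtain g where g: "g : A - J" "ksgn g J * a g * z (insert g J) ~= 0"
  unfolding kdiff_def by (meson sum.not_neutral_contains_not_neutral)
 hence "z (insert g J) ~= 0" by auto
 hence *: "insert g J <= A" "card (insert g J) = Suc i" using assms(2) by (auto simp: kchain_def)
 thus "J <= A" by simp
 show "card J = i" using * g(1) assms(1) finite_subset[of J A] by auto
qed

lemma kchain_kwedge:
 assumes "finite A" "z : kchain A dg i D" "!!g. g : A ==> r g : R (m - dg g)"
 shows "kwedge A r z : kchain A dg (Suc i) (D + m)"
 unfolding kchain_def
proof (intro CollectI allI conjI impI)
 fix J
 show "kwedge A r z J : R (D + m - sum dg J)" unfolding kwedge_def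
 proof (rule R_sum)
  fix g assume g: "g : A Int J"
  show "ksgn g (J - {g}) * r g * z (J - {g}) : R (D + m - sum dg J)"
  proof (cases "J - {g} <= A")
   case True
   hence "finite J" using assms(1) by (intro finite_subset[of J "insert g A"]) auto
   hence "sum dg J = dg g + sum dg (J - {g})" using g by (intro sum.remove) auto
   hence e: "(m - dg g) + (D - sum dg (J - {g})) = D + m - sum dg J" by linarith
   have "z (J - {g}) : R (D - sum dg (J - {g}))" using assms(2) by (auto simp: kchain_def)
   from R_mult[OF assms(3)[of g] this] show ?thesis using g R_ksgn e by (simp add: mult.assoc)
  next
   case False
   hence "z (J - {g}) = 0" using assms(2) by (auto simp: kchain_def)
   thus ?thesis by simp
  qed
 qed
 assume "kwedge A r z J ~= 0"
 then obtain g where g: "g : A Int J" "ksgn g (J - {g}) * r g * z (J - {g}) ~= 0"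
  unfolding kwedge_def by (meson sum.not_neutral_contains_not_neutral)
 hence "z (J - {g}) ~= 0" by auto
 hence *: "J - {g} <= A" "card (J - {g}) = i" using assms(2) by (auto simp: kchain_def)
 thus "J <= A" using g by auto
 hence "finite J" using assms(1) finite_subset by blast
 thus "card J = Suc i" using * g(1) card_Suc_Diff1[of J g] by auto
qed

lemma kchain_kjoin:
 assumes "finite A" "b ~: A" "z0 : kchain A dg (Suc i) D" "z1 : kchain A dg i (D - dg b)"
 shows "kjoin b z0 z1 : kchain (insert b A) dg (Suc i) D"
 unfolding kchain_def
proof (intro CollectI allI conjI impI)
 fix J
 have fin: "finite J" if "J - {b} <= A" using that assms(1) by (intro finite_subset[of J "insert b A"]) auto
 show "kjoin b z0 z1 J : R (D - sum dg J)"
 proof (cases "b : J & J - {b} <= A")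
  case True
  have "z1 (J - {b}) : R (D - dg b - sum dg (J - {b}))" using assms(4) by (auto simp: kchain_def)
  moreover have "sum dg J = dg b + sum dg (J - {b})" using True fin by (intro sum.remove) auto
  hence "D - dg b - sum dg (J - {b}) = D - sum dg J" by linarith
  ultimately show ?thesis using True R_ksgn by (simp add: kjoin_def)
 next
  case False
  hence "b : J ==> z1 (J - {b}) = 0" using assms(4) by (auto simp: kchain_def)
  thus ?thesis using assms(3) by (auto simp: kchain_def kjoin_def)
 qed
 assume nz: "kjoin b z0 z1 J ~= 0"
 show "J <= insert b A" "card J = Suc i"
 proof-
  have "J <= insert b A & card J = Suc i"
  proof (cases "b : J")
   case True
   hence "z1 (J - {b}) ~= 0" using nz by (auto simp: kjoin_def)
   hence "J - {b} <= A" "card (J - {b}) = i" using assms(4) by (auto simp: kchain_def)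
   thus ?thesis using True fin card_Suc_Diff1[of J b] by auto
  next
   case False
   hence "z0 J ~= 0" using nz by (auto simp: kjoin_def)
   thus ?thesis using assms(3) by (auto simp: kchain_def)
  qed
  thus "J <= insert b A" "card J = Suc i" by auto
 qed
qed

lemma kchain_split:
 assumes "finite A" "b ~: A" "z : kchain (insert b A) dg (Suc i) D"
 obtains z0 z1 where "z = kjoin b z0 z1"
  "z0 : kchain A dg (Suc i) D" "z1 : kchain A dg i (D - dg b)"
proof-
 obtain z0 z1 where z: "z = kjoin b z0 z1" "ksupp A z0" "ksupp A z1"
  "!!J. z0 J = (if b : J then 0 else z J)"
  "!!J. z1 J = (if b : J then 0 else ksgn b J * z (insert b J))" using kjoin_split[OF kchain_ksupp[OF assms(3)] assms(2)] by metis
 have "z0 : kchain A dg (Suc i) D" using z(2,4) assms(3) by (auto simp: kchain_def ksupp_def)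
 moreover have "z1 : kchain A dg i (D - dg b)" unfolding kchain_def
 proof (intro CollectI allI conjI impI)
  fix J
  show "z1 J : R (D - dg b - sum dg J)"
  proof (cases "z1 J = 0")
   case False
   hence J: "b ~: J" "finite J" using z(3,5) assms(1) finite_subset unfolding ksupp_def by (metis, blast)
   have "z (insert b J) : R (D - sum dg (insert b J))" using assms(3) by (auto simp: kchain_def)
   thus ?thesis using J z(5)[of J] R_ksgn by (simp add: diff_diff_eq)
  qed simp
  assume nz: "z1 J ~= 0"
  thus J: "J <= A" using z(3) by (auto simp: ksupp_def)
  have "z (insert b J) ~= 0" "b ~: J" using nz z(5)[of J] by (auto split: if_splits)
  thus "card J = i" using assms(3) J assms(1) finite_subset[of J A] by (auto simp: kchain_def)
 qed
 ultimately show ?thesis using that z(1) by blast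
qed

lemma kjoin_inject:
 assumes "b ~: A" "ksupp A z0" "ksupp A z1" "ksupp A y0" "ksupp A y1" "kjoin b z0 z1 = kjoin b y0 y1"
 shows "z0 = y0" "z1 = y1"
proof-
 show "z0 = y0"
 proof
  fix J
  show "z0 J = y0 J"
  proof (cases "b : J")
   case True
   thus ?thesis using assms by (metis ksupp_def subsetD)
  next
   case False
   thus ?thesis using fun_cong[OF assms(6), of J] by (simp add: kjoin_def)
  qed
 qed
 show "z1 = y1"
 proof
  fix J
  show "z1 J = y1 J"
  proof (cases "b : J")
   case True
   thus ?thesis using assms by (metis ksupp_def subsetD)
  next
   case False
   hence "ksgn b J * z1 J = ksgn b J * y1 J" using fun_cong[OF assms(6), of "insert b J"] by (simp add: kjoin_def)
   thus ?thesis by (metis ksgn_square_left)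
  qed
 qed
qed

lemma kcycle_kjoin:
 assumes "finite A" "b ~: A" "ksupp A z0" "ksupp A z1"
  and "kdiff (insert b A) a (kjoin b z0 z1) = kjoin b w0 w1" "ksupp A w0" "ksupp A w1"
 shows "w0 = (%J. kdiff A a z0 J + a b * z1 J)" "w1 = (%J. - kdiff A a z1 J)"
proof-
 have s: "ksupp A (%J. kdiff A a z0 J + a b * z1 J)" "ksupp A (%J. - kdiff A a z1 J)"
  using ksupp_kdiff[OF assms(3), of a] ksupp_kdiff[OF assms(4), of a] assms(4)
  unfolding ksupp_def by (metis add_0 mult_zero_right, metis neg_0_equal_iff_equal)
 have "kjoin b (%J. kdiff A a z0 J + a b * z1 J) (%J. - kdiff A a z1 J) = kjoin b w0 w1"
  using assms(5) kdiff_kjoin[OF assms(1-4), of a] by simp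
 from kjoin_inject[OF assms(2) s assms(6,7) this]
 show "w0 = (%J. kdiff A a z0 J + a b * z1 J)" "w1 = (%J. - kdiff A a z1 J)" by auto
qed

lemma ksupp_zero: "ksupp A (%J. 0)"
 by (simp add: ksupp_def)

text \<open>The long exact sequence of the mapping cone, made explicit. In a cycle (z0, z1) the part
  z1 is a cycle one chain degree lower, so it is the boundary of some y1; then z0 + a_b y1 is a
  cycle over \<open>A\<close> and bounds as well. The use of z1 costs one in the bound.\<close>

lemma kvanish_insert:
 assumes "finite A" "b ~: A" "kvanish A a dg d" "a b : R (dg b)"
 shows "kvanish (insert b A) a dg (Suc d)"
 unfolding kvanish_def
proof (intro allI impI ballI)
 fix i D z
 assume i: "Suc d < i" and z: "z : kchain (insert b A) dg i D"
  and cyc: "kdiff (insert b A) a z = (%J. 0)"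
 obtain k where k: "i = Suc (Suc k)" "d < Suc k" using i by (metis less_imp_Suc_add Suc_lessE Suc_less_SucD)
 obtain z0 z1 where zz: "z = kjoin b z0 z1"
  "z0 : kchain A dg i D" "z1 : kchain A dg (Suc k) (D - dg b)" using kchain_split[OF assms(1,2) z[unfolded k(1)]] k(1) by metis
 note s = kchain_ksupp[OF zz(2)] kchain_ksupp[OF zz(3)]
 have "kdiff (insert b A) a (kjoin b z0 z1) = kjoin b (%J. 0) (%J. 0)" using cyc zz(1) by (simp add: kjoin_cong_zero)
 from kcycle_kjoin[OF assms(1,2) s this ksupp_zero ksupp_zero]
 have c0: "kdiff A a z0 J + a b * z1 J = 0" and c1: "kdiff A a z1 J = 0" for J by (metis, metis neg_0_equal_iff_equal)
 obtain y1 where y1: "y1 : kchain A dg i (D - dg b)" "kdiff A a y1 = z1" using assms(3) k zz(3) c1 unfolding kvanish_def by blast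
 let ?w = "%J. z0 J + a b * y1 J"
 have w: "?w : kchain A dg i D" using zz(2) y1(1) assms(4) by (intro kchain_add kchain_scale) auto
 have "kdiff A a ?w = (%J. 0)" using c0 by (simp add: kdiff_add kdiff_scale y1(2))
 then obtain y0 where y0: "y0 : kchain A dg (Suc i) D" "kdiff A a y0 = ?w" using assms(3) w i unfolding kvanish_def by (meson Suc_lessD)
 let ?y = "kjoin b y0 (%J. - y1 J)"
 have "?y : kchain (insert b A) dg (Suc i) D" using assms(1,2) y0(1) y1(1) by (intro kchain_kjoin kchain_uminus)
 moreover have "kdiff (insert b A) a ?y = z"
  using kdiff_kjoin[OF assms(1,2) kchain_ksupp[OF y0(1)] kchain_ksupp[OF kchain_uminus[OF y1(1)]], of a]
  by (simp add: y0(2) kdiff_uminus y1(2) zz(1))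
 ultimately show "EX y:kchain (insert b A) dg (Suc i) D. kdiff (insert b A) a y = z" by blast
qed

text \<open>If \<open>a b\<close> lies in the ideal of the other elements, it acts on the complex
  over \<open>A\<close> as a map homotopic to 0, so the mapping cone splits in homology. The
  homotopy completes a cycle z over \<open>A\<close> to a cycle of the cone with z as second
  component, one chain degree higher; bounding it there bounds z.\<close>

lemma kvanish_remove:
 assumes "finite A" "b ~: A" "kvanish (insert b A) a dg (Suc d)"
  and "a b = (SUM j:A. r j * a j)" "!!j. j : A ==> r j : R (dg b - dg j)"
 shows "kvanish A a dg d"
 unfolding kvanish_def
proof (intro allI impI ballI)
 fix i D z
 assume i: "d < i" and z: "z : kchain A dg i D" and cyc: "kdiff A a z = (%J. 0)"
 define w where "w = (%J. - kwedge A r z J)"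
 have w: "w : kchain A dg (Suc i) (D + dg b)" unfolding w_def using kchain_kwedge[OF assms(1) z assms(5)] by (rule kchain_uminus)
 have z': "z : kchain A dg i (D + dg b - dg b)" using z by simp
 have "kdiff A a w J + a b * z J = 0" for J using kdiff_kwedge[OF assms(1) kchain_ksupp[OF z], of a r J] assms(4) cyc
  by (simp add: w_def kdiff_uminus) (simp add: kwedge_def)
 hence "kdiff (insert b A) a (kjoin b w z) = (%J. 0)" using kdiff_kjoin[OF assms(1,2) kchain_ksupp[OF w] kchain_ksupp[OF z], of a] cyc
  by (simp add: kjoin_cong_zero)
 moreover have "kjoin b w z : kchain (insert b A) dg (Suc i) (D + dg b)" by (rule kchain_kjoin[OF assms(1,2) w z'])
 ultimately obtain y where y: "y : kchain (insert b A) dg (Suc (Suc i)) (D + dg b)"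
   "kdiff (insert b A) a y = kjoin b w z" using assms(3) i unfolding kvanish_def by (meson Suc_mono)
 obtain y0 y1 where yy: "y = kjoin b y0 y1"
  "y0 : kchain A dg (Suc (Suc i)) (D + dg b)" "y1 : kchain A dg (Suc i) (D + dg b - dg b)" using kchain_split[OF assms(1,2) y(1)] by metis
 have "z = (%J. - kdiff A a y1 J)" using kcycle_kjoin(2)[OF assms(1,2) kchain_ksupp[OF yy(2)] kchain_ksupp[OF yy(3)] _
    kchain_ksupp[OF w] kchain_ksupp[OF z]] y(2) yy(1) by simp
 hence "kdiff A a (%J. - y1 J) = z" by (simp add: kdiff_uminus)
 moreover have "(%J. - y1 J) : kchain A dg (Suc i) D" using kchain_uminus[OF yy(3)] by simp
 ultimately show "EX y:kchain A dg (Suc i) D. kdiff A a y = z" by blast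
qed

text \<open>Graded Nakayama: a homology class is divisible by all powers of \<open>a b\<close>.\<close>

lemma kvanish_descend:
 assumes "finite A" "b ~: A" "kvanish (insert b A) a dg 0" "a b : R (dg b)"
  and "dg b > 0" "!!j. j : A ==> dg j >= 0"
 shows "kvanish A a dg 0"
proof-
 have "EX y:kchain A dg (Suc i) D. kdiff A a y = z" if "0 < i" "z : kchain A dg i D" "kdiff A a z = (%J. 0)" for i D z using that
 \<comment> \<open>The cofactor of e_b has total degree \<open>D - dg b\<close>, which is smaller;
   below degree 0 all chains vanish, since every coefficient would have negative degree.\<close>
 proof (induction "nat (D + 1)" arbitrary: D z rule: less_induct)
  case less
  show ?case
  proof (cases "D < 0")
   case True
   have "z J = 0" for J
   proof (rule ccontr)
    assume nz: "z J ~= 0"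
    hence "J <= A" using less.prems(2) by (auto simp: kchain_def)
    hence "sum dg J >= 0" using assms(6) by (intro sum_nonneg) auto
    hence "R (D - sum dg J) = {0}" using True by (intro R_neg) auto
    thus False using nz less.prems(2) by (auto simp: kchain_def)
   qed
   hence "z = (%J. 0)" by auto
   moreover have "kdiff A a (%J. 0) = (%J. 0)" by (simp add: kdiff_def fun_eq_iff)
   ultimately show ?thesis using kchain_zero by metis
  next
   case False
   obtain k where k: "i = Suc k" using less.prems(1) gr0_implies_Suc by blast
   have "kjoin b z (%J. 0) : kchain (insert b A) dg i D"
    unfolding k using less.prems(2) k by (intro kchain_kjoin assms(1,2) kchain_zero) auto
   moreover have "kdiff (insert b A) a (kjoin b z (%J. 0)) = (%J. 0)"
    using kdiff_kjoin[OF assms(1,2) kchain_ksupp[OF less.prems(2)] ksupp_zero, of a] less.prems(3)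
    by (simp add: kjoin_cong_zero) (simp add: kdiff_def kjoin_cong_zero)
   ultimately obtain y where y: "y : kchain (insert b A) dg (Suc i) D"
     "kdiff (insert b A) a y = kjoin b z (%J. 0)" using assms(3) less.prems(1) unfolding kvanish_def by meson
   obtain y0 y1 where yy: "y = kjoin b y0 y1"
    "y0 : kchain A dg (Suc i) D" "y1 : kchain A dg i (D - dg b)" using kchain_split[OF assms(1,2) y(1)] by metis
   from kcycle_kjoin[OF assms(1,2) kchain_ksupp[OF yy(2)] kchain_ksupp[OF yy(3)]
     y(2)[unfolded yy(1)] kchain_ksupp[OF less.prems(2)] ksupp_zero]
   have c: "z = (%J. kdiff A a y0 J + a b * y1 J)" "(%J. - kdiff A a y1 J) = (%J. 0)" by auto
   hence "kdiff A a y1 = (%J. 0)" by (metis neg_0_equal_iff_equal)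
   then obtain x where x: "x : kchain A dg (Suc i) (D - dg b)" "kdiff A a x = y1"
    using less.hyps[of "D - dg b" y1] False assms(5) less.prems(1) yy(3) by auto
   have "(%J. y0 J + a b * x J) : kchain A dg (Suc i) D" using yy(2) x(1) assms(4) by (intro kchain_add kchain_scale) auto
   moreover have "kdiff A a (%J. y0 J + a b * x J) = z" using c(1) x(2) by (simp add: kdiff_add kdiff_scale)
   ultimately show ?thesis by blast
  qed
 qed
 thus ?thesis by (auto simp: kvanish_def)
qed

text \<open>A relation \<open>a b * r\<close> = sum of \<open>s j * a j\<close> is a 1-cycle with
  coordinates r at b and -\<open>s j\<close> at j. When it is a boundary, its coordinate at b is a
  combination of the \<open>a j\<close>.\<close>

lemma kvanish_nonzerodivisor:
 assumes "finite A" "b ~: A" "kvanish (insert b A) a dg 0"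
  and "r : R m" "a b * r = (SUM j:A. s j * a j)" "!!j. j : A ==> s j : R (m + dg b - dg j)"
 obtains t where "r = (SUM j:A. t j * a j)" "!!j. j : A ==> t j : R (m - dg j)"
proof-
 define z0 where "z0 J = (if EX j:A. J = {j} then - s (the_elem J) else 0)" for J
 define z1 where "z1 J = (if J = {} then r else 0)" for J :: "nat set"
 have z0: "z0 : kchain A dg (Suc 0) (m + dg b)" using assms(6) by (auto simp: kchain_def z0_def R_uminus)
 have z1: "z1 : kchain A dg 0 (m + dg b - dg b)" using assms(4) by (auto simp: kchain_def z1_def)
 have d1: "kdiff A a z1 J = 0" for J by (simp add: kdiff_def z1_def)
 have d0: "kdiff A a z0 J + a b * z1 J = 0" for J
 proof (cases "J = {}")
  case True
  have "kdiff A a z0 {} = (SUM j:A. - (s j * a j))" unfolding kdiff_def by (rule sum.cong) (auto simp: z0_def)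
  thus ?thesis using True assms(5) by (simp add: z1_def sum_negf)
 next
  case False
  have "kdiff A a z0 J = 0" unfolding kdiff_def using False by (intro sum.neutral) (auto simp: z0_def)
  thus ?thesis using False by (simp add: z1_def)
 qed
 note s = kchain_ksupp[OF z0] kchain_ksupp[OF z1]
 have "kdiff (insert b A) a (kjoin b z0 z1) = (%J. 0)" using kdiff_kjoin[OF assms(1,2) s, of a] d0 d1 by (simp add: kjoin_cong_zero)
 moreover have "kjoin b z0 z1 : kchain (insert b A) dg (Suc 0) (m + dg b)" by (rule kchain_kjoin[OF assms(1,2) z0 z1])
 ultimately obtain y where y: "y : kchain (insert b A) dg (Suc (Suc 0)) (m + dg b)"
   "kdiff (insert b A) a y = kjoin b z0 z1" using assms(3) unfolding kvanish_def by (meson zero_less_Suc)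
 obtain y0 y1 where yy: "y = kjoin b y0 y1"
  "y0 : kchain A dg (Suc (Suc 0)) (m + dg b)" "y1 : kchain A dg (Suc 0) (m + dg b - dg b)" using kchain_split[OF assms(1,2) y(1)] by metis
 have "z1 = (%J. - kdiff A a y1 J)"
  using kcycle_kjoin(2)[OF assms(1,2) kchain_ksupp[OF yy(2)] kchain_ksupp[OF yy(3)] _ s] y(2) yy(1) by simp
 hence "r = - kdiff A a y1 {}" by (metis z1_def)
 hence "r = (SUM j:A. - y1 {j} * a j)" by (simp add: kdiff_def sum_negf mult.commute)
 moreover have "- y1 {j} : R (m - dg j)" if "j : A" for j
  using yy(3) that by (auto simp: kchain_def intro!: R_uminus dest: spec[of _ "{j}"])
 ultimately show ?thesis by (rule that[of "%j. - y1 {j}"])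
qed

end

section \<open>Generic triangulations\<close>

definition vbasis :: "'e::euclidean_space set => bool" where
 "vbasis B <-> independent B & card B = DIM('e)"

lemma vbasis_finite: "vbasis B ==> finite B"
 by (simp add: vbasis_def independent_imp_finite)

lemma vbasis_span: "vbasis B ==> span B = UNIV"
 by (metis card_ge_dim_independent dim_UNIV dim_span eq_refl subset_UNIV top.extremum_uniqueI vbasis_def)

context
 fixes B :: "'e::euclidean_space set"
 assumes B: "vbasis B"
begin

lemma crd_sum: "(SUM b:B. representation B v b \<cdot> b) = v"
 using B vbasis_finite[OF B] vbasis_span[OF B] by (intro real_vector.sum_representation_eq) (auto simp: vbasis_def)

lemma crd_add: "representation B (v + w) b = representation B v b + representation B w b"
 using B vbasis_span[OF B] by (subst real_vector.representation_add) (auto simp: vbasis_def)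

lemma crd_diff: "representation B (v - w) b = representation B v b - representation B w b"
 using B vbasis_span[OF B] by (subst real_vector.representation_diff) (auto simp: vbasis_def)

lemma crd_scale: "representation B (r \<cdot> v) b = r * representation B v b"
 using B vbasis_span[OF B] by (subst real_vector.representation_scale) (auto simp: vbasis_def)

lemma crd_sum_distrib: "representation B (SUM i:A. F i) b = (SUM i:A. representation B (F i) b)"
 using B vbasis_span[OF B] by (subst real_vector.representation_sum) (auto simp: vbasis_def)

lemma crd_basis: "b : B ==> representation B b b' = (if b' = b then 1 else 0)"
 using B by (subst real_vector.representation_basis) (auto simp: vbasis_def)

lemma crd_eqI:
 assumes "v = (SUM b:B. l b \<cdot> b)" "b : B"
 shows "representation B v b = l b"
proof-
 have "representation B v b = (SUM b':B. l b' * (if b = b' then 1 else 0))"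
  unfolding assms(1) by (simp add: crd_sum_distrib crd_scale crd_basis cong: sum.cong)
 also have "... = (SUM b':B. if b' = b then l b' else 0)" by (intro sum.cong) auto
 also have "... = l b" using assms(2) vbasis_finite[OF B] by simp
 finally show ?thesis .
qed

end

text \<open>The linear function that agrees with \<open>h\<close> on the basis
  \<open>B\<close>.\<close>

definition hext :: "('e => real) => 'e::euclidean_space set => 'e => real" where
 "hext h B v = (SUM b:B. representation B v b * h b)"

text \<open>Such a point lies on no wall of any simplicial cone spanned by vectors of
  \<open>Gv\<close>, so a cone that contains it contains it in its interior.\<close>

definition genpos :: "'e::euclidean_space set => 'e => bool" where
 "genpos Gv x <-> (ALL F<=Gv. card F < DIM('e) --> x ~: span F)"

definition open_cone :: "'e::euclidean_space set => 'e => bool" where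
 "open_cone B x <-> (ALL b:B. representation B x b > 0)"

text \<open>A cell is the projection of a lower facet of the cone over the points lifted to the heights \<open>h\<close>.\<close>

definition cell :: "'e::euclidean_space set => ('e => real) => 'e set => bool" where
 "cell Gv h B <-> B <= Gv & vbasis B & (ALL g:Gv - B. hext h B g < h g)"

lemma hext_base: "vbasis B ==> b : B ==> hext h B b = h b"
 unfolding hext_def using vbasis_finite[of B] by (simp add: crd_basis if_distrib[of "%x. x * _"] cong: if_cong)

lemma hext_add: "vbasis B ==> hext h B (v + w) = hext h B v + hext h B w"
 by (simp add: hext_def crd_add algebra_simps sum.distrib)

lemma hext_scale: "vbasis B ==> hext h B (r \<cdot> v) = r * hext h B v"
 by (simp add: hext_def crd_scale sum_distrib_left algebra_simps)

lemma hext_sum: "vbasis B ==> hext h B (SUM i:A. F i) = (SUM i:A. hext h B (F i))"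
 by (simp add: hext_def crd_sum_distrib sum_distrib_right sum.swap[of _ B])

lemma cell_height_le: "cell Gv h B ==> g : Gv ==> hext h B g <= h g"
 by (cases "g : B") (force simp: cell_def hext_base)+

text \<open>A point of the open cone of \<open>B\<close> is a positive combination of generators at
  which \<open>hext h B\<close> equals \<open>h\<close>, while \<open>hext h B'\<close> is at most
  \<open>h\<close> on all generators. Strictness comes from a generator of \<open>B\<close> that is
  not in \<open>B'\<close>. Uniqueness of cells and the descent of levels both follow from this
  comparison.\<close>

lemma cell_height_maximal:
 assumes "cell Gv h B" "cell Gv h B'" "open_cone B x"
 shows "hext h B' x <= hext h B x"
  and "B ~= B' ==> hext h B' x < hext h B x"
proof-
 have B: "vbasis B" "B <= Gv" and B': "vbasis B'" using assms by (auto simp: cell_def)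
 have le: "representation B x b * hext h B' b <= representation B x b * h b" if "b : B" for b
  using that B assms cell_height_le[OF assms(2), of b] by (intro mult_left_mono) (auto simp: open_cone_def)
 have x: "hext h B' x = (SUM b:B. representation B x b * hext h B' b)" using arg_cong[OF crd_sum[OF B(1), of x], of "hext h B'"]
  by (simp only: hext_sum[OF B'] hext_scale[OF B'])
 thus "hext h B' x <= hext h B x" using le by (simp add: hext_def[of h B] sum_mono)
 assume ne: "B ~= B'"
 have "~ B <= B'" using ne B(1) B' by (metis card_subset_eq vbasis_def vbasis_finite)
 then obtain b where b: "b : B" "b ~: B'" by auto
 hence "hext h B' b < h b" using assms(2) B(2) by (auto simp: cell_def)
 hence "representation B x b * hext h B' b < representation B x b * h b" using assms(3) b by (auto simp: open_cone_def)
 hence "(SUM b:B. representation B x b * hext h B' b) < (SUM b:B. representation B x b * h b)"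
  using le b vbasis_finite[OF B(1)] by (intro sum_strict_mono_ex1) auto
 thus "hext h B' x < hext h B x" by (simp add: x hext_def[of h B])
qed

lemma cell_unique:
 assumes "cell Gv h B" "cell Gv h B'" "open_cone B x" "open_cone B' x"
 shows "B = B'"
 using cell_height_maximal[OF assms(1,2,3)] cell_height_maximal[OF assms(2,1,4)] by force

lemma genpos_pos:
 fixes x :: "'e::euclidean_space"
 assumes "genpos Gv x" "S <= Gv" "finite S" "card S <= DIM('e)"
  and "x = (SUM s:S. l s \<cdot> s)" "!!s. s : S ==> l s >= 0"
 shows "card S = DIM('e) & (ALL s:S. l s > (0::real))"
proof-
 let ?F = "{s:S. l s > 0}"
 have "x = (SUM s:?F. l s \<cdot> s)" unfolding assms(5) using assms(3,6) by (intro sum.mono_neutral_right) (auto simp: less_eq_real_def)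
 hence "x : span ?F" by (auto intro!: span_sum span_scale intro: span_base)
 moreover have "?F <= Gv" using assms(2) by auto
 ultimately have "~ card ?F < DIM('e)" using assms(1) unfolding genpos_def by blast
 moreover have "card ?F <= card S" using assms(3) by (intro card_mono) auto
 ultimately have "card ?F = card S" "card S = DIM('e)" using assms(4) by auto
 hence "?F = S" using assms(3) by (intro card_subset_eq) auto
 thus ?thesis using `card S = _` by auto
qed

text \<open>Caratheodory's theorem for cones: in a representation of minimal support, a linear
  dependence could be subtracted until one coefficient vanishes.\<close>

lemma independent_support_exists:
 fixes x :: "'e::euclidean_space"
 assumes "finite Gv" "x = (SUM g:Gv. l g \<cdot> g)" "!!g. g : Gv ==> l g >= 0"
 obtains S l' where "S <= Gv" "independent S" "x = (SUM s:S. l' s \<cdot> s)" "!!s. s : S ==> l' s >= (0::real)"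
proof-
 let ?P = "%S. S <= Gv & (EX l. x = (SUM s:S. l s \<cdot> s) & (ALL s:S. l s >= 0))"
 have "?P Gv" using assms by auto
 then obtain S where S: "?P S" and min: "!!S'. ?P S' ==> card S <= card S'" using ex_has_least_nat[of ?P Gv card] by auto
 obtain l where l: "x = (SUM s:S. l s \<cdot> s)" "!!s. s : S ==> l s >= 0" using S by auto
 have fin: "finite S" using S assms(1) finite_subset by blast
 have "independent S"
 proof (rule ccontr)
  assume "~ independent S"
  then obtain c0 v where c0: "v : S" "c0 v ~= 0" "(SUM s:S. c0 s \<cdot> s) = 0" using real_vector.dependent_finite[OF fin] by auto
  \<comment> \<open>The sign is chosen to give the dependence a positive coefficient, as the ratio
    below needs one.\<close>
  define c where "c s = (if c0 v > 0 then c0 s else - c0 s)" for s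
  have c: "c v > 0" "(SUM s:S. c s \<cdot> s) = 0" using c0 by (cases "c0 v > 0"; simp add: c_def sum_negf)+
  let ?T = "{s : S. c s > 0}"
  have T: "finite ?T" "?T ~= {}" using fin c0(1) c(1) by auto
  define t where "t = Min ((%s. l s / c s) ` ?T)"
  have "t : (%s. l s / c s) ` ?T" unfolding t_def using T by (intro Min_in) auto
  then obtain s0 where s0: "s0 : ?T" "t = l s0 / c s0" by blast
  have t0: "t >= 0" using s0 l(2) by auto
  have tle: "t * c s <= l s" if "s : S" for s
  proof (cases "c s > 0")
   case True
   hence "t <= l s / c s" unfolding t_def using T that by (intro Min_le) auto
   thus ?thesis using True by (simp add: field_simps)
  next
   case False
   hence "t * c s <= 0" using t0 by (simp add: mult_nonneg_nonpos)
   thus ?thesis using l(2)[OF that] by simp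
  qed
  have z: "l s0 - t * c s0 = 0" using s0 by auto
  have "x = (SUM s:S. (l s - t * c s) \<cdot> s)"
   using c(2) l(1) by (simp add: scaleR_left_diff_distrib sum_subtractf scaleR_sum_right[symmetric]
     flip: scaleR_scaleR)
  also have "... = (SUM s:S - {s0}. (l s - t * c s) \<cdot> s)" using fin s0(1) z by (simp add: sum.remove[of S s0])
  finally have "?P (S - {s0})" using S tle by (intro conjI exI[of _ "%s. l s - t * c s"]) auto
  from min[OF this] show False using fin s0(1) card_gt_0_iff[of S] by auto
 qed
 thus ?thesis using that S l by blast
qed

text \<open>The simplex method. Among the bases whose open cone contains x, one with the lowest
  interpolated height at x is a cell: a generator below its linear function could be exchanged for a
  basis vector, and the exchange would lower the height. Ties are excluded by the genericity of
  \<open>h\<close>, degenerate exchanges by that of x.\<close>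

lemma cell_exists:
 fixes x :: "'e::euclidean_space"
 assumes fin: "finite Gv"
  and dgl: "linear dgl" "!!g. g : Gv ==> dgl g = (1::real)"
  and hgen: "!!B g. B <= Gv ==> vbasis B ==> g : Gv - B ==> hext h B g ~= h g"
  and gen: "genpos Gv x"
  and x: "x = (SUM g:Gv. l g \<cdot> g)" "!!g. g : Gv ==> l g >= 0"
 obtains B where "cell Gv h B" "open_cone B x"
proof-
 let ?C = "{B. B <= Gv & vbasis B & open_cone B x}"
 have openI: "open_cone B x" if "B <= Gv" "vbasis B" "x = (SUM s:B. l' s \<cdot> s)" "!!s. s : B ==> l' s >= 0" for B l'
  using genpos_pos[OF gen that(1) vbasis_finite[OF that(2)] _ that(3,4)] that(2)
   crd_eqI[OF that(2,3)] by (auto simp: open_cone_def vbasis_def)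
 obtain S l' where S: "S <= Gv" "independent S" "x = (SUM s:S. l' s \<cdot> s)" "!!s. s : S ==> l' s >= 0"
  using independent_support_exists[OF fin x] by metis
 have "card S = DIM('e)" using genpos_pos[OF gen S(1) _ _ S(3,4)] independent_bound[OF S(2)] by auto
 hence "vbasis S" using S(2) by (simp add: vbasis_def)
 hence "S : ?C" using openI[OF S(1) _ S(3,4)] S(1) by auto
 moreover have "finite ?C" using fin by (auto intro: finite_subset[of _ "Pow Gv"])
 ultimately obtain B where B: "B : ?C" and min: "!!B'. B' : ?C ==> hext h B x <= hext h B' x"
  using arg_min_if_finite[of ?C "%B. hext h B x"] by (metis (no_types, lifting) empty_iff not_le)
 hence B: "B <= Gv" "vbasis B" "open_cone B x" by auto
 note finB = vbasis_finite[OF B(2)]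
 have "hext h B g < h g" if g: "g : Gv - B" for g
 proof (rule ccontr)
  assume "~ hext h B g < h g"
  hence gt: "h g < hext h B g" using hgen[OF B(1,2) g] by linarith
  define mm where mu_def: "mm = representation B g"
  define lam where lam_def: "lam = representation B x"
  have mu: "(SUM b:B. mm b \<cdot> b) = g" and lam: "(SUM b:B. lam b \<cdot> b) = x" unfolding mu_def lam_def by (rule crd_sum[OF B(2)])+
  have "(SUM b:B. mm b * dgl b) = dgl g"
   unfolding mu[symmetric] by (simp only: linear_sum[OF dgl(1)] linear_scale[OF dgl(1)] real_scaleR_def)
  moreover have "(SUM b:B. mm b * dgl b) = (SUM b:B. mm b)" using dgl(2) B(1) by (intro sum.cong) auto
  \<comment> \<open>The only use of the linear form \<open>dgl\<close>: all generators lie on the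
    hyperplane of degree 1, so g has a positive coordinate and the ratio test below has a
    candidate.\<close>
  ultimately have "(SUM b:B. mm b) = 1" using dgl(2) g by auto
  then obtain b1 where b1: "b1 : B" "mm b1 > 0" by (metis not_le sum_nonpos zero_less_one)
  let ?T = "{b : B. mm b > 0}"
  have T: "finite ?T" "?T ~= {}" using finB b1 by auto
  define t where "t = Min ((%b. lam b / mm b) ` ?T)"
  have "t : (%b. lam b / mm b) ` ?T" unfolding t_def using T by (intro Min_in) auto
  then obtain b0 where b0: "b0 : ?T" "t = lam b0 / mm b0" by blast
  have lpos: "lam b > 0" if "b : B" for b using B(3) that by (auto simp: open_cone_def lam_def)
  have t0: "t > 0" using b0 lpos by auto
  have tle: "t * mm b <= lam b" if "b : B" for b
  proof (cases "mm b > 0")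
   case True
   hence "t <= lam b / mm b" unfolding t_def using T that by (intro Min_le) auto
   thus ?thesis using True by (simp add: field_simps)
  next
   case False
   hence "t * mm b <= 0" using t0 by (simp add: mult_nonneg_nonpos)
   thus ?thesis using lpos[OF that] by simp
  qed
  let ?B = "insert g (B - {b0})"
  have b0B: "b0 : B" and gB: "g ~: B" using b0 g by auto
  \<comment> \<open>New coordinates of x after g has entered with coefficient t; the coefficient of
    b0 becomes 0.\<close>
  define l'' where "l'' b = (if b = g then t else lam b - t * mm b)" for b
  have split: "(SUM b:?B. l'' b \<cdot> F b) = t \<cdot> F g + (SUM b:B. lam b \<cdot> F b) - t \<cdot> (SUM b:B. mm b \<cdot> F b)"
   for F :: "'e => 'f::real_vector"
  proof-
   have "(SUM b:?B. l'' b \<cdot> F b) = t \<cdot> F g + (SUM b:B - {b0}. l'' b \<cdot> F b)" using finB gB by (simp add: l''_def)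
   also have "(SUM b:B - {b0}. l'' b \<cdot> F b) = (SUM b:B - {b0}. (lam b - t * mm b) \<cdot> F b)"
    using gB by (intro sum.cong) (auto simp: l''_def)
   also have "... = (SUM b:B. (lam b - t * mm b) \<cdot> F b)" using finB b0 by (intro sum.mono_neutral_left) auto
   also have "... = (SUM b:B. lam b \<cdot> F b) - t \<cdot> (SUM b:B. mm b \<cdot> F b)"
    by (simp add: scaleR_left_diff_distrib sum_subtractf scaleR_sum_right)
   finally show ?thesis by simp
  qed
  have x': "x = (SUM b:?B. l'' b \<cdot> b)" using split[of "%b. b"] mu lam by simp
  have "g ~: span (B - {b0})"
  proof
   assume "g : span (B - {b0})"
   then obtain c where c: "g = (SUM b:B - {b0}. c b \<cdot> b)" using span_finite[of "B - {b0}"] finB by auto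
   have "g = (SUM b:B. (if b = b0 then 0 else c b) \<cdot> b)" unfolding c using finB b0B by (intro sum.mono_neutral_cong_left) auto
   from crd_eqI[OF B(2) this b0B] have "mm b0 = 0" by (simp add: mu_def)
   thus False using b0 by auto
  qed
  hence "independent ?B" using B(2) independent_mono[of B "B - {b0}"] by (intro independent_insertI) (auto simp: vbasis_def)
  moreover have "card ?B = DIM('e)" using finB gB b0B B(2) by (simp add: vbasis_def card_gt_0_iff)
  ultimately have B': "vbasis ?B" "?B <= Gv" using B(1) g by (auto simp: vbasis_def)
  have "open_cone ?B x" using tle t0 gB by (intro openI[OF B'(2,1) x']) (auto simp: l''_def)
  hence le: "hext h B x <= hext h ?B x" using min B' by auto
  have "hext h ?B x = (SUM b:?B. l'' b * h b)" unfolding hext_def using crd_eqI[OF B'(1) x'] by (intro sum.cong) auto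
  also have "... = t * h g + hext h B x - t * hext h B g" using split[of h] by (simp add: hext_def lam_def mu_def)
  also have "... < hext h B x" using t0 gt by simp
  finally show False using le by simp
 qed
 hence "cell Gv h B" using B by (auto simp: cell_def)
 thus ?thesis using that B(3) by blast
qed

text \<open>Heights are distinct powers of one number t. Equality of \<open>hext h B g\<close> and
  \<open>h g\<close> is a polynomial equation in t whose coefficient at the power of g is 1, because
  g is not in \<open>B\<close>; t avoids the roots of these finitely many polynomials.\<close>

lemma generic_height_exists:
 fixes Gv :: "'e::euclidean_space set"
 assumes "finite Gv"
 obtains h where "!!B g. B <= Gv ==> vbasis B ==> g : Gv - B ==> hext h B g ~= h g"
proof-
 obtain idx :: "'e => nat" where idx: "inj_on idx Gv" using assms finite_imp_inj_to_nat_seg by metis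
 define p where "p B g = monom 1 (idx g) - (SUM b:B. monom (representation B g b) (idx b))" for B g
 let ?I = "{(B, g). B <= Gv & g : Gv - B}"
 have fin: "finite ?I" by (rule finite_subset[of _ "Pow Gv \<times> Gv"]) (use assms in auto)
 have "p B g ~= 0" if "(B, g) : ?I" for B g
 proof-
  have "coeff (p B g) (idx g) = 1"
  proof-
   have "coeff (monom (representation B g b) (idx b)) (idx g) = 0" if "b : B" for b
   proof-
    have "idx b ~= idx g" using that `(B, g) : ?I` idx by (auto simp: inj_on_def)
    thus ?thesis by simp
   qed
   thus ?thesis by (simp add: p_def coeff_sum)
  qed
  thus ?thesis by auto
 qed
 hence "finite (UN (B, g):?I. {t. poly (p B g) t = 0})" using fin by (intro finite_UN_I) (auto simp: poly_roots_finite)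
 then obtain t where t: "t ~: (UN (B, g):?I. {t. poly (p B g) t = 0})" using ex_new_if_finite[OF infinite_UNIV_char_0] by blast
 show ?thesis
 proof (rule that[of "%g. t ^ idx g"])
  fix B g assume "B <= Gv" "vbasis B" "g : Gv - B"
  hence "poly (p B g) t ~= 0" using t by auto
  thus "hext (%g. t ^ idx g) B g ~= t ^ idx g" by (auto simp: p_def hext_def poly_sum poly_monom)
 qed
qed

text \<open>The bad shifts lie in countably many translates of proper subspaces, a null set, which
  cannot contain a nonempty open set.\<close>

lemma generic_shift_exists:
 fixes Gv :: "'e::euclidean_space set"
 assumes "finite Gv" "countable W" "open U" "U ~= {}"
 obtains xx where "xx : U" "!!w. w : W ==> genpos Gv (w + xx)"
proof-
 let ?F = "{F. F <= Gv & card F < DIM('e)}"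
 let ?N = "UN F:?F. UN w:W. (%x. - w + x) ` span F"
 have "negligible ((%x. - w + x) ` span F)" if "F : ?F" for F w
 proof-
  have "dim (span F) < DIM('e)" using that assms(1) dim_le_card[of "span F" F] finite_subset[of F Gv] by auto
  hence "negligible (span F)" using negligible_lowdim by blast
  thus ?thesis by (rule negligible_translation)
 qed
 hence "negligible (UN w:W. (%x. - w + x) ` span F)" if "F : ?F" for F using that assms(2) by (intro negligible_countable_Union) auto
 moreover have "countable ?F" using assms(1) by (intro countable_finite finite_subset[of ?F "Pow Gv"]) auto
 ultimately have "negligible ?N" using negligible_countable_Union[of "(%F. UN w:W. (%x. - w + x) ` span F) ` ?F"]
   countable_image by blast
 hence "~ U <= ?N" using assms(3,4) open_not_negligible negligible_subset by blast
 hence "EX xx. xx : U & xx ~: ?N" by (simp only: subset_iff not_all not_imp)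
 then obtain xx where x: "xx : U" "xx ~: ?N" by (elim exE conjE)
 have "genpos Gv (w + xx)" if "w : W" for w unfolding genpos_def
 proof (intro allI impI notI)
  fix F assume F: "F <= Gv" "card F < DIM('e)" "w + xx : span F"
  hence "xx : (%x. - w + x) ` span F" by (intro image_eqI[of _ _ "w + xx"]) auto
  thus False using x(2) F that by blast
 qed
 thus ?thesis using that x(1) by blast
qed

section \<open>The semigroup ring of a cone\<close>

definition nmul :: "nat => 'g::comm_monoid_add => 'g" where
 "nmul k w = (SUM i<k. w)"

lemma nmul_0 [simp]: "nmul 0 w = 0"
 by (simp add: nmul_def)

lemma nmul_Suc: "nmul (Suc k) w = nmul k w + w"
 by (simp add: nmul_def)

lemma nmul_mem: "submon D ==> w : D ==> nmul k w : D"
 by (induction k) (auto simp: nmul_Suc submon_def)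

lemma msing_power: "msing w c ^ k = msing (nmul k w) (c ^ k :: complex)"
 by (induction k) (simp_all add: nmul_Suc mult_single mult.commute add.commute single_one)

lemma additive_map_nmul: "additive_map h ==> h (nmul k w) = nmul k (h w)"
 by (induction k) (simp_all add: nmul_Suc additive_map_def)

lemma nmul_scaleR: "nmul k (x :: 'e::real_vector) = real k \<cdot> x"
 by (induction k) (simp_all add: nmul_Suc scaleR_left_distrib)

lemma nmul_int: "nmul k (x :: int) = int k * x"
 by (induction k) (simp_all add: nmul_Suc algebra_simps)

definition bdiff :: "(int => int) => int => int" where
 "bdiff c m = c m - c (m - 1)"

text \<open>The cone is described twice: by the integral inequalities \<open>ell i\<close>, which
  govern faces and the interior, and by the degree-one points \<open>Gs\<close>, which govern the
  grading and the triangulation. \<open>Gs\<close> generates the real cone, not necessarily the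
  semigroup \<open>L\<close>.\<close>

locale cone_semigroup =
 fixes L :: "'g::ab_group_add set" and deg :: "'g => int" and emb :: "'g => 'e::euclidean_space"
  and Gs :: "'g set" and I :: "'i set" and ell :: "'i => 'e => real" and dgl :: "'e => real"
 assumes emb: "additive_map emb" "inj emb"
  and deg: "additive_map deg"
  and dgl: "linear dgl" "!!w. dgl (emb w) = real_of_int (deg w)"
  and lattice: "!!r. finite {w. norm (emb w) <= r}"
  and Gs: "finite Gs" "Gs <= L" "!!g. g : Gs ==> deg g = 1" "span (emb ` Gs) = UNIV"
  and ell: "finite I" "!!i. i : I ==> linear (ell i)" "!!i w. i : I ==> ell i (emb w) : \<int>"
   "!!i. i : I ==> EX x. ell i x ~= 0"
  and L_ell: "!!w. w : L <-> (ALL i:I. ell i (emb w) >= 0)"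
  and L_cone: "!!w. w : L ==> EX l. (ALL g:Gs. l g >= 0) & emb w = (SUM g:Gs. l g \<cdot> emb g)"
begin

lemma emb_add: "emb (v + w) = emb v + emb w"
 using emb(1) by (simp add: additive_map_def)

lemma emb_diff: "emb (v - w) = emb v - emb w"
 using emb_add[of "v - w" w] by simp

lemma emb_0: "emb 0 = 0"
 using emb(1) by (simp add: additive_map_def)

lemma emb_nmul: "emb (nmul k w) = real k \<cdot> emb w"
 by (simp add: additive_map_nmul[OF emb(1)] nmul_scaleR)

lemma deg_add: "deg (v + w) = deg v + deg w"
 using deg by (simp add: additive_map_def)

lemma deg_diff: "deg (v - w) = deg v - deg w"
 using deg_add[of "v - w" w] by simp

lemma deg_0: "deg 0 = 0"
 using deg by (simp add: additive_map_def)

lemma deg_nmul: "deg (nmul k w) = int k * deg w"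
 by (simp add: additive_map_nmul[OF deg] nmul_int)

lemma submon_L: "submon L"
 unfolding submon_def
proof (intro conjI ballI)
 show "0 : L" using L_ell[of 0] ell(2) by (auto simp: emb_0 linear_0)
 fix v w assume "v : L" "w : L"
 thus "v + w : L" using ell(2) by (auto simp: L_ell emb_add linear_add)
qed

lemma deg_combination:
 assumes "emb w = (SUM g:Gs. l g \<cdot> emb g)"
 shows "real_of_int (deg w) = (SUM g:Gs. l g)"
 using arg_cong[OF assms, of dgl] by (simp add: linear_sum[OF dgl(1)] linear_scale[OF dgl(1)] dgl(2) Gs(3) cong: sum.cong)

lemma deg_nonneg: "w : L ==> deg w >= 0"
proof-
 assume "w : L"
 then obtain l where l: "ALL g:Gs. l g >= 0" "emb w = (SUM g:Gs. l g \<cdot> emb g)" using L_cone by blast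
 have "(SUM g:Gs. l g) >= 0" using l(1) by (intro sum_nonneg) auto
 thus ?thesis using deg_combination[OF l(2)] by simp
qed

lemma finite_L_deg: "finite {w : L. deg w = m}"
proof (rule finite_subset[OF _ lattice[of "\<bar>real_of_int m\<bar> * (SUM g:Gs. norm (emb g))"]], safe)
 fix w assume "w : L"
 then obtain l where l: "ALL g:Gs. l g >= 0" "emb w = (SUM g:Gs. l g \<cdot> emb g)" using L_cone by blast
 note s = deg_combination[OF l(2)]
 have le: "l g <= \<bar>real_of_int (deg w)\<bar>" if "g : Gs" for g using member_le_sum[of g Gs l] that l(1) Gs(1) s by auto
 have "norm (emb w) <= (SUM g:Gs. norm (l g \<cdot> emb g))" unfolding l(2) by (rule norm_sum)
 also have "... <= (SUM g:Gs. \<bar>real_of_int (deg w)\<bar> * norm (emb g))"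
  using l(1) le by (intro sum_mono) (auto intro!: mult_right_mono)
 finally show "norm (emb w) <= \<bar>real_of_int (deg w)\<bar> * (SUM g:Gs. norm (emb g))" by (simp add: sum_distrib_left)
qed

definition LR :: "int => ('g \<Rightarrow>\<^sub>0 complex) set" where
 "LR m = {r. pkeys r <= {w : L. deg w = m}}"

lemma LR_monalg: "r : LR m ==> r : monalg L"
 by (auto simp: LR_def monalg_def)

lemma LR_single: "w : L ==> deg w = m ==> msing w c : LR m"
 by (auto simp: LR_def)

end

sublocale cone_semigroup < LR: nonneg_graded LR
proof
 fix r s l m
 show "0 : LR m" by (simp add: LR_def)
 show "r : LR m ==> s : LR m ==> r + s : LR m" using keys_add[of r s] by (auto simp: LR_def)
 show "r : LR m ==> - r : LR m" by (auto simp: LR_def in_keys_iff)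
 show "1 : LR 0" using submon_L by (auto simp: LR_def submon_def deg_0)
 show "r * s : LR (l + m)" if "r : LR l" "s : LR m" unfolding LR_def
 proof safe
  fix x assume "x : pkeys (r * s)"
  then obtain v w where "x = v + w" "v : pkeys r" "w : pkeys s" using keys_mult[of r s] by auto
  moreover from this have "v : L" "w : L" "deg v = l" "deg w = m" using that by (auto simp: LR_def)
  ultimately show "x : L" "deg x = l + m" using submon_L by (auto simp: submon_def deg_add)
 qed
 show "LR m = {0}" if "m < 0"
 proof-
  have "{w : L. deg w = m} = {}" using deg_nonneg that by force
  thus ?thesis by (auto simp: LR_def subset_iff in_keys_iff intro!: poly_mapping_eqI)
 qed
qed

text \<open>The small generic vector \<open>xx\<close> moves every lattice point of the cone into the interior of a unique cell.\<close>

locale tricone = cone_semigroup L deg emb Gs I ell dgl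
 for L :: "'g::ab_group_add set" and deg and emb :: "'g => 'e::euclidean_space"
  and Gs and I :: "'i set" and ell and dgl +
 fixes h :: "'e => real" and xx :: 'e
 assumes hgen: "!!B g. B <= emb ` Gs ==> vbasis B ==> g : emb ` Gs - B ==> hext h B g ~= h g"
  and xi_gen: "!!w. genpos (emb ` Gs) (emb w + xx)"
  and xi_cone: "EX l. (ALL g:Gs. l g >= 0) & xx = (SUM g:Gs. l g \<cdot> emb g)"
  and xi_ell: "!!i. i : I ==> 0 < ell i xx & ell i xx < 1"

lemma (in cone_semigroup) triangulation_exists:
 assumes "countable (UNIV :: 'g set)"
 obtains h xx where "tricone L deg emb Gs I ell dgl h xx"
proof-
 let ?Gv = "emb ` Gs"
 have finGv: "finite ?Gv" using Gs(1) by simp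
 obtain h where h: "!!B g. B <= ?Gv ==> vbasis B ==> g : ?Gv - B ==> hext h B g ~= h g" using generic_height_exists[OF finGv] by metis
 obtain B0 where B0: "B0 <= ?Gv" "independent B0" "?Gv <= span B0" by (rule maximal_independent_subset)
 have sp: "span B0 = UNIV" using B0(3) Gs(4) span_minimal[OF B0(3)] by auto
 have vb: "vbasis B0" using B0(2) sp by (metis dim_UNIV dim_span_eq_card_independent vbasis_def)
 note finB0 = vbasis_finite[OF vb]
 \<comment> \<open>Positive coordinates keep the shift inside the cone, and
   \<open>ell i x < 1\<close> keeps it below the first lattice level of each facet.\<close>
 let ?U = "{x. (ALL b:B0. 0 < representation B0 x b) & (ALL i:I. ell i x < 1)}"
 have lin: "linear (%x. representation B0 x b)" for b by (rule linearI) (auto simp: crd_add[OF vb] crd_scale[OF vb])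
 have cont: "continuous_on UNIV (%x. representation B0 x b)" "i : I ==> continuous_on UNIV (ell i)" for b i
  using lin[of b] ell(2)[of i] by (auto intro: linear_continuous_on linear_conv_bounded_linear[THEN iffD1])
 have "open {x. 0 < representation B0 x b}" "i : I ==> open {x. ell i x < 1}" for b i
  using cont by (auto intro!: open_Collect_less continuous_on_const)
 hence "open ((INT b:B0. {x. 0 < representation B0 x b}) Int (INT i:I. {x. ell i x < 1}))"
  using finB0 ell(1) by (intro open_Int open_INT) auto
 also have "(INT b:B0. {x. 0 < representation B0 x b}) Int (INT i:I. {x. ell i x < 1}) = ?U" by auto
 finally have openU: "open ?U" .
 have U_ne: "?U ~= {}"
 proof-
  let ?s = "SUM b:B0. b"
  define M where "M = Max (insert 1 ((%i. ell i ?s) ` I))"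
  have M: "M >= 1" "!!i. i : I ==> ell i ?s <= M" unfolding M_def using ell(1) by (auto intro!: Max_ge)
  let ?x = "(1 / (2 * M)) \<cdot> ?s"
  have "representation B0 ?s b = 1" if "b : B0" for b using crd_eqI[OF vb, of ?s "%_. 1" b] that by simp
  hence "0 < representation B0 ?x b" if "b : B0" for b using that M(1) by (simp add: crd_scale[OF vb])
  moreover have "ell i ?x < 1" if "i : I" for i
  proof-
   have "ell i ?x = ell i ?s / (2 * M)" using ell(2)[OF that] by (simp add: linear_scale)
   also have "... < 1" using M(1) M(2)[OF that] by (simp add: field_simps)
   finally show ?thesis .
  qed
  ultimately have "?x : ?U" by auto
  thus ?thesis by blast
 qed
 have "countable (range emb)" using assms by simp
 from generic_shift_exists[OF finGv this openU U_ne]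
 obtain xx where x: "xx : ?U" "!!w. w : range emb ==> genpos ?Gv (w + xx)" by blast
 have xs: "xx = (SUM b:B0. representation B0 xx b \<cdot> b)" by (simp add: crd_sum[OF vb])
 have bL: "ell i b >= 0" if "b : B0" "i : I" for b i using that B0(1) Gs(2) L_ell by blast
 show ?thesis
 proof (rule that[of h xx], unfold_locales)
  show "EX l. (ALL g:Gs. 0 <= l g) & xx = (SUM g:Gs. l g \<cdot> emb g)"
  proof (intro exI conjI)
   let ?l = "%g. if emb g : B0 then representation B0 xx (emb g) else 0"
   show "ALL g:Gs. 0 <= ?l g" using x(1) by (auto intro: less_imp_le)
   have "(SUM g:Gs. ?l g \<cdot> emb g) = (SUM v:?Gv. (if v : B0 then representation B0 xx v else 0) \<cdot> v)"
    by (subst sum.reindex) (auto intro: inj_on_subset[OF emb(2)])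
   also have "... = (SUM b:B0. representation B0 xx b \<cdot> b)" using finGv B0(1) by (intro sum.mono_neutral_cong_right) auto
   finally show "xx = (SUM g:Gs. ?l g \<cdot> emb g)" using xs by simp
  qed
  fix i assume i: "i : I"
  have e: "ell i xx = (SUM b:B0. representation B0 xx b * ell i b)" using arg_cong[OF crd_sum[OF vb, of xx], of "ell i"]
   by (simp add: linear_sum[OF ell(2)[OF i]] linear_scale[OF ell(2)[OF i]])
  have "EX b:B0. ell i b ~= 0"
  proof (rule ccontr)
   assume "~ ?thesis"
   hence "!!x. x : span B0 ==> ell i x = 0" using linear_eq_0_on_span[OF ell(2)[OF i], of B0] by blast
   thus False using ell(4)[OF i] sp by auto
  qed
  then obtain b where b: "b : B0" "ell i b > 0" using bL i by force
  have "0 < (SUM b:B0. representation B0 xx b * ell i b)" using x(1) b bL i finB0 by (intro sum_pos2[of _ b]) (auto intro: less_imp_le)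
  thus "0 < ell i xx & ell i xx < 1" using e x(1) i by auto
 qed (use h x(2) in auto)
qed

context tricone
begin

abbreviation "Gv == emb ` Gs"

lemma finite_Gv: "finite Gv"
 using Gs(1) by simp

lemma Gv_ell: "v : Gv ==> i : I ==> ell i v >= 0"
 using Gs(2) L_ell by blast

lemma open_cone_ell:
 assumes "cell Gv h B" "open_cone B x" "i : I"
 shows "ell i x >= 0"
proof-
 have B: "vbasis B" "B <= Gv" using assms(1) by (auto simp: cell_def)
 have "ell i x = (SUM b:B. representation B x b * ell i b)" using arg_cong[OF crd_sum[OF B(1), of x], of "ell i"]
  by (simp add: linear_sum[OF ell(2)[OF assms(3)]] linear_scale[OF ell(2)[OF assms(3)]])
 also have "... >= 0" using assms B(2) Gv_ell by (intro sum_nonneg mult_nonneg_nonneg) (auto simp: open_cone_def less_imp_le)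
 finally show ?thesis .
qed

lemma open_cone_mem:
 assumes "cell Gv h B" "open_cone B (emb w + xx)"
 shows "w : L"
 unfolding L_ell
proof
 fix i assume i: "i : I"
 have "ell i (emb w) + ell i xx >= 0" using open_cone_ell[OF assms i] by (simp add: linear_add[OF ell(2)[OF i]])
 \<comment> \<open>Smallness of \<open>xx\<close> pays off here: integrality improves > -1 to >=
   0.\<close>
 hence "ell i (emb w) > -1" using xi_ell[OF i] by simp
 moreover obtain k where "ell i (emb w) = of_int k" using ell(3)[OF i, of w] by (elim Ints_cases)
 ultimately show "ell i (emb w) >= 0" by simp
qed

lemma cell_of_exists:
 assumes "w : L"
 shows "EX! B. cell Gv h B & open_cone B (emb w + xx)"
proof-
 obtain l1 where l1: "ALL g:Gs. l1 g >= 0" "emb w = (SUM g:Gs. l1 g \<cdot> emb g)" using L_cone[OF assms] by blast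
 obtain l2 where l2: "ALL g:Gs. l2 g >= 0" "xx = (SUM g:Gs. l2 g \<cdot> emb g)" using xi_cone by blast
 let ?l = "%v. l1 (inv_into UNIV emb v) + l2 (inv_into UNIV emb v)"
 have 1: "emb w + xx = (SUM v:Gv. ?l v \<cdot> v)"
  by (subst sum.reindex) (auto simp: l1(2) l2(2) inv_f_f[OF emb(2)] scaleR_left_distrib sum.distrib
    intro: inj_on_subset[OF emb(2)])
 have 2: "?l v >= 0" if "v : Gv" for v using that l1(1) l2(1) by (auto simp: inv_f_f[OF emb(2)])
 have 3: "dgl v = 1" if "v : Gv" for v using that dgl(2) Gs(3) by auto
 obtain B where "cell Gv h B" "open_cone B (emb w + xx)" using cell_exists[OF finite_Gv dgl(1) 3 hgen xi_gen[of w] 1 2] by blast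
 thus ?thesis using cell_unique by blast
qed

definition cell_of :: "'g => 'e set" where
 "cell_of w = (THE B. cell Gv h B & open_cone B (emb w + xx))"

lemma cell_of: "w : L ==> cell Gv h (cell_of w)" "w : L ==> open_cone (cell_of w) (emb w + xx)"
 using theI'[OF cell_of_exists] by (auto simp: cell_of_def)

lemma cell_of_eqI: "cell Gv h B ==> open_cone B (emb w + xx) ==> cell_of w = B"
 using cell_of_exists[OF open_cone_mem] cell_of[OF open_cone_mem] by metis

end

lemma finite_has_max:
 fixes F :: "'x => 'y::linorder"
 assumes "finite S" "S ~= {}"
 obtains p where "p : S" "!!q. q : S ==> F q <= F p"
proof-
 have "Max (F ` S) : F ` S" using assms by (intro Max_in) auto
 then obtain p where "p : S" "Max (F ` S) = F p" by auto
 moreover have "F q <= Max (F ` S)" if "q : S" for q using assms(1) that by (intro Max_ge) auto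
 ultimately show ?thesis using that by metis
qed

lemma lookup_ksgn_mult:
 "lkp (ksgn b J * r) w = ksgn b J * lkp (r :: 'g::ab_group_add \<Rightarrow>\<^sub>0 complex) w"
 by (cases "even (card {j : J. j < b})") (auto simp: ksgn_def)

section \<open>An acyclic matching on the Koszul complex of monomial powers\<close>

context tricone
begin

context
 fixes ga :: "nat => 'g" and N k :: nat and a dg
 assumes bij: "bij_betw ga {..<N} Gs" and k: "0 < k"
 defines "a == (%j. msing (ga j) (1::complex) ^ k)" and "dg == (%_::nat. int k)"
begin

abbreviation kg where "kg j == nmul k (ga j)"

text \<open>Moving \<open>kg j\<close> between the monomial \<open>w\<close> and the exterior part
  \<open>J\<close> changes the coordinate by k and the membership of j, and so leaves this sum
  fixed.\<close>

definition tot where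
 "tot w J j = representation (cell_of w) (emb w + xx) (emb (ga j)) + (if j : J then real k else 0)"

text \<open>The indices that can be toggled: for j in \<open>J\<close> the inequality holds because
  the coordinate is positive; for j outside \<open>J\<close> it says that \<open>kg j\<close> can be
  subtracted from \<open>w\<close> without leaving the open cell.\<close>

definition free where
 "free w J = {j : {..<N}. emb (ga j) : cell_of w & tot w J j > real k}"

definition pivot where
 "pivot w J = Min (free w J)"

text \<open>The matching toggles the pivot: a lower pair \<open>(J, w)\<close> is matched with
  \<open>(insert j J, w - kg j)\<close> for j the pivot. Toggling keeps the cell and the free set,
  hence the pivot.\<close>

definition lower where
 "lower w J <-> free w J ~= {} & pivot w J ~: J"

text \<open>The monomial contributes its interpolated height, each exterior generator its own
  height. Turning a generator of \<open>J\<close> into part of the monomial can only lose height,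
  which is what makes the matching acyclic.\<close>

definition level where
 "level w J = hext h (cell_of w) (emb w + xx) + real k * (SUM j:J. h (emb (ga j)))"

lemma a_eq: "a j = msing (kg j) 1"
 by (simp add: a_def msing_power)

lemma gamma_mem: "j < N ==> ga j : Gs"
 using bij by (auto simp: bij_betw_def)

lemma gamma_inj: "j < N ==> l < N ==> emb (ga j) = emb (ga l) <-> j = l"
 using bij emb(2) by (auto simp: bij_betw_def inj_on_def)

lemma kg_mem: "j < N ==> kg j : L"
 using gamma_mem Gs(2) nmul_mem[OF submon_L] by blast

lemma kg_deg: "j < N ==> deg (kg j) = int k"
 using gamma_mem Gs(3) by (simp add: deg_nmul)

lemma a_deg: "j < N ==> a j : LR (dg j)"
 by (simp add: a_eq dg_def LR_single kg_mem kg_deg)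

lemma finite_free: "finite (free w J)"
 by (simp add: free_def)

lemma pivot_mem: "free w J ~= {} ==> pivot w J : free w J"
 using Min_in[OF finite_free] by (simp add: pivot_def)

lemma L_add: "v : L ==> w : L ==> v + w : L"
 using submon_L by (auto simp: submon_def)

lemma crd_move:
 assumes "vbasis B" "j < N" "l < N" "emb (ga j) : B"
 shows "representation B (emb (w + kg j) + xx) (emb (ga l)) =
  representation B (emb w + xx) (emb (ga l)) + (if j = l then real k else 0)"
proof-
 have "emb (w + kg j) + xx = (emb w + xx) + real k \<cdot> emb (ga j)" by (simp add: emb_add emb_nmul)
 thus ?thesis using assms gamma_inj[of l j] by (auto simp add: crd_add crd_scale crd_basis)
qed

lemma cell_of_vbasis: "w : L ==> vbasis (cell_of w)" "w : L ==> cell_of w <= Gv"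
 using cell_of(1) by (auto simp: cell_def)

lemma cell_index:
 assumes "w : L" "b : cell_of w"
 obtains l where "l < N" "b = emb (ga l)" using cell_of_vbasis(2)[OF assms(1)] assms(2) bij by (fastforce simp: bij_betw_def)

lemma cell_of_up:
 assumes "w : L" "j < N" "emb (ga j) : cell_of w"
 shows "cell_of (w + kg j) = cell_of w"
proof (rule cell_of_eqI[OF cell_of(1)[OF assms(1)]])
 show "open_cone (cell_of w) (emb (w + kg j) + xx)" unfolding open_cone_def
 proof
  fix b assume b: "b : cell_of w"
  then obtain l where l: "l < N" "b = emb (ga l)" using cell_index assms(1) by blast
  thus "0 < representation (cell_of w) (emb (w + kg j) + xx) b"
   using crd_move[OF cell_of_vbasis(1)[OF assms(1)] assms(2) l(1) assms(3), of w]
    cell_of(2)[OF assms(1)] b by (auto simp: open_cone_def)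
 qed
qed

lemma free_move:
 assumes "w : L" "j < N" "emb (ga j) : cell_of w" "j : J"
 shows "free (w + kg j) (J - {j}) = free w J"
proof-
 have "tot (w + kg j) (J - {j}) l = tot w J l" if "l < N" for l
  using crd_move[OF cell_of_vbasis(1)[OF assms(1)] assms(2) that assms(3), of w] assms(4) by (auto simp: tot_def cell_of_up[OF assms(1-3)])
 thus ?thesis by (auto simp: free_def cell_of_up[OF assms(1-3)])
qed

lemma cell_of_down:
 assumes "w : L" "j : free w J" "j ~: J"
 shows "w - kg j : L" "cell_of (w - kg j) = cell_of w"
  "free (w - kg j) (insert j J) = free w J"
proof-
 have j: "j < N" "emb (ga j) : cell_of w" "tot w J j > real k" using assms(2) by (auto simp: free_def)
 note vb = cell_of_vbasis(1)[OF assms(1)]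
 have *: "open_cone (cell_of w) (emb (w - kg j) + xx)" unfolding open_cone_def
 proof
  fix b assume b: "b : cell_of w"
  then obtain l where l: "l < N" "b = emb (ga l)" using cell_index assms(1) by blast
  have "representation (cell_of w) (emb w + xx) b =
    representation (cell_of w) (emb (w - kg j) + xx) b + (if j = l then real k else 0)"
   using crd_move[OF vb j(1) l(1) j(2), of "w - kg j"] l(2) by simp
  moreover have "0 < representation (cell_of w) (emb w + xx) b" using cell_of(2)[OF assms(1)] b by (auto simp: open_cone_def)
  ultimately show "0 < representation (cell_of w) (emb (w - kg j) + xx) b" using j(3) assms(3) l(2) by (auto simp: tot_def split: if_splits)
 qed
 note cw = cell_of(1)[OF assms(1)]
 show 1: "w - kg j : L" by (rule open_cone_mem[OF cw *])
 show 2: "cell_of (w - kg j) = cell_of w" by (rule cell_of_eqI[OF cw *])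
 show "free (w - kg j) (insert j J) = free w J" using free_move[OF 1 j(1), of "insert j J"] j(2) 2 assms(3) by simp
qed

text \<open>The level strictly drops along all faces of the partner other than the matched one.\<close>

lemma level_face:
 assumes "w : L" "lower w J" "finite J" "j : J" "j < N"
  and "w' = w - kg (pivot w J)" "J' = insert (pivot w J) J"
  and "lower (w' + kg j) (J' - {j})"
 shows "level (w' + kg j) (J' - {j}) < level w J"
proof-
 let ?j0 = "pivot w J"
 have j0: "?j0 : free w J" "?j0 ~: J" using assms(2) pivot_mem by (auto simp: lower_def)
 hence j0': "?j0 < N" "emb (ga ?j0) : cell_of w" by (auto simp: free_def)
 note d = cell_of_down[OF assms(1) j0, folded assms(6,7)]
 have ne: "j ~= ?j0" using j0(2) assms(4) by auto
 let ?B = "cell_of w" and ?w'' = "w' + kg j"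
 have w'': "?w'' : L" using d(1) kg_mem[OF assms(5)] L_add by blast
 let ?B'' = "cell_of ?w''"
 \<comment> \<open>Otherwise the move of j would leave the free set unchanged, and its least
   element, the pivot, belongs to \<open>J' - {j}\<close>; the face would then not be lower.\<close>
 have jB: "emb (ga j) ~: ?B"
 proof
  assume jB: "emb (ga j) : ?B"
  hence "free ?w'' (J' - {j}) = free w' J'" using free_move[OF d(1) assms(5), of J'] d(2) assms(4,7) by auto
  hence "pivot ?w'' (J' - {j}) = ?j0" using d(3) by (simp add: pivot_def)
  thus False using assms(8) ne assms(7) by (auto simp: lower_def)
 qed
 note vb = cell_of_vbasis(1)[OF assms(1)] and vb'' = cell_of_vbasis(1)[OF w'']
 note c = cell_of(1)[OF assms(1)] and c'' = cell_of(1)[OF w'']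
 have w: "emb w + xx = (emb w' + xx) + real k \<cdot> emb (ga ?j0)" by (simp add: assms(6) emb_diff emb_nmul)
 have hw: "hext h ?B (emb w + xx) = hext h ?B (emb w' + xx) + real k * h (emb (ga ?j0))"
  unfolding w by (simp add: hext_add[OF vb] hext_scale[OF vb] hext_base[OF vb j0'(2)])
 have hw'': "hext h ?B'' (emb ?w'' + xx) = hext h ?B'' (emb w' + xx) + real k * hext h ?B'' (emb (ga j))"
 proof-
  have e: "emb ?w'' + xx = (emb w' + xx) + real k \<cdot> emb (ga j)" by (simp add: emb_add emb_nmul)
  show ?thesis unfolding e by (simp add: hext_add[OF vb''] hext_scale[OF vb''])
 qed
 have o: "open_cone ?B (emb w' + xx)" using cell_of(2)[OF d(1)] d(2) by simp
 have gj: "emb (ga j) : Gv" using gamma_mem[OF assms(5)] by simp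
 have kpos: "real k > 0" using k by simp
 \<comment> \<open>If the cell stays the same, \<open>ga j\<close> lies outside it and strictly
   above its linear function. If the cell changes, the linear function of the new one is strictly
   smaller on the open cone of the old one.\<close>
 have *: "hext h ?B'' (emb w' + xx) + real k * hext h ?B'' (emb (ga j)) <
   hext h ?B (emb w' + xx) + real k * h (emb (ga j))"
 proof (cases "?B = ?B''")
  case True
  hence "hext h ?B'' (emb (ga j)) < h (emb (ga j))" using c'' gj jB by (auto simp: cell_def)
  thus ?thesis using True kpos by simp
 next
  case False
  have "real k * hext h ?B'' (emb (ga j)) <= real k * h (emb (ga j))" using cell_height_le[OF c'' gj] kpos by simp
  thus ?thesis using cell_height_maximal(2)[OF c c'' o False] by linarith
 qed
 have "(SUM l:J. h (emb (ga l))) = h (emb (ga j)) + (SUM l:J - {j}. h (emb (ga l)))" using assms(3,4) by (simp add: sum.remove)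
 moreover have "J' - {j} = insert ?j0 (J - {j})" using ne assms(7) by auto
 hence "(SUM l:J' - {j}. h (emb (ga l))) = h (emb (ga ?j0)) + (SUM l:J - {j}. h (emb (ga l)))" using assms(3) j0(2) by simp
 ultimately show ?thesis using * unfolding level_def hw hw'' by (simp add: distrib_left)
qed

definition elementary :: "nat set => 'g => complex => nat set => 'g \<Rightarrow>\<^sub>0 complex" where
 "elementary K w c J = (if J = K then msing w c else 0)"

lemma lookup_kdiff:
 "lkp (kdiff A a z J) v = (SUM g:A - J. ksgn g J * lkp (z (insert g J)) (v - kg g))" unfolding kdiff_def lookup_sum
 by (intro sum.cong refl) (simp add: mult.assoc lookup_ksgn_mult a_eq lookup_single_mult)

lemma deg_sum_dg: "sum dg J = int k * int (card J)"
 by (simp add: dg_def)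

definition bpairs where
 "bpairs i D = {(J, v). J <= {..<N} & card J = i & v : L & deg v = D - int k * int i}"

lemma finite_bpairs: "finite (bpairs i D)"
 by (rule finite_subset[of _ "Pow {..<N} \<times> {v : L. deg v = D - int k * int i}"])
  (auto simp: bpairs_def finite_L_deg)

lemma kchain_support:
 assumes "z : LR.kchain {..<N} dg i D" "lkp (z J) v ~= 0"
 shows "(J, v) : bpairs i D"
proof-
 have "z J ~= 0" using assms(2) by auto
 hence "J <= {..<N}" "card J = i" "z J : LR (D - sum dg J)" using assms(1) by (auto simp: LR.kchain_def)
 thus ?thesis using assms(2) by (auto simp: bpairs_def LR_def deg_sum_dg in_keys_iff)
qed

lemma kchain_elementary:
 assumes "(K, w) : bpairs i D"
 shows "elementary K w c : LR.kchain {..<N} dg i D"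
 using assms by (auto simp: LR.kchain_def elementary_def bpairs_def deg_sum_dg intro!: LR_single)

text \<open>Gaussian elimination along the matching. The boundary of the partner of a lower pair has
  a unit coefficient at that pair and meets other lower pairs only at smaller levels, so the pair of
  highest level is cancelled first. \<open>AA\<close> holds the pairs that may still occur; it is
  closed under passing to lower levels.\<close>

lemma eliminate_lower:
 assumes "AA <= bpairs i D" "!!K w. (K, w) : AA ==> lower w K"
  and "!!K w J v. (K, w) : AA ==> (J, v) : bpairs i D ==> lower v J ==>
     level v J < level w K ==> (J, v) : AA"
  and "z : LR.kchain {..<N} dg i D"
  and "!!J v. lkp (z J) v ~= 0 ==> lower v J ==> (J, v) : AA"
 shows "EX y:LR.kchain {..<N} dg (Suc i) D. ALL J v. lower v J --> lkp (z J) v = lkp (kdiff {..<N} a y J) v"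
 using assms
proof (induction "card AA" arbitrary: AA z)
 case 0
 hence "AA = {}" using finite_bpairs finite_subset by (metis card_0_eq)
 hence "ALL J v. lower v J --> lkp (z J) v = 0" using 0 by blast
 thus ?case by (intro bexI[of _ "%J. 0"] LR.kchain_zero) (simp add: lookup_kdiff)
next
 case (Suc n)
 have finA: "finite AA" using Suc.prems(1) finite_bpairs finite_subset by blast
 have neA: "AA ~= {}" using Suc.hyps(2) by auto
 obtain p where p: "p : AA" "!!q. q : AA ==> level (snd q) (fst q) <= level (snd p) (fst p)"
  using finite_has_max[OF finA neA, of "%q. level (snd q) (fst q)"] by blast
 obtain K w where Kw: "p = (K, w)" by (cases p)
 have bp: "K <= {..<N}" "card K = i" "w : L" "deg w = D - int k * int i" using Suc.prems(1) p(1) Kw by (auto simp: bpairs_def)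
 have finK: "finite K" using bp(1) finite_subset by blast
 have low: "lower w K" using Suc.prems(2) p(1) Kw by blast
 let ?j = "pivot w K"
 have j: "?j : free w K" "?j ~: K" using low pivot_mem by (auto simp: lower_def)
 have jN: "?j < N" using j by (auto simp: free_def)
 define c where "c = lkp (z K) w"
 \<comment> \<open>The sign makes the coefficient of the boundary at \<open>(K, w)\<close> equal to
   c.\<close>
 define y1 where "y1 = elementary (insert ?j K) (w - kg ?j) (ksgn ?j K * c)"
 have y1: "y1 : LR.kchain {..<N} dg (Suc i) D" unfolding y1_def using bp jN j(2) finK cell_of_down(1)[OF bp(3) j] kg_deg[OF jN]
  by (intro kchain_elementary) (auto simp: bpairs_def deg_diff algebra_simps)
 have d1: "lkp (kdiff {..<N} a y1 K) w = c"
 proof-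
  have "lkp (kdiff {..<N} a y1 K) w = (SUM g:{..<N} - K. if g = ?j then c else 0)" unfolding lookup_kdiff
  proof (intro sum.cong refl)
   fix g assume g: "g : {..<N} - K"
   have "insert g K = insert ?j K <-> g = ?j" using g j(2) by auto
   thus "ksgn g K * lkp (y1 (insert g K)) (w - kg g) = (if g = ?j then c else 0)" by (auto simp: y1_def elementary_def)
  qed
  also have "... = c" using jN j(2) by (subst sum.delta) auto
  finally show ?thesis .
 qed
 have d2: "(J, v) : AA & (J, v) ~= p" if nz: "lkp (kdiff {..<N} a y1 J) v ~= 0" and lo: "lower v J" and ne: "(J, v) ~= p" for J v
 proof-
  obtain g where g: "g : {..<N} - J" "ksgn g J * lkp (y1 (insert g J)) (v - kg g) ~= 0"
   using nz unfolding lookup_kdiff by (meson sum.not_neutral_contains_not_neutral)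
  hence e: "insert g J = insert ?j K" "v - kg g = w - kg ?j" by (auto simp: y1_def elementary_def lookup_single when_def split: if_splits)
  have J: "J = insert ?j K - {g}" using e(1) g(1) by auto
  have v: "v = (w - kg ?j) + kg g" using e(2) by (metis diff_add_cancel)
  have gj: "g ~= ?j"
  proof
   assume "g = ?j"
   hence "J = K" "v = w" using J v j(2) by auto
   thus False using ne Kw by simp
  qed
  hence gK: "g : K" using e(1) by auto
  have lv: "level v J < level w K" using level_face[OF bp(3) low finK gK _ refl refl] lo J v g(1) by auto
  have "(J, v) : bpairs i D"
  proof-
   have "kdiff {..<N} a y1 : LR.kchain {..<N} dg i D" using y1 a_deg by (intro LR.kchain_kdiff) auto
   thus ?thesis using kchain_support nz by blast
  qed
  thus ?thesis using Suc.prems(3)[of K w J v] p(1) Kw lo lv ne by auto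
 qed
 define z' where "z' = (%J. z J + - kdiff {..<N} a y1 J)"
 have z': "z' : LR.kchain {..<N} dg i D" unfolding z'_def using Suc.prems(4) y1 a_deg
  by (intro LR.kchain_add LR.kchain_uminus LR.kchain_kdiff) auto
 have "EX y:LR.kchain {..<N} dg (Suc i) D. ALL J v. lower v J --> lkp (z' J) v = lkp (kdiff {..<N} a y J) v"
 proof (rule Suc.hyps(1)[of "AA - {p}"])
  show "n = card (AA - {p})" using Suc.hyps(2) p(1) finA by simp
  show "AA - {p} <= bpairs i D" using Suc.prems(1) by auto
  show "lower w K" if "(K, w) : AA - {p}" for K w using that Suc.prems(2) by auto
  show "(J, v) : AA - {p}" if "(K', w') : AA - {p}" "(J, v) : bpairs i D" "lower v J"
   "level v J < level w' K'" for K' w' J v using that Suc.prems(3)[of K' w' J v] p(2)[of "(K', w')"] Kw by auto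
  show "z' : LR.kchain {..<N} dg i D" by (rule z')
  show "(J, v) : AA - {p}" if nz: "lkp (z' J) v ~= 0" and lo: "lower v J" for J v
  proof (cases "(J, v) = p")
   case True
   hence "lkp (z' J) v = 0" using d1 Kw by (simp add: z'_def lookup_add lookup_minus c_def)
   thus ?thesis using nz by simp
  next
   case False
   hence "lkp (z J) v ~= 0 | lkp (kdiff {..<N} a y1 J) v ~= 0" using nz by (auto simp: z'_def lookup_add lookup_minus)
   thus ?thesis using Suc.prems(5) lo d2 False by blast
  qed
 qed
 then obtain y2 where y2: "y2 : LR.kchain {..<N} dg (Suc i) D"
  "ALL J v. lower v J --> lkp (z' J) v = lkp (kdiff {..<N} a y2 J) v" by blast
 show ?case
 proof (rule bexI[of _ "%J. y1 J + y2 J"])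
  show "(%J. y1 J + y2 J) : LR.kchain {..<N} dg (Suc i) D" using y1 y2(1) by (rule LR.kchain_add)
  show "ALL J v. lower v J --> lkp (z J) v = lkp (kdiff {..<N} a (%J. y1 J + y2 J) J) v"
  proof (intro allI impI)
   fix J v assume "lower v J"
   hence "lkp (z' J) v = lkp (kdiff {..<N} a y2 J) v" using y2(2) by blast
   thus "lkp (z J) v = lkp (kdiff {..<N} a (%J. y1 J + y2 J) J) v" by (simp add: z'_def kdiff_add lookup_add lookup_minus algebra_simps)
  qed
 qed
qed

text \<open>Pigeonhole: a cell uses \<open>DIM('e)\<close> of the N generators, so more than N minus
  that many indices cannot all avoid it, and an index of \<open>J\<close> in the cell is free. This
  is the source of the homology bound.\<close>

lemma free_nonempty:
 assumes "(J, v) : bpairs i D" "N - DIM('e) < i"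
 shows "free v J ~= {}"
proof-
 have v: "v : L" "J <= {..<N}" "card J = i" using assms(1) by (auto simp: bpairs_def)
 let ?C = "{j : {..<N}. emb (ga j) : cell_of v}"
 have "(%j. emb (ga j)) ` ?C = cell_of v"
 proof (intro equalityI subsetI)
  fix b assume b: "b : cell_of v"
  obtain l where l: "l < N" "b = emb (ga l)" by (rule cell_index[OF v(1) b])
  hence "l : ?C" using b by simp
  thus "b : (%j. emb (ga j)) ` ?C" using l(2) by (rule rev_image_eqI)
 qed auto
 moreover have "inj_on (%j. emb (ga j)) ?C"
 proof (rule inj_onI)
  fix x y assume "x : ?C" "y : ?C" "emb (ga x) = emb (ga y)"
  thus "x = y" using gamma_inj[of x y] by simp
 qed
 ultimately have "card ?C = card (cell_of v)" using card_image[of "%j. emb (ga j)" ?C] by simp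
 hence "card ?C = DIM('e)" using cell_of_vbasis(1)[OF v(1)] by (simp add: vbasis_def)
 moreover have "card (J Un ?C) <= card {..<N}" using v(2) by (intro card_mono) auto
 hence "card (J Un ?C) <= N" by simp
 moreover have "card J + card ?C = card (J Un ?C) + card (J Int ?C)" using v(2) finite_subset by (intro card_Un_Int) auto
 ultimately have "card (J Int ?C) ~= 0" using assms(2) v(3) by linarith
 hence "J Int ?C ~= {}" by (metis card.empty)
 then obtain j where j: "j : J" "j < N" "emb (ga j) : cell_of v" by auto
 have "0 < representation (cell_of v) (emb v + xx) (emb (ga j))" using cell_of(2)[OF v(1)] j(3) by (auto simp: open_cone_def)
 hence "j : free v J" using j by (auto simp: free_def tot_def)
 thus ?thesis by auto
qed

text \<open>In the support, all pairs are upper. For one whose lower partner has the highest level,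
  the boundary at that partner receives a contribution from no other pair of the support, so it
  cannot vanish.\<close>

lemma cycle_without_lower:
 assumes z: "z : LR.kchain {..<N} dg i D" and cyc: "kdiff {..<N} a z = (%J. 0)"
  and i: "N - DIM('e) < i" and nolow: "!!J v. lower v J ==> lkp (z J) v = 0"
 shows "z = (%J. 0)"
proof (rule ccontr)
 assume "z ~= (%J. 0)"
 then obtain J1 where "z J1 ~= 0" by auto
 have "EX v. lkp (z J1) v ~= 0"
 proof (rule ccontr)
  assume "\<nexists>v. lkp (z J1) v ~= 0"
  hence "z J1 = 0" by (intro poly_mapping_eqI) simp
  thus False using `z J1 ~= 0` by simp
 qed
 then obtain v1 where "lkp (z J1) v1 ~= 0" by blast
 let ?U = "{(J, v). lkp (z J) v ~= 0}"
 have U: "p : ?U ==> p : bpairs i D" for p using kchain_support[OF z] by (cases p) auto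
 hence finU: "finite ?U" using finite_bpairs[of i D] by (meson finite_subset subsetI)
 have neU: "?U ~= {}" using `lkp (z J1) v1 ~= 0` by auto
 define low where "low p = (fst p - {pivot (snd p) (fst p)}, snd p + kg (pivot (snd p) (fst p)))" for p
 have up: "pivot v J : J & pivot v J : free v J" if "(J, v) : ?U" for J v
  using that nolow[of v J] free_nonempty[OF U[OF that] i] pivot_mem by (auto simp: lower_def)
 have lowp: "free (snd (low (J, v))) (fst (low (J, v))) = free v J"
   "snd (low (J, v)) : L" "lower (snd (low (J, v))) (fst (low (J, v)))"
   "snd (low (J, v)) - kg (pivot v J) = v" "insert (pivot v J) (fst (low (J, v))) = J"
   "pivot (snd (low (J, v))) (fst (low (J, v))) = pivot v J" if "(J, v) : ?U" for J v
 proof-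
  have u: "pivot v J : J" "pivot v J : free v J" using up[OF that] by auto
  hence p: "pivot v J < N" "emb (ga (pivot v J)) : cell_of v" by (auto simp: free_def)
  have v: "v : L" using U[OF that] by (auto simp: bpairs_def)
  show f: "free (snd (low (J, v))) (fst (low (J, v))) = free v J" using free_move[OF v p u(1)] by (simp add: low_def)
  show "snd (low (J, v)) : L" using L_add[OF v kg_mem[OF p(1)]] by (simp add: low_def)
  show pv: "pivot (snd (low (J, v))) (fst (low (J, v))) = pivot v J" using f by (simp add: pivot_def)
  show "lower (snd (low (J, v))) (fst (low (J, v)))" unfolding lower_def pv f using u by (auto simp: low_def)
  show "snd (low (J, v)) - kg (pivot v J) = v" "insert (pivot v J) (fst (low (J, v))) = J" using u(1) by (auto simp: low_def)
 qed
 obtain p where p: "p : ?U" "!!q. q : ?U ==> level (snd (low q)) (fst (low q)) <= level (snd (low p)) (fst (low p))"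
  using finite_has_max[OF finU neU, of "%q. level (snd (low q)) (fst (low q))"] by blast
 obtain J v where Jv: "p = (J, v)" by (cases p)
 obtain K w where Kw: "low p = (K, w)" by (cases "low p")
 let ?j = "pivot v J"
 have pU: "(J, v) : ?U" using p(1) Jv by simp
 note lp = lowp[OF pU, folded Jv, unfolded Kw fst_conv snd_conv]
 have jJ: "?j : J" "?j < N" using up[OF pU] by (auto simp: free_def)
 have K: "K = J - {?j}" "w = v + kg ?j" using Kw Jv by (auto simp: low_def)
 \<comment> \<open>A second contributor is either matched with the same partner, which would force
   the same pivot, or its own partner has a strictly higher level.\<close>
 have others: "ksgn g K * lkp (z (insert g K)) (w - kg g) = 0" if g: "g : {..<N} - K" "g ~= ?j" for g
 proof (rule ccontr)
  assume "~ ?thesis"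
  hence q: "(insert g K, w - kg g) : ?U" by auto
  let ?q = "(insert g K, w - kg g)"
  obtain K2 w2 where K2: "low ?q = (K2, w2)" by (cases "low ?q")
  note lq = lowp[OF q, unfolded K2 fst_conv snd_conv]
  let ?j1 = "pivot (w - kg g) (insert g K)"
  show False
  proof (cases "?j1 = g")
   case True
   hence "K2 = K" "w2 = w" using K2 g(1) by (auto simp: low_def)
   thus False using lq(6) lp(6) True g(2) by simp
  next
   case False
   have "K2 = insert g K - {?j1}" using K2 by (auto simp: low_def)
   hence gK2: "g : K2" using False by auto
   have "insert ?j1 K2 <= {..<N}" using U[OF q] lq(5) by (auto simp: bpairs_def)
   hence fK2: "finite K2" by (intro finite_subset[of K2 "{..<N}"]) auto
   have e: "(w - kg g) + kg g = w" "insert g K - {g} = K" using g(1) by auto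
   have "level ((w - kg g) + kg g) (insert g K - {g}) < level w2 K2"
    by (rule level_face[OF lq(2,3) fK2 gK2]) (use g(1) lq(4,5,6) lp(3) e in auto)
   hence "level w K < level w2 K2" unfolding e .
   thus False using p(2)[OF q] K2 Kw by simp
  qed
 qed
 have "lkp (kdiff {..<N} a z K) w = ksgn ?j K * lkp (z (insert ?j K)) (w - kg ?j)"
 proof-
  have "?j : {..<N} - K" using jJ K by auto
  hence "lkp (kdiff {..<N} a z K) w = ksgn ?j K * lkp (z (insert ?j K)) (w - kg ?j) +
    (SUM g:{..<N} - K - {?j}. ksgn g K * lkp (z (insert g K)) (w - kg g))" unfolding lookup_kdiff by (intro sum.remove) auto
  also have "(SUM g:{..<N} - K - {?j}. ksgn g K * lkp (z (insert g K)) (w - kg g)) = 0" using others by (intro sum.neutral) auto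
  finally show ?thesis by simp
 qed
 also have "... = ksgn ?j K * lkp (z J) v" using lp(4,5) by simp
 finally have "ksgn ?j K * lkp (z J) v = 0" using cyc by simp
 thus False using pU by (auto simp: ksgn_def)
qed

text \<open>N elements with homology ending at N minus the dimension: the depth of the semigroup
  ring equals its dimension. After the lower pairs are eliminated, the rest of the cycle is
  zero.\<close>

theorem kvanish_monomials: "LR.kvanish {..<N} a dg (N - DIM('e))" unfolding LR.kvanish_def
proof (intro allI impI ballI)
 fix i D z
 assume i: "N - DIM('e) < i" and z: "z : LR.kchain {..<N} dg i D"
  and cyc: "kdiff {..<N} a z = (%J. 0)"
 let ?A = "{(J, v) : bpairs i D. lower v J}"
 have "EX y:LR.kchain {..<N} dg (Suc i) D. ALL J v. lower v J --> lkp (z J) v = lkp (kdiff {..<N} a y J) v"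
 proof (rule eliminate_lower[of ?A i D z])
  show "?A <= bpairs i D" by (simp add: subset_iff split_paired_all)
  show "lower w K" if "(K, w) : ?A" for K w using that by simp
  show "(J, v) : ?A" if "(J, v) : bpairs i D" "lower v J" for J v using that by simp
  show "z : LR.kchain {..<N} dg i D" by (rule z)
  show "(J, v) : ?A" if "lkp (z J) v ~= 0" "lower v J" for J v
  proof-
   have "(J, v) : bpairs i D" by (rule kchain_support[OF z that(1)])
   thus ?thesis using that(2) by (simp only: mem_Collect_eq prod.case)
  qed
 qed
 then obtain y where y: "y : LR.kchain {..<N} dg (Suc i) D"
   "!!J v. lower v J ==> lkp (z J) v = lkp (kdiff {..<N} a y J) v" by blast
 define z' where "z' = (%J. z J + - kdiff {..<N} a y J)"
 have dy: "kdiff {..<N} a y : LR.kchain {..<N} dg i D" using y(1) a_deg by (intro LR.kchain_kdiff) auto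
 have z': "z' : LR.kchain {..<N} dg i D" unfolding z'_def using z dy by (intro LR.kchain_add LR.kchain_uminus)
 have cyc': "kdiff {..<N} a z' = (%J. 0)" unfolding z'_def kdiff_add kdiff_uminus
  using cyc kdiff_kdiff[OF _ LR.kchain_ksupp[OF y(1)]] by simp
 have "lkp (z' J) v = 0" if "lower v J" for J v using y(2)[OF that] by (simp add: z'_def lookup_minus)
 hence "z' = (%J. 0)" by (rule cycle_without_lower[OF z' cyc' i])
 hence "z J + - kdiff {..<N} a y J = 0" for J unfolding z'_def by (rule fun_cong)
 hence "z J = kdiff {..<N} a y J" for J by (simp add: add_eq_0_iff2)
 hence "kdiff {..<N} a y = z" by auto
 thus "EX y:LR.kchain {..<N} dg (Suc i) D. kdiff {..<N} a y = z" using y(1) by blast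
qed

end

end

section \<open>Hilbert functions with rational generating series\<close>

lemma bdiff_funpow_sum:
 "(bdiff ^^ d) (%m. SUM i:A. f i m) = (%m. SUM i:A. (bdiff ^^ d) (f i) m)"
proof (induction d)
 case (Suc d)
 thus ?case by (auto simp: bdiff_def sum_subtractf)
qed simp

lemma bdiff_funpow_shift:
 "(bdiff ^^ d) (%m. c (m - e)) = (%m. (bdiff ^^ d) c (m - e))"
proof (induction d)
 case (Suc d)
 thus ?case by (auto simp: bdiff_def algebra_simps)
qed simp

text \<open>The generating series of \<open>c\<close> times the d-th power of (1 - x) has no terms
  beyond degree t + d; thus t bounds the degree of the series as a rational function with a pole of
  order at most d at 1.\<close>

definition recurrent :: "nat => int => (int => int) => bool" where
 "recurrent d t c <-> (ALL m > t + int d. (bdiff ^^ d) c m = 0)"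

text \<open>The series is multiplied by 1 - x^e, which is 1 - x times the sum of the x^j with j < e:
  one pole fewer, and degree larger by e.\<close>

lemma recurrent_diff:
 assumes "recurrent (Suc d) t c"
 shows "recurrent d (t + int e) (%m. c m - c (m - int e))"
 unfolding recurrent_def
proof (intro allI impI)
 fix m assume m: "t + int e + int d < m"
 have "(%m. c m - c (m - int e)) = (%m. SUM j<e. bdiff c (m - int j))"
 proof
  fix m show "c m - c (m - int e) = (SUM j<e. bdiff c (m - int j))" by (induction e) (auto simp: bdiff_def algebra_simps)
 qed
 hence "(bdiff ^^ d) (%m. c m - c (m - int e)) m = (SUM j<e. (bdiff ^^ d) (bdiff c) (m - int j))"
  by (simp add: bdiff_funpow_sum bdiff_funpow_shift)
 also have "... = (SUM j<e. (bdiff ^^ Suc d) c (m - int j))" by (simp add: funpow_swap1)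
 also have "... = 0" using assms m by (intro sum.neutral ballI) (auto simp: recurrent_def simp del: funpow.simps)
 finally show "(bdiff ^^ d) (%m. c m - c (m - int e)) m = 0" .
qed

text \<open>The first difference vanishes only above t + 1, but this already fixes the value from t
  + 1 on, hence at every m > t.\<close>

lemma recurrent_one:
 assumes "recurrent 1 t c" "t < m" "m <= m'"
 shows "c m' = c m"
 using assms(3)
proof (induction m' rule: int_ge_induct)
 case (step i)
 hence "bdiff c (i + 1) = 0" using assms(1,2) by (auto simp: recurrent_def)
 thus ?case using step.IH by (simp add: bdiff_def)
qed simp

context tricone
begin

lemma open_cone_shift:
 assumes "vbasis B" "emb g : B" "b : B"
 shows "representation B (emb (w + g) + xx) b = representation B (emb w + xx) b + (if b = emb g then 1 else 0)"
proof-
 have "emb (w + g) + xx = (emb w + xx) + emb g" by (simp add: emb_add)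
 thus ?thesis using assms by (simp add: crd_add crd_basis)
qed

text \<open>Coordinates in \<open>F\<close> run over all positive numbers, those outside
  \<open>F\<close> over the half-open interval (0, 1]. \<open>F = B\<close> gives a whole cell and
  \<open>F = {}\<close> its box.\<close>

definition cpart :: "'e set => 'e set => 'g set" where
 "cpart B F = {w. open_cone B (emb w + xx) & (ALL b:B - F. representation B (emb w + xx) b <= 1)}"

lemma cpart_subset: "cell Gv h B ==> cpart B F <= L"
 using open_cone_mem by (auto simp: cpart_def)

lemma finite_cpart: "cell Gv h B ==> finite {w : cpart B F. deg w = m}"
 using cpart_subset[of B F] by (intro finite_subset[OF _ finite_L_deg[of m]]) auto

definition pcount :: "'e set => 'e set => int => int" where
 "pcount B F m = int (card {w : cpart B F. deg w = m})"

text \<open>Points whose coordinate at b exceeds 1 are exactly the translates by the generator b, of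
  degree 1, of all points; the difference operator removes them.\<close>

lemma pcount_insert:
 assumes B: "cell Gv h B" and b: "b : B" "b ~: F"
 shows "bdiff (pcount B (insert b F)) = pcount B F"
proof
 fix m
 have vb: "vbasis B" "B <= Gv" using B by (auto simp: cell_def)
 obtain g where g: "g : Gs" "b = emb g" using b(1) vb(2) by auto
 have dg: "deg g = 1" using Gs(3) g(1) by blast
 let ?r = "%w b. representation B (emb w + xx) b"
 have sh: "?r (w + g) b' = ?r w b' + (if b' = b then 1 else 0)" if "b' : B" for w b'
  using open_cone_shift[OF vb(1), of g b' w] that b(1) g(2) by simp
 let ?X = "{w : cpart B (insert b F). deg w = m}"
 let ?Y = "{w : cpart B F. deg w = m}"
 let ?Z = "(%w. w + g) ` {w : cpart B (insert b F). deg w = m - 1}"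
 have "?X = ?Y Un ?Z"
 proof (intro equalityI subsetI)
  fix w assume w: "w : ?X"
  show "w : ?Y Un ?Z"
  proof (cases "?r w b <= 1")
   case True
   hence "w : ?Y" using w by (auto simp: cpart_def)
   thus ?thesis by simp
  next
   case False
   have s: "?r w b' = ?r (w - g) b' + (if b' = b then 1 else 0)" if "b' : B" for b' using sh[OF that, of "w - g"] by simp
   have "?r (w - g) b' > 0" if "b' : B" for b' using s[OF that] False w that by (auto simp: cpart_def open_cone_def split: if_splits)
   moreover have "?r (w - g) b' <= 1" if "b' : B - insert b F" for b'
   proof-
    have "?r w b' <= 1" using w that by (auto simp: cpart_def)
    thus ?thesis using s[of b'] that by simp
   qed
   ultimately have "w - g : {w : cpart B (insert b F). deg w = m - 1}" using w dg by (auto simp: cpart_def open_cone_def deg_diff)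
   hence "w : ?Z" by (rule rev_image_eqI) simp
   thus ?thesis by simp
  qed
 next
  fix w assume "w : ?Y Un ?Z"
  thus "w : ?X"
  proof
   assume "w : ?Y" thus ?thesis by (auto simp: cpart_def)
  next
   assume "w : ?Z"
   then obtain v where v: "w = v + g" "v : cpart B (insert b F)" "deg v = m - 1" by auto
   have "?r w b' > 0" if "b' : B" for b' using sh[OF that, of v] v(2) that by (auto simp: v(1) cpart_def open_cone_def add_pos_nonneg)
   moreover have "?r w b' <= 1" if "b' : B - insert b F" for b' using sh[of b' v] v(2) that by (auto simp: v(1) cpart_def)
   ultimately show ?thesis using v(3) dg by (auto simp: v(1) cpart_def open_cone_def deg_add)
  qed
 qed
 moreover have "?Y Int ?Z = {}"
 proof (intro equals0I)
  fix w assume "w : ?Y Int ?Z"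
  then obtain v where v: "w = v + g" "v : cpart B (insert b F)" "w : cpart B F" by auto
  have "?r v b > 0" "?r w b <= 1" using v(2,3) b by (auto simp: cpart_def open_cone_def)
  thus False using sh[OF b(1), of v] by (simp add: v(1))
 qed
 ultimately have "card ?X = card ?Y + card ?Z" using finite_cpart[OF B] by (simp add: card_Un_disjoint)
 moreover have "card ?Z = card {w : cpart B (insert b F). deg w = m - 1}" by (intro card_image inj_onI) simp
 ultimately show "bdiff (pcount B (insert b F)) m = pcount B F m" by (simp add: bdiff_def pcount_def)
qed

lemma pcount_boxes:
 assumes B: "cell Gv h B" and F: "F <= B"
 shows "(bdiff ^^ card F) (pcount B F) = pcount B {}"
proof-
 have "finite F" using F B vbasis_finite finite_subset by (auto simp: cell_def)
 thus ?thesis using F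
 proof (induction F rule: finite_induct)
  case (insert b F)
  have "(bdiff ^^ card (insert b F)) (pcount B (insert b F)) =
    (bdiff ^^ card F) (bdiff (pcount B (insert b F)))" using insert.hyps by (simp add: funpow_swap1)
  thus ?case using pcount_insert[OF B, of b F] insert by simp
 qed simp
qed

text \<open>Reflecting a box sends its points to interior points of the cone.\<close>

lemma box_degree:
 assumes B: "cell Gv h B" and w: "w : cpart B {}"
  and c: "!!w. (!!i. i : I ==> ell i (emb w) > 0) ==> deg w >= c"
 shows "deg w <= int DIM('e) - c"
proof-
 have vb: "vbasis B" "B <= Gv" using B by (auto simp: cell_def)
 let ?G = "{g : Gs. emb g : B}"
 have img: "emb ` ?G = B" using vb(2) by auto
 have inj: "inj_on emb ?G" using emb(2) by (rule inj_on_subset) simp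
 have cG: "card ?G = DIM('e)" using card_image[OF inj] img vb(1) by (simp add: vbasis_def)
 \<comment> \<open>For a point of the box the coordinates of \<open>emb w' - xx\<close> are 1 minus
   numbers in (0, 1], hence nonnegative, and adding \<open>xx\<close> makes every
   \<open>ell i\<close> positive.\<close>
 define w' where "w' = (SUM g:?G. g) - w"
 have esum: "emb (SUM g:A. f g) = (SUM g:A. emb (f g))" and dsum: "deg (SUM g:A. f g) = (SUM g:A. deg (f g))" for A and f :: "'g => 'g"
  by (induction A rule: infinite_finite_induct) (simp_all add: emb_0 emb_add deg_0 deg_add)
 have "emb w' + emb w = (SUM b:B. b)" unfolding w'_def emb_diff esum using sum.reindex[OF inj, of "%b. b"] img by simp
 hence e: "emb w' - xx = (SUM b:B. b) - (emb w + xx)" by (simp add: algebra_simps)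
 have "representation B (SUM b:B. b) b = 1" if "b : B" for b using crd_eqI[OF vb(1), of "SUM b:B. b" "%_. 1" b] that by simp
 hence r: "representation B (emb w' - xx) b >= 0" if "b : B" for b using that w unfolding e by (simp add: crd_diff[OF vb(1)] cpart_def)
 have "ell i (emb w') > 0" if i: "i : I" for i
 proof-
  have "ell i (emb w' - xx) = (SUM b:B. representation B (emb w' - xx) b * ell i b)"
   using arg_cong[OF crd_sum[OF vb(1), of "emb w' - xx"], of "ell i"]
   by (simp add: linear_sum[OF ell(2)[OF i]] linear_scale[OF ell(2)[OF i]])
  also have "... >= 0" using r vb(2) Gv_ell[OF _ i] by (intro sum_nonneg mult_nonneg_nonneg) auto
  finally show ?thesis using xi_ell[OF i] by (simp add: linear_diff[OF ell(2)[OF i]])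
 qed
 hence "deg w' >= c" by (rule c)
 moreover have "deg w' = int DIM('e) - deg w" using Gs(3) cG by (simp add: w'_def deg_diff dsum)
 ultimately show ?thesis by simp
qed

text \<open>The open cells partition the shifted lattice points. After \<open>DIM('e)\<close>
  differences each cell counts only its box, and reflection bounds the degrees there by
  \<open>DIM('e)\<close> - c.\<close>

theorem hilbert_recurrent:
 assumes c: "!!w. (!!i. i : I ==> ell i (emb w) > 0) ==> deg w >= c"
 shows "recurrent DIM('e) (- c) (%m. int (card {w : L. deg w = m}))"
 unfolding recurrent_def
proof (intro allI impI)
 fix m assume m: "- c + int DIM('e) < m"
 let ?C = "{B. cell Gv h B}"
 have finC: "finite ?C" using finite_Gv by (intro finite_subset[of ?C "Pow Gv"]) (auto simp: cell_def)
 have "int (card {w : L. deg w = m}) = (SUM B:?C. pcount B B m)" for m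
 proof-
  have "{w : L. deg w = m} = (UN B:?C. {w : cpart B B. deg w = m})"
  proof (intro equalityI subsetI)
   fix w assume "w : {w : L. deg w = m}"
   thus "w : (UN B:?C. {w : cpart B B. deg w = m})" using cell_of[of w] by (auto simp: cpart_def intro!: bexI[of _ "cell_of w"])
  qed (use cpart_subset in blast)
  moreover have "card (UN B:?C. {w : cpart B B. deg w = m}) =
    (SUM B:?C. card {w : cpart B B. deg w = m})"
  proof (intro card_UN_disjoint finC ballI impI)
   fix B B' assume BB: "B : ?C" "B' : ?C" "B ~= B'"
   show "{w : cpart B B. deg w = m} Int {w : cpart B' B'. deg w = m} = {}"
   proof (intro equals0I)
    fix w assume "w : {w : cpart B B. deg w = m} Int {w : cpart B' B'. deg w = m}"
    hence "open_cone B (emb w + xx)" "open_cone B' (emb w + xx)" by (auto simp: cpart_def)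
    hence "B = B'" using BB(1,2) cell_unique[of Gv h B B'] by blast
    thus False using BB(3) by simp
   qed
  qed (use finite_cpart in auto)
  ultimately show ?thesis by (simp add: pcount_def)
 qed
 hence "(bdiff ^^ DIM('e)) (%m. int (card {w : L. deg w = m})) m =
   (SUM B:?C. (bdiff ^^ DIM('e)) (pcount B B) m)" by (simp add: bdiff_funpow_sum)
 also have "... = 0"
 proof (intro sum.neutral ballI)
  fix B assume "B : ?C"
  hence B: "cell Gv h B" by simp
  hence "card B = DIM('e)" by (auto simp: cell_def vbasis_def)
  hence "(bdiff ^^ DIM('e)) (pcount B B) m = pcount B {} m" using pcount_boxes[OF B order_refl] by simp
  moreover have e: "{w : cpart B {}. deg w = m} = {}" using box_degree[OF B _ c] m by force
  have "pcount B {} m = 0" unfolding pcount_def e by simp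
  ultimately show "(bdiff ^^ DIM('e)) (pcount B B) m = 0" by simp
 qed
 finally show "(bdiff ^^ DIM('e)) (%m. int (card {w : L. deg w = m})) m = 0" .
qed

end

section \<open>Points of monoid algebras\<close>

lemma homogeneous_system:
 fixes M :: "'c => 'k => 'f::field"
 assumes "finite K" "finite C" "card K < card C"
 obtains bb where "EX c:C. bb c ~= 0" "!!k. k : K ==> (SUM c:C. bb c * M c k) = 0"
proof-
 have "EX bb. (EX c:C. bb c ~= 0) & (ALL k:K. (SUM c:C. bb c * M c k) = 0)" using assms
 proof (induction K arbitrary: C M rule: finite_induct)
  case empty
  hence "C ~= {}" by auto
  thus ?case by (intro exI[of _ "%_. 1"]) auto
 next
  case (insert k0 K)
  show ?case
  proof (cases "ALL c:C. M c k0 = 0")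
   case True
   have "card K < card C" using insert by simp
   then obtain bb where b: "EX c:C. bb c ~= 0" "ALL k:K. (SUM c:C. bb c * M c k) = 0" using insert.IH[OF insert.prems(1), of M] by blast
   have "(SUM c:C. bb c * M c k0) = 0" using True by (intro sum.neutral) auto
   thus ?thesis using b by (intro exI[of _ bb]) auto
  next
   case False
   then obtain c0 where c0: "c0 : C" "M c0 k0 ~= 0" by auto
   let ?C = "C - {c0}"
   define M' where "M' c k = M c k - M c k0 / M c0 k0 * M c0 k" for c k
   have "card K < card ?C" using insert c0(1) by simp
   then obtain bb where b: "EX c:?C. bb c ~= 0" "ALL k:K. (SUM c:?C. bb c * M' c k) = 0" using insert.IH[of ?C M'] insert.prems(1) by auto
   define t where "t = - (SUM c:?C. bb c * (M c k0 / M c0 k0))"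
   let ?bb = "bb(c0 := t)"
   have split: "(SUM c:C. ?bb c * M c k) = t * M c0 k + (SUM c:?C. bb c * M c k)" for k
    using insert.prems(1) c0(1) by (subst sum.remove[of C c0]) auto
   have tM: "t * M c0 k = - (SUM c:?C. bb c * (M c k0 / M c0 k0 * M c0 k))" for k by (simp add: t_def sum_distrib_right mult.assoc)
   have "(SUM c:C. ?bb c * M c k0) = 0" unfolding split tM using c0(2) by simp
   moreover have "(SUM c:C. ?bb c * M c k) = 0" if "k : K" for k
    unfolding split tM using b(2) that by (simp add: M'_def right_diff_distrib sum_subtractf)
   moreover have "EX c:C. ?bb c ~= 0" using b(1) by auto
   ultimately show ?thesis by (intro exI[of _ ?bb]) auto
  qed
 qed
 thus ?thesis using that by blast
qed

definition pev :: "('g::comm_monoid_add \<Rightarrow>\<^sub>0 complex) => complex poly => 'g \<Rightarrow>\<^sub>0 complex" where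
 "pev h q = fold_coeffs (%a r. cst a + h * r) q 0"

lemma pev_0 [simp]: "pev h 0 = 0"
 by (simp add: pev_def)

lemma pev_pCons [simp]: "pev h (pCons a q) = cst a + h * pev h q"
 by (cases "a = 0 & q = 0") (auto simp: pev_def)

lemma pev_add: "pev h (p + q) = pev h p + pev h q"
 by (induction p q rule: poly_induct2) (auto simp: single_add algebra_simps)

lemma pev_smult: "pev h (smult a q) = cst a * pev h q"
 by (induction q) (auto simp: mult_single algebra_simps)

lemma pev_mult: "pev h (p * q) = pev h p * pev h q"
 by (induction p) (auto simp: pev_add pev_smult algebra_simps)

lemma pev_sum: "pev h (sum f A) = (SUM i:A. pev h (f i))"
 by (induction A rule: infinite_finite_induct) (auto simp: pev_add)

lemma pev_prod: "pev h (prod f A) = (PROD i:A. pev h (f i))"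
proof (induction A rule: infinite_finite_induct)
 have "pev h 1 = 1" by (simp add: one_pCons)
 thus "!!A. infinite A ==> pev h (prod f A) = (PROD i:A. pev h (f i))" "pev h (prod f {}) = (PROD i:{}. pev h (f i))" by auto
qed (auto simp: pev_mult)

lemma pev_monalg: "submon D ==> h : monalg D ==> pev h q : monalg D"
 by (induction q) (auto intro!: monalg_0 monalg_add monalg_cst monalg_mult)

definition alg_ideal :: "'g::comm_monoid_add set => ('g \<Rightarrow>\<^sub>0 complex) set => bool" where
 "alg_ideal D b <-> b <= monalg D & 0 : b & (ALL r:b. ALL s:b. r + s : b) &
   (ALL r:monalg D. ALL s:b. r * s : b)"

lemma alg_ideal_sum:
 "alg_ideal D b ==> (!!i. i : A ==> f i : b) ==> sum f A : b" by (induction A rule: infinite_finite_induct) (auto simp: alg_ideal_def)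

lemma alg_ideal_diff:
 assumes "submon D" "alg_ideal D b" "r : b" "s : b"
 shows "r - s : b"
proof-
 have "cst (-1) * s : b" using assms monalg_cst[OF assms(1), of "-1"] by (auto simp: alg_ideal_def)
 moreover have "cst (-1) * s = - s" by (simp add: single_uminus single_one)
 ultimately have "r + (- s) : b" using assms by (auto simp: alg_ideal_def)
 thus ?thesis by simp
qed

text \<open>Maximality makes the localization at s of the quotient by p a field: modulo p, every
  element outside p divides a power of s. The points found below are therefore points where s does
  not vanish.\<close>

locale prime_avoiding =
 fixes D :: "'g::comm_monoid_add set" and p s
 assumes D: "submon D" "countable D" and p: "alg_ideal D p"
  and s: "s : monalg D" "!!N. s ^ N ~: p"
  and max: "!!q. alg_ideal D q ==> p <= q ==> (!!N. s ^ N ~: q) ==> q = p"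
begin

lemma p_add: "r : p ==> t : p ==> r + t : p" and p_mult: "r : monalg D ==> t : p ==> r * t : p"
 and p_0: "0 : p" and p_monalg: "r : p ==> r : monalg D" using p by (auto simp: alg_ideal_def)

lemma p_diff: "r : p ==> t : p ==> r - t : p"
 using alg_ideal_diff[OF D(1) p] .

lemma p_sum: "(!!i. i : A ==> f i : p) ==> sum f A : p"
 using alg_ideal_sum[OF p] .

lemma outside:
 assumes "x : monalg D" "x ~: p"
 obtains N r t where "r : monalg D" "t : p" "s ^ N = t + x * r"
proof-
 let ?q = "{t + x * r | t r. t : p & r : monalg D}"
 have "alg_ideal D ?q" unfolding alg_ideal_def
 proof (intro conjI ballI)
  show "?q <= monalg D" using assms(1) by (auto intro!: monalg_add[OF p_monalg monalg_mult[OF D(1)]])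
  show "0 : ?q" using p_0 monalg_0 by (intro CollectI exI[of _ 0]) auto
  fix a assume "a : ?q"
  then obtain t r where a: "a = t + x * r" "t : p" "r : monalg D" by blast
  { fix b assume "b : ?q"
   then obtain t' r' where b: "b = t' + x * r'" "t' : p" "r' : monalg D" by blast
   have "a + b = (t + t') + x * (r + r')" using a(1) b(1) by (simp add: algebra_simps)
   thus "a + b : ?q" using a b p_add monalg_add by blast }
  { fix c assume c: "c : monalg D"
   have "c * a = c * t + x * (c * r)" using a(1) by (simp add: algebra_simps)
   thus "c * a : ?q" using a c p_mult monalg_mult[OF D(1)] by blast }
 qed
 moreover have "p <= ?q"
 proof
  fix t assume "t : p"
  thus "t : ?q" using monalg_0 by (intro CollectI exI[of _ t] exI[of _ 0]) auto
 qed
 moreover have "x : ?q" using p_0 monalg_1[OF D(1)] by (intro CollectI exI[of _ 0] exI[of _ 1]) auto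
 hence "?q ~= p" using assms(2) by blast
 ultimately obtain N where "s ^ N : ?q" using max[of ?q] by blast
 thus ?thesis using that by blast
qed

lemma prime:
 assumes "x : monalg D" "y : monalg D" "x * y : p"
 shows "x : p | y : p"
proof (rule ccontr)
 assume "~ ?thesis"
 then obtain N r t N' r' t' where *: "r : monalg D" "t : p" "s ^ N = t + x * r"
  "r' : monalg D" "t' : p" "s ^ N' = t' + y * r'" using outside[OF assms(1)] outside[OF assms(2)] by metis
 have "s ^ (N + N') = (t' + y * r') * t + (x * r) * t' + (r * r') * (x * y)" unfolding power_add *(3,6) by (simp add: algebra_simps)
 also have "... : p"
 proof-
  have "t' + y * r' : monalg D" using * assms(2) monalg_add[OF p_monalg monalg_mult[OF D(1)]] by blast
  moreover have "x * r : monalg D" "r * r' : monalg D" using * assms(1) monalg_mult[OF D(1)] by auto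
  ultimately show ?thesis using p_add[OF p_add[OF p_mult[OF _ *(2)] p_mult[OF _ *(5)]] p_mult[OF _ assms(3)]] by blast
 qed
 finally show False using s(2) by blast
qed

lemma one_notin: "1 ~: p"
 using s(2)[of 0] by simp

lemma cst_notin: "c ~= 0 ==> cst c ~: p"
proof
 assume "c ~= 0" "cst c : p"
 hence "cst (1 / c) * cst c : p" using monalg_cst[OF D(1)] p_mult by blast
 thus False using `c ~= 0` one_notin by (simp add: mult_single single_one)
qed

text \<open>The polynomial splits into linear factors and p is prime, so one factor h - c lies in
  p.\<close>

lemma pev_root:
 assumes h: "h : monalg D"
 shows "q ~= 0 ==> pev h q : p ==> EX c. h - cst c : p"
proof (induction "degree q" arbitrary: q rule: less_induct)
 case less
 show ?case
 proof (cases "degree q = 0")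
  case True
  then obtain a where "q = [:a:]" "a ~= 0" using less.prems(1) by (metis degree_eq_zeroE pCons_0_0)
  thus ?thesis using less.prems(2) cst_notin by simp
 next
  case False
  then obtain z where "poly q z = 0" using fundamental_theorem_of_algebra[of q] constant_degree[of q] by auto
  then obtain q' where q': "q = [:-z, 1:] * q'" using poly_eq_0_iff_dvd by (metis dvdE)
  hence nz: "q' ~= 0" using less.prems(1) by auto
  hence dg: "degree q' < degree q" unfolding q' by (subst degree_mult_eq) auto
  have "(h - cst z) * pev h q' : p" using less.prems(2) unfolding q' pev_mult by (simp add: single_uminus single_one)
  moreover have "h - cst z : monalg D" using h monalg_cst[OF D(1)] monalg_diff by blast
  ultimately have "h - cst z : p | pev h q' : p" using prime pev_monalg[OF D(1) h] by blast
  thus ?thesis using less.hyps[OF dg nz] by blast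
 qed
qed

text \<open>Otherwise the inverses of the \<open>h - c\<close> would be uncountably many elements of a space of countable dimension.\<close>

lemma residue_exists:
 assumes h: "h : monalg D"
 shows "EX c. h - cst c : p"
proof (rule ccontr)
 assume no: "\<nexists>c. h - cst c : p"
 have hc: "h - cst c : monalg D" for c using h monalg_cst[OF D(1)] monalg_diff by blast
 have "EX N r t. r : monalg D & t : p & s ^ N = t + (h - cst c) * r" for c using outside[OF hc, of c] no by metis
 then obtain N u t where Nu: "!!c. u c : monalg D" "!!c. t c : p" "!!c. s ^ N c = t c + (h - cst c) * u c" by metis
 \<comment> \<open>Only countably many exponents and supports occur, so infinitely many c share
   both. Their \<open>u c\<close> then lie in one space of finite dimension, and
   \<open>card K + 1\<close> of them are linearly dependent.\<close>
 let ?F = "%c. (N c, pkeys (u c))"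
 have "range ?F <= UNIV \<times> {K. finite K & K <= D}" using Nu(1) by (auto simp: monalg_def)
 moreover have "countable {K. finite K & K <= D}" using D(2) by (rule countable_Collect_finite_subset)
 ultimately have cF: "countable (range ?F)" by (meson countable_SIGMA countable_subset countableI_type)
 have "EX y:range ?F. infinite (?F -` {y})"
 proof (rule ccontr)
  assume "~ ?thesis"
  hence "countable (UN y:range ?F. ?F -` {y})" using cF by (intro countable_UN) (auto intro: countable_finite)
  moreover have "(UN y:range ?F. ?F -` {y}) = UNIV" by auto
  ultimately show False using uncountable_UNIV_complex by simp
 qed
 then obtain n K where inf: "infinite (?F -` {(n, K)})" "(n, K) : range ?F" by auto
 hence finK: "finite K" by auto
 obtain C where C: "C <= ?F -` {(n, K)}" "finite C" "card C = Suc (card K)" using infinite_arbitrarily_large[OF inf(1)] by metis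
 have c: "N c = n" "pkeys (u c) = K" if "c : C" for c using C(1) that by auto
 obtain bb where b: "EX c:C. bb c ~= 0" "!!k. k : K ==> (SUM c:C. bb c * lkp (u c) k) = 0"
  using homogeneous_system[OF finK C(2), of "%c. lkp (u c)"] C(3) by auto
 have "(SUM c:C. cst (bb c) * u c) = 0"
 proof (rule poly_mapping_eqI)
  fix k
  have "lkp (cst a * v) k = a * lkp v k" for a and v :: "'g \<Rightarrow>\<^sub>0 complex"
   using mult_map_scale_conv_mult[of a v] by (simp add: map.rep_eq when_def flip: mult_map_scale_conv_mult)
  hence "lkp (SUM c:C. cst (bb c) * u c) k = (SUM c:C. bb c * lkp (u c) k)" by (simp add: lookup_sum)
  also have "... = 0"
  proof (cases "k : K")
   case False
   hence "lkp (u c) k = 0" if "c : C" for c using c(2)[OF that] not_in_keys_iff_lookup_eq_zero[of k "u c"] by simp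
   thus ?thesis by (intro sum.neutral) simp
  qed (rule b(2))
  finally show "lkp (SUM c:C. cst (bb c) * u c) k = lkp 0 k" by simp
 qed
 define P where "P c = (PROD c':C - {c}. h - cst c')" for c
 have Pm: "P c : monalg D" for c
 proof-
  have "(PROD c':A. h - cst c') : monalg D" for A by (induction A rule: infinite_finite_induct) (auto intro!: monalg_1 monalg_mult D(1) hc)
  thus ?thesis by (simp add: P_def)
 qed
 have full: "(h - cst c) * P c = (PROD c':C. h - cst c')" if "c : C" for c using that C(2) by (simp add: P_def prod.remove)
 let ?Q = "SUM c:C. cst (bb c) * P c"
 have "s ^ n * ?Q = (SUM c:C. (cst (bb c) * P c) * t c) + (SUM c:C. cst (bb c) * u c) * (PROD c':C. h - cst c')"
 proof-
  have "s ^ n * (cst (bb c) * P c) = (cst (bb c) * P c) * t c + (cst (bb c) * u c) * (PROD c':C. h - cst c')" if "c : C" for c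
  proof-
   have "s ^ n * (cst (bb c) * P c) = (t c + (h - cst c) * u c) * (cst (bb c) * P c)" using Nu(3)[of c] c(1)[OF that] by simp
   thus ?thesis unfolding full[OF that, symmetric] by (simp add: algebra_simps)
  qed
  thus ?thesis by (simp add: sum_distrib_left sum_distrib_right sum.distrib cong: sum.cong)
 qed
 also have "... = (SUM c:C. (cst (bb c) * P c) * t c)" using `(SUM c:C. cst (bb c) * u c) = 0` by simp
 also have "... : p" using Nu(2) Pm monalg_cst[OF D(1)] D(1) by (intro p_sum p_mult monalg_mult) auto
 finally have "s ^ n * ?Q : p" .
 moreover have "?Q : monalg D" using Pm monalg_cst[OF D(1)] D(1) by (intro monalg_sum monalg_mult) auto
 ultimately have Qp: "?Q : p" using prime[of "s ^ n" ?Q] s monalg_power[OF D(1)] by blast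
 \<comment> \<open>The numerator of the sum of the \<open>bb c / (X - c)\<close>. At c0 only the
   summand of c0 survives, so q is not zero.\<close>
 define q where "q = (SUM c:C. smult (bb c) (PROD c':C - {c}. [:-c', 1:]))"
 have "pev h q = ?Q" by (simp add: q_def pev_sum pev_smult pev_prod P_def single_uminus single_one)
 moreover have "q ~= 0"
 proof
  assume q0: "q = 0"
  obtain c0 where c0: "c0 : C" "bb c0 ~= 0" using b(1) by blast
  have "poly q c0 = (SUM c:C. bb c * (PROD c':C - {c}. c0 - c'))" by (simp add: q_def poly_sum poly_prod)
  also have "... = bb c0 * (PROD c':C - {c0}. c0 - c')"
  proof-
   have "(PROD c':C - {c}. c0 - c') = 0" if "c : C - {c0}" for c using that c0(1) C(2) by (intro prod_zero) auto
   hence "(SUM c:C - {c0}. bb c * (PROD c':C - {c}. c0 - c')) = 0" by (intro sum.neutral) simp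
   thus ?thesis using C(2) c0(1) by (simp only: sum.remove[of C c0]) simp
  qed
  also have "... ~= 0" using c0(2) C(2) by (auto simp: prod_zero_iff)
  finally show False using q0 by simp
 qed
 ultimately show False using pev_root[OF h] Qp no by metis
qed

lemma residue_unique: "h - cst c : p ==> h - cst c' : p ==> c = c'"
proof-
 assume "h - cst c : p" "h - cst c' : p"
 hence "(h - cst c') - (h - cst c) : p" using p_diff by blast
 hence "cst (c - c') : p" by (simp add: single_diff)
 thus ?thesis using cst_notin[of "c - c'"] by auto
qed

lemma point:
 obtains hh where "mchar D hh" "!!r. r : p ==> mev hh r = 0" "mev hh s ~= 0"
proof-
 define hh where "hh w = (THE c. msing w 1 - cst c : p)" for w
 have eta: "msing w 1 - cst (hh w) : p" if "w : D" for w
 proof-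
  have "EX! c. msing w 1 - cst c : p" using residue_exists[OF monalg_single[OF that]] residue_unique by metis
  thus ?thesis unfolding hh_def by (rule theI')
 qed
 have ev: "r - cst (mev hh r) : p" if "r : monalg D" for r
 proof-
  have "r - cst (mev hh r) = (SUM w:pkeys r. cst (lkp r w) * (msing w 1 - cst (hh w)))"
  proof-
   have cs: "cst (sum f A) = (SUM w:A. cst (f w))" for f :: "'g => complex" and A
    by (induction A rule: infinite_finite_induct) (auto simp: single_add)
   have "cst (mev hh r) = (SUM w:pkeys r. cst (lkp r w) * cst (hh w))" by (simp add: mev_def monext_def cs mult_single)
   moreover have "r = (SUM w:pkeys r. cst (lkp r w) * msing w 1)" using pm_sum_single[of r] by (simp add: mult_single)
   ultimately show ?thesis by (simp add: right_diff_distrib sum_subtractf)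
  qed
  also have "... : p" using that eta monalg_cst[OF D(1)] by (intro p_sum p_mult) (auto simp: monalg_def)
  finally show ?thesis .
 qed
 have one: "hh 0 = 1" using eta[of 0] residue_unique[of 1 "hh 0" 1] D(1) p_0 by (simp add: submon_def single_one)
 have mult: "hh (v + w) = hh v * hh w" if vw: "v : D" "w : D" for v w
 proof-
  have "msing (v + w) 1 - cst (hh v * hh w) =
    msing v 1 * (msing w 1 - cst (hh w)) + cst (hh w) * (msing v 1 - cst (hh v))"
   by (simp add: right_diff_distrib mult_single algebra_simps)
  also have "... : p" using eta vw monalg_single monalg_cst[OF D(1)] by (intro p_add p_mult) auto
  finally show ?thesis using eta[of "v + w"] vw D(1) residue_unique by (auto simp: submon_def)
 qed
 show ?thesis
 proof (rule that)
  show "mchar D hh" using one mult by (auto simp: mchar_def)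
  show "mev hh r = 0" if "r : p" for r using ev[OF p_monalg[OF that]] that residue_unique[of r "mev hh r" 0] by simp
  show "mev hh s ~= 0"
  proof
   assume "mev hh s = 0"
   hence "s : p" using ev[OF s(1)] by simp
   thus False using s(2)[of 1] by simp
  qed
 qed
qed

end

text \<open>Zorn's lemma supplies the maximal ideal; countability of \<open>D\<close> replaces
  finite generation, since the field is uncountable.\<close>

theorem nullstellensatz:
 fixes D :: "'g::comm_monoid_add set"
 assumes D: "submon D" "countable D" and b: "alg_ideal D b"
  and s: "s : monalg D" "!!N. s ^ N ~: b"
 obtains hh where "mchar D hh" "!!r. r : b ==> mev hh r = 0" "mev hh s ~= 0"
proof-
 let ?A = "{p. alg_ideal D p & b <= p & (ALL N. s ^ N ~: p)}"
 have "?A ~= {}" using b s by blast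
 moreover have "\<Union>C : ?A" if "C ~= {}" "subset.chain ?A C" for C
 proof-
  have C: "!!p. p : C ==> alg_ideal D p & b <= p & (ALL N. s ^ N ~: p)"
   "!!p q. p : C ==> q : C ==> p <= q | q <= p" using that(2) by (auto simp: subset_chain_def)
  have "alg_ideal D (\<Union>C)" unfolding alg_ideal_def
  proof (intro conjI ballI)
   show "\<Union>C <= monalg D" using C(1) unfolding alg_ideal_def by blast
   show "0 : \<Union>C" using C(1) that(1) unfolding alg_ideal_def by blast
   fix r assume r: "r : \<Union>C"
   { fix t assume "t : \<Union>C"
    then obtain p q where pq: "p : C" "q : C" "r : p" "t : q" using r by blast
    then obtain m where "m : C" "r : m" "t : m" using C(2)[OF pq(1,2)] by blast
    thus "r + t : \<Union>C" using C(1)[of m] unfolding alg_ideal_def by blast }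
   { fix c assume "c : monalg D"
    thus "c * r : \<Union>C" using r C(1) unfolding alg_ideal_def by blast }
  qed
  moreover have "EX q. q : C" using that(1) by blast
  then obtain q where "q : C" ..
  hence "b <= \<Union>C" using C(1)[of q] by (meson Union_upper subset_trans)
  moreover have "s ^ N ~: \<Union>C" for N using C(1) by (meson UnionE)
  ultimately show ?thesis by simp
 qed
 ultimately have "EX p:?A. ALL q:?A. p <= q --> q = p" by (rule subset_Zorn_nonempty)
 then obtain p where p: "p : ?A" and pmax: "ALL q:?A. p <= q --> q = p" ..
 have sub: "b <= p" using p by simp
 interpret prime_avoiding D p s
 proof
  show "q = p" if q: "alg_ideal D q" "p <= q" "!!N. s ^ N ~: q" for q
  proof-
   have "q : ?A" using q sub by (simp add: subset_trans[OF sub])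
   from bspec[OF pmax this] show ?thesis using q(2) by (rule mp)
  qed
  show "alg_ideal D p" "s ^ N ~: p" for N using p by simp_all
 qed (rule D s(1))+
 show ?thesis
 proof (rule point)
  fix hh assume "mchar D hh" "!!r. r : p ==> mev hh r = 0" "mev hh s ~= 0"
  with sub show ?thesis by (intro that[of hh]) auto
 qed
qed

section \<open>Dimensions of quotients\<close>

text \<open>Bases modulo a subspace are phrased with representatives, matching the independent
  families in \<open>quotient_dim\<close>; no quotient space is formed.\<close>

locale qspace = vector_space scale for scale :: "complex => 'b::ab_group_add => 'b"
begin

definition qindep :: "'b set => 'b set => bool" where
 "qindep W B <-> (ALL r. (SUM b:B. scale (r b) b) : W --> (ALL b:B. r b = 0))"

definition qspans :: "'b set => 'b set => 'b set => bool" where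
 "qspans W V B <-> (ALL v:V. EX r. v - (SUM b:B. scale (r b) b) : W)"

definition qbasis :: "'b set => 'b set => 'b set => bool" where
 "qbasis V W B <-> finite B & B <= V & qindep W B & qspans W V B"

text \<open>Expand the members of B in S modulo W. With more members than elements of S, a
  nontrivial combination has all its coefficients at S equal to 0.\<close>

lemma qindep_card_le:
 assumes W: "subspace W" and S: "finite S" "qspans W V S" and B: "finite B" "B <= V" "qindep W B"
 shows "card B <= card S"
proof (rule ccontr)
 assume "~ card B <= card S"
 hence lt: "card S < card B" by simp
 have "ALL b:B. EX r. b - (SUM s:S. scale (r s) s) : W" using S(2) B(2) by (auto simp: qspans_def)
 then obtain M where M: "!!b. b : B ==> b - (SUM s:S. scale (M b s) s) : W" by metis
 obtain bb where b: "EX b:B. bb b ~= 0" "!!s. s : S ==> (SUM b:B. bb b * M b s) = 0"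
  using homogeneous_system[OF S(1) B(1) lt, of M] by blast
 have "(SUM b:B. scale (bb b) (b - (SUM s:S. scale (M b s) s))) : W" using M W by (intro subspace_sum subspace_scale) auto
 moreover have "(SUM b:B. scale (bb b) (SUM s:S. scale (M b s) s)) = (SUM s:S. scale (SUM b:B. bb b * M b s) s)"
  by (simp add: scale_sum_right scale_sum_left sum.swap[of _ S B])
 hence "(SUM b:B. scale (bb b) (SUM s:S. scale (M b s) s)) = 0" using b(2) by simp
 ultimately have "(SUM b:B. scale (bb b) b) : W" by (simp add: scale_right_diff_distrib sum_subtractf)
 thus False using B(3) b(1) by (auto simp: qindep_def)
qed

lemma qbasis_exists:
 assumes W: "subspace W" and le: "!!B. finite B ==> B <= V ==> qindep W B ==> card B <= n"
 obtains B where "qbasis V W B"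
proof-
 let ?P = "%k. EX B. finite B & B <= V & qindep W B & card B = k"
 have "?P 0" by (intro exI[of _ "{}"]) (auto simp: qindep_def)
 moreover have "!!k. ?P k ==> k <= n" using le by blast
 ultimately have ex: "?P (Greatest ?P)" and mx: "!!k. ?P k ==> k <= Greatest ?P"
  using GreatestI_nat[of ?P 0 n] Greatest_le_nat[of ?P _ n] by blast+
 obtain B where B: "finite B" "B <= V" "qindep W B" "card B = Greatest ?P" using ex by blast
 have "EX r. v - (SUM b:B. scale (r b) b) : W" if v: "v : V" for v
 proof (rule ccontr)
  assume no: "~ ?thesis"
  have vB: "v ~: B"
  proof
   assume vB: "v : B"
   have "(SUM b:B. scale (if b = v then 1 else 0) b) = (SUM b:B. if b = v then b else 0)" by (intro sum.cong) auto
   hence "v - (SUM b:B. scale (if b = v then 1 else 0) b) : W" using vB B(1) subspace_0[OF W] by simp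
   hence "EX r. v - (SUM b:B. scale (r b) b) : W" by (rule exI[of _ "%b. if b = v then 1 else 0"])
   thus False using no by simp
  qed
  have "qindep W (insert v B)" unfolding qindep_def
  proof (intro allI impI)
   fix r assume r: "(SUM b:insert v B. scale (r b) b) : W"
   hence r': "scale (r v) v + (SUM b:B. scale (r b) b) : W" using vB B(1) by simp
   have "r v = 0"
   proof (rule ccontr)
    assume nz: "r v ~= 0"
    have "scale (1 / r v) (scale (r v) v + (SUM b:B. scale (r b) b)) : W" using r' W subspace_scale by blast
    hence "v + (SUM b:B. scale (r b / r v) b) : W" using nz by (simp add: scale_right_distrib scale_sum_right)
    hence "v - (SUM b:B. scale (- (r b / r v)) b) : W" by (simp add: sum_negf)
    hence "EX r. v - (SUM b:B. scale (r b) b) : W" by (rule exI[of _ "%b. - (r b / r v)"])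
    thus False using no by simp
   qed
   moreover hence "ALL b:B. r b = 0" using r' B(3) by (auto simp: qindep_def)
   ultimately show "ALL b:insert v B. r b = 0" by simp
  qed
  hence "?P (Suc (card B))" using B v vB by (intro exI[of _ "insert v B"]) auto
  thus False using mx B(4) by fastforce
 qed
 hence "qbasis V W B" using B by (auto simp: qbasis_def qspans_def)
 thus ?thesis by (rule that)
qed

lemma quotient_dim_eq: "quotient_dim scale V W = Sup {enat (card B) | B. finite B & B <= V & qindep W B}"
 by (simp add: quotient_dim_def qindep_def)

lemma quotient_dim_qbasis:
 assumes W: "subspace W" and B: "qbasis V W B"
 shows "quotient_dim scale V W = enat (card B)"
 unfolding quotient_dim_eq
proof (rule antisym)
 show "Sup {enat (card B) | B. finite B & B <= V & qindep W B} <= enat (card B)"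
  using B qindep_card_le[OF W, of B V] by (intro Sup_least) (auto simp: qbasis_def)
 show "enat (card B) <= Sup {enat (card B) | B. finite B & B <= V & qindep W B}" using B by (intro Sup_upper) (auto simp: qbasis_def)
qed

lemma qbasis_card_unique: "subspace W ==> qbasis V W B ==> qbasis V W B' ==> card B = card B'"
 using quotient_dim_qbasis[of W V B] quotient_dim_qbasis[of W V B'] by simp

lemma qbasis_finite_spans:
 assumes "subspace W" "finite S" "qspans W V S"
 obtains B where "qbasis V W B" using qbasis_exists[OF assms(1), of V "card S"] qindep_card_le[OF assms(1,2,3)] by blast

lemma qbasis_sub:
 assumes W: "subspace W" "subspace W0" "W0 <= W" and U: "U <= V" and S: "finite S" "qspans W0 V S"
 obtains B where "qbasis U W B"
proof (rule qbasis_exists[OF W(1), of U "card S"])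
 fix B assume B: "finite B" "B <= U" "qindep W B"
 hence "qindep W0 B" using W(3) by (auto simp: qindep_def)
 thus "card B <= card S" using qindep_card_le[OF W(2) S B(1)] B(2) U by blast
qed (rule that)

lemma qbasis_trans:
 assumes sub: "subspace W" "subspace U" "W <= U" and B1: "qbasis V U B1" and B2: "qbasis U W B2"
  and UV: "U <= V"
 shows "qbasis V W (B1 Un B2)" "B1 Int B2 = {}"
proof-
 note b1 = B1[unfolded qbasis_def] and b2 = B2[unfolded qbasis_def]
 have disjU: "b ~: U" if "b : B1" for b
 proof
  assume bU: "b : U"
  have "(SUM x:B1. scale (if x = b then 1 else 0) x) = (SUM x:B1. if x = b then x else 0)" by (intro sum.cong) auto
  hence "(SUM x:B1. scale (if x = b then 1 else 0) x) : U" using bU that b1 by simp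
  moreover have "qindep U B1" using b1 by simp
  ultimately have "ALL x:B1. (if x = b then 1 else 0) = (0::complex)"
   unfolding qindep_def by (elim allE[of _ "%x. if x = b then 1 else 0"] impE)
  thus False using that by (auto dest: bspec[of _ _ b])
 qed
 thus disj: "B1 Int B2 = {}" using b2 by blast
 have un: "(SUM b:B1 Un B2. scale (r b) b) = (SUM b:B1. scale (r b) b) + (SUM b:B2. scale (r b) b)" for r
  using b1 b2 disj by (intro sum.union_disjoint) auto
 show "qbasis V W (B1 Un B2)" unfolding qbasis_def
 proof (intro conjI)
  show "finite (B1 Un B2)" "B1 Un B2 <= V" using b1 b2 UV by auto
  show "qindep W (B1 Un B2)" unfolding qindep_def
  proof (intro allI impI)
   fix r assume r: "(SUM b:B1 Un B2. scale (r b) b) : W"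
   have s2: "(SUM b:B2. scale (r b) b) : U" using b2 sub(2) by (intro subspace_sum subspace_scale) auto
   have "(SUM b:B1. scale (r b) b) = (SUM b:B1 Un B2. scale (r b) b) - (SUM b:B2. scale (r b) b)" by (simp add: un)
   also have "... : U" using r s2 sub by (intro subspace_diff) auto
   finally have z: "ALL b:B1. r b = 0" using b1 by (simp add: qindep_def)
   hence "(SUM b:B1. scale (r b) b) = 0" by (intro sum.neutral) auto
   hence "(SUM b:B2. scale (r b) b) : W" using r un by simp
   hence "ALL b:B2. r b = 0" using b2 by (simp add: qindep_def)
   thus "ALL b:B1 Un B2. r b = 0" using z by blast
  qed
  show "qspans W V (B1 Un B2)" unfolding qspans_def
  proof
   fix v assume "v : V"
   then obtain r1 where r1: "v - (SUM b:B1. scale (r1 b) b) : U" using b1 by (auto simp: qspans_def)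
   then obtain r2 where r2: "v - (SUM b:B1. scale (r1 b) b) - (SUM b:B2. scale (r2 b) b) : W" using b2 by (auto simp: qspans_def)
   let ?r = "%b. if b : B1 then r1 b else r2 b"
   have "(SUM b:B2. scale (?r b) b) = (SUM b:B2. scale (r2 b) b)" using disj by (intro sum.cong) auto
   moreover have "(SUM b:B1. scale (?r b) b) = (SUM b:B1. scale (r1 b) b)" by simp
   ultimately have "v - (SUM b:B1 Un B2. scale (?r b) b) : W" using r2 by (simp add: un diff_diff_eq)
   thus "EX r. v - (SUM b:B1 Un B2. scale (r b) b) : W" by (rule exI[of _ ?r])
  qed
 qed
qed

end

text \<open>The map induces an isomorphism from V/W to V'/W'. Distinct basis elements with equal
  images would differ by an element of W, against independence.\<close>

lemma qbasis_transfer: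
 fixes s1 :: "complex => 'b::ab_group_add => 'b" and s2 :: "complex => 'c::ab_group_add => 'c"
 assumes "qspace s1" "qspace s2"
  and W': "module.subspace s2 W'"
  and B: "qspace.qbasis s1 V W B"
  and ph: "!!x y. ph (x + y) = ph x + ph y" "!!c x. ph (s1 c x) = s2 c (ph x)"
  and V: "!!v. v : V ==> ph v : V'" "module.subspace s1 V"
  and iff: "!!v. v : V ==> ph v : W' <-> v : W"
  and surj: "!!v'. v' : V' ==> EX v:V. v' - ph v : W'"
 shows "qspace.qbasis s2 V' W' (ph ` B)" "card (ph ` B) = card B"
proof-
 interpret v1: qspace s1 by fact
 interpret v2: qspace s2 by fact
 have phi0: "ph 0 = 0" using ph(1)[of 0 0] by simp
 have phis: "ph (SUM b:A. s1 (r b) b) = (SUM b:A. s2 (r b) (ph b))" for A r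
  by (induction A rule: infinite_finite_induct) (auto simp: phi0 ph)
 have phid: "ph (x - y) = ph x - ph y" for x y using ph(1)[of "x - y" y] by simp
 have b: "finite B" "B <= V" "v1.qindep W B" "v1.qspans W V B" using B by (simp_all add: v1.qbasis_def)
 have comb: "(SUM b:A. s1 (r b) b) : V" if "A <= B" for A r using b(2) that V(2) by (intro v1.subspace_sum v1.subspace_scale) auto
 have inj: "inj_on ph B"
 proof (rule inj_onI, rule ccontr)
  fix x y assume xy: "x : B" "y : B" "ph x = ph y" "x ~= y"
  let ?r = "%z. if z = x then 1 else if z = y then -1 else (0::complex)"
  have "(SUM z:B. s1 (?r z) z) = (SUM z:{x, y}. s1 (?r z) z)" using b(1) xy(1,2) by (intro sum.mono_neutral_right) auto
  hence "(SUM z:B. s1 (?r z) z) = x - y" using xy(4) by simp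
  moreover have "x - y : V" using xy(1,2) b(2) by (intro v1.subspace_diff[OF V(2)]) auto
  hence "x - y : W" using iff[of "x - y"] xy(3) phid v2.subspace_0[OF W'] by simp
  ultimately have "(SUM z:B. s1 (?r z) z) : W" by simp
  moreover note b(3)
  ultimately have "ALL z:B. ?r z = 0" unfolding v1.qindep_def by (elim allE[of _ ?r] impE)
  hence "?r x = 0" using xy(1) by (rule bspec)
  thus False by simp
 qed
 thus "card (ph ` B) = card B" by (rule card_image)
 have sphi: "(SUM c:ph ` B. s2 (r c) c) = ph (SUM b:B. s1 (r (ph b)) b)" for r using inj by (simp add: phis sum.reindex)
 show "v2.qbasis V' W' (ph ` B)" unfolding v2.qbasis_def
 proof (intro conjI)
  show "finite (ph ` B)" using b(1) by simp
  show "ph ` B <= V'" using b(2) V(1) by blast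
  show "v2.qindep W' (ph ` B)" unfolding v2.qindep_def sphi
  proof (intro allI impI)
   fix r assume "ph (SUM b:B. s1 (r (ph b)) b) : W'"
   hence "(SUM b:B. s1 (r (ph b)) b) : W" using iff[OF comb[of B]] by simp
   hence "ALL b:B. r (ph b) = 0" using b(3) unfolding v1.qindep_def by (elim allE[of _ "%b. r (ph b)"] impE)
   thus "ALL c:ph ` B. r c = 0" by blast
  qed
  show "v2.qspans W' V' (ph ` B)" unfolding v2.qspans_def
  proof
   fix v' assume "v' : V'"
   then obtain v where v: "v : V" "v' - ph v : W'" using surj by metis
   then obtain r where r: "v - (SUM b:B. s1 (r b) b) : W" using b(4) unfolding v1.qspans_def by metis
   have "v - (SUM b:B. s1 (r b) b) : V" using v(1) comb[of B] by (intro v1.subspace_diff[OF V(2)]) auto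
   hence "ph v - ph (SUM b:B. s1 (r b) b) : W'" using r by (simp add: iff flip: phid)
   hence "(v' - ph v) + (ph v - ph (SUM b:B. s1 (r b) b)) : W'" using v(2) by (intro v2.subspace_add[OF W'])
   hence "v' - ph (SUM b:B. s1 (r b) b) : W'" by simp
   moreover have "ph (SUM b:B. s1 (r b) b) = (SUM c:ph ` B. s2 (r (inv_into B ph c)) c)" unfolding sphi using inj by (simp cong: sum.cong)
   ultimately have "v' - (SUM c:ph ` B. s2 (r (inv_into B ph c)) c) : W'" by simp
   thus "EX r. v' - (SUM c:ph ` B. s2 (r c) c) : W'" by (rule exI[of _ "%c. r (inv_into B ph c)"])
  qed
 qed
qed

abbreviation pscale :: "complex => ('g \<Rightarrow>\<^sub>0 complex) => 'g \<Rightarrow>\<^sub>0 complex" where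
 "pscale == %c. Poly_Mapping.map ((*) c)"

lemma lookup_pscale: "lkp (pscale c r) w = c * lkp r w"
 by (simp add: map.rep_eq when_def)

interpretation pv: qspace pscale by unfold_locales (auto intro!: poly_mapping_eqI simp: lookup_pscale lookup_add algebra_simps)

lemma pscale_cst: "pscale c r = cst c * (r :: 'g::comm_monoid_add \<Rightarrow>\<^sub>0 complex)"
 by (rule mult_map_scale_conv_mult)

lemma pscale_mult: "pscale c (r * s) = r * pscale c (s :: 'g::comm_monoid_add \<Rightarrow>\<^sub>0 complex)"
 by (simp add: pscale_cst algebra_simps)

lemma nullstellensatz_ex:
 fixes D :: "'g::comm_monoid_add set"
 assumes "submon D" "countable D" "alg_ideal D b" "s : monalg D" "!!N. s ^ N ~: b"
 shows "EX hh. mchar D hh & (ALL r:b. mev hh r = 0) & mev hh s ~= 0"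
proof (rule nullstellensatz[OF assms])
 fix hh assume "mchar D hh" "!!r. r : b ==> mev hh r = 0" "mev hh s ~= 0"
 thus ?thesis by (intro exI[of _ hh]) simp
qed

section \<open>Systems of parameters\<close>

context nonneg_graded
begin

lemma kchain_cong:
 assumes "!!j. j : A ==> dg j = dg' j"
 shows "kchain A dg i D = kchain A dg' i D"
proof-
 have "z J : R (D - sum dg J) & (z J ~= 0 --> J <= A & card J = i) <->
   z J : R (D - sum dg' J) & (z J ~= 0 --> J <= A & card J = i)" for z :: "nat set => 'r" and J
 proof (cases "J <= A")
  case True
  hence "sum dg J = sum dg' J" using assms by (intro sum.cong) auto
  thus ?thesis by simp
 next
  case False
  thus ?thesis by (cases "z J = 0") auto
 qed
 thus ?thesis unfolding kchain_def by simp
qed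

lemma kvanish_cong:
 assumes "!!j. j : A ==> a j = a' j" "!!j. j : A ==> dg j = dg' j"
 shows "kvanish A a dg d = kvanish A a' dg' d"
proof-
 have "kdiff A a = kdiff A a'" using assms(1) by (intro ext) (auto simp: kdiff_def intro!: sum.cong)
 thus ?thesis unfolding kvanish_def using kchain_cong[OF assms(2)] by simp
qed

definition gid :: "'x set => ('x => 'r) => ('x => int) => int => 'r set" where
 "gid A a dg m = {r. EX t. (ALL j:A. t j : R (m - dg j)) & r = (SUM j:A. t j * a j)}"

lemma gid_subset: "(!!j. j : A ==> a j : R (dg j)) ==> gid A a dg m <= R m"
proof
 fix r assume a: "!!j. j : A ==> a j : R (dg j)" and "r : gid A a dg m"
 then obtain t where t: "!!j. j : A ==> t j : R (m - dg j)" "r = (SUM j:A. t j * a j)" by (auto simp: gid_def)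
 show "r : R m" unfolding t(2) using a t(1) by (intro R_sum R_mult'[of _ "m - dg _"]) auto
qed

lemma gid_0: "0 : gid A a dg m"
 unfolding gid_def by (intro CollectI exI[of _ "%_. 0"]) simp

lemma gid_add: "r : gid A a dg m ==> s : gid A a dg m ==> r + s : gid A a dg m"
proof-
 assume "r : gid A a dg m" "s : gid A a dg m"
 then obtain t t' where "ALL j:A. t j : R (m - dg j)" "r = (SUM j:A. t j * a j)"
  "ALL j:A. t' j : R (m - dg j)" "s = (SUM j:A. t' j * a j)" by (auto simp: gid_def)
 thus ?thesis unfolding gid_def by (intro CollectI exI[of _ "%j. t j + t' j"]) (auto simp: R_add distrib_right sum.distrib)
qed

lemma gid_mult: "s : R l ==> r : gid A a dg m ==> s * r : gid A a dg (l + m)"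
proof-
 assume s: "s : R l" and "r : gid A a dg m"
 then obtain t where t: "ALL j:A. t j : R (m - dg j)" "r = (SUM j:A. t j * a j)" by (auto simp: gid_def)
 have "ALL j:A. s * t j : R (l + m - dg j)" using s t(1) by (auto intro!: R_mult'[OF s])
 thus ?thesis unfolding gid_def t(2) by (intro CollectI exI[of _ "%j. s * t j"]) (auto simp: sum_distrib_left mult.assoc)
qed

lemma gid_mult': "s : R l ==> r : gid A a dg m ==> k = l + m ==> s * r : gid A a dg k"
 using gid_mult by blast

lemma gid_sum: "(!!i. i : B ==> F i : gid A a dg m) ==> sum F B : gid A a dg m"
 by (induction B rule: infinite_finite_induct) (auto intro: gid_0 gid_add)

end

context cone_semigroup
begin

text \<open>Excludes the vertex of the affine cone; what remains are representatives of the points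
  of Proj.\<close>

definition nonirr :: "('g => complex) => bool" where
 "nonirr hh <-> (EX g:Gs. hh g ~= 0)"

text \<open>Where \<open>ell i\<close> is nonzero at w it is at least 1 by integrality, so a large
  multiple of w dominates v.\<close>

lemma multiple_minus:
 assumes "v : L" "w : L" "!!i. i : I ==> ell i (emb w) = 0 ==> ell i (emb v) = 0"
 obtains K where "nmul K w - v : L"
proof-
 define K where "K = nat \<lceil>SUM i:I. ell i (emb v)\<rceil>"
 have "ell i (emb (nmul K w - v)) >= 0" if i: "i : I" for i
 proof-
  have e: "ell i (emb (nmul K w - v)) = real K * ell i (emb w) - ell i (emb v)"
   by (simp add: emb_diff emb_nmul linear_diff[OF ell(2)[OF i]] linear_scale[OF ell(2)[OF i]])
  have pos: "ell j (emb v) >= 0" "ell j (emb w) >= 0" if "j : I" for j using assms(1,2) L_ell that by auto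
  show ?thesis
  proof (cases "ell i (emb w) = 0")
   case True
   thus ?thesis using assms(3)[OF i] e by simp
  next
   case False
   obtain z where z: "ell i (emb w) = real_of_int z" using ell(3)[OF i, of w] by (elim Ints_cases)
   have ge1: "ell i (emb w) >= 1" using False pos(2)[OF i] unfolding z by simp
   have "ell i (emb v) <= (SUM i:I. ell i (emb v))" using pos(1) i ell(1) by (intro member_le_sum) auto
   also have "... <= real K" unfolding K_def by linarith
   also have "... <= real K * ell i (emb w)" using ge1 mult_left_mono[OF ge1, of "real K"] by simp
   finally show ?thesis using e by simp
  qed
 qed
 thus ?thesis using that L_ell by blast
qed

lemma character_nmul:
 assumes "mchar L hh" "w : L"
 shows "hh (nmul k w) = hh w ^ k"
 using assms nmul_mem[OF submon_L] by (induction k) (auto simp: nmul_Suc mchar_def)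

text \<open>v divides a power of w in the semigroup, so a zero at v would be inherited by w.\<close>

lemma character_face:
 assumes hh: "mchar L hh" and "v : L" "w : L" "hh w ~= 0"
  and "!!i. i : I ==> ell i (emb w) = 0 ==> ell i (emb v) = 0"
 shows "hh v ~= 0"
proof-
 obtain K where K: "nmul K w - v : L" using multiple_minus[OF assms(2,3,5)] by blast
 have "hh (nmul K w - v + v) = hh (nmul K w - v) * hh v" using hh K assms(2) unfolding mchar_def by blast
 hence "hh w ^ K = hh (nmul K w - v) * hh v" using character_nmul[OF hh assms(3)] by simp
 thus ?thesis using assms(4) by (metis mult_zero_right power_not_zero)
qed

lemma generator_in_face:
 assumes "w : L" "deg w > 0"
 obtains g where "g : Gs" "!!i. i : I ==> ell i (emb w) = 0 ==> ell i (emb g) = 0"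
proof-
 obtain l where l: "ALL g:Gs. l g >= 0" "emb w = (SUM g:Gs. l g \<cdot> emb g)" using L_cone[OF assms(1)] by blast
 have "(SUM g:Gs. l g) > 0" using deg_combination[OF l(2)] assms(2) by simp
 then obtain g where g: "g : Gs" "l g > 0" using l(1) by (metis not_le sum_nonpos)
 have "ell i (emb g) = 0" if i: "i : I" "ell i (emb w) = 0" for i
 proof-
  have "(SUM g:Gs. l g * ell i (emb g)) = 0"
   using i(2) unfolding l(2) by (simp add: linear_sum[OF ell(2)[OF i(1)]] linear_scale[OF ell(2)[OF i(1)]])
  moreover have "!!g. g : Gs ==> l g * ell i (emb g) >= 0" using l(1) Gs(2) L_ell i(1) by (auto intro!: mult_nonneg_nonneg)
  ultimately have "l g * ell i (emb g) = 0" using Gs(1) g(1) by (subst (asm) sum_nonneg_eq_0_iff) auto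
  thus ?thesis using g(2) by simp
 qed
 thus ?thesis using that g(1) by blast
qed

lemma nonirrI:
 assumes "mchar L hh" "w : L" "deg w > 0" "hh w ~= 0"
 shows "nonirr hh"
proof-
 obtain g where g: "g : Gs" "!!i. i : I ==> ell i (emb w) = 0 ==> ell i (emb g) = 0" using generator_in_face[OF assms(2,3)] by blast
 hence "hh g ~= 0" using character_face[OF assms(1) _ assms(2,4) g(2)] Gs(2) by blast
 thus ?thesis using g(1) by (auto simp: nonirr_def)
qed

lemma nonirr_of_mev:
 assumes "mchar L hh" "s : LR e" "e > 0" "mev hh s ~= 0"
 shows "nonirr hh"
proof-
 obtain w where w: "w : pkeys s" "lkp s w * hh w ~= 0"
  using assms(4) unfolding mev_def monext_def by (meson sum.not_neutral_contains_not_neutral)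
 thus ?thesis using assms(1-3) by (intro nonirrI[of hh w]) (auto simp: LR_def)
qed

definition hcomp :: "int => ('g \<Rightarrow>\<^sub>0 complex) => 'g \<Rightarrow>\<^sub>0 complex" where
 "hcomp m = keyrestrict {w. deg w = m}"

lemma hcomp_LR: "r : monalg L ==> hcomp m r : LR m"
 by (auto simp: hcomp_def LR_def monalg_def keys_keyrestrict)

lemma hcomp_id: "r : LR m ==> hcomp m r = r"
 unfolding hcomp_def by (rule keyrestrict_id) (auto simp: LR_def)

lemma hcomp_sum: "hcomp m (sum F A) = (SUM i:A. hcomp m (F i))"
 by (simp add: hcomp_def keyrestrict_sum)

lemma hcomp_mult:
 assumes "h : LR e"
 shows "hcomp m (t * h) = hcomp (m - e) t * h"
proof (rule poly_mapping_eqI)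
 fix w
 have sub: "hcomp (m - e) t = t - (t - hcomp (m - e) t)" by simp
 have kk: "deg v = deg w - e" if nz: "lkp (r * h) w ~= 0" and one: "pkeys r = {v}" for r :: "'g \<Rightarrow>\<^sub>0 complex" and v
 proof-
  have "w : pkeys (r * h)" using nz by (simp add: in_keys_iff)
  then obtain x where "w = v + x" "x : pkeys h" using keys_mult[of r h] one by auto
  thus ?thesis using assms by (auto simp: LR_def deg_add)
 qed
 have ts: "t = (SUM v:pkeys t. msing v (lkp t v))" by (rule pm_sum_single)
 have "lkp (t * h) w = (SUM v:pkeys t. lkp (msing v (lkp t v) * h) w)"
  using arg_cong[OF ts, of "%t. lkp (t * h) w"] by (simp add: sum_distrib_right lookup_sum)
 moreover have "lkp (hcomp (m - e) t * h) w = (SUM v:pkeys t Int {v. deg v = m - e}. lkp (msing v (lkp t v) * h) w)"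
  by (simp add: hcomp_def keyrestrict_def sum_distrib_right lookup_sum)
 moreover have "lkp (msing v (lkp t v) * h) w = 0" if "v : pkeys t" "deg v ~= deg w - e" for v
  using kk[of "msing v (lkp t v)" v] that by (auto simp: in_keys_iff)
 ultimately show "lkp (hcomp m (t * h)) w = lkp (hcomp (m - e) t * h) w" unfolding hcomp_def[of m] lookup_keyrestrict
  by (auto intro!: sum.mono_neutral_right sum.neutral[symmetric])
qed

text \<open>A character with a nonzero value at s is relevant because s has positive degree. Taking
  homogeneous components of the coefficients makes the resulting identity graded.\<close>

lemma graded_nullstellensatz:
 assumes cnt: "countable (UNIV :: 'g set)" and A: "finite A" "!!j. j : A ==> h j : LR (e j)"
  and s: "s : LR e0" "e0 > 0"
  and zeros: "!!hh. mchar L hh ==> nonirr hh ==> (!!j. j : A ==> mev hh (h j) = 0) ==> mev hh s = 0"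
 obtains N where "s ^ N : LR.gid A h e (int N * e0)"
proof-
 let ?b = "{r. EX t. (ALL j:A. t j : monalg L) & r = (SUM j:A. t j * h j)}"
 have hm: "h j : monalg L" if "j : A" for j using A(2)[OF that] by (rule LR_monalg)
 have ideal: "alg_ideal L ?b" unfolding alg_ideal_def
 proof (intro conjI ballI)
  show "?b <= monalg L" using hm by (auto intro!: monalg_sum monalg_mult[OF submon_L])
  show "0 : ?b" by (intro CollectI exI[of _ "%_. 0"]) (simp add: monalg_0)
  fix r assume "r : ?b"
  then obtain t where t: "ALL j:A. t j : monalg L" "r = (SUM j:A. t j * h j)" by blast
  { fix r' assume "r' : ?b"
   then obtain t' where t': "ALL j:A. t' j : monalg L" "r' = (SUM j:A. t' j * h j)" by blast
   show "r + r' : ?b" using t t' by (intro CollectI exI[of _ "%j. t j + t' j"]) (auto simp: monalg_add distrib_right sum.distrib) }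
  { fix c assume c: "c : monalg L"
   show "c * r : ?b"
    using t c by (intro CollectI exI[of _ "%j. c * t j"]) (auto simp: monalg_mult[OF submon_L] sum_distrib_left mult.assoc) }
 qed
 have "EX N. s ^ N : ?b"
 proof (rule ccontr)
  assume no: "~ ?thesis"
  have cL: "countable L" using cnt by (rule countable_subset[rotated]) simp
  have nb: "s ^ N ~: ?b" for N using no by simp
  obtain hh where hh: "mchar L hh" "ALL r:?b. mev hh r = 0" "mev hh s ~= 0"
   using nullstellensatz_ex[OF submon_L cL ideal LR_monalg[OF s(1)] nb] by (elim exE conjE)
  have "h j : ?b" if "j : A" for j
  proof-
   have "(SUM i:A. (if i = j then 1 else 0) * h i) = (SUM i:A. if i = j then h i else 0)" by (intro sum.cong) auto
   hence "h j = (SUM i:A. (if i = j then 1 else 0) * h i)" using A(1) that by simp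
   thus ?thesis by (intro CollectI exI[of _ "%i. if i = j then 1 else 0"]) (simp add: monalg_1[OF submon_L] monalg_0)
  qed
  hence "mev hh (h j) = 0" if "j : A" for j using bspec[OF hh(2)] that by simp
  hence "mev hh s = 0" by (rule zeros[OF hh(1) nonirr_of_mev[OF hh(1) s hh(3)]])
  thus False using hh(3) by simp
 qed
 then obtain N t where t: "!!j. j : A ==> t j : monalg L" "s ^ N = (SUM j:A. t j * h j)" by blast
 have "s ^ N = hcomp (int N * e0) (s ^ N)" using hcomp_id[OF LR.R_power[OF s(1)]] by simp
 also have "... = (SUM j:A. hcomp (int N * e0 - e j) (t j) * h j)" unfolding t(2) hcomp_sum using A(2) by (intro sum.cong refl hcomp_mult)
 finally have "s ^ N = (SUM j:A. hcomp (int N * e0 - e j) (t j) * h j)" .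
 hence "s ^ N : LR.gid A h e (int N * e0)" unfolding LR.gid_def using t(1) hcomp_LR
  by (intro CollectI exI[of _ "%j. hcomp (int N * e0 - e j) (t j)"]) simp
 thus ?thesis by (rule that)
qed

lemma L_deg_0: "w : L ==> deg w = 0 ==> w = 0"
proof-
 assume w: "w : L" "deg w = 0"
 obtain l where l: "ALL g:Gs. l g >= 0" "emb w = (SUM g:Gs. l g \<cdot> emb g)" using L_cone[OF w(1)] by blast
 have "(SUM g:Gs. l g) = 0" using deg_combination[OF l(2)] w(2) by simp
 hence "ALL g:Gs. l g = 0" using l(1) Gs(1) by (simp add: sum_nonneg_eq_0_iff)
 hence "emb w = 0" using l(2) by simp
 thus "w = 0" using emb(2) emb_0 by (metis injD)
qed

end

text \<open>The common zero of \<open>f 1, ..., f n\<close> guards against constants: a degree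
  \<open>d j\<close> may be 0, and a nonzero constant among them would generate the unit
  ideal.\<close>

locale parameter_system = cone_semigroup L deg emb Gs I ell dgl
 for L :: "'g::ab_group_add set" and deg and emb :: "'g => 'e::euclidean_space"
  and Gs and I :: "'i set" and ell and dgl +
 fixes f :: "nat => 'g \<Rightarrow>\<^sub>0 complex" and d :: "nat => nat" and n :: nat
 assumes cnt: "countable (UNIV :: 'g set)" and dim: "DIM('e) = Suc n"
  and f: "!!j. j <= n ==> f j : LR (int (d j))" and d0: "d 0 = 1"
  and no_zero: "!!hh. mchar L hh ==> nonirr hh ==> EX j<=n. mev hh (f j) ~= 0"
  and zero: "EX hh. mchar L hh & nonirr hh & (ALL j:{1..n}. mev hh (f j) = 0)"
begin

abbreviation fdeg :: "nat => int" where "fdeg j == int (d j)"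

lemma monomial_power_mem:
 assumes "g : Gs"
 obtains k where "!!k'. k' >= k ==> msing g 1 ^ k' : LR.gid {0..n} f fdeg (int k')"
proof-
 have g: "msing g 1 : LR 1" using assms Gs(2,3) LR_single by auto
 obtain N where N: "msing g 1 ^ N : LR.gid {0..n} f fdeg (int N * 1)"
 proof (rule graded_nullstellensatz[OF cnt _ _ g, of "{0..n}" f fdeg])
  fix hh assume "mchar L hh" "nonirr hh" "!!j. j : {0..n} ==> mev hh (f j) = 0"
  thus "mev hh (msing g 1) = 0" using no_zero[of hh] by force
 qed (use f in auto)
 show ?thesis
 proof (rule that[of N])
  fix k' assume k: "N <= k'"
  have "msing g 1 ^ (k' - N) * msing g 1 ^ N : LR.gid {0..n} f fdeg (int k')"
   using LR.R_power[OF g, of "k' - N"] N k by (intro LR.gid_mult') auto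
  thus "msing g 1 ^ k' : LR.gid {0..n} f fdeg (int k')" using k by (simp flip: power_add)
 qed
qed

text \<open>Monomial powers alone have bound N - (n + 1). Adding the n + 1 parameters raises it to
  N. Each of the N monomial powers lies in the ideal of the parameters, so removing them one at a
  time lowers the bound to 0.\<close>

theorem kvanish_parameters:
 "EX N. LR.kvanish {N..<N + Suc n} (%i. f (i - N)) (%i. fdeg (i - N)) 0"
proof-
 obtain h xx where tr: "tricone L deg emb Gs I ell dgl h xx" using triangulation_exists[OF cnt] by blast
 interpret T: tricone L deg emb Gs I ell dgl h xx by (rule tr)
 obtain ga where g: "bij_betw ga {0..<card Gs} Gs" using ex_bij_betw_nat_finite[OF Gs(1)] by blast
 define N where "N = card Gs"
 have bij: "bij_betw ga {..<N} Gs" using g by (simp add: N_def lessThan_atLeast0)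
 have "DIM('e) = dim (span (emb ` Gs))" using Gs(4) by simp
 also have "... <= card (emb ` Gs)" using Gs(1) by (intro dim_le_card) auto
 also have "... <= N" unfolding N_def using Gs(1) by (rule card_image_le)
 finally have NDIM: "Suc n <= N" using dim by simp
 have "ALL g:Gs. EX k. ALL k'>=k. msing g 1 ^ k' : LR.gid {0..n} f fdeg (int k')" using monomial_power_mem by metis
 then obtain kf where kf: "!!g k'. g : Gs ==> k' >= kf g ==> msing g 1 ^ k' : LR.gid {0..n} f fdeg (int k')" by metis
 \<comment> \<open>One exponent for all generators; \<open>Suc\<close> keeps it positive.\<close>
 define k where "k = Suc (SUM g:Gs. kf g)"
 have kk: "msing g 1 ^ k : LR.gid {0..n} f fdeg (int k)" if "g : Gs" for g
  using member_le_sum[of g Gs kf] Gs(1) that by (intro kf) (auto simp: k_def)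
 \<comment> \<open>Positions below N carry the monomial powers, position N + j carries the parameter
   \<open>f j\<close>.\<close>
 define a where "a i = (if i < N then msing (ga i) (1::complex) ^ k else f (i - N))" for i
 define dg where "dg i = (if i < N then int k else fdeg (i - N))" for i
 have adg: "a i : LR (dg i)" if "i <= N + n" for i
 proof (cases "i < N")
  case True
  hence "ga i : Gs" using bij by (auto simp: bij_betw_def)
  hence "msing (ga i) 1 : LR 1" using Gs(2,3) LR_single by auto
  thus ?thesis using True LR.R_power[of "msing (ga i) 1" 1 k] by (simp add: a_def dg_def)
 next
  case False
  thus ?thesis using f[of "i - N"] that by (simp add: a_def dg_def)
 qed
 have "LR.kvanish {..<N} a dg (N - DIM('e))" using T.kvanish_monomials[OF bij, of k]
  by (subst LR.kvanish_cong[of _ a "%j. msing (ga j) 1 ^ k" dg "%_. int k"]) (auto simp: a_def dg_def k_def)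
 hence "m <= Suc n ==> LR.kvanish {..<N + m} a dg (N - Suc n + m)" for m
 proof (induction m)
  case 0
  thus ?case using dim by simp
 next
  case (Suc m)
  have "LR.kvanish (insert (N + m) {..<N + m}) a dg (Suc (N - Suc n + m))" using Suc by (intro LR.kvanish_insert adg) auto
  moreover have "insert (N + m) {..<N + m} = {..<N + Suc m}" by auto
  ultimately show ?case by simp
 qed
 from this[of "Suc n"] have start: "LR.kvanish {..<N + Suc n} a dg N" using NDIM by simp
 have "m <= N ==> LR.kvanish {m..<N + Suc n} a dg (N - m)" for m
 proof (induction m)
  case 0
  thus ?case using start by (simp add: lessThan_atLeast0)
 next
  case (Suc m)
  have "ga m : Gs" using bij Suc.prems by (auto simp: bij_betw_def)
  hence "a m : LR.gid {0..n} f fdeg (dg m)" using kk Suc.prems by (simp add: a_def dg_def)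
  hence "EX t. (ALL j:{0..n}. t j : LR (dg m - fdeg j)) & a m = (SUM j:{0..n}. t j * f j)" unfolding LR.gid_def by (rule CollectD)
  then obtain t where t: "ALL j:{0..n}. t j : LR (dg m - fdeg j)" "a m = (SUM j:{0..n}. t j * f j)" by (elim exE conjE)
  define r where "r i = (if i < N then 0 else t (i - N))" for i
  have "(SUM i:{Suc m..<N + Suc n}. r i * a i) = (SUM i:{N..<N + Suc n}. r i * a i)"
   using Suc.prems by (intro sum.mono_neutral_right) (auto simp: r_def)
  also have "... = (SUM i:{N..<N + Suc n}. t (i - N) * f (i - N))" by (intro sum.cong) (auto simp: r_def a_def)
  also have "... = (SUM j:{0..n}. t j * f j)" by (rule sum.reindex_bij_witness[of _ "%j. j + N" "%i. i - N"]) auto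
  finally have am: "a m = (SUM i:{Suc m..<N + Suc n}. r i * a i)" using t(2) by simp
  have rr: "r i : LR (dg m - dg i)" if "i : {Suc m..<N + Suc n}" for i using bspec[OF t(1), of "i - N"] that by (auto simp: r_def dg_def)
  have "insert m {Suc m..<N + Suc n} = {m..<N + Suc n}" using Suc.prems by auto
  moreover have "N - m = Suc (N - Suc m)" using Suc.prems by simp
  ultimately have "LR.kvanish (insert m {Suc m..<N + Suc n}) a dg (Suc (N - Suc m))" using Suc by simp
  thus ?case by (rule LR.kvanish_remove[OF _ _ _ am rr, rotated 2]) auto
 qed
 from this[of N] have "LR.kvanish {N..<N + Suc n} a dg 0" by simp
 moreover have "LR.kvanish {N..<N + Suc n} a dg 0 =
   LR.kvanish {N..<N + Suc n} (%i. f (i - N)) (%i. fdeg (i - N)) 0" by (rule LR.kvanish_cong) (auto simp: a_def dg_def)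
 ultimately show ?thesis by blast
qed

end

section \<open>Regularity of the parameters and the Hilbert function of the quotient\<close>

context parameter_system
begin

abbreviation Fid :: "nat => int => ('g \<Rightarrow>\<^sub>0 complex) set" where
 "Fid k m == LR.gid {1..k} f fdeg m"

lemma msing_one_inj: "inj (%w :: 'g. msing w (1::complex))"
proof (rule injI)
 fix v w :: 'g assume "msing v (1::complex) = msing w 1"
 hence "lkp (msing w (1::complex)) v = 1" by (metis lookup_single_eq)
 thus "v = w" by (auto simp: lookup_single when_def split: if_splits)
qed

lemma constant_zero:
 assumes "j : {1..n}" "d j = 0"
 shows "f j = 0"
proof-
 have "pkeys (f j) <= {0}" using f[of j] assms L_deg_0 by (auto simp: LR_def)
 hence "lkp (f j) w = 0" if "w ~= 0" for w using that by (auto simp: in_keys_iff)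
 hence "f j = cst (lkp (f j) 0)" by (intro poly_mapping_eqI) (auto simp: lookup_single when_def)
 then obtain c where c: "f j = cst c" by blast
 obtain hh where "mchar L hh" "ALL j:{1..n}. mev hh (f j) = 0" using zero by blast
 hence "mev hh (f j) = 0" "hh 0 = 1" using assms(1) by (auto simp: mchar_def)
 hence "c = 0" by (simp add: c)
 thus ?thesis using c by simp
qed

text \<open>A parameter of degree 0 is a constant with a zero, hence 0. It would annihilate 1, and
  regularity would put 1 into the ideal of the remaining parameters, which vanishes in degree
  0.\<close>

lemma fdeg_pos:
 assumes "j : {1..n}"
 shows "d j > 0"
proof (rule ccontr)
 assume "~ d j > 0"
 hence dj: "d j = 0" by simp
 obtain N where N: "LR.kvanish {N..<N + Suc n} (%i. f (i - N)) (%i. fdeg (i - N)) 0" using kvanish_parameters by blast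
 let ?A = "{N..<N + Suc n} - {N + j}"
 have "insert (N + j) ?A = {N..<N + Suc n}" using assms by auto
 hence kv: "LR.kvanish (insert (N + j) ?A) (%i. f (i - N)) (%i. fdeg (i - N)) 0" using N by simp
 have fin: "finite ?A" "N + j ~: ?A" by auto
 have z: "f (N + j - N) * 1 = (SUM i:?A. 0 * f (i - N))" using constant_zero[OF assms dj] by simp
 obtain t where t: "1 = (SUM i:?A. t i * f (i - N))" "!!i. i : ?A ==> t i : LR (0 - fdeg (i - N))"
  using LR.kvanish_nonzerodivisor[OF fin kv LR.R_one z] by (metis LR.R_zero)
 have "t i * f (i - N) = 0" if i: "i : ?A" for i
 proof (cases "d (i - N) = 0")
  case True
  hence "i - N ~= 0" using d0 by auto
  hence "i - N : {1..n}" using i by auto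
  thus ?thesis using constant_zero True by simp
 next
  case False
  thus ?thesis using t(2)[OF i] LR.R_neg[of "0 - fdeg (i - N)"] by auto
 qed
 hence "(1 :: 'g \<Rightarrow>\<^sub>0 complex) = 0" using t(1) by simp
 thus False by simp
qed

lemma gid_shift:
 assumes "r : LR.gid {Suc N..<N + Suc k} (%i. f (i - N)) (%i. fdeg (i - N)) m"
 shows "r : Fid k m"
proof-
 obtain t where t: "ALL i:{Suc N..<N + Suc k}. t i : LR (m - fdeg (i - N))"
  "r = (SUM i:{Suc N..<N + Suc k}. t i * f (i - N))" using assms unfolding LR.gid_def by (elim CollectE exE conjE)
 have "r = (SUM j:{1..k}. t (j + N) * f j)" unfolding t(2) by (rule sum.reindex_bij_witness[of _ "%j. j + N" "%i. i - N"]) auto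
 moreover have "t (j + N) : LR (m - fdeg j)" if "j : {1..k}" for j using bspec[OF t(1), of "j + N"] that by simp
 ultimately show ?thesis unfolding LR.gid_def by (intro CollectI exI[of _ "%j. t (j + N)"]) simp
qed

lemma gid_unshift:
 assumes "r : Fid k m"
 obtains t where "!!i. i : {Suc N..<N + Suc k} ==> t i : LR (m - fdeg (i - N))"
  "r = (SUM i:{Suc N..<N + Suc k}. t i * f (i - N))"
proof-
 obtain t where t: "ALL j:{1..k}. t j : LR (m - fdeg j)" "r = (SUM j:{1..k}. t j * f j)"
  using assms unfolding LR.gid_def by (elim CollectE exE conjE)
 have "r = (SUM i:{Suc N..<N + Suc k}. t (i - N) * f (i - N))"
  unfolding t(2) by (rule sum.reindex_bij_witness[of _ "%i. i - N" "%j. j + N"]) auto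
 moreover have "t (i - N) : LR (m - fdeg (i - N))" if "i : {Suc N..<N + Suc k}" for i
 proof-
  have "i - N : {1..k}" using that by (simp, linarith)
  thus ?thesis using t(1) by blast
 qed
 ultimately show ?thesis using that[of "%i. t (i - N)"] by blast
qed

text \<open>Graded Nakayama drops \<open>f 0\<close> and then the last parameters one after the
  other, which needs their degrees to be positive. \<open>N\<close> is the offset left over from the
  monomials.\<close>

lemma kvanish_initial:
 "EX N. LR.kvanish {N..<N + Suc n} (%i. f (i - N)) (%i. fdeg (i - N)) 0 &
   (ALL k<=n. LR.kvanish {Suc N..<N + Suc k} (%i. f (i - N)) (%i. fdeg (i - N)) 0)"
proof-
 obtain N where N: "LR.kvanish {N..<N + Suc n} (%i. f (i - N)) (%i. fdeg (i - N)) 0" using kvanish_parameters by blast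
 have "insert N {Suc N..<N + Suc n} = {N..<N + Suc n}" by auto
 hence kv: "LR.kvanish (insert N {Suc N..<N + Suc n}) (%i. f (i - N)) (%i. fdeg (i - N)) 0" using N by simp
 have start: "LR.kvanish {Suc N..<N + Suc n} (%i. f (i - N)) (%i. fdeg (i - N)) 0"
  by (rule LR.kvanish_descend[OF _ _ kv]) (use f[of 0] d0 in auto)
 have "m <= n ==> LR.kvanish {Suc N..<N + Suc (n - m)} (%i. f (i - N)) (%i. fdeg (i - N)) 0" for m
 proof (induction m)
  case 0
  thus ?case using start by simp
 next
  case (Suc m)
  let ?b = "N + (n - m)"
  have e: "insert ?b {Suc N..<N + Suc (n - Suc m)} = {Suc N..<N + Suc (n - m)}" using Suc.prems by auto
  have kv: "LR.kvanish (insert ?b {Suc N..<N + Suc (n - Suc m)}) (%i. f (i - N)) (%i. fdeg (i - N)) 0" using Suc unfolding e by simp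
  show ?case by (rule LR.kvanish_descend[OF _ _ kv]) (use Suc.prems f[of "n - m"] fdeg_pos[of "n - m"] in auto)
 qed
 hence "ALL k<=n. LR.kvanish {Suc N..<N + Suc k} (%i. f (i - N)) (%i. fdeg (i - N)) 0" by (metis diff_diff_cancel diff_le_self)
 thus ?thesis using N by blast
qed

theorem regular:
 assumes "k < n" "r : LR m" "f (Suc k) * r : Fid k (m + fdeg (Suc k))"
 shows "r : Fid k m"
proof-
 obtain N where N: "ALL k<=n. LR.kvanish {Suc N..<N + Suc k} (%i. f (i - N)) (%i. fdeg (i - N)) 0" using kvanish_initial by blast
 have e: "insert (N + Suc k) {Suc N..<N + Suc k} = {Suc N..<N + Suc (Suc k)}" by auto
 have kv: "LR.kvanish (insert (N + Suc k) {Suc N..<N + Suc k}) (%i. f (i - N)) (%i. fdeg (i - N)) 0"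
  unfolding e using N[rule_format, of "Suc k"] assms(1) by simp
 obtain t where t: "!!i. i : {Suc N..<N + Suc k} ==> t i : LR (m + fdeg (Suc k) - fdeg (i - N))"
  "f (Suc k) * r = (SUM i:{Suc N..<N + Suc k}. t i * f (i - N))" using gid_unshift[OF assms(3)] by blast
 have t2: "f (N + Suc k - N) * r = (SUM i:{Suc N..<N + Suc k}. t i * f (i - N))" using t(2) by simp
 have t1: "t i : LR (m + fdeg (N + Suc k - N) - fdeg (i - N))" if "i : {Suc N..<N + Suc k}" for i using t(1)[OF that] by simp
 obtain s where "r = (SUM i:{Suc N..<N + Suc k}. s i * f (i - N))"
   "!!i. i : {Suc N..<N + Suc k} ==> s i : LR (m - fdeg (i - N))" using LR.kvanish_nonzerodivisor[OF _ _ kv assms(2) t2 t1] by auto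
 hence "r : LR.gid {Suc N..<N + Suc k} (%i. f (i - N)) (%i. fdeg (i - N)) m" unfolding LR.gid_def by (intro CollectI exI[of _ s]) simp
 thus ?thesis by (rule gid_shift)
qed

theorem regular_0:
 assumes "r : LR m" "f 0 * r : Fid n (m + 1)"
 shows "r : Fid n m"
proof-
 obtain N where N: "LR.kvanish {N..<N + Suc n} (%i. f (i - N)) (%i. fdeg (i - N)) 0" using kvanish_initial by blast
 have e: "insert N {Suc N..<N + Suc n} = {N..<N + Suc n}" by auto
 have kv: "LR.kvanish (insert N {Suc N..<N + Suc n}) (%i. f (i - N)) (%i. fdeg (i - N)) 0" unfolding e using N by simp
 obtain t where t: "!!i. i : {Suc N..<N + Suc n} ==> t i : LR (m + 1 - fdeg (i - N))"
  "f 0 * r = (SUM i:{Suc N..<N + Suc n}. t i * f (i - N))" using gid_unshift[OF assms(2)] by blast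
 have t2: "f (N - N) * r = (SUM i:{Suc N..<N + Suc n}. t i * f (i - N))" using t(2) by simp
 have t1: "t i : LR (m + fdeg (N - N) - fdeg (i - N))" if "i : {Suc N..<N + Suc n}" for i using t(1)[OF that] d0 by simp
 obtain s where "r = (SUM i:{Suc N..<N + Suc n}. s i * f (i - N))"
   "!!i. i : {Suc N..<N + Suc n} ==> s i : LR (m - fdeg (i - N))" using LR.kvanish_nonzerodivisor[OF _ _ kv assms(1) t2 t1] by auto
 hence "r : LR.gid {Suc N..<N + Suc n} (%i. f (i - N)) (%i. fdeg (i - N)) m" unfolding LR.gid_def by (intro CollectI exI[of _ s]) simp
 thus ?thesis by (rule gid_shift)
qed

lemma regular_0_power:
 assumes "r : LR m" "f 0 ^ k * r : Fid n (m + int k)"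
 shows "r : Fid n m"
 using assms
proof (induction k arbitrary: m r)
 case (Suc k)
 have f0: "f 0 : LR 1" using f[of 0] d0 by simp
 have "f 0 * r : LR (m + 1)" using LR.R_mult[OF f0 Suc.prems(1)] by (simp add: add.commute)
 moreover have "f 0 ^ k * (f 0 * r) : Fid n (m + 1 + int k)" using Suc.prems(2) by (simp add: mult_ac add_ac)
 ultimately show ?case using Suc.IH Suc.prems(1) regular_0 by blast
qed simp

lemma cst_LR: "cst c : LR 0"
 using submon_L by (intro LR_single) (auto simp: submon_def deg_0)

lemma LR_subspace: "pv.subspace (LR m)"
 unfolding pv.subspace_def using LR.R_add LR.R_mult'[OF cst_LR] by (auto simp: pscale_cst)

lemma Fid_subspace: "pv.subspace (Fid k m)"
proof (rule pv.subspaceI)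
 show "pscale c r : Fid k m" if "r : Fid k m" for c r using LR.gid_mult'[OF cst_LR that, of m c] by (simp add: pscale_cst)
qed (rule LR.gid_0, rule LR.gid_add)

lemma Fid_subset: "k <= n ==> Fid k m <= LR m"
 using f by (intro LR.gid_subset) auto

lemma LR_basis: "pv.qbasis (LR m) {0} ((%w. msing w (1::complex)) ` {w : L. deg w = m})"
proof-
 let ?W = "{w : L. deg w = m}"
 have fin: "finite ?W" by (rule finite_L_deg)
 have s: "(SUM b:(%w. msing w (1::complex)) ` ?W. pscale (r b) b) = (SUM w:?W. msing w (r (msing w 1)))"
  for r :: "('g \<Rightarrow>\<^sub>0 complex) => complex"
  by (subst sum.reindex) (auto intro: inj_on_subset[OF msing_one_inj] simp: pscale_cst mult_single)
 show ?thesis unfolding pv.qbasis_def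
 proof (intro conjI)
  show "finite ((%w. msing w (1::complex)) ` ?W)" using fin by simp
  show "(%w. msing w (1::complex)) ` ?W <= LR m" by (auto intro: LR_single)
  show "pv.qindep {0} ((%w. msing w (1::complex)) ` ?W)" unfolding pv.qindep_def s
  proof (intro allI impI ballI)
   fix r :: "('g \<Rightarrow>\<^sub>0 complex) => complex" and b assume z: "(SUM w:?W. msing w (r (msing w 1))) : {0}" and "b : (%w. msing w (1::complex)) ` ?W"
   then obtain w where w: "w : ?W" "b = msing w 1" by blast
   have "lkp (SUM w:?W. msing w (r (msing w 1))) w = r b" using fin w by (simp add: lookup_sum lookup_single when_def)
   thus "r b = 0" using z by simp
  qed
  show "pv.qspans {0} (LR m) ((%w. msing w (1::complex)) ` ?W)" unfolding pv.qspans_def s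
  proof
   fix r assume r: "r : LR m"
   define c where "c b = lkp r (the_elem (pkeys b))" for b :: "'g \<Rightarrow>\<^sub>0 complex"
   have "(SUM w:?W. msing w (c (msing w 1))) = (SUM w:?W. msing w (lkp r w))" by (intro sum.cong) (auto simp: c_def)
   also have "... = (SUM w:pkeys r. msing w (lkp r w))" using r fin by (intro sum.mono_neutral_right) (auto simp: LR_def in_keys_iff)
   also have "... = r" by (rule pm_sum_single[symmetric])
   finally show "EX c :: ('g \<Rightarrow>\<^sub>0 complex) => complex. r - (SUM w:?W. msing w (c (msing w 1))) : {0}" by (intro exI[of _ c]) simp
  qed
 qed
qed

lemma sub_qbasis_exists:
 assumes "U <= LR m" "pv.subspace W"
 shows "EX B. pv.qbasis U W B"
proof-
 have z: "pv.subspace {0}" by (rule pv.subspace_single_0)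
 have b: "finite ((%w. msing w (1::complex)) ` {w : L. deg w = m})" "pv.qspans {0} (LR m) ((%w. msing w (1::complex)) ` {w : L. deg w = m})"
  using LR_basis[of m] unfolding pv.qbasis_def by simp_all
 have "{0} <= W" using pv.subspace_0[OF assms(2)] by simp
 from pv.qbasis_sub[OF assms(2) z this assms(1) b] show ?thesis by blast
qed

definition hf :: "nat => int => int" where
 "hf k m = int (card (SOME B. pv.qbasis (LR m) (Fid k m) B))"

lemma hf_basis:
 obtains B where "pv.qbasis (LR m) (Fid k m) B" "hf k m = int (card B)"
proof (rule that)
 show "pv.qbasis (LR m) (Fid k m) (SOME B. pv.qbasis (LR m) (Fid k m) B)"
  using sub_qbasis_exists[OF order_refl Fid_subspace] by (rule someI_ex)
qed (rule hf_def)

lemma hf_eq: "pv.qbasis (LR m) (Fid k m) B ==> hf k m = int (card B)"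
 using hf_basis[of m k] pv.qbasis_card_unique[OF Fid_subspace] by metis

lemma hf_0: "hf 0 m = int (card {w : L. deg w = m})"
proof-
 have "Fid 0 m = {0}" by (auto simp: LR.gid_def)
 hence "hf 0 m = int (card ((%w. msing w (1::complex)) ` {w : L. deg w = m}))" using LR_basis by (intro hf_eq) simp
 also have "card ((%w. msing w (1::complex)) ` {w : L. deg w = m}) = card {w : L. deg w = m}"
  by (intro card_image inj_on_subset[OF msing_one_inj]) simp
 finally show ?thesis .
qed

lemma Fid_Suc_subset: "Fid k m <= Fid (Suc k) m"
proof
 fix r assume "r : Fid k m"
 then obtain t where t: "ALL j:{1..k}. t j : LR (m - fdeg j)" "r = (SUM j:{1..k}. t j * f j)"
  unfolding LR.gid_def by (elim CollectE exE conjE)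
 show "r : Fid (Suc k) m" unfolding LR.gid_def
 proof (intro CollectI exI[of _ "t(Suc k := 0)"] conjI ballI)
  show "(t(Suc k := 0)) j : LR (m - fdeg j)" if "j : {1..Suc k}" for j using t(1) that by auto
  have "(SUM j:{1..k}. (t(Suc k := 0)) j * f j) = (SUM j:{1..k}. t j * f j)" by (intro sum.cong) auto
  thus "r = (SUM j:{1..Suc k}. (t(Suc k := 0)) j * f j)" unfolding t(2) by simp
 qed
qed

text \<open>Multiplication by the next parameter is injective modulo the previous ones, and its
  image modulo them is the next ideal; the two quotients fit into a short exact sequence.\<close>

lemma hf_Suc:
 assumes k: "k < n"
 shows "hf (Suc k) m = hf k m - hf k (m - fdeg (Suc k))"
proof-
 let ?m = "m - fdeg (Suc k)"
 have fk: "f (Suc k) : LR (fdeg (Suc k))" using f k by simp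
 obtain B1 where B1: "pv.qbasis (LR m) (Fid (Suc k) m) B1" "hf (Suc k) m = int (card B1)" by (rule hf_basis)
 obtain B2 where B2: "pv.qbasis (LR ?m) (Fid k ?m) B2" "hf k ?m = int (card B2)" by (rule hf_basis)
 have Fk: "f (Suc k) * v : Fid (Suc k) m" if v: "v : LR ?m" for v unfolding LR.gid_def
 proof (intro CollectI exI[of _ "%j. if j = Suc k then v else 0"] conjI ballI)
  show "(if j = Suc k then v else 0) : LR (m - fdeg j)" for j using v by simp
  have "(SUM j:{1..Suc k}. (if j = Suc k then v else 0) * f j) = (SUM j:{1..Suc k}. if j = Suc k then v * f j else 0)"
   by (intro sum.cong) auto
  thus "f (Suc k) * v = (SUM j:{1..Suc k}. (if j = Suc k then v else 0) * f j)" by (simp add: mult.commute)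
 qed
 have surj: "EX v:LR ?m. v' - f (Suc k) * v : Fid k m" if v': "v' : Fid (Suc k) m" for v'
 proof-
  obtain t where t: "ALL j:{1..Suc k}. t j : LR (m - fdeg j)" "v' = (SUM j:{1..Suc k}. t j * f j)"
   using v' unfolding LR.gid_def by (elim CollectE exE conjE)
  have "v' - f (Suc k) * t (Suc k) = (SUM j:{1..k}. t j * f j)" unfolding t(2) by (simp add: mult.commute)
  hence "v' - f (Suc k) * t (Suc k) : Fid k m" unfolding LR.gid_def using t(1) by (intro CollectI exI[of _ t]) simp
  thus ?thesis using t(1) by (intro bexI[of _ "t (Suc k)"]) auto
 qed
 have iff: "f (Suc k) * v : Fid k m <-> v : Fid k ?m" if v: "v : LR ?m" for v
 proof
  assume "f (Suc k) * v : Fid k m"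
  thus "v : Fid k ?m" using regular[OF k v] by simp
 next
  assume "v : Fid k ?m"
  thus "f (Suc k) * v : Fid k m" using fk by (intro LR.gid_mult'[OF fk]) auto
 qed
 have qs: "qspace (pscale :: complex => ('g \<Rightarrow>\<^sub>0 complex) => _)" ..
 note tr = qbasis_transfer[OF qs qs Fid_subspace[of k m] B2(1), of "%v. f (Suc k) * v" "Fid (Suc k) m",
   OF distrib_left pscale_mult[symmetric] Fk LR_subspace iff surj]
 have "pv.qbasis (LR m) (Fid k m) (B1 Un (%v. f (Suc k) * v) ` B2)" "B1 Int (%v. f (Suc k) * v) ` B2 = {}"
  using pv.qbasis_trans[OF Fid_subspace Fid_subspace Fid_Suc_subset B1(1) tr(1)] Fid_subset[of "Suc k"] k by auto
 hence "hf k m = int (card (B1 Un (%v. f (Suc k) * v) ` B2))"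
  and "card (B1 Un (%v. f (Suc k) * v) ` B2) = card B1 + card ((%v. f (Suc k) * v) ` B2)"
  using B1(1) tr(1) by (auto intro!: hf_eq card_Un_disjoint simp: pv.qbasis_def)
 thus ?thesis using tr(2) B1(2) B2(2) by simp
qed

text \<open>The Hilbert function of the ring has degree at most -c and pole order n + 1. The n
  parameters leave pole order 1 and raise the degree to the sum of the \<open>d j\<close> minus
  c.\<close>

theorem hf_constant:
 assumes c: "!!w. (!!i. i : I ==> ell i (emb w) > 0) ==> deg w >= c"
  and m: "(SUM j=1..n. fdeg j) - c < m" "m <= m'"
 shows "hf n m' = hf n m"
proof-
 obtain h xx where tr: "tricone L deg emb Gs I ell dgl h xx" using triangulation_exists[OF cnt] by blast
 interpret T: tricone L deg emb Gs I ell dgl h xx by (rule tr)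
 have h0: "recurrent (Suc n) (- c) (hf 0)" unfolding ext[of "hf 0", OF hf_0] using T.hilbert_recurrent[OF c] dim by simp
 have "k <= n ==> recurrent (Suc n - k) (- c + (SUM j=1..k. fdeg j)) (hf k)" for k
 proof (induction k)
  case 0
  thus ?case using h0 by simp
 next
  case (Suc k)
  hence "recurrent (Suc (Suc n - Suc k)) (- c + (SUM j=1..k. fdeg j)) (hf k)" by (simp add: Suc_diff_le)
  from recurrent_diff[OF this, of "d (Suc k)"]
  have "recurrent (Suc n - Suc k) (- c + (SUM j=1..k. fdeg j) + fdeg (Suc k)) (%m. hf k m - hf k (m - fdeg (Suc k)))" .
  moreover have "hf (Suc k) = (%m. hf k m - hf k (m - fdeg (Suc k)))" using hf_Suc[of k] Suc.prems by auto
  moreover have "- c + (SUM j=1..Suc k. fdeg j) = - c + (SUM j=1..k. fdeg j) + fdeg (Suc k)" by simp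
  ultimately show ?case by (simp only:)
 qed
 from this[of n] have "recurrent 1 (- c + (SUM j=1..n. fdeg j)) (hf n)" by simp
 from recurrent_one[OF this _ m(2)] m(1) show ?thesis by simp
qed

end

section \<open>Rational fans\<close>

lemma rv_add: "rv (v + w) = rv v + rv w"
 by (simp add: rv_def vec_eq_iff)

lemma rv_scale: "rv (k *s v) = real_of_int k \<cdot> rv v"
 by (simp add: rv_def vec_eq_iff)

lemma rv_0 [simp]: "rv 0 = 0"
 by (simp add: rv_def vec_eq_iff)

lemma rv_minus: "rv (- v) = - rv v"
 by (simp add: rv_def vec_eq_iff)

lemma rv_diff: "rv (v - w) = rv v - rv w"
 by (simp add: rv_def vec_eq_iff)

lemma rv_inj [simp]: "rv v = rv w <-> v = w"
 by (simp add: rv_def vec_eq_iff)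

lemma rv_eq_0 [simp]: "rv v = 0 <-> v = 0"
 using rv_inj[of v 0] by simp

lemma inner_rv: "rv v \<bullet> rv m = real_of_int (pairing v m)"
 by (simp add: inner_vec_def rv_def pairing_def)

lemma pairing_add_right: "pairing v (m + m') = pairing v m + pairing v m'"
 by (simp add: pairing_def distrib_left sum.distrib)

lemma pairing_scale_right: "pairing v (k *s m) = k * pairing v m"
 by (simp add: pairing_def sum_distrib_left algebra_simps)

lemma pairing_scale_left: "pairing (k *s v) m = k * pairing v m"
 by (simp add: pairing_def sum_distrib_left algebra_simps)

lemma pairing_diff_left: "pairing (v - w) m = pairing v m - pairing w m"
 by (simp add: pairing_def left_diff_distrib sum_subtractf)

lemma pairing_minus_left: "pairing (- v) m = - pairing v m"
 by (simp add: pairing_def sum_negf)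

lemma pairing_minus_right: "pairing v (- m) = - pairing v m"
 by (simp add: pairing_def sum_negf)

lemma pairing_diff_right: "pairing v (m - m') = pairing v m - pairing v m'"
 by (simp add: pairing_def right_diff_distrib sum_subtractf)

lemma pairing_0_right [simp]: "pairing v 0 = 0"
 by (simp add: pairing_def)

lemma pairing_axis: "pairing v (axis k t) = v $ k * t"
proof-
 have "pairing v (axis k t) = (SUM i:UNIV. if i = k then v $ i * t else 0)" unfolding pairing_def by (intro sum.cong) (auto simp: axis_def)
 thus ?thesis by simp
qed

text \<open>Rational linear systems with real solutions have integer solutions, by elimination of the equations.\<close>

lemma integer_solution_strict:
 fixes B :: "(int ^ 'n) set"
 assumes "finite B" "!!b. b : B ==> rv b \<bullet> x > 0"
 shows "EX m. ALL b:B. pairing b m > 0"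
proof-
 define e where "e b = (SUM i:UNIV. \<bar>real_of_int (b $ i)\<bar>)" for b :: "int ^ 'n"
 have "ALL b:B. EX N::nat. real N * (rv b \<bullet> x) > e b" using assms(2) reals_Archimedean3 by blast
 then obtain Nf where Nf: "!!b. b : B ==> real (Nf b) * (rv b \<bullet> x) > e b" by metis
 define N where "N = (SUM b:B. Nf b)"
 \<comment> \<open>Rounding down changes the pairing with b by at most \<open>e b\<close>, which the
   multiple N of x exceeds.\<close>
 define m where "m = (\<chi> i. \<lfloor>real N * (x $ i)\<rfloor>)"
 have "pairing b m > 0" if b: "b : B" for b
 proof-
  have "Nf b <= N" unfolding N_def using assms(1) b by (intro member_le_sum) auto
  hence "real (Nf b) * (rv b \<bullet> x) <= real N * (rv b \<bullet> x)" using assms(2)[OF b] by (intro mult_right_mono) auto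
  hence gt: "real N * (rv b \<bullet> x) > e b" using Nf[OF b] by linarith
  have "real N * (rv b \<bullet> x) - real_of_int (pairing b m) =
    (SUM i:UNIV. real_of_int (b $ i) * (real N * (x $ i) - real_of_int \<lfloor>real N * (x $ i)\<rfloor>))"
   by (simp add: inner_vec_def rv_def pairing_def m_def sum_distrib_left right_diff_distrib
     sum_subtractf algebra_simps)
  also have "... <= e b" unfolding e_def
  proof (rule sum_mono)
   fix i
   let ?t = "real N * (x $ i) - real_of_int \<lfloor>real N * (x $ i)\<rfloor>"
   have "\<bar>?t\<bar> <= 1" by linarith
   hence "\<bar>real_of_int (b $ i)\<bar> * \<bar>?t\<bar> <= \<bar>real_of_int (b $ i)\<bar>" by (simp add: mult_left_le)
   thus "real_of_int (b $ i) * ?t <= \<bar>real_of_int (b $ i)\<bar>" by (metis abs_le_D1 abs_mult)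
  qed
  finally have "real_of_int (pairing b m) > 0" using gt by linarith
  thus ?thesis by simp
 qed
 thus ?thesis by blast
qed

lemma integer_solution:
 fixes A B :: "(int ^ 'n) set"
 assumes "finite A" "finite B" "!!a. a : A ==> rv a \<bullet> x = 0" "!!b. b : B ==> rv b \<bullet> x > 0"
 shows "EX m. (ALL a:A. pairing a m = 0) & (ALL b:B. pairing b m > 0)"
 using assms
proof (induction "card A" arbitrary: A B rule: less_induct)
 case less
 show ?case
 proof (cases "EX a:A. a ~= 0")
  case False
  hence "ALL a:A. pairing a m = 0" for m by (auto simp: pairing_def)
  thus ?thesis using integer_solution_strict[OF less.prems(2,4)] by blast
 next
  case True
  then obtain a0 where a0: "a0 : A" "a0 ~= 0" by blast
  then obtain k where k: "a0 $ k ~= 0" by (auto simp: vec_eq_iff)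
  define a where "a = (if a0 $ k > 0 then a0 else - a0)"
  have a: "a $ k > 0" "rv a \<bullet> x = 0" using k less.prems(3)[OF a0(1)] by (auto simp: a_def rv_minus)
  \<comment> \<open>Elimination of coordinate k with the pivot row a. As a annihilates x and
    \<open>a $ k > 0\<close>, signs at x are preserved.\<close>
  define ph where "ph v = (a $ k) *s v - (v $ k) *s a" for v
  have x: "rv (ph v) \<bullet> x = real_of_int (a $ k) * (rv v \<bullet> x)" for v
   using a(2) by (simp add: ph_def rv_diff rv_scale inner_diff_left)
  have "card (ph ` (A - {a0})) <= card (A - {a0})" using less.prems(1) by (intro card_image_le) auto
  also have "... < card A" using a0(1) less.prems(1) by (intro card_Diff1_less)
  finally have lt: "card (ph ` (A - {a0})) < card A" .
  obtain m where m: "!!v. v : A - {a0} ==> pairing (ph v) m = 0" "!!v. v : B ==> pairing (ph v) m > 0"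
  proof-
   have "EX m. (ALL a:ph ` (A - {a0}). pairing a m = 0) & (ALL b:ph ` B. pairing b m > 0)"
   proof (rule less.hyps[OF lt])
    show "rv v \<bullet> x = 0" if "v : ph ` (A - {a0})" for v using that less.prems(3) by (auto simp: x)
    show "0 < rv v \<bullet> x" if "v : ph ` B" for v using that less.prems(4) a(1) by (auto simp: x)
   qed (use less.prems in auto)
   thus ?thesis using that by blast
  qed
  \<comment> \<open>Back substitution: coordinate k is corrected so that a annihilates m', after
    clearing the denominator \<open>a $ k\<close>.\<close>
  define m' where "m' = (a $ k) *s m + axis k (- pairing a m)"
  have pm: "pairing v m' = (a $ k) * pairing v m - v $ k * pairing a m" for v
   by (simp add: m'_def pairing_add_right pairing_scale_right pairing_axis)
  hence v: "pairing v m' = pairing (ph v) m" for v by (simp add: ph_def pairing_diff_left pairing_scale_left)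
  have "pairing a m' = 0" by (simp add: pm)
  hence "pairing a0 m' = 0" by (auto simp: a_def pairing_minus_left split: if_splits)
  hence "ALL v:A. pairing v m' = 0" using m(1) v by (metis DiffI singletonD)
  moreover have "ALL v:B. pairing v m' > 0" using m(2) v by simp
  ultimately show ?thesis by blast
 qed
qed

lemma convex_cone_hull_finite_iff:
 fixes S :: "'e::real_vector set"
 assumes "finite S"
 shows "x : convex_cone hull S <-> (EX l. (ALL s:S. l s >= 0) & x = (SUM s:S. l s \<cdot> s))"
proof
 let ?C = "{x. EX l. (ALL s:S. l s >= 0) & x = (SUM s:S. l s \<cdot> s)}"
 have "convex_cone ?C" unfolding convex_cone_iff
 proof (intro conjI ballI allI impI)
  show "0 : ?C" by (auto intro!: exI[of _ "%_. 0"])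
  fix x y assume "x : ?C" "y : ?C"
  then obtain l l' where "ALL s:S. l s >= 0" "x = (SUM s:S. l s \<cdot> s)" "ALL s:S. l' s >= 0" "y = (SUM s:S. l' s \<cdot> s)" by blast
  thus "x + y : ?C" by (intro CollectI exI[of _ "%s. l s + l' s"]) (auto simp: scaleR_left_distrib sum.distrib)
 next
  fix x and c :: real assume "x : ?C" "0 <= c"
  then obtain l where "ALL s:S. l s >= 0" "x = (SUM s:S. l s \<cdot> s)" by blast
  thus "c \<cdot> x : ?C" using `0 <= c` by (intro CollectI exI[of _ "%s. c * l s"]) (auto simp: scaleR_sum_right)
 qed
 moreover have "S <= ?C"
 proof
  fix s0 assume s0: "s0 : S"
  have "(SUM s:S. (if s = s0 then 1 else 0) \<cdot> s) = (SUM s:S. if s = s0 then s else 0)" by (intro sum.cong) auto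
  hence "s0 = (SUM s:S. (if s = s0 then 1 else 0) \<cdot> s)" using s0 assms by simp
  thus "s0 : ?C" by (intro CollectI exI[of _ "%s. if s = s0 then 1 else 0"]) simp
 qed
 ultimately have "convex_cone hull S <= ?C" by (intro hull_minimal) auto
 thus "x : convex_cone hull S ==> EX l. (ALL s:S. l s >= 0) & x = (SUM s:S. l s \<cdot> s)" by blast
next
 assume "EX l. (ALL s:S. l s >= 0) & x = (SUM s:S. l s \<cdot> s)"
 then obtain l where l: "ALL s:S. l s >= 0" "x = (SUM s:S. l s \<cdot> s)" by blast
 have "(SUM s:T. l s \<cdot> s) : convex_cone hull S" if "T <= S" for T using finite_subset[OF that assms] that
 proof (induction T rule: finite_induct)
  case empty
  thus ?case by (simp add: convex_cone_hull_contains_0)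
 next
  case (insert s T)
  thus ?case using l(1) convex_cone_hull_add[OF convex_cone_hull_mul[OF hull_inc[of s S convex_cone], of "l s"]] by auto
 qed
 thus "x : convex_cone hull S" using l(2) by blast
qed

section \<open>Cones, rays and faces of a complete fan\<close>

locale ctfan =
 fixes Sg :: "(real ^ 'n) set set" and u :: "'k::finite => int ^ 'n"
 assumes cf: "complete_fan Sg" and rg: "ray_generators Sg u"
begin

lemma fan: "fan Sg" and covers: "EX si:Sg. x : si"
 using cf by (auto simp: complete_fan_def)

lemma finite_fan: "finite Sg"
 using fan by (simp add: fan_def)

lemma cone_rational: "si : Sg ==> rational_polyhedral_cone si"
 and cone_pointed: "si : Sg ==> strongly_convex si"
 and face_mem: "si : Sg ==> ta face_of si ==> ta ~= {} ==> ta : Sg"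
 and inter_face: "si : Sg ==> ta : Sg ==> (si Int ta) face_of si" using fan unfolding fan_def by blast+

lemma cone_hull:
 assumes "si : Sg"
 obtains G where "finite G" "si = convex_cone hull (rv ` G)" using cone_rational[OF assms] by (auto simp: rational_polyhedral_cone_def)

lemma cone_convex_cone: "si : Sg ==> convex_cone si"
 by (metis cone_hull convex_cone_convex_cone_hull)

lemma cone_polyhedron: "si : Sg ==> polyhedron si"
 by (metis cone_hull polyhedron_convex_cone_hull finite_imageI)

lemma cone_closed: "si : Sg ==> closed si"
 using cone_polyhedron polyhedron_imp_closed by blast

lemma cone_add: "si : Sg ==> x : si ==> y : si ==> x + y : si"
 and cone_scale: "si : Sg ==> x : si ==> 0 <= t ==> t \<cdot> x : si"
 and cone_0: "si : Sg ==> 0 : si" using cone_convex_cone by (auto simp: convex_cone_iff)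

lemma cone_convex: "si : Sg ==> convex si"
 using cone_convex_cone by (auto simp: convex_cone_def)

lemma cone_sum: "si : Sg ==> (!!i. i : A ==> f i : si) ==> sum f A : si"
 by (induction A rule: infinite_finite_induct) (auto intro: cone_add cone_0)

lemma cone_antisym: "si : Sg ==> x : si ==> - x : si ==> x = 0"
proof-
 assume "si : Sg" "x : si" "- x : si"
 hence "x : si Int uminus ` si" by (auto intro: image_eqI[of _ _ "- x"])
 thus ?thesis using cone_pointed[OF `si : Sg`] by (auto simp: strongly_convex_def)
qed

lemma cone_sum_zero: "si : Sg ==> x : si ==> y : si ==> x + y = 0 ==> x = 0"
 using cone_antisym[of si x] by (simp add: add_eq_0_iff2 add_eq_0_iff)

lemma primitive_ray:
 assumes "rh : rays Sg"
 obtains i where "primitive_generator (u i) rh"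
proof-
 have rh: "rh : Sg" "aff_dim rh = 1" using assms by (auto simp: rays_def)
 obtain G where G: "finite G" "rh = convex_cone hull (rv ` G)" using cone_hull[OF rh(1)] .
 have "~ G <= {0}"
 proof
  assume "G <= {0}"
  hence "rv ` G <= {0}" by auto
  hence "rh <= {0}" unfolding G(2) by (intro hull_minimal) (auto simp: convex_cone_singleton)
  hence "aff_dim rh <= aff_dim {0::real^'n}" by (rule aff_dim_subset)
  thus False using rh(2) by simp
 qed
 then obtain g where g: "g : G" "g ~= 0" by auto
 have gr: "rv g : rh" unfolding G(2) using g(1) by (intro hull_inc) auto
 have line: "EX t>=0. x = t \<cdot> rv g" if x: "x : rh" for x
 proof-
  have "int (dim rh) = 1" using aff_dim_zero[of rh] hull_inc[OF cone_0[OF rh(1)]] rh(2) by metis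
  hence d: "dim rh = 1" by simp
  have "independent {rv g}" using g(2) by simp
  hence "rh <= span {rv g}" using card_eq_dim[of "{rv g}" rh] gr d by auto
  then obtain t where t: "x = t \<cdot> rv g" using x by (auto simp: span_singleton)
  have "t >= 0"
  proof (rule ccontr)
   assume "~ t >= 0"
   hence "(1 / (- t)) \<cdot> x : rh" using x rh(1) by (intro cone_scale) auto
   moreover have "(1 / (- t)) \<cdot> x = - rv g" using `~ t >= 0` t by simp
   ultimately show False using cone_antisym[OF rh(1) gr] g(2) by simp
  qed
  thus ?thesis using t by blast
 qed
 \<comment> \<open>The 1-norm is integral on the lattice and proportional to the parameter along the
   ray, so a shortest nonzero lattice vector exists.\<close>
 define nm where "nm v = nat (SUM i:UNIV. \<bar>v $ i\<bar>)" for v :: "int ^ 'n"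
 let ?P = "%v. v ~= 0 & rv v : rh"
 obtain v where v: "?P v" "!!w. ?P w ==> nm v <= nm w" using ex_has_least_nat[of ?P g nm] g(2) gr by auto
 obtain t0 where t0: "t0 >= 0" "rv v = t0 \<cdot> rv g" using line v(1) by blast
 have t0p: "t0 > 0" using t0 v(1) by (cases "t0 = 0") auto
 have nmt: "real (nm w) = t * real (nm g)" if "rv w = t \<cdot> rv g" "t >= 0" for w t
 proof-
  have c: "real_of_int (w $ i) = t * real_of_int (g $ i)" for i using arg_cong[OF that(1), of "%x. x $ i"] by (simp add: rv_def)
  have "real (nm w) = (SUM i:UNIV. \<bar>real_of_int (w $ i)\<bar>)" by (simp add: nm_def sum_nonneg)
  also have "... = t * (SUM i:UNIV. \<bar>real_of_int (g $ i)\<bar>)" using that(2) by (simp add: c abs_mult sum_distrib_left)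
  also have "... = t * real (nm g)" by (simp add: nm_def sum_nonneg)
  finally show ?thesis .
 qed
 have nmg: "real (nm g) > 0"
 proof-
  obtain i where "g $ i ~= 0" using g(2) by (auto simp: vec_eq_iff)
  hence "(SUM i:UNIV. \<bar>g $ i\<bar>) > 0" by (intro sum_pos2[of _ i]) auto
  hence "nm g > 0" unfolding nm_def by (subst zero_less_nat_eq)
  thus ?thesis by simp
 qed
 have "{w. rv w : rh} = {int l *s v | l :: nat. True}"
 proof (intro equalityI subsetI)
  fix w assume "w : {w. rv w : rh}"
  then obtain t where t: "t >= 0" "rv w = t \<cdot> rv g" using line by blast
  \<comment> \<open>Division with remainder by v: a nonzero remainder would be a shorter lattice
    vector on the ray.\<close>
  define l where "l = nat \<lfloor>t / t0\<rfloor>"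
  have l: "real l <= t / t0" "t / t0 < real l + 1" using t(1) t0p by (auto simp: l_def)
  let ?w = "w - int l *s v"
  have r: "rv ?w = (t - real l * t0) \<cdot> rv g" using t(2) t0(2) by (simp add: rv_diff rv_scale algebra_simps)
  have nn: "t - real l * t0 >= 0" and lt: "t - real l * t0 < t0" using l t0p by (simp_all add: field_simps)
  have "?w = 0"
  proof (rule ccontr)
   assume "?w ~= 0"
   moreover have "rv ?w : rh" unfolding r using nn gr rh(1) by (intro cone_scale)
   ultimately have "nm v <= nm ?w" by (intro v(2)) auto
   hence "t0 * real (nm g) <= (t - real l * t0) * real (nm g)" using nmt[OF t0(2,1)] nmt[OF r nn] by linarith
   thus False using lt nmg by simp
  qed
  thus "w : {int l *s v | l :: nat. True}" by auto
 next
  fix w assume "w : {int l *s v | l :: nat. True}"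
  then obtain l :: nat where "w = int l *s v" by blast
  thus "w : {w. rv w : rh}" using cone_scale[OF rh(1), of "rv v" "real l"] v(1) by (simp add: rv_scale)
 qed
 hence "primitive_generator v rh" by (simp add: primitive_generator_def)
 hence "v : range u" using rg assms unfolding ray_generators_def bij_betw_def by blast
 thus ?thesis using that `primitive_generator v rh` by blast
qed

lemma u_nonzero: "u i ~= 0"
proof
 assume z: "u i = 0"
 have "u i : {v. EX rh:rays Sg. primitive_generator v rh}" using rg unfolding ray_generators_def bij_betw_def by blast
 then obtain rh where rh: "rh : Sg" "aff_dim rh = 1" "primitive_generator 0 rh" using z by (auto simp: rays_def)
 obtain G where G: "finite G" "rh = convex_cone hull (rv ` G)" using cone_hull[OF rh(1)] .
 have "{w. rv w : rh} = {0}" using rh(3) by (auto simp: primitive_generator_def)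
 hence "G <= {0}" using G(2) hull_subset[of "rv ` G" convex_cone] by blast
 hence "rv ` G <= {0}" by auto
 hence "rh <= {0}" unfolding G(2) by (intro hull_minimal) (auto simp: convex_cone_singleton)
 hence "aff_dim rh <= aff_dim {0::real^'n}" by (rule aff_dim_subset)
 thus False using rh(2) by simp
qed

definition crays :: "(real ^ 'n) set => 'k set" where
 "crays si = {i. rv (u i) : si}"

text \<open>In a generating set of least cardinality every generator spans an extreme ray. That ray
  is a face, hence a ray of the fan, so it carries some \<open>u i\<close>.\<close>

lemma cone_generated:
 assumes si: "si : Sg" and x: "x : si"
 obtains l where "!!i. l i >= 0" "x = (SUM i:crays si. l i \<cdot> rv (u i))"
proof-
 let ?P = "%G. finite G & si = convex_cone hull (rv ` G)"
 obtain G0 where "?P G0" using cone_hull[OF si] by blast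
 then obtain G where G: "finite G" "si = convex_cone hull (rv ` G)"
  and min: "!!H. ?P H ==> card G <= card H" using ex_has_least_nat[of ?P G0 card] by blast
 have irr: "rv g ~: convex_cone hull (rv ` (G - {g}))" if g: "g : G" for g
 proof
  assume "rv g : convex_cone hull (rv ` (G - {g}))"
  hence "rv ` G <= convex_cone hull (rv ` (G - {g}))" by (auto intro: hull_inc)
  hence "si <= convex_cone hull (rv ` (G - {g}))" unfolding G(2) by (intro hull_minimal convex_cone_convex_cone_hull)
  moreover have "convex_cone hull (rv ` (G - {g})) <= si" unfolding G(2) by (intro hull_mono) auto
  ultimately have "card G <= card (G - {g})" using G(1) by (intro min) auto
  thus False using g G(1) by (metis card_Diff1_less not_le)
 qed
 have gen: "EX i t. rv (u i) : si & t >= 0 & rv g = t \<cdot> rv (u i)" if g: "g : G" for g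
 proof-
  let ?H = "convex_cone hull (rv ` (G - {g}))"
  let ?rh = "range (%t. \<bar>t\<bar> \<cdot> rv g)"
  have rhI: "t \<cdot> rv g : ?rh" if "t >= 0" for t using that by (intro image_eqI[of _ _ t]) auto
  have Hs: "?H <= si" unfolding G(2) by (intro hull_mono) auto
  have gsi: "rv g : si" unfolding G(2) using g by (intro hull_inc) auto
  have g0: "g ~= 0" using irr[OF g] convex_cone_hull_contains_0[of "rv ` (G - {g})"] by auto
  have dec: "EX al y. al >= 0 & y : ?H & z = al \<cdot> rv g + y" if z: "z : si" for z
  proof-
   obtain l where l: "ALL s:rv ` G. l s >= 0" "z = (SUM s:rv ` G. l s \<cdot> s)"
    using convex_cone_hull_finite_iff[of "rv ` G" z] G z by auto
   have im: "rv ` G = insert (rv g) (rv ` (G - {g}))" using g by auto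
   have "z = l (rv g) \<cdot> rv g + (SUM s:rv ` (G - {g}). l s \<cdot> s)" unfolding l(2) im using G(1) by (subst sum.insert) auto
   moreover have "(SUM s:rv ` (G - {g}). l s \<cdot> s) : ?H" using convex_cone_hull_finite_iff[of "rv ` (G - {g})"] G(1) l(1) by auto
   moreover have "l (rv g) >= 0" using l(1) g by auto
   ultimately show ?thesis by blast
  qed
  \<comment> \<open>Write a and b as multiples of g plus terms x', y' from the other generators,
    with x' + y' = s g. For s > 0 the generator g would be redundant; otherwise x' and a further
    element of the cone cancel, and pointedness gives x' = 0.\<close>
  have core: "a : ?rh" if ab: "a : si" "b : si" "a + b : ?rh" for a b
  proof-
   obtain al x' where a: "al >= 0" "x' : ?H" "a = al \<cdot> rv g + x'" using dec[OF ab(1)] by blast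
   obtain bb y' where b: "bb >= 0" "y' : ?H" "b = bb \<cdot> rv g + y'" using dec[OF ab(2)] by blast
   obtain t where t: "a + b = \<bar>t\<bar> \<cdot> rv g" using ab(3) by auto
   define s where "s = \<bar>t\<bar> - al - bb"
   have e: "x' + y' = s \<cdot> rv g" using t a(3) b(3) by (simp add: s_def algebra_simps)
   show ?thesis
   proof (cases "s > 0")
    case True
    have "(1 / s) \<cdot> (x' + y') : ?H" using a(2) b(2) True by (intro convex_cone_hull_mul convex_cone_hull_add) auto
    hence "rv g : ?H" using True by (simp add: e)
    thus ?thesis using irr[OF g] by simp
   next
    case False
    have "y' + (- s) \<cdot> rv g : si" using b(2) Hs False gsi si by (intro cone_add cone_scale) auto
    moreover have "x' + (y' + (- s) \<cdot> rv g) = 0" using e by (simp add: algebra_simps)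
    moreover have "x' : si" using a(2) Hs by blast
    ultimately have "x' = 0" using cone_sum_zero[OF si] by blast
    thus ?thesis using a rhI by simp
   qed
  qed
  have face: "?rh face_of si" unfolding face_of_def
  proof (intro conjI ballI impI)
   show "?rh <= si" using gsi si cone_scale by auto
   show "convex ?rh"
   proof (rule convexI)
    fix a b and p q :: real assume "a : ?rh" "b : ?rh" "0 <= p" "0 <= q"
    then obtain s t where "p \<cdot> a + q \<cdot> b = (p * \<bar>s\<bar> + q * \<bar>t\<bar>) \<cdot> rv g"
     by (auto simp: scaleR_left_distrib)
    thus "p \<cdot> a + q \<cdot> b : ?rh" using rhI[of "p * \<bar>s\<bar> + q * \<bar>t\<bar>"] `0 <= p` `0 <= q` by simp
   qed
   fix a b z assume ab: "a : si" "b : si" "z : ?rh" "z : open_segment a b"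
   obtain w where w: "0 < w" "w < 1" "z = (1 - w) \<cdot> a + w \<cdot> b" using ab(4) by (auto simp: in_segment)
   have mem: "(1 - w) \<cdot> a : si" "w \<cdot> b : si" using ab w si by (auto intro: cone_scale)
   have "(1 - w) \<cdot> a : ?rh" "w \<cdot> b : ?rh" using core[OF mem] core[OF mem(2,1)] ab(3) w(3) by (auto simp: add.commute)
   then obtain s t where st: "(1 - w) \<cdot> a = \<bar>s\<bar> \<cdot> rv g" "w \<cdot> b = \<bar>t\<bar> \<cdot> rv g" by auto
   have "a = (1 / (1 - w)) \<cdot> ((1 - w) \<cdot> a)" "b = (1 / w) \<cdot> (w \<cdot> b)" using w by auto
   hence "a = (\<bar>s\<bar> / (1 - w)) \<cdot> rv g" "b = (\<bar>t\<bar> / w) \<cdot> rv g" unfolding st by simp_all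
   thus "a : ?rh" "b : ?rh" using w rhI by auto
  qed
  have grh: "rv g : ?rh" using rhI[of 1] by simp
  have rhSg: "?rh : Sg" using face_mem[OF si face] grh by blast
  have "aff_dim ?rh = 1"
  proof-
   have "span ?rh = span {rv g}" using grh by (intro span_eq[THEN iffD2]) (auto intro: span_base span_scale)
   hence "dim ?rh = 1" using g0 by (metis dim_span dim_singleton rv_eq_0)
   moreover have "0 : affine hull ?rh" using cone_0[OF rhSg] by (rule hull_inc)
   ultimately show ?thesis using aff_dim_zero by fastforce
  qed
  hence "?rh : rays Sg" using rhSg by (simp add: rays_def)
  then obtain i where i: "primitive_generator (u i) ?rh" using primitive_ray by blast
  hence "g : {int l *s u i | l :: nat. True}" using grh unfolding primitive_generator_def by blast
  then obtain l :: nat where l: "g = int l *s u i" by blast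
  have "rv (u i) : ?rh"
  proof-
   have "u i : {int l *s u i | l :: nat. True}" by (intro CollectI exI[of _ 1]) simp
   thus ?thesis using i unfolding primitive_generator_def by blast
  qed
  hence "rv (u i) : si" using face face_of_imp_subset by blast
  thus ?thesis using l rv_scale[of "int l" "u i"] by (intro exI[of _ i] exI[of _ "real l"]) simp
 qed
 let ?C = "convex_cone hull ((%i. rv (u i)) ` crays si)"
 have "rv ` G <= ?C"
 proof
  fix y assume "y : rv ` G"
  then obtain g where g: "g : G" "y = rv g" by blast
  then obtain i t where it: "rv (u i) : si" "t >= 0" "rv g = t \<cdot> rv (u i)" using gen by blast
  thus "y : ?C" unfolding g(2) it(3) by (intro convex_cone_hull_mul hull_inc) (auto simp: crays_def)
 qed
 hence "si <= ?C" unfolding G(2) by (intro hull_minimal convex_cone_convex_cone_hull)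
 hence "x : ?C" using x by blast
 then obtain l where l: "ALL s:(%i. rv (u i)) ` crays si. l s >= 0"
   "x = (SUM s:(%i. rv (u i)) ` crays si. l s \<cdot> s)" by (subst (asm) convex_cone_hull_finite_iff) auto
 have inj: "inj_on (%i. rv (u i)) (crays si)" using rg unfolding ray_generators_def bij_betw_def by (auto simp: inj_on_def)
 show ?thesis
 proof (rule that[of "%i. \<bar>l (rv (u i))\<bar>"])
  show "x = (SUM i:crays si. \<bar>l (rv (u i))\<bar> \<cdot> rv (u i))"
   unfolding l(2) using l(1) inj by (subst sum.reindex) (auto intro!: sum.cong)
 qed simp
qed

lemma cone_inner_nonneg:
 assumes "si : Sg" "x : si" "!!i. i : crays si ==> rv (u i) \<bullet> y >= 0"
 shows "x \<bullet> y >= 0"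
proof-
 obtain l where l: "!!i. l i >= 0" "x = (SUM i:crays si. l i \<cdot> rv (u i))" using cone_generated[OF assms(1,2)] by blast
 show ?thesis unfolding l(2) inner_sum_left using l(1) assms(3) by (intro sum_nonneg) auto
qed

lemma dsg_iff:
 "si : Sg ==> m : dsg si <-> (ALL i:crays si. pairing (u i) m >= 0)" unfolding dsg_def using cone_inner_nonneg[of si _ "rv m"]
 by (auto simp: crays_def inner_rv)

text \<open>A minimal cone through x works: on its relative boundary a supporting hyperplane would
  cut out a smaller face through x.\<close>

lemma relint_cone_exists:
 obtains ta where "ta : Sg" "x : rel_interior ta"
proof-
 let ?S = "{si : Sg. x : si}"
 have "finite ?S" using finite_fan by simp
 moreover have "?S ~= {}" using covers[of x] by blast
 ultimately have "EX ta:?S. ALL si:?S. si <= ta --> ta = si" by (rule finite_has_minimal)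
 then obtain ta where ta: "ta : ?S" and min: "ALL si:?S. si <= ta --> ta = si" ..
 have "x : rel_interior ta"
 proof (rule ccontr)
  assume "x ~: rel_interior ta"
  have "EX a. (ALL y:ta. a \<bullet> x <= a \<bullet> y) & (ALL y:rel_interior ta. a \<bullet> x < a \<bullet> y)"
   by (rule supporting_hyperplane_rel_boundary[OF cone_convex[of ta] _ `x ~: rel_interior ta`])
    (use ta in auto)
  then obtain a where a: "ALL y:ta. a \<bullet> x <= a \<bullet> y" "ALL y:rel_interior ta. a \<bullet> x < a \<bullet> y" by blast
  have f: "(ta Int {y. a \<bullet> y = a \<bullet> x}) face_of ta"
   using a(1) ta cone_convex[of ta] by (intro face_of_Int_supporting_hyperplane_ge) auto
  have "ta Int {y. a \<bullet> y = a \<bullet> x} : ?S" using face_mem[OF _ f] ta by auto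
  from bspec[OF min this] have e: "ta = ta Int {y. a \<bullet> y = a \<bullet> x}" by simp
  have "rel_interior ta ~= {}" using ta cone_convex[of ta] rel_interior_eq_empty[of ta] by auto
  then obtain y where y: "y : rel_interior ta" by blast
  hence "y : ta" using rel_interior_subset[of ta] by (rule rev_subsetD)
  hence "y : ta Int {y. a \<bullet> y = a \<bullet> x}" by (subst e[symmetric])
  hence "a \<bullet> y = a \<bullet> x" by simp
  thus False using a(2) y by force
 qed
 moreover have "ta : Sg" using ta by simp
 ultimately show ?thesis using that by blast
qed

text \<open>The segment from y to x can be prolonged beyond x inside the cone; a positive value at y
  would force a negative one there.\<close>

lemma relint_zero:
 assumes "ta : Sg" "x : rel_interior ta" "!!y. y : ta ==> y \<bullet> w >= 0" "x \<bullet> w <= 0" "y : ta"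
 shows "y \<bullet> w = 0"
proof-
 have xt: "x : ta" using assms(2) rel_interior_subset by blast
 obtain e where e: "e > 1" "(1 - e) \<cdot> y + e \<cdot> x : ta"
  using convex_rel_interior_iff[OF cone_convex[OF assms(1)], of x] assms(1,2,5) by (metis empty_iff)
 have x0: "x \<bullet> w = 0" using assms(3)[OF xt] assms(4) by simp
 have "((1 - e) \<cdot> y + e \<cdot> x) \<bullet> w >= 0" using assms(3) e(2) by blast
 hence "(1 - e) * (y \<bullet> w) >= 0" by (simp add: inner_add_left x0)
 hence "y \<bullet> w <= 0" using e(1) by (simp add: zero_le_mult_iff)
 thus ?thesis using assms(3)[OF assms(5)] by simp
qed

text \<open>Faces of a polyhedral cone are exposed by real functionals; the conditions on the rays
  are rational, so an integral functional exists as well.\<close>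

lemma face_exposed:
 assumes si: "si : Sg" and ta: "ta : Sg" "ta face_of si"
 obtains m where "m : dsg si" "!!i. i : crays si ==> pairing (u i) m = 0 <-> i : crays ta"
  "ta = {x : si. x \<bullet> rv m = 0}"
proof-
 have "ta exposed_face_of si" using exposed_face_of_polyhedron[OF cone_polyhedron[OF si]] ta(2) by blast
 then obtain a b where ab: "si <= {x. a \<bullet> x <= b}" "ta = si Int {x. a \<bullet> x = b}" by (auto simp: exposed_face_of_def)
 have b0: "b = 0" using cone_0[OF ta(1)] ab(2) by auto
 have sub: "crays ta <= crays si" using ab(2) by (auto simp: crays_def)
 obtain m where m: "ALL v:u ` crays ta. pairing v m = 0" "ALL v:u ` (crays si - crays ta). pairing v m > 0"
 proof-
  have "EX m. (ALL v:u ` crays ta. pairing v m = 0) & (ALL v:u ` (crays si - crays ta). pairing v m > 0)"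
  proof (rule integer_solution[where x = "- a"])
   show "rv v \<bullet> - a = 0" if "v : u ` crays ta" for v using that ab(2) b0 by (auto simp: crays_def inner_commute)
   show "rv v \<bullet> - a > 0" if v: "v : u ` (crays si - crays ta)" for v
   proof-
    obtain i where i: "v = u i" "rv (u i) : si" "rv (u i) ~: ta" using v by (auto simp: crays_def)
    hence "a \<bullet> rv v <= 0" "a \<bullet> rv v ~= 0" using ab b0 by auto
    thus ?thesis by (simp add: inner_commute)
   qed
  qed auto
  thus ?thesis using that by blast
 qed
 have pos: "pairing (u i) m > 0" if "i : crays si" "i ~: crays ta" for i using m(2) that by blast
 have zero: "pairing (u i) m = 0" if "i : crays ta" for i using m(1) that by blast
 have iff: "pairing (u i) m = 0 <-> i : crays ta" and nn: "pairing (u i) m >= 0" if "i : crays si" for i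
  using pos[OF that] zero[of i] by fastforce+
 have "ta = {x : si. x \<bullet> rv m = 0}"
 proof (intro equalityI subsetI)
  fix x assume x: "x : ta"
  obtain l where l: "!!i. l i >= 0" "x = (SUM i:crays ta. l i \<cdot> rv (u i))" using cone_generated[OF ta(1) x] by blast
  have "x \<bullet> rv m = (SUM i:crays ta. l i * real_of_int (pairing (u i) m))" unfolding l(2) by (simp add: inner_sum_left inner_rv)
  also have "... = 0" using m(1) by (intro sum.neutral) auto
  finally show "x : {x : si. x \<bullet> rv m = 0}" using x ab(2) by auto
 next
  fix x assume x: "x : {x : si. x \<bullet> rv m = 0}"
  obtain l where l: "!!i. l i >= 0" "x = (SUM i:crays si. l i \<cdot> rv (u i))" using cone_generated[OF si, of x] x by blast
  have "(SUM i:crays si. l i * real_of_int (pairing (u i) m)) = x \<bullet> rv m" unfolding l(2) by (simp add: inner_sum_left inner_rv)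
  hence "(SUM i:crays si. l i * real_of_int (pairing (u i) m)) = 0" using x by simp
  hence z: "!!i. i : crays si ==> l i * real_of_int (pairing (u i) m) = 0" using l(1) nn by (subst (asm) sum_nonneg_eq_0_iff) auto
  have "x = (SUM i:crays ta. l i \<cdot> rv (u i))" unfolding l(2)
  proof (rule sum.mono_neutral_right)
   show "ALL i:crays si - crays ta. l i \<cdot> rv (u i) = 0"
   proof
    fix i assume i: "i : crays si - crays ta"
    hence "pairing (u i) m ~= 0" using iff by simp
    hence "l i = 0" using z[of i] i by simp
    thus "l i \<cdot> rv (u i) = 0" by simp
   qed
  qed (use sub in auto)
  also have "... : ta" using l(1) ta(1) by (intro cone_sum cone_scale) (auto simp: crays_def)
  finally show "x : ta" .
 qed
 moreover have "m : dsg si" using nn dsg_iff[OF si] by blast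
 ultimately show ?thesis using that iff by blast
qed

end

section \<open>Points of a toric variety\<close>

lemma mchar_nmul:
 assumes "mchar D ga" "submon D" "w : D"
 shows "ga (nmul k w) = ga w ^ k"
proof (induction k)
 case 0 thus ?case using assms(1) by (simp add: mchar_def)
next
 case (Suc k)
 thus ?case using assms nmul_mem[OF assms(2,3), of k] by (simp add: nmul_Suc mchar_def)
qed

lemma mchar_inverse:
 fixes w :: "'g::ab_group_add"
 assumes "mchar UNIV th"
 shows "th w * th (- w) = 1" "th w ~= 0"
proof-
 have "th (w + - w) = th w * th (- w)" using assms unfolding mchar_def by blast
 thus "th w * th (- w) = 1" using assms by (simp add: mchar_def)
 thus "th w ~= 0" by auto
qed

text \<open>The Nullstellensatz for the ideal of all \<open>r\<close> on which the functionals supported on the cosets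
  of the group generated by \<open>N\<close> vanish; each of these functionals extends \<open>ga\<close> up to a translation.\<close>

lemma character_extension:
 fixes N :: "'g::ab_group_add set" and ga :: "'g => complex"
 assumes N: "submon N" and ga: "mchar N ga" "!!v. v : N ==> ga v ~= 0"
  and cnt: "countable (UNIV :: 'g set)"
 obtains th where "mchar UNIV th" "!!v. v : N ==> th v = ga v"
proof-
 \<comment> \<open>The extension of \<open>ga\<close> to the group generated by \<open>N\<close>,
   set to 0 outside it; the choice of the difference does not matter.\<close>
 define ka where "ka z = (if EX v:N. EX w:N. z = v - w then ga (fst (SOME p. fst p : N & snd p : N & z = fst p - snd p))
   / ga (snd (SOME p. fst p : N & snd p : N & z = fst p - snd p)) else 0)" for z
 have mul: "ga (v + w) = ga v * ga w" and Nadd: "v + w : N" if "v : N" "w : N" for v w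
  using that ga(1) N by (simp_all add: mchar_def submon_def)
 have N0: "0 : N" "ga 0 = 1" using N ga(1) by (simp_all add: submon_def mchar_def)
 have ka: "ka (v - w) = ga v / ga w" if v: "v : N" "w : N" for v w
 proof-
  define p where "p = (SOME p. fst p : N & snd p : N & v - w = fst p - snd p)"
  have p: "fst p : N & snd p : N & v - w = fst p - snd p" unfolding p_def by (rule someI[of _ "(v, w)"]) (use v in simp)
  have "v + snd p = fst p + w" using p by (simp add: algebra_simps)
  hence "ga v * ga (snd p) = ga (fst p) * ga w" using mul p v by metis
  hence "ga (fst p) / ga (snd p) = ga v / ga w" using ga(2) p v by (simp add: field_simps)
  moreover have "EX x:N. EX y:N. v - w = x - y" using v by blast
  ultimately show ?thesis by (simp add: ka_def p_def)
 qed
 have kaN: "ka v = ga v" if "v : N" for v using ka[OF that N0(1)] N0(2) by simp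
 have shift: "ka (v + z) = ga v * ka z" if v: "v : N" for v z
 proof (cases "EX x:N. EX y:N. z = x - y")
  case True
  then obtain x y where z: "x : N" "y : N" "z = x - y" by blast
  have "v + z = (v + x) - y" using z by simp
  thus ?thesis using ka[of "v + x" y] ka[of x y] mul[of v x] Nadd v z by (simp add: add_diff_eq)
 next
  case False
  have "~ (EX x:N. EX y:N. v + z = x - y)"
  proof
   assume "EX x:N. EX y:N. v + z = x - y"
   then obtain x y where "x : N" "y : N" "v + z = x - y" by blast
   hence "z = x - (y + v)" by (simp add: algebra_simps)
   thus False using False `x : N` `y : N` Nadd v by blast
  qed
  thus ?thesis using False by (simp add: ka_def)
 qed
 define b where "b = {r. ALL w. mev (%v. ka (v - w)) r = 0}"
 have U: "submon (UNIV :: 'g set)" by (simp add: submon_def)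
 have single: "mev (%v. ka (v - w)) (msing x c * r) = c * mev (%v. ka (v - (w - x))) r" for w x c r
 proof-
  have "msing x c * r = (SUM v:pkeys r. msing (x + v) (c * lkp r v))"
   by (subst pm_sum_single[of r]) (simp add: sum_distrib_left mult_single)
  hence "mev (%v. ka (v - w)) (msing x c * r) = (SUM v:pkeys r. c * (lkp r v * ka (v - (w - x))))" by (simp add: mev_sum algebra_simps)
  thus ?thesis by (simp add: mev_def monext_def sum_distrib_left)
 qed
 have ideal: "alg_ideal UNIV b" unfolding alg_ideal_def
 proof (intro conjI ballI)
  fix r s assume s: "s : b"
  have "r * s = (SUM x:pkeys r. msing x (lkp r x) * s)" by (subst pm_sum_single[of r]) (simp add: sum_distrib_right)
  thus "r * s : b" using s by (simp add: b_def mev_sum single)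
 qed (auto simp: b_def mev_add monalg_def)
 have "1 ~: b"
 proof
  assume "1 : b"
  hence "mev (%v. ka (v - 0)) 1 = 0" by (simp only: b_def mem_Collect_eq)
  thus False using mev_one[where ga = ka] kaN[OF N0(1)] N0(2) by simp
 qed
 then obtain th where th: "mchar UNIV th" "!!r. r : b ==> mev th r = 0"
  using nullstellensatz[OF U cnt ideal monalg_1[OF U]] by (metis power_one)
 have "th v = ga v" if "v : N" for v
 proof-
  have "mev (%x. ka (x - w)) (msing v 1 - cst (ga v)) = 0" for w using shift[OF that, of "- w"] by (simp add: mev_diff)
  hence "mev th (msing v 1 - cst (ga v)) = 0" using th(2) by (simp add: b_def)
  thus ?thesis using th(1) by (simp add: mev_diff mchar_def)
 qed
 thus ?thesis using th(1) that by blast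
qed

lemma pairing_nmul: "pairing v (nmul k m) = int k * pairing v m"
 by (induction k) (simp_all add: nmul_Suc pairing_add_right algebra_simps)

lemma pairing_sum: "pairing v (sum f A) = (SUM i:A. pairing v (f i))"
 by (induction A rule: infinite_finite_induct) (simp_all add: pairing_add_right)

lemma countable_int_vec: "countable (UNIV :: (int ^ 'n) set)"
proof-
 have "countable (Pi\<^sub>E (UNIV :: 'n set) (%_. UNIV :: int set))" by (rule countable_PiE) auto
 hence "countable (UNIV :: ('n => int) set)" by (simp add: PiE_UNIV_domain)
 hence "countable (range (vec_lambda :: ('n => int) => int ^ 'n))" by (rule countable_image)
 moreover have "range (vec_lambda :: ('n => int) => int ^ 'n) = UNIV" by (metis surj_def vec_nth_inverse)
 ultimately show ?thesis by simp
qed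

context ctfan
begin

definition perp :: "(real ^ 'n) set => (int ^ 'n) set" where
 "perp ta = {m. ALL i:crays ta. pairing (u i) m = 0}"

text \<open>The point of the orbit of \<open>ta\<close> given by the character \<open>th\<close>; only the restriction of \<open>th\<close> to \<open>perp \<tau>\<close> matters.\<close>

definition orbc :: "(real ^ 'n) set => (int ^ 'n => complex) => int ^ 'n => complex" where
 "orbc ta th m = (if m : perp ta then th m else 0)"

text \<open>The gluing class written out: one representative in every chart that contains the
  orbit.\<close>

definition opt :: "(real ^ 'n) set => (int ^ 'n => complex) => 'n toric_point" where
 "opt ta th = {(si, restrict (orbc ta th) (dsg si)) | si. si : Sg & ta <= si}"

lemma submon_dual: "submon (dsg si)"
 by (auto simp: submon_def dsg_def rv_add inner_add_right)

lemma submon_perp: "submon (perp ta)"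
 by (auto simp: submon_def perp_def pairing_add_right)

lemma perp_minus: "m : perp ta ==> - m : perp ta"
 by (simp add: perp_def pairing_minus_right)

lemma perp_diff: "m : perp ta ==> m' : perp ta ==> m - m' : perp ta"
 by (simp add: perp_def pairing_diff_right)

lemma dual_mono: "ta <= si ==> dsg si <= dsg ta"
 by (auto simp: dsg_def)

lemma crays_mono: "ta <= si ==> crays ta <= crays si"
 by (auto simp: crays_def)

lemma cone_subset: "ta : Sg ==> si : Sg ==> crays ta <= crays si ==> ta <= si"
proof
 fix x assume a: "ta : Sg" "si : Sg" "crays ta <= crays si" "x : ta"
 obtain l where l: "!!i. l i >= 0" "x = (SUM i:crays ta. l i \<cdot> rv (u i))" using cone_generated[OF a(1,4)] by blast
 show "x : si" unfolding l(2) by (intro cone_sum[OF a(2)] cone_scale[OF a(2)] l(1)) (use a(3) in "auto simp: crays_def")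
qed

lemma subset_face: "ta : Sg ==> si : Sg ==> ta <= si ==> ta face_of si"
 using inter_face[of si ta] by (simp add: Int_absorb1)

lemma perp_dual: "ta : Sg ==> m : perp ta ==> m : dsg ta"
 by (simp add: dsg_iff perp_def)

lemma face_functional:
 assumes "ta : Sg" "si : Sg" "ta <= si"
 obtains m where "m : dsg si" "m : perp ta"
  "!!i. i : crays si ==> pairing (u i) m = 0 ==> i : crays ta"
proof-
 obtain m where m: "m : dsg si" "!!i. i : crays si ==> pairing (u i) m = 0 <-> i : crays ta"
  using face_exposed[OF assms(2,1) subset_face[OF assms]] by blast
 have "m : perp ta" unfolding perp_def using m(2) crays_mono[OF assms(3)] by blast
 thus ?thesis using that m by blast
qed

lemma cone_inter: "ta : Sg ==> si : Sg ==> si Int ta : Sg"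
 using face_mem[OF _ inter_face[of si ta]] cone_0[of si] cone_0[of ta] by blast

lemma perp_unit:
 assumes "ta : Sg" "mchar (dsg ta) de" "m : perp ta"
 shows "de m ~= 0"
proof-
 have "m : dsg ta" "- m : dsg ta" using perp_dual[OF assms(1)] perp_minus assms(3) by blast+
 hence "de (m + - m) = de m * de (- m)" using assms(2) unfolding mchar_def by blast
 thus ?thesis using assms(2) by (auto simp: mchar_def)
qed

text \<open>The chart of a face is a localization: a multiple of the functional that exposes the
  face clears the negative values on the other rays.\<close>

lemma face_localization:
 assumes "ta : Sg" "si : Sg" "ta <= si" "m : dsg ta"
 obtains m0 k where "m0 : dsg si" "m0 : perp ta" "m + nmul k m0 : dsg si"
proof-
 obtain m0 where m0: "m0 : dsg si" "m0 : perp ta"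
  "!!i. i : crays si ==> pairing (u i) m0 = 0 ==> i : crays ta" using face_functional[OF assms(1-3)] by blast
 let ?k = "nat (SUM i:UNIV. \<bar>pairing (u i) m\<bar>)"
 have "m + nmul ?k m0 : dsg si" unfolding dsg_iff[OF assms(2)]
 proof
  fix i assume i: "i : crays si"
  show "0 <= pairing (u i) (m + nmul ?k m0)"
  proof (cases "i : crays ta")
   case True
   thus ?thesis using assms(1,4) m0(2) by (simp add: pairing_add_right pairing_nmul dsg_iff perp_def)
  next
   case False
   hence "pairing (u i) m0 ~= 0" using m0(3) i by blast
   moreover have "pairing (u i) m0 >= 0" using m0(1) i assms(2) by (simp add: dsg_iff)
   ultimately have "pairing (u i) m0 >= 1" by simp
   hence "int ?k * pairing (u i) m0 >= int ?k * 1" by (intro mult_left_mono) auto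
   moreover have "int ?k >= \<bar>pairing (u i) m\<bar>" using member_le_sum[of i UNIV "%i. \<bar>pairing (u i) m\<bar>"] by simp
   ultimately show ?thesis by (simp add: pairing_add_right pairing_nmul)
  qed
 qed
 thus ?thesis using m0(1,2) that by blast
qed

lemma orbc_character:
 assumes "ta : Sg" "mchar UNIV th"
 shows "mchar (dsg ta) (orbc ta th)"
 unfolding mchar_def
proof (intro conjI ballI)
 show "orbc ta th 0 = 1" using assms(2) by (simp add: orbc_def perp_def mchar_def)
 fix v w assume "v : dsg ta" "w : dsg ta"
 hence "v + w : perp ta <-> v : perp ta & w : perp ta" unfolding perp_def mem_Collect_eq pairing_add_right dsg_iff[OF assms(1)]
  by (metis add.right_neutral add_nonneg_eq_0_iff)
 thus "orbc ta th (v + w) = orbc ta th v * orbc ta th w" using assms(2) by (auto simp: orbc_def mchar_def)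
qed

lemma orbc_nonzero: "mchar UNIV th ==> orbc ta th m ~= 0 <-> m : perp ta"
 using mchar_inverse(2)[of th] by (auto simp: orbc_def)

lemma chart_iff: "ga : chart si <-> ga : extensional (dsg si) & mchar (dsg si) ga"
 by (auto simp: chart_def mchar_def)

lemma restrict_orbc_chart:
 assumes "ta : Sg" "mchar UNIV th" "ta <= si"
 shows "restrict (orbc ta th) (dsg si) : chart si"
 using orbc_character[OF assms(1,2)] dual_mono[OF assms(3)] submon_dual[of si]
 unfolding chart_iff mchar_def submon_def by (auto simp: subset_iff)

text \<open>The exponents on which the point does not vanish are those that are zero on a face
  \<open>ta\<close>. On them it is a character with nonzero values, which extends to the
  torus.\<close>

lemma chart_canonical:
 assumes si: "si : Sg" and ga: "ga : chart si"
 obtains ta th where "ta : Sg" "ta <= si" "mchar UNIV th" "ga = restrict (orbc ta th) (dsg si)"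
proof-
 have ch: "mchar (dsg si) ga" using ga by (simp add: chart_iff)
 define J where "J = {j:crays si. ALL m:dsg si. ga m ~= 0 --> pairing (u j) m = 0}"
 have "EX m:dsg si. ga m ~= 0 & pairing (u j) m ~= 0" if "j : crays si - J" for j using that by (auto simp: J_def)
 then obtain f where f: "!!j. j : crays si - J ==> f j : dsg si & ga (f j) ~= 0 & pairing (u j) (f j) ~= 0" by metis
 have sums: "sum f A : dsg si & ga (sum f A) ~= 0" if "finite A" "A <= crays si - J" for A using that
 proof (induction A rule: finite_induct)
  case empty thus ?case using ch submon_dual[of si] by (simp add: mchar_def submon_def)
 next
  case (insert a A)
  thus ?case using f[of a] ch submon_dual[of si] by (simp add: mchar_def submon_def)
 qed
 \<comment> \<open>A sum of witnesses is still not killed by the point and is nonzero on every ray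
   outside \<open>J\<close>; it exposes the face wanted.\<close>
 define m where "m = sum f (crays si - J)"
 have m: "m : dsg si" "ga m ~= 0" using sums[of "crays si - J"] by (auto simp: m_def)
 have mj: "pairing (u j) m = 0 <-> j : J" if j: "j : crays si" for j
 proof
  assume z: "pairing (u j) m = 0"
  show "j : J"
  proof (rule ccontr)
   assume n: "j ~: J"
   have "pairing (u j) (f i) >= 0" if "i : crays si - J" for i using f[OF that] si j by (simp add: dsg_iff)
   hence "pairing (u j) (f j) = 0" using z j n unfolding m_def pairing_sum by (subst (asm) sum_nonneg_eq_0_iff) auto
   thus False using f[of j] j n by simp
  qed
 qed (use m J_def in auto)
 define ta where "ta = si Int {x. rv m \<bullet> x = 0}"
 have "ta face_of si" unfolding ta_def using m(1) by (intro face_of_Int_supporting_hyperplane_ge cone_convex[OF si])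
   (auto simp: dsg_def inner_commute)
 moreover have "0 : ta" using cone_0[OF si] by (simp add: ta_def)
 ultimately have ta: "ta : Sg" using face_mem[OF si] by blast
 have tasi: "ta <= si" by (auto simp: ta_def)
 have cr: "crays ta = J" using mj by (auto simp: crays_def ta_def inner_rv J_def inner_commute[of "rv m"])
 have nz: "ga w ~= 0 <-> w : perp ta" if w: "w : dsg si" for w
 proof
  show "ga w ~= 0 ==> w : perp ta" using w by (auto simp: perp_def cr J_def)
  assume p: "w : perp ta"
  hence "- w : dsg ta" by (intro perp_dual[OF ta] perp_minus)
  let ?k = "nat (SUM i:UNIV. \<bar>pairing (u i) w\<bar>)"
  have "nmul ?k m - w : dsg si" unfolding dsg_iff[OF si]
  proof
   fix i assume i: "i : crays si"
   show "0 <= pairing (u i) (nmul ?k m - w)"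
   proof (cases "i : J")
    case True
    thus ?thesis using p mj[OF i] by (simp add: pairing_diff_right pairing_nmul perp_def cr)
   next
    case False
    hence "pairing (u i) m >= 1" using m(1) i si mj[OF i] by (metis dsg_iff int_one_le_iff_zero_less order_le_less)
    hence "int ?k * pairing (u i) m >= int ?k * 1" by (intro mult_left_mono) auto
    moreover have "int ?k >= \<bar>pairing (u i) w\<bar>" using member_le_sum[of i UNIV "%i. \<bar>pairing (u i) w\<bar>"] by simp
    ultimately show ?thesis by (simp add: pairing_diff_right pairing_nmul)
   qed
  qed
  hence "ga (nmul ?k m - w + w) = ga (nmul ?k m - w) * ga w" using ch w unfolding mchar_def by blast
  hence "ga m ^ ?k = ga (nmul ?k m - w) * ga w" using mchar_nmul[OF ch submon_dual m(1), of ?k] by simp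
  thus "ga w ~= 0" using m(2) by auto
 qed
 let ?N = "dsg si Int perp ta"
 have "submon ?N" using submon_dual[of si] submon_perp[of ta] by (simp add: submon_def)
 moreover have "mchar ?N ga" using ch by (simp add: mchar_def)
 ultimately obtain th where th: "mchar UNIV th" "!!v. v : ?N ==> th v = ga v"
  using character_extension[OF _ _ _ countable_int_vec, of ?N ga] nz by (metis IntD1 IntD2)
 have "ga = restrict (orbc ta th) (dsg si)"
 proof (rule extensionalityI[of _ "dsg si"])
  show "ga : extensional (dsg si)" using ga by (simp add: chart_iff)
  fix w assume "w : dsg si"
  thus "ga w = restrict (orbc ta th) (dsg si) w" using nz[of w] th(2)[of w] by (auto simp: orbc_def)
 qed simp
 thus ?thesis using that ta tasi th(1) by blast
qed

lemma gluing_class: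
 assumes ta: "ta : Sg" "mchar UNIV th" and si: "si : Sg" "ta <= si"
 shows "gluing Sg `` {(si, restrict (orbc ta th) (dsg si))} = opt ta th"
proof (rule Set.set_eqI, rule iffI)
 fix z assume "z : opt ta th"
 then obtain si' where z: "si' : Sg" "ta <= si'" "z = (si', restrict (orbc ta th) (dsg si'))" by (auto simp: opt_def)
 have d: "restrict (restrict (orbc ta th) (dsg (si Int si'))) (dsg rh) = restrict (orbc ta th) (dsg rh)" if "si Int si' <= rh" for rh
  using dual_mono[OF that] by (auto simp: restrict_def fun_eq_iff)
 have "restrict (orbc ta th) (dsg (si Int si')) : chart (si Int si')" using si z by (intro restrict_orbc_chart ta) auto
 thus "z : gluing Sg `` {(si, restrict (orbc ta th) (dsg si))}" using d[of si] d[of si'] si z unfolding gluing_def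
  by (simp add: Image_def) (rule bexI[of _ "restrict (orbc ta th) (dsg (si Int si'))"]; simp)
next
 fix z assume "z : gluing Sg `` {(si, restrict (orbc ta th) (dsg si))}"
 then obtain si' de where z: "z = (si', restrict de (dsg si'))" "si' : Sg" and de: "de : chart (si Int si')"
  and e: "restrict (orbc ta th) (dsg si) = restrict de (dsg si)" by (auto simp: gluing_def)
 have agree: "de m = orbc ta th m" if "m : dsg si" for m using fun_cong[OF e, of m] that by simp
 have i: "si Int si' : Sg" using cone_inter si(1) z(2) by blast
 have ch: "mchar (dsg (si Int si')) de" using de by (simp add: chart_iff)
 \<comment> \<open>The functional exposing the intersection in \<open>si\<close> is invertible on
   the smaller chart, hence nonzero at the point; nonvanishing there means that it is zero on
   \<open>ta\<close>.\<close>
 have sub: "ta <= si Int si'"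
 proof-
  obtain m0 where m0: "m0 : dsg si" "m0 : perp (si Int si')"
   "!!i. i : crays si ==> pairing (u i) m0 = 0 ==> i : crays (si Int si')" using face_functional[OF i si(1) Int_lower1] by blast
  have "m0 : perp ta" using perp_unit[OF i ch m0(2)] agree[OF m0(1)] orbc_nonzero[OF ta(2)] by metis
  hence "crays ta <= crays (si Int si')" using m0(3) crays_mono[OF si(2)] unfolding perp_def by blast
  thus ?thesis by (rule cone_subset[OF ta(1) i])
 qed
 have all: "de m = orbc ta th m" if m: "m : dsg (si Int si')" for m
 proof-
  obtain m0 k where m0: "m0 : dsg si" "m0 : perp (si Int si')" "m + nmul k m0 : dsg si" using face_localization[OF i si(1) _ m] by blast
  have k: "nmul k m0 : dsg si" "nmul k m0 : perp (si Int si')" using nmul_mem[OF submon_dual m0(1)] nmul_mem[OF submon_perp m0(2)] by auto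
  have k': "nmul k m0 : dsg (si Int si')" by (rule perp_dual[OF i k(2)])
  have "de (m + nmul k m0) = de m * de (nmul k m0)" using ch m k' unfolding mchar_def by blast
  moreover have "orbc ta th (m + nmul k m0) = orbc ta th m * orbc ta th (nmul k m0)"
   using orbc_character[OF ta] m k' dual_mono[OF sub] unfolding mchar_def by blast
  moreover have "nmul k m0 : perp ta" using k(2) crays_mono[OF sub] by (auto simp: perp_def)
  hence "orbc ta th (nmul k m0) ~= 0" using orbc_nonzero[OF ta(2)] by blast
  ultimately show ?thesis using agree[OF m0(3)] agree[OF k(1)] by simp
 qed
 have "restrict de (dsg si') = restrict (orbc ta th) (dsg si')"
  using all dual_mono[of "si Int si'" si'] by (auto simp: restrict_def fun_eq_iff)
 thus "z : opt ta th" using z sub by (auto simp: opt_def)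
qed

lemma tvar_opt: "tvar Sg = {opt ta th | ta th. ta : Sg & mchar UNIV th}"
proof (rule Set.set_eqI, rule iffI)
 fix ze assume "ze : tvar Sg"
 then obtain si ga where s: "si : Sg" "ga : chart si" "ze = gluing Sg `` {(si, ga)}" by (auto simp: tvar_def quotient_def)
 obtain ta th where t: "ta : Sg" "ta <= si" "mchar UNIV th" "ga = restrict (orbc ta th) (dsg si)" using chart_canonical[OF s(1,2)] by blast
 show "ze : {opt ta th | ta th. ta : Sg & mchar UNIV th}" using gluing_class[OF t(1,3) s(1) t(2)] s(3) t by auto
next
 fix ze assume "ze : {opt ta th | ta th. ta : Sg & mchar UNIV th}"
 then obtain ta th where t: "ta : Sg" "mchar UNIV th" "ze = opt ta th" by blast
 have "ze = gluing Sg `` {(ta, restrict (orbc ta th) (dsg ta))}" using gluing_class[OF t(1,2) t(1)] t(3) by simp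
 moreover have "restrict (orbc ta th) (dsg ta) : chart ta" using restrict_orbc_chart[OF t(1,2)] by simp
 ultimately show "ze : tvar Sg" using t(1) by (auto simp: tvar_def quotient_def)
qed

lemma opt_eqD:
 assumes "opt ta th = opt ta' th'" and ta: "ta : Sg" "ta' : Sg"
 shows "ta = ta'" "!!m. m : perp ta ==> th m = th' m"
proof-
 have "(ta, restrict (orbc ta th) (dsg ta)) : opt ta' th'"
  and "(ta', restrict (orbc ta' th') (dsg ta')) : opt ta th" using ta assms(1) by (auto simp: opt_def)
 hence t: "ta' <= ta" "ta <= ta'"
  "restrict (orbc ta th) (dsg ta) = restrict (orbc ta' th') (dsg ta)" by (auto simp: opt_def)
 show eq: "ta = ta'" using t by blast
 fix m assume m: "m : perp ta"
 show "th m = th' m" using fun_cong[OF t(3), of m] perp_dual[OF ta(1) m] m eq by (simp add: orbc_def)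
qed

lemma opt_cong: "(!!m. m : perp ta ==> th m = th' m) ==> opt ta th = opt ta th'"
proof-
 assume "!!m. m : perp ta ==> th m = th' m"
 hence "orbc ta th = orbc ta th'" by (auto simp: orbc_def)
 thus ?thesis by (simp add: opt_def)
qed

lemma cpts_opt:
 assumes "ta : Sg" "mchar UNIV th"
 shows "opt ta th : cpts Sg si <-> si : Sg & ta <= si"
proof-
 have "opt ta th : tvar Sg" using assms tvar_opt by blast
 thus ?thesis by (auto simp: cpts_def opt_def)
qed

lemma cval_opt:
 assumes "si : Sg" "ta <= si" "g : cring si"
 shows "cval si g (opt ta th) = mev (orbc ta th) g"
proof-
 have "chart_coord si (opt ta th) = restrict (orbc ta th) (dsg si)"
  unfolding chart_coord_def by (rule the_equality) (use assms in "auto simp: opt_def")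
 thus ?thesis using assms(3) by (auto simp: cval_def mev_def monext_def cring_def subset_iff intro!: sum.cong)
qed

lemma cox_local_zero:
 assumes x: "!!i. x $ i = (if i : crays ta then 0 else 1)" and "ta : Sg" "si : Sg" "ta <= si"
 shows "cox_local u si x = restrict (orbc ta (%_. 1)) (dsg si)"
proof-
 have "(PROD i:UNIV. (x $ i) powi pairing (u i) m) = orbc ta (%_. 1) m" for m
 proof (cases "m : perp ta")
  case True
  thus ?thesis by (auto simp: orbc_def perp_def x intro!: prod.neutral)
 next
  case False
  then obtain i where i: "i : crays ta" "pairing (u i) m ~= 0" by (auto simp: perp_def)
  hence "(x $ i) powi pairing (u i) m = 0" by (simp add: x power_int_0_left_if)
  thus ?thesis using False by (auto simp: orbc_def intro!: prod_zero)
 qed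
 thus ?thesis by (simp add: cox_local_def)
qed

lemma x_hat_eval: "cox_eval (x_hat u si) x ~= 0 <-> (ALL i. i ~: crays si --> x $ i ~= 0)"
 by (auto simp: cox_eval_def x_hat_def crays_def)

lemma cox_quotient_origin:
 assumes "ta : Sg" and x: "!!i. x $ i = (if i : crays ta then 0 else 1)"
 shows "cox_quotient Sg u x = opt ta (%_. 1)"
proof-
 have 1: "mchar UNIV (%_::int ^ 'n. 1)" by (simp add: mchar_def)
 have "cox_eval (x_hat u si) x ~= 0 <-> ta <= si" if "si : Sg" for si
  using cone_subset[OF assms(1) that] crays_mono[of ta si] unfolding x_hat_eval x by auto
 hence "{(si, cox_local u si x) | si. si : Sg & cox_eval (x_hat u si) x ~= 0} = opt ta (%_. 1)"
  unfolding opt_def using cox_local_zero[of x ta, OF x assms(1)] by force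
 moreover have "gluing Sg `` opt ta (%_. 1) = (UN z:opt ta (%_. 1). gluing Sg `` {z})" by blast
 moreover have "gluing Sg `` {z} = opt ta (%_. 1)" if "z : opt ta (%_. 1)" for z
  using that gluing_class[OF assms(1) 1] by (auto simp: opt_def)
 moreover have "opt ta (%_. 1) ~= {}" using assms(1) by (auto simp: opt_def)
 ultimately show ?thesis by (simp add: cox_quotient_def)
qed

text \<open>If \<open>x $ i\<close> were 0 with i in a cone \<open>si\<close> representing the
  point, the functional exposing the intersection with \<open>ta\<close> would vanish at x, although
  it is a unit on the overlap.\<close>

lemma cox_quotient_nonzero:
 assumes ta: "ta : Sg" and q: "cox_quotient Sg u x = opt ta th" and i: "i ~: crays ta"
 shows "x $ i ~= 0"
proof-
 have "(ta, restrict (orbc ta th) (dsg ta)) : cox_quotient Sg u x" unfolding q using ta by (auto simp: opt_def)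
 then obtain si de where si: "si : Sg" "cox_eval (x_hat u si) x ~= 0" and de: "de : chart (si Int ta)"
  "cox_local u si x = restrict de (dsg si)" by (auto simp: cox_quotient_def gluing_def)
 show ?thesis
 proof (cases "i : crays si")
  case True
  have c: "si Int ta : Sg" using cone_inter si(1) ta by blast
  obtain m0 where m0: "m0 : dsg si" "m0 : perp (si Int ta)"
   "!!i. i : crays si ==> pairing (u i) m0 = 0 ==> i : crays (si Int ta)" using face_functional[OF c si(1) Int_lower1] by blast
  have "de m0 ~= 0" using perp_unit[OF c _ m0(2)] de(1) by (simp add: chart_iff)
  moreover have "cox_local u si x m0 = de m0" using de(2) m0(1) by simp
  ultimately have "(PROD i:UNIV. (x $ i) powi pairing (u i) m0) ~= 0" using m0(1) by (simp add: cox_local_def)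
  hence "(x $ i) powi pairing (u i) m0 ~= 0" by simp
  moreover have "pairing (u i) m0 ~= 0" using m0(3)[OF True] i by (auto simp: crays_def)
  ultimately show ?thesis by (auto simp: power_int_0_left_if)
 next
  case False
  thus ?thesis using si(2) x_hat_eval by blast
 qed
qed

end

section \<open>The section ring of a nef divisor\<close>

lemma divisor_class_iff: "e : divisor_class u a <-> (EX m. e = a + cdiv u m)"
 by (auto simp: divisor_class_def r_coset_def torus_divisors_def add.commute)

locale nef_divisor = ctfan Sg u
 for Sg :: "(real ^ 'n) set set" and u :: "'k::finite => int ^ 'n" +
 fixes a :: "int ^ 'k"
 assumes nef: "divisor_class u a : Pic_nef Sg u"
  and full: "aff_dim (polytope_of u a) = int CARD('n)"
begin

text \<open>Base point freeness is applied to the distinguished point of the orbit of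
  \<open>si\<close>, with Cox coordinates 0 on the rays of \<open>si\<close> and 1 elsewhere. A
  section nonzero there has a monomial without the variables of \<open>si\<close>; its exponent is
  the desired lattice point of the polytope.\<close>

lemma vertex_exists:
 assumes "si : Sg"
 shows "EX v. ALL i. pairing (u i) v + a $ i >= 0 & (i : crays si --> pairing (u i) v + a $ i = 0)"
proof-
 define x :: "complex ^ 'k" where "x = vec_lambda (%i. if i : crays si then 0 else 1)"
 have x: "x $ i = (if i : crays si then 0 else 1)" for i by (simp add: x_def)
 have q: "cox_quotient Sg u x = opt si (%_. 1)" by (rule cox_quotient_origin[OF assms x])
 have "mchar UNIV (%_::int ^ 'n. 1)" by (simp add: mchar_def)
 hence tv: "opt si (%_. 1) : tvar Sg" using tvar_opt assms by blast
 hence "~ basepoint Sg u (divisor_class u a) (opt si (%_. 1))" using nef by (simp add: Pic_nef_def)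
 then obtain f where f: "f : cox_piece (divisor_class u a)" "opt si (%_. 1) ~: Var_section Sg u f" using tv by (auto simp: basepoint_def)
 have one: "cox_eval (Poly_Mapping.single 0 1) y = 1" for y :: "complex ^ 'k" by (simp add: cox_eval_def)
 have "x ~: Var_affine (irrelevant_ideal Sg u)"
 proof-
  have "x_hat u si : irrelevant_ideal Sg u"
   unfolding irrelevant_ideal_def ideal_gen_def using assms by (intro module.span_base[OF module_mult]) auto
  moreover have "cox_eval (x_hat u si) x ~= 0" by (simp add: x_hat_eval x)
  ultimately show ?thesis by (auto simp: Var_affine_def)
 qed
 hence "cox_eval f x ~= 0" using f(2) q tv by (auto simp: Var_section_def)
 then obtain e where e: "e : pkeys f" "(PROD i:UNIV. (x $ i) ^ (e $ i)) ~= 0"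
  unfolding cox_eval_def by (metis (no_types, lifting) mult_zero_right sum.not_neutral_contains_not_neutral)
 have e0: "e $ i = 0" if "i : crays si" for i
 proof-
  have "(x $ i) ^ (e $ i) ~= 0" using e(2) by simp
  thus ?thesis using that by (auto simp: x power_0_left split: if_splits)
 qed
 have "vec_lambda (%i. int (e $ i)) : divisor_class u a" using f(1) e(1) by (simp add: cox_piece_def)
 then obtain v where v: "vec_lambda (%i. int (e $ i)) = a + cdiv u v" using divisor_class_iff by blast
 have "pairing (u i) v + a $ i = int (e $ i)" for i using arg_cong[OF v, of "%z. z $ i"] by (simp add: cdiv_def)
 thus ?thesis using e0 by (intro exI[of _ v]) simp
qed

definition vtx :: "(real ^ 'n) set => int ^ 'n" where
 "vtx si = (SOME v. ALL i. pairing (u i) v + a $ i >= 0 & (i : crays si --> pairing (u i) v + a $ i = 0))"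

lemma vtx: "si : Sg ==> pairing (u i) (vtx si) + a $ i >= 0"
  "si : Sg ==> i : crays si ==> pairing (u i) (vtx si) = - a $ i" using someI_ex[OF vertex_exists[of si]] unfolding vtx_def[symmetric]
 by (auto simp: add_eq_0_iff2)

text \<open>A pair \<open>(m, p)\<close> stands for the Laurent monomial with exponent \<open>m a + div \<chi>\<^sup>p\<close>.\<close>

definition ell :: "'k => int \<times> (int ^ 'n) => int" where
 "ell i w = pairing (u i) (snd w) + fst w * a $ i"

definition rell :: "'k => real \<times> (real ^ 'n) => real" where
 "rell i z = rv (u i) \<bullet> snd z + fst z * real_of_int (a $ i)"

definition emb :: "int \<times> (int ^ 'n) => real \<times> (real ^ 'n)" where
 "emb w = (real_of_int (fst w), rv (snd w))"

definition L :: "(int \<times> (int ^ 'n)) set" where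
 "L = {w. ALL i. ell i w >= 0}"

text \<open>Cones of every dimension contribute, so besides the vertices of the polytope further
  lattice points of its faces may occur.\<close>

definition Gs :: "(int \<times> (int ^ 'n)) set" where
 "Gs = (%si. (1, vtx si)) ` Sg"

lemma ell_add: "ell i (v + w) = ell i v + ell i w"
 and ell_diff: "ell i (v - w) = ell i v - ell i w"
 and ell_0: "ell i 0 = 0" by (simp_all add: ell_def pairing_add_right pairing_diff_right algebra_simps)

lemma ell_nmul: "ell i (nmul k w) = int k * ell i w"
 by (induction k) (simp_all add: nmul_Suc ell_add ell_0 algebra_simps)

lemma rell_emb: "rell i (emb w) = real_of_int (ell i w)"
 by (simp add: rell_def emb_def ell_def inner_rv)

lemma linear_rell: "linear (rell i)"
 by (rule linearI) (simp_all add: rell_def inner_add_right algebra_simps)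

lemma interior_point_exists: "EX y. ALL i. rv (u i) \<bullet> y + real_of_int (a $ i) > 0"
proof-
 let ?P = "polytope_of u a"
 have conv: "convex ?P"
 proof-
  have e: "0 <= x + b <-> x >= - b" for x b :: real by linarith
  have "?P = (INT i. {m. rv (u i) \<bullet> m >= - real_of_int (a $ i)})" unfolding polytope_of_def e by auto
  thus ?thesis by (simp add: convex_INT convex_halfspace_ge)
 qed
 have "affine hull ?P = UNIV" using full aff_dim_eq_full[of ?P] by simp
 hence "rel_interior ?P = interior ?P" "?P ~= {}" by (auto simp: rel_interior_interior)
 then obtain y where "y : interior ?P" using rel_interior_eq_empty[OF conv] by auto
 then obtain e where e: "e > 0" "ball y e <= ?P" using mem_interior by blast
 have "rv (u i) \<bullet> y + real_of_int (a $ i) > 0" for i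
 proof-
  let ?n = "norm (rv (u i))" and ?y = "y - (e / 2 / norm (rv (u i))) \<cdot> rv (u i)"
  have n: "?n > 0" using u_nonzero by simp
  have "?y : ball y e" using e(1) n by (simp add: dist_norm)
  hence "?y : ?P" using e(2) by (rule rev_subsetD)
  hence "0 <= rv (u i) \<bullet> ?y + real_of_int (a $ i)" unfolding polytope_of_def by blast
  moreover have "rv (u i) \<bullet> ?y = rv (u i) \<bullet> y - e / 2 * ?n"
   using n by (simp add: inner_diff_right dot_square_norm power2_eq_square field_simps)
  ultimately show ?thesis using n e(1) mult_pos_pos[of "e / 2" ?n] by linarith
 qed
 thus ?thesis by blast
qed

text \<open>By completeness -y lies in some cone, and pairing it with y is then nonnegative.\<close>

lemma positive_vector_zero:
 assumes "!!i. rv (u i) \<bullet> y > 0"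
 shows False
proof-
 obtain si where si: "si : Sg" "- y : si" using covers by blast
 have "(- y) \<bullet> y >= 0" by (rule cone_inner_nonneg[OF si]) (rule less_imp_le[OF assms])
 hence "y = 0" using inner_ge_zero[of y] by simp
 thus False using assms[of undefined] by simp
qed

lemma finite_Gs: "finite Gs" using finite_fan by (simp add: Gs_def)

text \<open>The polytope is the convex hull of the points \<open>vtx si\<close>. A separating
  functional h is tested on the point of the cone that contains \<open>snd h\<close>: there it takes
  its minimum over the polytope.\<close>

lemma real_cone:
 assumes nonneg: "!!i. rell i z >= 0"
 shows "z : convex_cone hull (emb ` Gs)"
proof (rule ccontr)
 assume n: "z ~: convex_cone hull (emb ` Gs)"
 obtain ys where ys: "!!i. rv (u i) \<bullet> ys + real_of_int (a $ i) > 0" using interior_point_exists by blast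
 \<comment> \<open>At negative height, subtracting the multiple of an interior point would give a
   vector positive on all rays.\<close>
 have s: "fst z >= 0"
 proof (rule ccontr)
  assume "~ fst z >= 0"
  hence "rv (u i) \<bullet> (snd z - fst z \<cdot> ys) > 0" for i using nonneg[of i] mult_pos_pos[of "- fst z", OF _ ys[of i]]
   by (simp add: rell_def inner_diff_right algebra_simps)
  thus False by (rule positive_vector_zero)
 qed
 have cl: "closed (convex_cone hull (emb ` Gs))" using finite_Gs by (intro closed_convex_cone_hull) simp
 have cc: "convex_cone (convex_cone hull (emb ` Gs))" by (rule convex_cone_convex_cone_hull)
 hence "convex (convex_cone hull (emb ` Gs))" by (simp add: convex_cone_def)
 then obtain h b where hb: "h \<bullet> z < b" "!!x. x : convex_cone hull (emb ` Gs) ==> h \<bullet> x > b"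
  using separating_hyperplane_closed_point[OF _ cl n] by blast
 have "0 : convex_cone hull (emb ` Gs)" using cc by (rule convex_cone_contains_0)
 hence b0: "b < 0" using hb(2)[of 0] by simp
 have hn: "h \<bullet> g >= 0" if g: "g : emb ` Gs" for g
 proof (rule ccontr)
  assume "~ h \<bullet> g >= 0"
  hence neg: "h \<bullet> g < 0" by simp
  have "(b / (h \<bullet> g)) \<cdot> g : convex_cone hull (emb ` Gs)"
   using hull_inc[OF g] b0 neg by (intro convex_cone_scaleR[OF cc]) (simp add: divide_nonpos_nonpos)
  thus False using hb(2) neg by fastforce
 qed
 obtain si where si: "si : Sg" "snd h : si" using covers by blast
 have "snd h \<bullet> (snd z - fst z \<cdot> rv (vtx si)) >= 0"
 proof (rule cone_inner_nonneg[OF si])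
  fix i assume "i : crays si"
  hence "rv (u i) \<bullet> rv (vtx si) = - real_of_int (a $ i)" by (simp add: inner_rv vtx(2)[OF si(1)])
  thus "rv (u i) \<bullet> (snd z - fst z \<cdot> rv (vtx si)) >= 0" using nonneg[of i] by (simp add: rell_def inner_diff_right)
 qed
 moreover have "fst h + snd h \<bullet> rv (vtx si) >= 0"
  using hn[OF imageI[of "(1, vtx si)"]] si(1) by (simp add: Gs_def emb_def inner_prod_def)
 hence "fst z * (fst h + snd h \<bullet> rv (vtx si)) >= 0" using s by simp
 ultimately have "h \<bullet> z >= 0" by (simp add: inner_prod_def inner_diff_right algebra_simps)
 thus False using hb(1) b0 by simp
qed

text \<open>Here full dimension is used: a large multiple of the interior point absorbs any vector,
  so every vector is a difference of two points of the cone.\<close>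

lemma span_Gs: "span (emb ` Gs) = UNIV"
proof-
 obtain ys where ys: "!!i. rv (u i) \<bullet> ys + real_of_int (a $ i) > 0" using interior_point_exists by blast
 have cs: "convex_cone hull (emb ` Gs) <= span (emb ` Gs)" by (rule hull_minimal[OF span_superset]) (simp add: subspace_imp_convex_cone)
 have pos: "rell i (1, ys) > 0" for i using ys[of i] by (simp add: rell_def)
 have "z : span (emb ` Gs)" for z
 proof-
  define t where "t = (SUM i:UNIV. \<bar>rell i z\<bar> / rell i (1, ys))"
  have t: "t * rell i (1, ys) + rell i z >= 0" for i
  proof-
   have "\<bar>rell i z\<bar> / rell i (1, ys) <= t" unfolding t_def using pos by (intro member_le_sum) (auto simp: less_imp_le)
   hence "\<bar>rell i z\<bar> <= t * rell i (1, ys)" using pos[of i] by (simp add: pos_divide_le_eq)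
   thus ?thesis by linarith
  qed
  have "t >= 0" unfolding t_def using pos by (intro sum_nonneg) (simp add: less_imp_le)
  hence "rell i (t \<cdot> (1, ys)) >= 0" "rell i (t \<cdot> (1, ys) + z) >= 0" for i using t[of i] pos[of i]
   by (simp_all add: linear_add[OF linear_rell] linear_scale[OF linear_rell, of _ t] del: scaleR_Pair)
  hence "t \<cdot> (1, ys) : span (emb ` Gs)" "t \<cdot> (1, ys) + z : span (emb ` Gs)" using real_cone cs by blast+
  hence "t \<cdot> (1, ys) + z - t \<cdot> (1, ys) : span (emb ` Gs)" by (intro span_diff)
  thus ?thesis by simp
 qed
 thus ?thesis by blast
qed

lemma Gs_L: "Gs <= L"
 using vtx(1) by (auto simp: Gs_def L_def ell_def)

lemma additive_emb: "additive_map emb"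
 by (simp add: additive_map_def emb_def rv_add zero_prod_def)

lemma inj_emb: "inj emb"
 by (rule injI) (auto simp: emb_def prod_eq_iff)

lemma finite_lattice_ball: "finite {w. norm (emb w) <= r}"
proof-
 let ?Z = "{- \<lceil>r\<rceil>..\<lceil>r\<rceil>}" and ?V = "vec_lambda ` Pi\<^sub>E UNIV (%_. {- \<lceil>r\<rceil>..\<lceil>r\<rceil>}) :: (int ^ 'n) set"
 have Z: "k : ?Z" if "\<bar>real_of_int k\<bar> <= r" for k using that by (simp add: abs_le_iff) linarith
 have "w : ?Z \<times> ?V" if w: "norm (emb w) <= r" for w
 proof-
  have "\<bar>real_of_int (fst w)\<bar> <= r" using norm_fst_le[of "fst (emb w)" "snd (emb w)"] w by (simp add: emb_def)
  moreover have "\<bar>real_of_int (snd w $ i)\<bar> <= r" for i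
  proof-
   have "norm (rv (snd w)) <= r" using norm_snd_le[of "snd (emb w)" "fst (emb w)"] w by (simp add: emb_def)
   thus ?thesis using component_le_norm_cart[of "rv (snd w)" i] by (simp add: rv_def)
  qed
  ultimately have "fst w : ?Z" "vec_nth (snd w) : Pi\<^sub>E UNIV (%_. ?Z)" using Z by auto
  hence "snd w : ?V" by (intro image_eqI[of _ vec_lambda "vec_nth (snd w)"]) simp_all
  thus ?thesis using `fst w : ?Z` by (simp add: mem_Times_iff)
 qed
 hence "{w. norm (emb w) <= r} <= ?Z \<times> ?V" by blast
 moreover have "finite (?Z \<times> ?V)" by (intro finite_cartesian_product finite_imageI finite_PiE) auto
 ultimately show ?thesis by (rule finite_subset)
qed

lemma rell_nonzero: "EX x. rell i x ~= 0"
 using u_nonzero[of i] by (intro exI[of _ "(0, rv (u i))"]) (simp add: rell_def)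

lemma L_combination:
 assumes "w : L"
 shows "EX l. (ALL g:Gs. l g >= 0) & emb w = (SUM g:Gs. l g \<cdot> emb g)"
proof-
 have "emb w : convex_cone hull (emb ` Gs)" using assms by (intro real_cone) (simp add: rell_emb L_def)
 then obtain l where l: "ALL s:emb ` Gs. l s >= 0" "emb w = (SUM s:emb ` Gs. l s \<cdot> s)"
  using convex_cone_hull_finite_iff[of "emb ` Gs"] finite_Gs by blast
 have "emb w = (SUM g:Gs. l (emb g) \<cdot> emb g)" unfolding l(2) by (subst sum.reindex[OF inj_on_subset[OF inj_emb subset_UNIV]]) simp
 thus ?thesis using l(1) by (intro exI[of _ "%g. l (emb g)"]) simp
qed

sublocale cone_semigroup L fst emb Gs "UNIV :: 'k set" rell fst
proof (rule cone_semigroup.intro)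
 show "additive_map emb" "inj emb" "span (emb ` Gs) = UNIV" by (rule additive_emb inj_emb span_Gs)+
 show "linear (fst :: real \<times> (real ^ 'n) => real)" "finite Gs" "Gs <= L" by (rule linear_fst finite_Gs Gs_L)+
 show "finite (UNIV :: 'k set)" by simp
 show "finite {w. norm (emb w) <= r}" "linear (rell i)" "EX x. rell i x ~= 0" for r i
  by (rule finite_lattice_ball linear_rell rell_nonzero)+
 show "w : L ==> EX l. (ALL g:Gs. l g >= 0) & emb w = (SUM g:Gs. l g \<cdot> emb g)" for w by (rule L_combination)
 show "additive_map (fst :: int \<times> (int ^ 'n) => int)" by (simp add: additive_map_def)
 show "fst (emb w) = real_of_int (fst w)" for w by (simp add: emb_def)
 show "g : Gs ==> fst g = 1" for g by (auto simp: Gs_def)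
 show "rell i (emb w) : \<int>" for i w by (simp add: rell_emb)
 show "w : L <-> (ALL i:UNIV. rell i (emb w) >= 0)" for w by (simp add: rell_emb L_def)
qed

text \<open>Strict inequalities describe an open subset of the dilated polytope, so the lattice
  point is interior to it. Degree 0 is excluded by completeness.\<close>

lemma interior_degree:
 assumes "!!i. ell i w > 0"
 shows "fst w >= int (codegree (polytope_of u a))"
proof-
 have L: "w : L" using assms by (auto simp: L_def less_imp_le)
 have "fst w ~= 0"
 proof
  assume "fst w = 0"
  hence "rv (u i) \<bullet> rv (snd w) > 0" for i using assms[of i] by (simp add: inner_rv ell_def)
  thus False by (rule positive_vector_zero)
 qed
 hence pos: "fst w > 0" using deg_nonneg[OF L] by simp
 define m where "m = nat (fst w)"
 have m: "int m = fst w" "m >= 1" using pos by (auto simp: m_def)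
 have rm: "real m = real_of_int (fst w)" by (metis m(1) of_int_of_nat_eq)
 let ?S = "{y. ALL i. rv (u i) \<bullet> y + real m * real_of_int (a $ i) > 0}"
 have e: "x + b > 0 <-> x > - b" for x b :: real by linarith
 have "?S = (INT i. {y. rv (u i) \<bullet> y > - (real m * real_of_int (a $ i))})" unfolding e by auto
 hence op: "open ?S" by (simp add: open_halfspace_gt open_INT)
 have sub: "?S <= (%x. real m \<cdot> x) ` polytope_of u a"
 proof
  fix y assume y: "y : ?S"
  have "(1 / real m) \<cdot> y : polytope_of u a" unfolding polytope_of_def
  proof safe
   fix i
   have "real m * (rv (u i) \<bullet> ((1 / real m) \<cdot> y) + real_of_int (a $ i)) > 0" using y m(2) by (simp add: algebra_simps)
   thus "rv (u i) \<bullet> ((1 / real m) \<cdot> y) + real_of_int (a $ i) >= 0" unfolding zero_less_mult_iff by linarith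
  qed
  thus "y : (%x. real m \<cdot> x) ` polytope_of u a" by (rule rev_image_eqI) (use m(2) in simp)
 qed
 have "rv (snd w) : ?S"
 proof safe
  fix i
  have "real_of_int (ell i w) > 0" using assms by simp
  thus "rv (u i) \<bullet> rv (snd w) + real m * real_of_int (a $ i) > 0" unfolding rm by (simp add: ell_def inner_rv)
 qed
 hence "rv (snd w) : rel_interior ((%x. real m \<cdot> x) ` polytope_of u a)"
  using interior_maximal[OF sub op] interior_subset_rel_interior by blast
 hence "codegree (polytope_of u a) <= m" unfolding codegree_def using m(2) by (intro Least_le) blast
 thus ?thesis using m(1) by simp
qed

lemma countable_lattice: "countable (UNIV :: (int \<times> (int ^ 'n)) set)"
 using countable_SIGMA[of "UNIV :: int set" "%_. UNIV :: (int ^ 'n) set"] countable_int_vec by simp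

end

section \<open>Dehomogenization\<close>

lemma monmap_compose: "monmap h (monmap k r) = monmap (h \<circ> k) r"
proof-
 have "monmap h (monmap k r) = (SUM w:pkeys r. monmap h (msing (k w) (lkp r w)))" by (simp add: monmap_def[of k] monext_def monmap_sum)
 thus ?thesis by (simp add: monmap_def[of "h \<circ> k"] monext_def monmap_single)
qed

lemma monmap_cong: "(!!w. w : pkeys r ==> h w = k w) ==> monmap h r = monmap k r"
 by (simp add: monmap_def monext_def)

lemma monmap_shift:
 fixes h :: "'g => 'h::comm_monoid_add"
 assumes "!!w. w : pkeys r ==> k w = z + h w"
 shows "monmap k r = msing z 1 * monmap h r"
 using assms by (simp add: monmap_def monext_def sum_distrib_left mult_single)

lemma monmap_pscale: "monmap h (pscale c r) = pscale c (monmap h r)" for h :: "'g::comm_monoid_add => 'h::comm_monoid_add"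
proof-
 have "monmap h (pscale c r) = monmap h (SUM w:pkeys r. msing w (c * lkp r w))"
  by (subst pm_sum_single[of r]) (simp add: pscale_cst sum_distrib_left mult_single)
 also have "... = (SUM w:pkeys r. msing (h w) (c * lkp r w))" by (simp add: monmap_sum monmap_single)
 also have "... = pscale c (monmap h r)" by (simp add: pscale_cst monmap_def monext_def sum_distrib_left mult_single)
 finally show ?thesis .
qed

lemma monmap_mret:
 assumes "inj h" "pkeys r <= range h"
 shows "monmap h (mret h r) = r"
proof (rule poly_mapping_eqI)
 fix x
 show "lkp (monmap h (mret h r)) x = lkp r x"
 proof (cases "x : range h")
  case True
  then obtain y where "x = h y" by blast
  thus ?thesis by (simp only: lookup_monmap[OF assms(1)] lookup_mret[OF assms(1)])
 next
  case False
  hence "x ~: pkeys (monmap h (mret h r))" "x ~: pkeys r" using keys_monmap[of h "mret h r"] assms(2) by blast+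
  thus ?thesis by (simp add: in_keys_iff)
 qed
qed

lemma ideal_gen_image_iff:
 assumes "finite A"
 shows "g : ideal_gen (f ` A) <-> (EX h. g = (SUM j:A. h j * f j))"
proof
 let ?T = "{g. EX h. g = (SUM j:A. h j * f j)}"
 have "f ` A <= ?T"
 proof safe
  fix j assume j: "j : A"
  have "f j = (SUM i:A. (if i = j then 1 else 0) * f i)" using assms j by (simp add: if_distrib[of "%x. x * _"] cong: if_cong)
  thus "EX h. f j = (SUM i:A. h i * f i)" by (rule exI[of _ "%i. if i = j then 1 else 0"])
 qed
 moreover have "module.subspace (*) ?T" unfolding module.subspace_def[OF module_mult]
 proof (intro conjI ballI allI)
  show "0 : ?T" by (auto intro: exI[of _ "%_. 0"])
  fix x y assume "x : ?T" "y : ?T"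
  then obtain h k where "x = (SUM j:A. h j * f j)" "y = (SUM j:A. k j * f j)" by blast
  hence "x + y = (SUM j:A. (h j + k j) * f j)" by (simp add: sum.distrib algebra_simps)
  thus "x + y : ?T" by (intro CollectI exI[of _ "%j. h j + k j"])
 next
  fix c x assume "x : ?T"
  then obtain h where "x = (SUM j:A. h j * f j)" by blast
  hence "c * x = (SUM j:A. (c * h j) * f j)" by (simp add: sum_distrib_left algebra_simps)
  thus "c * x : ?T" by (intro CollectI exI[of _ "%j. c * h j"])
 qed
 ultimately have "ideal_gen (f ` A) <= ?T" unfolding ideal_gen_def by (rule module.span_minimal[OF module_mult])
 thus "g : ideal_gen (f ` A) ==> EX h. g = (SUM j:A. h j * f j)" by blast
 assume "EX h. g = (SUM j:A. h j * f j)"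
 then obtain h where g: "g = (SUM j:A. h j * f j)" by blast
 show "g : ideal_gen (f ` A)" unfolding g ideal_gen_def
  by (intro module.span_sum[OF module_mult] module.span_scale[OF module_mult] module.span_base[OF module_mult]) simp
qed

definition cint :: "nat ^ 'k => int ^ 'k" where "cint e = vec_lambda (%i. int (e $ i))"

definition cnat :: "int ^ 'k => nat ^ 'k" where "cnat z = vec_lambda (%i. nat (z $ i))"

lemma cint_cnat: "(!!i. z $ i >= 0) ==> cint (cnat z) = z"
 by (simp add: cint_def cnat_def vec_eq_iff)

lemma cint_nth [simp]: "cint e $ i = int (e $ i)"
 by (simp add: cint_def)

lemma additive_cint: "additive_map cint"
 by (simp add: additive_map_def vec_eq_iff)

lemma inj_cint: "inj cint"
 by (rule injI) (simp add: vec_eq_iff)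

lemma laur_monmap: "laur = monmap cint"
 by (simp add: fun_eq_iff laur_def monmap_def monext_def cint_def)

lemma homogenize_monmap: "homogenize u = monmap (cdiv u)"
 by (simp add: fun_eq_iff homogenize_def monmap_def monext_def)

lemma laur_mult: "laur (g * h) = laur g * laur h"
 unfolding laur_monmap by (rule monmap_mult[OF additive_cint])

lemma laur_inj: "laur g = laur h ==> g = h"
 unfolding laur_monmap by (rule monmap_inj[OF inj_cint])

lemma laur_surj:
 assumes "!!z i. z : pkeys r ==> z $ i >= 0"
 shows "laur (monmap cnat r) = r"
proof-
 have "monmap (cint \<circ> cnat) r = monmap id r" using assms by (intro monmap_cong) (simp add: cint_cnat)
 also have "... = r" using pm_sum_single[of r] by (simp add: monmap_def monext_def)
 finally show ?thesis by (simp add: laur_monmap monmap_compose)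
qed

lemma laur_sum: "laur (sum F A) = (SUM i:A. laur (F i))"
 by (simp add: laur_monmap monmap_sum)

lemma cox_piece_iff: "g : cox_piece al <-> cint ` pkeys g <= al"
 by (auto simp: cox_piece_def cint_def)

lemma additive_cdiv: "additive_map (cdiv u)"
 by (simp add: additive_map_def cdiv_def vec_eq_iff pairing_add_right)

context nef_divisor
begin

definition iota :: "int \<times> (int ^ 'n) => int ^ 'k" where
 "iota w = vec_lambda (%i. ell i w)"

lemma iota_nth [simp]: "iota w $ i = ell i w" by (simp add: iota_def)

lemma iota_eq: "iota (m, p) = m *s a + cdiv u p"
 by (simp add: vec_eq_iff ell_def cdiv_def)

lemma additive_iota: "additive_map iota"
 by (simp add: additive_map_def vec_eq_iff ell_add ell_0)

lemma ell_zero: "(!!i. ell i w = 0) ==> w = 0"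
proof-
 assume z: "!!i. ell i w = 0"
 have "w : L" "- w : L" using z ell_diff[of _ 0 w] by (simp_all add: L_def ell_0)
 hence "fst w = 0" using deg_nonneg[of w] deg_nonneg[of "- w"] by simp
 thus ?thesis using L_deg_0 `w : L` by blast
qed

lemma inj_iota: "inj iota"
proof (rule injI)
 fix v w assume "iota v = iota w"
 hence "ell i (v - w) = 0" for i by (metis ell_diff iota_nth right_minus_eq)
 thus "v = w" using ell_zero[of "v - w"] by simp
qed

lemma inj_cdiv: "inj (cdiv u)"
proof (rule injI)
 fix p q assume "cdiv u p = cdiv u q"
 hence "iota (0, p) = iota (0, q)" by (simp add: iota_eq)
 thus "p = q" using inj_iota by (simp add: inj_eq)
qed

text \<open>Identifies the pieces of the Cox ring in multiples of the class with the graded pieces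
  of the section ring; monomials of other classes are discarded. \<open>co\<close> is the way
  back.\<close>

definition dh :: "'k cox => (int \<times> (int ^ 'n)) \<Rightarrow>\<^sub>0 complex" where
 "dh g = mret iota (laur g)"

definition co :: "((int \<times> (int ^ 'n)) \<Rightarrow>\<^sub>0 complex) => 'k cox" where
 "co r = monmap cnat (monmap iota r)"

lemma divisor_class_multiple: "z : divisor_class u (m *s a) <-> (EX p. z = iota (m, p))"
 by (auto simp: divisor_class_iff iota_eq)

lemma co_laur:
 assumes "r : monalg L"
 shows "laur (co r) = monmap iota r"
 unfolding co_def
proof (rule laur_surj)
 fix z i assume "z : pkeys (monmap iota r)"
 then obtain w where "w : pkeys r" "z = iota w" using keys_monmap[of iota r] by blast
 thus "z $ i >= 0" using assms by (auto simp: monalg_def L_def)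
qed

lemma dh_co: "r : monalg L ==> dh (co r) = r"
 by (simp add: dh_def co_laur mret_monmap[OF inj_iota])

lemma cox_piece_laur:
 assumes "g : cox_piece (divisor_class u (m *s a))"
 shows "laur g = monmap iota (dh g)"
proof-
 have "pkeys (laur g) <= divisor_class u (m *s a)"
  using assms keys_monmap[of cint g] unfolding cox_piece_iff laur_monmap by (rule order_trans[rotated])
 hence "pkeys (laur g) <= range iota" using divisor_class_multiple by blast
 thus ?thesis unfolding dh_def by (rule monmap_mret[OF inj_iota, symmetric])
qed

lemma mret_iota_monalg: "mret iota (laur g) : monalg L"
 unfolding monalg_def
proof safe
 fix m p assume "(m, p) : pkeys (mret iota (laur g))"
 hence "iota (m, p) : pkeys (laur g)" by (simp add: in_keys_iff lookup_mret[OF inj_iota])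
 then obtain e where "iota (m, p) = cint e" unfolding laur_monmap using keys_monmap[of cint g] by blast
 hence "ell i (m, p) = int (e $ i)" for i by (metis cint_nth iota_nth)
 thus "(m, p) : L" by (simp add: L_def)
qed

lemma dh_LR:
 assumes g: "g : cox_piece (divisor_class u (m *s a))"
 shows "dh g : LR m"
proof-
 have "fst w = m" if w: "w : pkeys (dh g)" for w
 proof-
  have "iota w : pkeys (laur g)" using w by (simp add: dh_def in_keys_iff lookup_mret[OF inj_iota])
  hence "iota w : cint ` pkeys g" using keys_monmap[of cint g] unfolding laur_monmap by (rule rev_subsetD)
  hence "iota w : divisor_class u (m *s a)" using g unfolding cox_piece_iff by (rule rev_subsetD)
  then obtain p where "iota w = iota (m, p)" using divisor_class_multiple by blast
  hence "w = (m, p)" using inj_iota by (simp add: inj_eq)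
  thus ?thesis by simp
 qed
 thus ?thesis using mret_iota_monalg[of g] by (auto simp: LR_def monalg_def dh_def)
qed

lemma co_piece:
 assumes r: "r : LR m"
 shows "co r : cox_piece (divisor_class u (m *s a))"
 unfolding cox_piece_iff
proof
 fix z assume "z : cint ` pkeys (co r)"
 hence "z : pkeys (laur (co r))" unfolding laur_monmap keys_monmap_inj[OF inj_cint] .
 then obtain w where w: "w : pkeys r" "z = iota w" unfolding co_laur[OF LR_monalg[OF r]] using keys_monmap[of iota r] by blast
 have "w = (m, snd w)" using r w(1) by (auto simp: LR_def prod_eq_iff)
 thus "z : divisor_class u (m *s a)" unfolding divisor_class_multiple w(2) by (intro exI[of _ "snd w"]) simp
qed

lemma co_dh: "g : cox_piece (divisor_class u (m *s a)) ==> co (dh g) = g"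
 by (rule laur_inj) (simp add: co_laur LR_monalg[OF dh_LR] cox_piece_laur)

lemma co_pscale: "co (pscale c r) = pscale c (co r)"
 by (simp add: co_def monmap_pscale)

text \<open>Division of a section of degree m by the m-th power of the section
  \<open>vtx si\<close>, which generates the line bundle on \<open>U_si\<close>.\<close>

definition dk :: "(real ^ 'n) set => int \<times> (int ^ 'n) => int ^ 'n" where
 "dk si w = snd w - fst w *s vtx si"

abbreviation dhom :: "(real ^ 'n) set => ((int \<times> (int ^ 'n)) \<Rightarrow>\<^sub>0 complex) => (int ^ 'n) \<Rightarrow>\<^sub>0 complex" where
 "dhom si == monmap (dk si)"

lemma additive_dk: "additive_map (dk si)"
 by (auto simp: additive_map_def dk_def vec_eq_iff algebra_simps)

lemma dk_add: "dk si (v + w) = dk si v + dk si w" and dk_0: "dk si 0 = 0"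
 using additive_dk[of si] unfolding additive_map_def by blast+

lemma pairing_dk: "si : Sg ==> i : crays si ==> pairing (u i) (dk si w) = ell i w"
 by (simp add: dk_def pairing_diff_right pairing_scale_right vtx(2) ell_def)

lemma dk_dual: "si : Sg ==> w : L ==> dk si w : dsg si"
 by (simp add: dsg_iff pairing_dk L_def)

lemma dk_perp: "si : Sg ==> dk si w : perp si <-> (ALL i:crays si. ell i w = 0)"
 by (simp add: perp_def pairing_dk)

lemma dhom_cring: "si : Sg ==> r : monalg L ==> dhom si r : cring si"
 using keys_monmap[of "dk si" r] dk_dual by (force simp: cring_def monalg_def)

lemma iota_dhom:
 assumes "r : LR m"
 shows "monmap iota r = msing (iota (m, m *s vtx si)) 1 * monmap (cdiv u) (dhom si r)"
 unfolding monmap_compose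
proof (rule monmap_shift)
 fix w assume "w : pkeys r"
 hence "fst w = m" using assms by (auto simp: LR_def)
 thus "iota w = iota (m, m *s vtx si) + (cdiv u \<circ> dk si) w" by (simp add: vec_eq_iff ell_def cdiv_def dk_def pairing_diff_right)
qed

end

section \<open>The equations in the Cox ring, in the section ring and in the charts\<close>

locale toric_system = nef_divisor Sg u a
 for Sg :: "(real ^ 'n) set set" and u :: "'k::finite => int ^ 'n" and a :: "int ^ 'k" +
 fixes f :: "nat => 'k cox" and d :: "nat => nat" and I :: "'k cox set" and n :: nat
 assumes n: "n = CARD('n)" and fpiece: "!!j. j : {1..n} ==> f j : cox_piece (divisor_class u (int (d j) *s a))"
  and I: "I = ideal_gen (f ` {1..n})"
begin

abbreviation J :: "nat set" where "J == {1..n}"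

definition fp :: "nat => (int \<times> (int ^ 'n)) \<Rightarrow>\<^sub>0 complex" where "fp j = dh (f j)"

abbreviation Fi :: "int => ((int \<times> (int ^ 'n)) \<Rightarrow>\<^sub>0 complex) set" where
 "Fi m == LR.gid J fp (%j. int (d j)) m"

lemma fp_LR: "j : J ==> fp j : LR (int (d j))"
 unfolding fp_def by (rule dh_LR[OF fpiece])

lemma fp_laurent: "j : J ==> laur (f j) = monmap iota (fp j)"
 unfolding fp_def by (rule cox_piece_laur[OF fpiece])

lemma I_iff: "g : I <-> (EX h. g = (SUM j:J. h j * f j))"
 unfolding I by (rule ideal_gen_image_iff) simp

text \<open>The coefficients of a combination in the Cox ring are arbitrary polynomials. The
  retraction along \<open>iota\<close> moves them into the section ring, and homogeneous components
  fix their degrees.\<close>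

lemma ideal_piece:
 assumes g: "g : cox_piece (divisor_class u (m *s a))"
 shows "g : I <-> dh g : Fi m"
proof
 assume "g : I"
 then obtain h where h: "g = (SUM j:J. h j * f j)" using I_iff by blast
 have "dh g = (SUM j:J. mret iota (laur (h j) * monmap iota (fp j)))"
  unfolding dh_def h by (simp add: laur_sum laur_mult fp_laurent mret_sum[OF inj_iota])
 also have "... = (SUM j:J. dh (h j) * fp j)" by (simp add: mret_monmap_mult[OF inj_iota additive_iota] dh_def)
 finally have "hcomp m (dh g) = (SUM j:J. hcomp (m - int (d j)) (dh (h j)) * fp j)" by (simp add: hcomp_sum hcomp_mult[OF fp_LR])
 hence "dh g = (SUM j:J. hcomp (m - int (d j)) (dh (h j)) * fp j)" using hcomp_id[OF dh_LR[OF g]] by simp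
 moreover have "hcomp (m - int (d j)) (dh (h j)) : LR (m - int (d j))" for j by (rule hcomp_LR) (simp add: dh_def mret_iota_monalg)
 ultimately show "dh g : Fi m" unfolding LR.gid_def by (intro CollectI exI[of _ "%j. hcomp (m - int (d j)) (dh (h j))"]) simp
next
 assume "dh g : Fi m"
 then obtain t where t: "!!j. j : J ==> t j : LR (m - int (d j))" "dh g = (SUM j:J. t j * fp j)" unfolding LR.gid_def by blast
 have "laur g = (SUM j:J. monmap iota (t j) * monmap iota (fp j))"
  unfolding cox_piece_laur[OF g] t(2) by (simp add: monmap_sum monmap_mult[OF additive_iota])
 also have "... = (SUM j:J. laur (co (t j) * f j))"
  by (intro sum.cong refl) (simp only: laur_mult fp_laurent co_laur[OF LR_monalg[OF t(1)]])
 finally have "g = (SUM j:J. co (t j) * f j)" by (intro laur_inj) (simp add: laur_sum)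
 thus "g : I" unfolding I_iff by (rule exI[of _ "%j. co (t j)"])
qed

lemma x_hat_laurent:
 "laur (x_hat u si) = msing (vec_lambda (%i. if i : crays si then 0 else 1)) 1" unfolding laur_monmap x_hat_def monmap_single
 by (rule arg_cong[of _ _ "%z. msing z 1"]) (simp add: vec_eq_iff crays_def)

text \<open>On \<open>U_si\<close> each \<open>f j\<close> is its dehomogenization times a monomial
  that involves only variables inverted there, hence a unit.\<close>

lemma chart_ideal_iff:
 assumes si: "si : Sg"
 shows "g : chart_ideal u I si <-> (EX s. (ALL j:J. s j : cring si) & g = (SUM j:J. s j * dhom si (fp j)))"
proof
 define xh :: "int ^ 'k" where "xh = vec_lambda (%i. if i : crays si then 0 else 1)"
 define bb where "bb j = iota (int (d j), int (d j) *s vtx si)" for j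
 have bb0: "bb j $ i = 0" if "i : crays si" for i j using vtx(2)[OF si that] by (simp add: bb_def ell_def pairing_scale_right)
 have xh_power: "laur (x_hat u si) ^ l = msing (nmul l xh) 1" for l by (simp add: x_hat_laurent msing_power xh_def)
 have nmul_xh: "nmul l xh $ i = (if i : crays si then 0 else int l)" for l i by (induction l) (simp_all add: nmul_Suc xh_def)
 have fj: "laur (f j) = msing (bb j) 1 * monmap (cdiv u) (dhom si (fp j))" if "j : J" for j
  unfolding fp_laurent[OF that] bb_def by (rule iota_dhom[OF fp_LR[OF that]])
 have cr: "cring si = monalg (dsg si)" by (simp add: cring_def monalg_def)
 {
  assume "g : chart_ideal u I si"
  then obtain l h where h: "laur (SUM j:J. h j * f j) = laur (x_hat u si) ^ l * homogenize u g" using I_iff by (auto simp: chart_ideal_def)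
  have "homogenize u g = msing (- nmul l xh) 1 * (msing (nmul l xh) 1 * homogenize u g)" by (simp add: mult_single flip: mult.assoc)
  also have "... = msing (- nmul l xh) 1 * laur (SUM j:J. h j * f j)" unfolding h xh_power ..
  also have "... = (SUM j:J. (msing (bb j - nmul l xh) 1 * laur (h j)) * monmap (cdiv u) (dhom si (fp j)))"
  proof-
   have "msing (- nmul l xh) 1 * (laur (h j) * laur (f j)) =
     (msing (- nmul l xh) 1 * msing (bb j) 1) * laur (h j) * monmap (cdiv u) (dhom si (fp j))" if "j : J" for j
    unfolding fj[OF that] by (simp only: ac_simps)
   thus ?thesis by (simp add: laur_sum laur_mult sum_distrib_left mult_single)
  qed
  finally have "mret (cdiv u) (homogenize u g) =
    (SUM j:J. mret (cdiv u) (msing (bb j - nmul l xh) 1 * laur (h j)) * dhom si (fp j))"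
   by (simp add: mret_sum[OF inj_cdiv] mret_monmap_mult[OF inj_cdiv additive_cdiv])
  hence g: "g = (SUM j:J. mret (cdiv u) (msing (bb j - nmul l xh) 1 * laur (h j)) * dhom si (fp j))"
   by (simp add: homogenize_monmap mret_monmap[OF inj_cdiv])
  have "mret (cdiv u) (msing (bb j - nmul l xh) 1 * laur (h j)) : cring si" for j unfolding cr monalg_def
  proof safe
   fix p assume "p : pkeys (mret (cdiv u) (msing (bb j - nmul l xh) 1 * laur (h j)))"
   hence "cdiv u p - (bb j - nmul l xh) : pkeys (laur (h j))" by (simp add: in_keys_iff lookup_mret[OF inj_cdiv] lookup_single_mult)
   then obtain e where e: "cdiv u p - (bb j - nmul l xh) = cint e" unfolding laur_monmap using keys_monmap[of cint "h j"] by blast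
   show "p : dsg si" unfolding dsg_iff[OF si]
   proof
    fix i assume "i : crays si"
    thus "0 <= pairing (u i) p" using arg_cong[OF e, of "%z. z $ i"] by (simp add: nmul_xh bb0 cdiv_def)
   qed
  qed
  thus "EX s. (ALL j:J. s j : cring si) & g = (SUM j:J. s j * dhom si (fp j))"
   by (intro exI[of _ "%j. mret (cdiv u) (msing (bb j - nmul l xh) 1 * laur (h j))"] conjI g) blast
 next
  assume "EX s. (ALL j:J. s j : cring si) & g = (SUM j:J. s j * dhom si (fp j))"
  then obtain s where s: "!!j. j : J ==> s j : cring si" and g: "g = (SUM j:J. s j * dhom si (fp j))" by blast
  have gr: "g : cring si" unfolding g cr using s dhom_cring[OF si LR_monalg[OF fp_LR]] submon_dual
   by (intro monalg_sum monalg_mult) (auto simp: cr)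
  define X where "X = (%(j, p, i). bb j $ i - pairing (u i) p) ` (SIGMA j:J. pkeys (s j) \<times> (UNIV :: 'k set))"
  \<comment> \<open>A power of \<open>x_hat\<close> large enough to clear all negative exponents of
    the coefficients after division by the monomials \<open>bb j\<close>.\<close>
  define l where "l = nat (Max (insert 0 X))"
  have finX: "finite X" unfolding X_def by (intro finite_imageI finite_SigmaI) auto
  have bound: "bb j $ i - pairing (u i) p <= int l" if "j : J" "p : pkeys (s j)" for i j p
  proof-
   have "bb j $ i - pairing (u i) p : X" unfolding X_def using that by (intro image_eqI[of _ _ "(j, p, i)"]) auto
   hence "bb j $ i - pairing (u i) p <= Max (insert 0 X)" using finX by simp
   also have "... <= int l" by (simp add: l_def)
   finally show ?thesis .
  qed
  define q where "q j = msing (nmul l xh - bb j) 1 * monmap (cdiv u) (s j)" for j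
  have q: "laur (monmap cnat (q j)) = q j" if j: "j : J" for j
  proof (rule laur_surj)
   fix z i assume "z : pkeys (q j)"
   hence "z - (nmul l xh - bb j) : pkeys (monmap (cdiv u) (s j))" by (simp add: q_def in_keys_iff lookup_single_mult)
   then obtain p where p: "p : pkeys (s j)" "z - (nmul l xh - bb j) = cdiv u p" using keys_monmap[of "cdiv u" "s j"] by blast
   have "z $ i = nmul l xh $ i - bb j $ i + pairing (u i) p" using arg_cong[OF p(2), of "%z. z $ i"] by (simp add: cdiv_def)
   moreover have "pairing (u i) p >= 0" if "i : crays si" using s[OF j] p(1) that unfolding cring_def dsg_iff[OF si, symmetric]
    by (auto simp: dsg_iff[OF si])
   ultimately show "z $ i >= 0" using bound[OF j p(1), of i] bb0[of i j] by (simp add: nmul_xh)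
  qed
  have "laur (SUM j:J. monmap cnat (q j) * f j) = (SUM j:J. q j * laur (f j))" by (simp add: laur_sum laur_mult q)
  also have "... = (SUM j:J. msing (nmul l xh) 1 * monmap (cdiv u) (s j * dhom si (fp j)))"
  proof (rule sum.cong[OF refl])
   fix j assume j: "j : J"
   have "q j * laur (f j) = (msing (nmul l xh - bb j) 1 * msing (bb j) 1) *
     (monmap (cdiv u) (s j) * monmap (cdiv u) (dhom si (fp j)))" unfolding fj[OF j] q_def by (simp only: ac_simps)
   thus "q j * laur (f j) = msing (nmul l xh) 1 * monmap (cdiv u) (s j * dhom si (fp j))"
    by (simp add: mult_single monmap_mult[OF additive_cdiv])
  qed
  also have "... = laur (x_hat u si) ^ l * homogenize u g" by (simp add: xh_power homogenize_monmap g monmap_sum sum_distrib_left)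
  finally have e: "laur (SUM j:J. monmap cnat (q j) * f j) = laur (x_hat u si) ^ l * homogenize u g" .
  have "(SUM j:J. monmap cnat (q j) * f j) : I" unfolding I_iff by (rule exI[of _ "%j. monmap cnat (q j)"]) simp
  thus "g : chart_ideal u I si" using gr e unfolding chart_ideal_def by blast
 }
qed

text \<open>The point as a character of the section ring, with the generator at \<open>ta\<close> as
  trivialization. Another trivialization would rescale it in each degree.\<close>

definition etac :: "(real ^ 'n) set => (int ^ 'n => complex) => int \<times> (int ^ 'n) => complex" where
 "etac ta th w = orbc ta th (dk ta w)"

lemma etac_nonzero:
 assumes "ta : Sg" "mchar UNIV th"
 shows "etac ta th w ~= 0 <-> (ALL i:crays ta. ell i w = 0)"
 unfolding etac_def orbc_nonzero[OF assms(2)] dk_perp[OF assms(1)] ..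

lemma etac_character:
 assumes "ta : Sg" "mchar UNIV th"
 shows "mchar L (etac ta th)"
 using orbc_character[OF assms] dk_dual[OF assms(1)] by (simp add: mchar_def etac_def dk_add dk_0)

lemma etac_vtx: "ta : Sg ==> mchar UNIV th ==> etac ta th (1, vtx ta) = 1"
 by (simp add: etac_def dk_def orbc_def perp_def mchar_def)

lemma etac_nonirr: "ta : Sg ==> mchar UNIV th ==> nonirr (etac ta th)"
 unfolding nonirr_def by (rule bexI[of _ "(1, vtx ta)"]) (auto simp: etac_vtx Gs_def)

lemma vtx_diff_perp: "ta : Sg ==> si : Sg ==> ta <= si ==> m *s (vtx ta - vtx si) : perp ta"
 using crays_mono[of ta si] by (auto simp: perp_def pairing_scale_right pairing_diff_right vtx(2))

text \<open>The unit in front is the transition function between the trivializations at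
  \<open>ta\<close> and at \<open>si\<close>.\<close>

lemma cval_dhom:
 assumes ta: "ta : Sg" "mchar UNIV th" and si: "si : Sg" "ta <= si" and r: "r : LR m"
 shows "cval si (dhom si r) (opt ta th) = th (m *s (vtx ta - vtx si)) * mev (etac ta th) r"
proof-
 let ?z = "m *s (vtx ta - vtx si)"
 have z: "?z : perp ta" by (rule vtx_diff_perp[OF ta(1) si])
 have "(orbc ta th \<circ> dk si) w = th ?z * etac ta th w" if "w : pkeys r" for w
 proof-
  have w: "w : L" "fst w = m" using r that by (auto simp: LR_def)
  have "dk si w = ?z + dk ta w" using w(2) by (simp add: dk_def vec_eq_iff algebra_simps)
  hence "orbc ta th (dk si w) = orbc ta th ?z * orbc ta th (dk ta w)"
   using orbc_character[OF ta] perp_dual[OF ta(1) z] dk_dual[OF ta(1) w(1)] by (simp add: mchar_def)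
  thus ?thesis using z by (simp add: etac_def orbc_def)
 qed
 hence "mev (orbc ta th \<circ> dk si) r = (SUM w:pkeys r. th ?z * (lkp r w * etac ta th w))"
  by (simp add: mev_def monext_def algebra_simps)
 thus ?thesis using cval_opt[OF si dhom_cring[OF si(1) LR_monalg[OF r]]]
  by (simp add: mev_monmap mev_def[of "etac ta th"] monext_def sum_distrib_left)
qed

lemma Var_opt:
 assumes ta: "ta : Sg" "mchar UNIV th"
 shows "opt ta th : Var Sg u I <-> (ALL j:J. mev (etac ta th) (fp j) = 0)"
proof
 assume V: "opt ta th : Var Sg u I"
 show "ALL j:J. mev (etac ta th) (fp j) = 0"
 proof
  fix j assume j: "j : J"
  have "dhom ta (fp j) = (SUM i:J. (if i = j then 1 else 0) * dhom ta (fp i))"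
   using j by (simp add: if_distrib[of "%x. x * _"] cong: if_cong)
  moreover have "(if i = j then 1 else 0) : cring ta" for i
   using monalg_1[OF submon_dual[of ta]] monalg_0[of "dsg ta"] by (simp add: cring_def monalg_def)
  ultimately have "dhom ta (fp j) : chart_ideal u I ta"
   unfolding chart_ideal_iff[OF ta(1)] by (intro exI[of _ "%i. if i = j then 1 else 0"]) simp
  moreover have "opt ta th : cpts Sg ta" using cpts_opt[OF ta] ta(1) by simp
  ultimately have "cval ta (dhom ta (fp j)) (opt ta th) = 0" using V ta(1) by (simp add: Var_def)
  thus "mev (etac ta th) (fp j) = 0" using cval_dhom[OF ta ta(1) subset_refl fp_LR[OF j]] ta(2) mchar_inverse(2)[OF ta(2)] by simp
 qed
next
 assume z: "ALL j:J. mev (etac ta th) (fp j) = 0"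
 have "cval si g (opt ta th) = 0" if si: "si : Sg" "opt ta th : cpts Sg si" and g: "g : chart_ideal u I si" for si g
 proof-
  have sub: "ta <= si" using cpts_opt[OF ta] si(2) by blast
  obtain s where s: "!!j. j : J ==> s j : cring si" "g = (SUM j:J. s j * dhom si (fp j))" using g chart_ideal_iff[OF si(1)] by blast
  have "g : cring si" using g by (simp add: chart_ideal_def)
  hence "cval si g (opt ta th) = mev (orbc ta th) g" by (rule cval_opt[OF si(1) sub])
  also have "... = (SUM j:J. mev (orbc ta th) (s j * dhom si (fp j)))" unfolding s(2) by (rule mev_sum)
  also have "... = 0"
  proof (rule sum.neutral, rule ballI)
   fix j assume j: "j : J"
   have dr: "dhom si (fp j) : cring si" by (rule dhom_cring[OF si(1) LR_monalg[OF fp_LR[OF j]]])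
   have "mev (orbc ta th) (dhom si (fp j)) = 0" using cval_opt[OF si(1) sub dr] cval_dhom[OF ta si(1) sub fp_LR[OF j]] z j by simp
   moreover have "monalg (dsg si) <= monalg (dsg ta)" using dual_mono[OF sub] by (auto simp: monalg_def)
   hence "s j : monalg (dsg ta)" "dhom si (fp j) : monalg (dsg ta)" using s(1)[OF j] dr by (auto simp: cring_def monalg_def)
   ultimately show "mev (orbc ta th) (s j * dhom si (fp j)) = 0" using mev_mult[OF orbc_character[OF ta]] by simp
  qed
  finally show ?thesis .
 qed
 moreover have "opt ta th : tvar Sg" using tvar_opt ta by blast
 ultimately show "opt ta th : Var Sg u I" by (simp add: Var_def)
qed

end

section \<open>Finiteness of zero-dimensional subvarieties\<close>

text \<open>Zorn's lemma is applied to families whose finite intersections are infinite; closure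
  under supersets and intersections and primality follow from maximality.\<close>

lemma free_ultrafilter:
 assumes "infinite (W :: 'a set)"
 obtains F where "W : F" "!!A. A : F ==> A <= W" "!!A B. A : F ==> B : F ==> A Int B : F"
  "!!A B. A : F ==> A <= B ==> B <= W ==> B : F"
  "!!A B. A <= W ==> B <= W ==> A Un B : F ==> A : F | B : F" "!!A. A : F ==> infinite A"
proof-
 define P where "P = {F. F <= Pow W & (ALL G. finite G --> G <= F --> infinite (W Int \<Inter>G))}"
 have "{} : P" using assms by (auto simp: P_def)
 hence "P ~= {}" by blast
 moreover have "\<Union>C : P" if C: "C ~= {}" "subset.chain P C" for C
 proof-
  have CP: "C <= P" using C(2) by (simp add: subset_chain_def)
  have "infinite (W Int \<Inter>G)" if G: "finite G" "G <= \<Union>C" for G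
  proof-
   obtain B where B: "B : C" "G <= B" by (rule finite_subset_Union_chain[OF G C])
   hence "B : P" using CP by blast
   thus ?thesis using B(2) G(1) by (simp add: P_def)
  qed
  moreover have "\<Union>C <= Pow W" using CP by (auto simp: P_def)
  ultimately show ?thesis by (simp add: P_def)
 qed
 ultimately have "EX F:P. ALL X:P. F <= X --> X = F" by (rule subset_Zorn_nonempty)
 then obtain F where F: "F : P" "!!X. X : P ==> F <= X ==> X = F" by blast
 have FW: "A <= W" if "A : F" for A using F(1) that by (auto simp: P_def)
 have Finf: "infinite (W Int \<Inter>G)" if "finite G" "G <= F" for G using F(1) that by (auto simp: P_def)
 \<comment> \<open>Maximality in usable form: a set left out has finite intersection with finitely
   many members.\<close>
 have small: "EX G. finite G & G <= F & finite (W Int \<Inter>G Int A)" if A: "A <= W" "A ~: F" for A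
 proof (rule ccontr)
  assume n: "~ ?thesis"
  have "insert A F : P" unfolding P_def
  proof (intro CollectI conjI allI impI)
   show "insert A F <= Pow W" using A FW by blast
   fix G assume G: "finite G" "G <= insert A F"
   have GA: "finite (G - {A})" "G - {A} <= F" using G by auto
   have sub: "W Int \<Inter>(G - {A}) Int A <= W Int \<Inter>G"
   proof
    fix x assume "x : W Int \<Inter>(G - {A}) Int A"
    thus "x : W Int \<Inter>G" by (cases "A : G") auto
   qed
   show "infinite (W Int \<Inter>G)"
   proof
    assume "finite (W Int \<Inter>G)"
    hence "finite (W Int \<Inter>(G - {A}) Int A)" by (rule finite_subset[OF sub])
    thus False using n GA by (metis (no_types))
   qed
  qed
  hence "insert A F = F" by (rule F(2)) (rule subset_insertI)
  thus False using A(2) by blast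
 qed
 have mem: "B : F" if B: "B <= W" "finite G" "G <= F" "W Int \<Inter>G <= B" for B G
 proof (rule ccontr)
  assume "B ~: F"
  obtain G' where G': "finite G'" "G' <= F" "finite (W Int \<Inter>G' Int B)" using small[OF B(1) `B ~: F`] by (elim exE conjE)
  have "W Int \<Inter>(G Un G') <= W Int \<Inter>G' Int B" using B(4) by auto
  hence "finite (W Int \<Inter>(G Un G'))" using G'(3) by (rule finite_subset)
  thus False using Finf[of "G Un G'"] B(2,3) G'(1,2) by simp
 qed
 show ?thesis
 proof (rule that)
  show "W : F" by (rule mem[of _ "{}"]) auto
  show "A : F ==> A <= W" for A by (rule FW)
  show "A : F ==> infinite A" for A using Finf[of "{A}"] FW[of A] by (auto simp: Int_absorb1)
  show "A : F ==> B : F ==> A Int B : F" for A B by (rule mem[of _ "{A, B}"]) (use FW in auto)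
  show "A : F ==> A <= B ==> B <= W ==> B : F" for A B by (rule mem[of _ "{A}"]) auto
  show "A : F | B : F" if AB: "A <= W" "B <= W" "A Un B : F" for A B
  proof (rule ccontr)
   assume "~ (A : F | B : F)"
   hence n: "A ~: F" "B ~: F" by simp_all
   obtain G where G: "finite G" "G <= F" "finite (W Int \<Inter>G Int A)" using small[OF AB(1) n(1)] by (elim exE conjE)
   obtain G' where G': "finite G'" "G' <= F" "finite (W Int \<Inter>G' Int B)"  using small[OF AB(2) n(2)] by (elim exE conjE)
   have "W Int \<Inter>(insert (A Un B) (G Un G')) <= (W Int \<Inter>G Int A) Un (W Int \<Inter>G' Int B)" by auto
   hence "finite (W Int \<Inter>(insert (A Un B) (G Un G')))" by (rule finite_subset) (use G G' in blast)
   thus False using Finf[of "insert (A Un B) (G Un G')"] G(1,2) G'(1,2) AB(3) by simp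
  qed
 qed
qed

section \<open>The Zariski topology in the charts\<close>

context ctfan
begin

lemma cring_monalg: "cring si = monalg (dsg si)"
 by (simp add: cring_def monalg_def)

lemma chart_pointE:
 assumes "ze : cpts Sg si"
 obtains ta th where "ta : Sg" "mchar UNIV th" "ze = opt ta th" "si : Sg" "ta <= si"
proof-
 have "ze : tvar Sg" using assms by (simp add: cpts_def)
 then obtain ta th where t: "ta : Sg" "mchar UNIV th" "ze = opt ta th" using tvar_opt by blast
 thus ?thesis using cpts_opt[OF t(1,2), of si] assms that by simp
qed

lemma chart_character:
 assumes "ze : cpts Sg si"
 obtains ga where "mchar (dsg si) ga"
  "!!g. g : cring si ==> cval si g ze = mev ga g"
proof-
 obtain ta th where t: "ta : Sg" "mchar UNIV th" "ze = opt ta th" "si : Sg" "ta <= si" using chart_pointE[OF assms] by blast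
 have "mchar (dsg si) (orbc ta th)" using orbc_character[OF t(1,2)] dual_mono[OF t(5)] by (auto simp: mchar_def)
 thus ?thesis using that cval_opt[OF t(4,5)] t(3) by blast
qed

lemma chart_point_exists:
 assumes si: "si : Sg" and ga: "mchar (dsg si) ga"
 obtains ze where "ze : cpts Sg si" "!!g. g : cring si ==> cval si g ze = mev ga g"
proof-
 let ?g = "restrict ga (dsg si)"
 have "?g : chart si" using ga submon_dual[of si] by (auto simp: chart_iff mchar_def submon_def)
 then obtain ta th where t: "ta : Sg" "ta <= si" "mchar UNIV th" "?g = restrict (orbc ta th) (dsg si)" using chart_canonical[OF si] by blast
 have e: "ga m = orbc ta th m" if "m : dsg si" for m using fun_cong[OF t(4), of m] that by simp
 have "cval si g (opt ta th) = mev ga g" if g: "g : cring si" for g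
 proof-
  have "mev (orbc ta th) g = mev ga g" by (rule mev_cong) (use g e in "auto simp: cring_def")
  thus ?thesis using cval_opt[OF si t(2) g] by simp
 qed
 thus ?thesis using that cpts_opt[OF t(1,3)] si t(2) by blast
qed

lemma chart_separated:
 assumes "ze : cpts Sg si" "xx : cpts Sg si"
  and "!!m. m : dsg si ==> cval si (msing m 1) ze = cval si (msing m 1) xx"
 shows "ze = xx"
proof-
 obtain ta th where t: "ta : Sg" "mchar UNIV th" "ze = opt ta th" "si : Sg" "ta <= si" using chart_pointE[OF assms(1)] by blast
 obtain ta' th' where t': "ta' : Sg" "mchar UNIV th'" "xx = opt ta' th'" "si : Sg" "ta' <= si" using chart_pointE[OF assms(2)] by blast
 have "orbc ta th m = orbc ta' th' m" if m: "m : dsg si" for m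
 proof-
  have "msing m (1 :: complex) : cring si" using m by (simp add: cring_def)
  thus ?thesis using assms(3)[OF m] t(3) t'(3) cval_opt[OF t(4,5)] cval_opt[OF t'(4,5)] by simp
 qed
 hence "restrict (orbc ta th) (dsg si) = restrict (orbc ta' th') (dsg si)" by (auto simp: restrict_def)
 thus ?thesis using gluing_class[OF t(1,2,4,5)] gluing_class[OF t'(1,2,4,5)] t(3) t'(3) by simp
qed

definition bopen :: "(real ^ 'n) set => ((int ^ 'n) \<Rightarrow>\<^sub>0 complex) => 'n toric_point set" where
 "bopen si g = {ze : cpts Sg si. cval si g ze ~= 0}"

lemma open_basic: "si : Sg ==> g : cring si ==> openin (zariski Sg) (bopen si g)"
 unfolding zariski_def bopen_def by (rule topology_generated_by_Basis) blast

lemma one_cring: "1 : cring si"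
 unfolding cring_monalg by (rule monalg_1[OF submon_dual])

lemma cval_one: "ze : cpts Sg si ==> cval si 1 ze = 1"
 by (erule chart_character) (simp add: one_cring mev_one mchar_def)

lemma bopen_one: "bopen si 1 = cpts Sg si"
 by (auto simp: bopen_def cval_one)

lemma topspace_zariski: "topspace (zariski Sg) = tvar Sg"
proof
 show "topspace (zariski Sg) <= tvar Sg" by (auto simp: zariski_def cpts_def)
 show "tvar Sg <= topspace (zariski Sg)"
 proof
  fix ze assume "ze : tvar Sg"
  then obtain ta th where t: "ta : Sg" "mchar UNIV th" "ze = opt ta th" using tvar_opt by blast
  hence "ze : bopen ta 1" using cpts_opt[OF t(1,2), of ta] by (simp add: bopen_one)
  thus "ze : topspace (zariski Sg)" using openin_subset[OF open_basic[OF t(1) one_cring]] by blast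
 qed
qed

lemma cval_mult:
 assumes "ze : cpts Sg si" "g : cring si" "h : cring si"
 shows "cval si (g * h) ze = cval si g ze * cval si h ze" "g * h : cring si"
proof-
 obtain ga where ga: "mchar (dsg si) ga"
  "!!g. g : cring si ==> cval si g ze = mev ga g" using chart_character[OF assms(1)] by blast
 show m: "g * h : cring si" using assms(2,3) unfolding cring_monalg by (rule monalg_mult[OF submon_dual])
 show "cval si (g * h) ze = cval si g ze * cval si h ze" using mev_mult[OF ga(1)] assms(2,3) m by (simp add: ga(2) flip: cring_monalg)
qed

text \<open>The intersection with another chart is where the functional \<open>m0\<close>, exposing
  the common face, is nonzero. A multiple of \<open>m0\<close> clears the exponents of g, and one
  more factor confines the set to the intersection.\<close>

lemma bopen_restrict:
 assumes si: "si : Sg" and ta: "ta : Sg" and g: "g : cring si"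
 obtains h where "h : cring ta" "bopen ta h = bopen si g Int cpts Sg ta"
proof-
 have i: "ta Int si : Sg" using cone_inter si ta by blast
 obtain m0 where m0: "m0 : dsg ta" "m0 : perp (ta Int si)"
  "!!i. i : crays ta ==> pairing (u i) m0 = 0 ==> i : crays (ta Int si)" using face_functional[OF i ta Int_lower1] by blast
 define k where "k = nat (SUM m:pkeys g. SUM i:UNIV. \<bar>pairing (u i) m\<bar>)"
 have "nmul k m0 + m : dsg ta" if m: "m : pkeys g" for m unfolding dsg_iff[OF ta]
 proof
  fix i assume i: "i : crays ta"
  show "0 <= pairing (u i) (nmul k m0 + m)"
  proof (cases "i : crays (ta Int si)")
   case True
   hence "pairing (u i) m0 = 0" using m0(2) by (simp add: perp_def)
   moreover have "m : dsg si" "i : crays si" using g m True by (auto simp: cring_def crays_def)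
   ultimately show ?thesis using si by (simp add: pairing_add_right pairing_nmul dsg_iff)
  next
   case False
   hence "pairing (u i) m0 ~= 0" "pairing (u i) m0 >= 0" using m0(1,3) i ta by (auto simp: dsg_iff)
   hence "int k * pairing (u i) m0 >= int k * 1" by (intro mult_left_mono) auto
   moreover have "\<bar>pairing (u i) m\<bar> <= (SUM i:UNIV. \<bar>pairing (u i) m\<bar>)" by (rule member_le_sum) auto
   moreover have "(SUM i:UNIV. \<bar>pairing (u i) m\<bar>) <= (SUM m:pkeys g. SUM i:UNIV. \<bar>pairing (u i) m\<bar>)"
    by (rule member_le_sum[OF m]) (auto intro: sum_nonneg)
   ultimately have "\<bar>pairing (u i) m\<bar> <= int k" "int k <= int k * pairing (u i) m0" unfolding k_def by linarith+
   thus ?thesis unfolding pairing_add_right pairing_nmul by linarith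
  qed
 qed
 hence sh: "msing (nmul k m0) 1 * g : cring ta" by (auto simp: cring_def in_keys_iff lookup_single_mult)
   (metis add.commute diff_add_cancel in_keys_iff)
 have s0: "msing m0 (1 :: complex) : cring ta" using m0(1) by (simp add: cring_def)
 let ?h = "msing m0 1 * (msing (nmul k m0) 1 * g)"
 have hr: "?h : cring ta" using s0 sh unfolding cring_monalg by (rule monalg_mult[OF submon_dual])
 have "ze : bopen ta ?h <-> ze : bopen si g" if "ze : cpts Sg ta" for ze
 proof-
  obtain rh th where t: "rh : Sg" "mchar UNIV th" "ze = opt rh th" "rh <= ta" using chart_pointE[OF `ze : cpts Sg ta`] by blast
  have v: "cval ta ?h ze = orbc rh th m0 * mev (orbc rh th) (msing (nmul k m0) 1 * g)"
   using cval_mult(1)[OF that s0 sh] cval_opt[OF ta t(4) s0] cval_opt[OF ta t(4) sh] t(3) by simp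
  show ?thesis
  proof (cases "rh <= si")
   case True
   have "m0 : perp rh" using m0(2) crays_mono[of rh "ta Int si"] True t(4) by (auto simp: perp_def)
   hence nz: "orbc rh th m0 ~= 0" "orbc rh th (nmul k m0) ~= 0" "nmul k m0 : dsg rh"
    using orbc_nonzero[OF t(2)] nmul_mem[OF submon_perp] perp_dual[OF t(1)] by auto
   have "mev (orbc rh th) (msing (nmul k m0) 1 * g) = orbc rh th (nmul k m0) * mev (orbc rh th) g"
    using mev_mult[OF orbc_character[OF t(1,2)], of "msing (nmul k m0) 1" g] nz(3) g dual_mono[OF True] by (auto simp: monalg_def cring_def)
   hence "cval ta ?h ze ~= 0 <-> cval si g ze ~= 0" using v nz cval_opt[OF si True g] t(3) by simp
   moreover have "ze : cpts Sg si" using cpts_opt[OF t(1,2)] si True t(3) by simp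
   ultimately show ?thesis using that by (simp add: bopen_def)
  next
   case False
   have "m0 ~: perp rh"
   proof
    assume "m0 : perp rh"
    hence "crays rh <= crays (ta Int si)" using m0(3) crays_mono[OF t(4)] by (auto simp: perp_def)
    thus False using cone_subset[OF t(1) i] False by blast
   qed
   hence "cval ta ?h ze = 0" using v by (simp add: orbc_def)
   moreover have "ze ~: cpts Sg si" using cpts_opt[OF t(1,2)] False t(3) by simp
   ultimately show ?thesis by (simp add: bopen_def)
  qed
 qed
 hence "bopen ta ?h = bopen si g Int cpts Sg ta" by (auto simp: bopen_def)
 thus ?thesis using that hr by blast
qed

lemma open_chart:
 assumes "openin (zariski Sg) U" "ze : U" "ze : cpts Sg ta" and ta: "ta : Sg"
 shows "EX g:cring ta. ze : bopen ta g & bopen ta g <= U"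
proof-
 have "generate_topology_on {{ze : cpts Sg si. cval si g ze ~= 0} | si g. si : Sg & g : cring si} U"
  using assms(1) unfolding zariski_def openin_topology_generated_by_iff .
 thus ?thesis using assms(2)
 proof (induction rule: generate_topology_on.induct)
  case Empty thus ?case by simp
 next
  case (Int A B)
  from Int.prems have "ze : A" "ze : B" by auto
  obtain g where g: "g : cring ta" "ze : bopen ta g" "bopen ta g <= A" using Int.IH(1)[OF `ze : A`] by blast
  obtain h where h: "h : cring ta" "ze : bopen ta h" "bopen ta h <= B" using Int.IH(2)[OF `ze : B`] by blast
  have "bopen ta (g * h) = bopen ta g Int bopen ta h" using cval_mult(1)[OF _ g(1) h(1)] by (auto simp: bopen_def)
  thus ?case using g h cval_mult(2)[OF assms(3) g(1) h(1)] by (intro bexI[of _ "g * h"]) auto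
 next
  case (UN K) thus ?case by blast
 next
  case (Basis S)
  then obtain si g where s: "S = bopen si g" "si : Sg" "g : cring si" by (auto simp: bopen_def)
  obtain h where "h : cring ta" "bopen ta h = bopen si g Int cpts Sg ta" using bopen_restrict[OF s(2) ta s(3)] by blast
  thus ?case using s(1) Basis.prems assms(3) by (intro bexI[of _ h]) auto
 qed
qed

lemma cval_shift:
 assumes m: "m : dsg si"
 shows "msing m 1 - cst c : cring si"
  and "ze : cpts Sg si ==> cval si (msing m 1 - cst c) ze = cval si (msing m 1) ze - c"
proof-
 have mr: "msing m (1::complex) : cring si" using m by (simp add: cring_def)
 show g: "msing m 1 - cst c : cring si" unfolding cring_monalg
  using mr monalg_cst[OF submon_dual] by (intro monalg_diff) (auto simp: cring_monalg)
 assume "ze : cpts Sg si"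
 then obtain ga where ga: "mchar (dsg si) ga"
  "!!g. g : cring si ==> cval si g ze = mev ga g" using chart_character by blast
 show "cval si (msing m 1 - cst c) ze = cval si (msing m 1) ze - c"
  using ga(1) by (simp add: ga(2)[OF g] ga(2)[OF mr]) (simp add: mev_diff mchar_def)
qed

lemma point_closed:
 assumes "xx : tvar Sg"
 shows "closedin (zariski Sg) {xx}"
 unfolding closedin_def topspace_zariski
proof (intro conjI)
 show "{xx} <= tvar Sg" using assms by simp
 show "openin (zariski Sg) (tvar Sg - {xx})"
 proof (subst openin_subopen, rule ballI)
  fix ze assume z: "ze : tvar Sg - {xx}"
  then obtain ta th where t: "ta : Sg" "mchar UNIV th" "ze = opt ta th" using tvar_opt by blast
  have zt: "ze : cpts Sg ta" using cpts_opt[OF t(1,2)] t by simp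
  have "EX g:cring ta. ze : bopen ta g & xx ~: bopen ta g"
  proof (cases "xx : cpts Sg ta")
   case True
   then obtain m where m: "m : dsg ta" "cval ta (msing m 1) ze ~= cval ta (msing m 1) xx" using chart_separated[OF zt True] z by blast
   define g where "g = msing m 1 - cst (cval ta (msing m 1) xx)"
   have g: "g : cring ta" "cval ta g ze ~= 0" "cval ta g xx = 0" using m cval_shift[OF m(1)] zt True by (simp_all add: g_def)
   thus ?thesis using zt by (intro bexI[of _ g]) (auto simp: bopen_def)
  next
   case False
   thus ?thesis using zt one_cring by (intro bexI[of _ 1]) (auto simp: bopen_one)
  qed
  then obtain g where g: "g : cring ta" "ze : bopen ta g" "xx ~: bopen ta g" by blast
  have o: "openin (zariski Sg) (bopen ta g)" by (rule open_basic[OF t(1) g(1)])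
  thus "EX T. openin (zariski Sg) T & ze : T & T <= tvar Sg - {xx}" using g openin_subset[OF o] unfolding topspace_zariski by blast
 qed
qed

text \<open>Reducing coefficients modulo 1 in a lattice basis of the span leaves vectors of bounded
  norm, of which there are finitely many. Generation is expressed through closed sets
  \<open>D\<close>.\<close>

lemma perp_generated:
 obtains E where "finite E" "E <= perp ta"
  "!!D. E <= D ==> 0 : D ==> (!!v w. v : D ==> w : D ==> v + w : D) ==> (!!v. v : D ==> - v : D) ==> perp ta <= D"
proof-
 let ?H = "rv ` perp ta"
 obtain B where B: "B <= ?H" "independent B" "?H <= span B" using basis_exists[of ?H] by metis
 have finB: "finite B" using B(2) by (rule independent_imp_finite)
 define E where "E = {m : perp ta. norm (rv m) <= (SUM b:B. norm b)}"
 show ?thesis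
 proof (rule that[of E])
  have "finite {v :: int ^ 'n. norm (rv v) <= r}" for r
  proof-
   let ?V = "vec_lambda ` Pi\<^sub>E UNIV (%_. {- \<lceil>r\<rceil>..\<lceil>r\<rceil>}) :: (int ^ 'n) set"
   have "v : ?V" if v: "norm (rv v) <= r" for v
   proof-
    have "\<bar>real_of_int (v $ i)\<bar> <= r" for i using component_le_norm_cart[of "rv v" i] v by (simp add: rv_def)
    hence "v $ i : {- \<lceil>r\<rceil>..\<lceil>r\<rceil>}" for i by (simp add: abs_le_iff) (smt (verit) le_of_int_ceiling of_int_le_iff of_int_minus)
    hence "vec_nth v : Pi\<^sub>E UNIV (%_. {- \<lceil>r\<rceil>..\<lceil>r\<rceil>})" by auto
    thus ?thesis by (intro image_eqI[of _ vec_lambda "vec_nth v"]) simp_all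
   qed
   hence "{v. norm (rv v) <= r} <= ?V" by blast
   moreover have "finite ?V" by (intro finite_imageI finite_PiE) auto
   ultimately show ?thesis by (rule finite_subset)
  qed
  thus "finite E" unfolding E_def by (rule rev_finite_subset) blast
  show "E <= perp ta" by (auto simp: E_def)
  fix D assume ED: "E <= D" and D0: "0 : D" and add: "!!v w. v : D ==> w : D ==> v + w : D"
   and neg: "!!v. v : D ==> - v : D"
  have nat: "int k *s v : D" if "v : D" for k v
  proof (induction k)
   case (Suc k)
   have "int (Suc k) *s v = v + int k *s v" by (simp add: vec_eq_iff algebra_simps)
   thus ?case using add that Suc by simp
  qed (simp add: D0)
  have int: "k *s v : D" if "v : D" for k v
  proof (cases "k >= 0")
   case True thus ?thesis using nat[OF that, of "nat k"] by simp
  next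
   case False
   have "k *s v = - (int (nat (- k)) *s v)" using False by (simp add: vec_eq_iff)
   thus ?thesis using neg[OF nat[OF that, of "nat (- k)"]] by (simp only:)
  qed
  define p where "p b = (SOME m. m : perp ta & rv m = b)" for b
  have p: "p b : perp ta & rv (p b) = b" if "b : B" for b unfolding p_def by (rule someI_ex) (use B(1) that in blast)
  have pE: "p b : E" if "b : B" for b using p[OF that] finB that by (simp add: E_def member_le_sum)
  show "perp ta <= D"
  proof
   fix m assume m: "m : perp ta"
   hence "rv m : span B" using B(3) by blast
   then obtain c where c: "rv m = (SUM b:B. c b \<cdot> b)" using span_finite[OF finB] by auto
   let ?z = "SUM b:B. \<lfloor>c b\<rfloor> *s p b"
   have rz: "rv ?z = (SUM b:B. real_of_int \<lfloor>c b\<rfloor> \<cdot> b)"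
   proof-
    have "rv (sum g A) = (SUM b:A. rv (g b))" for g :: "real ^ 'n => int ^ 'n" and A
     by (induction A rule: infinite_finite_induct) (simp_all add: rv_add)
    thus ?thesis using p by (simp add: rv_scale)
   qed
   have zp: "?z : perp ta" using p by (simp add: perp_def pairing_sum pairing_scale_right)
   have "rv (m - ?z) = (SUM b:B. frac (c b) \<cdot> b)" by (simp add: rv_diff rz c frac_def scaleR_diff_left sum_subtractf)
   moreover have "norm (SUM b:B. frac (c b) \<cdot> b) <= (SUM b:B. norm b)"
    by (rule sum_norm_le) (simp add: mult_left_le_one_le frac_lt_1 less_imp_le)
   ultimately have "m - ?z : E" using perp_diff[OF m zp] by (simp add: E_def)
   moreover have "sum (%b. \<lfloor>c b\<rfloor> *s p b) A : D" if "finite A" "A <= B" for A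
    using that by (induction A rule: finite_induct) (use D0 add int pE ED in "auto simp: subset_iff")
   hence "?z : D" using finB by blast
   ultimately have "(m - ?z) + ?z : D" using add ED by blast
   thus "m : D" by simp
  qed
 qed
qed

end

lemma infinite_singleton_contradiction:
 assumes "infinite {w : W. Q w}" "!!w w'. w : W ==> Q w ==> w' : W ==> Q w' ==> w = w'"
 shows False
proof-
 obtain w where "w : W" "Q w" using infinite_imp_nonempty[OF assms(1)] by blast
 hence "{w : W. Q w} <= {w}" using assms(2) by blast
 thus False using assms(1) finite_subset by blast
qed

locale zero_dim_system = toric_system Sg u a f d I n
 for Sg :: "(real ^ 'n) set set" and u :: "'k::finite => int ^ 'n" and a :: "int ^ 'k"
  and f :: "nat => 'k cox" and d :: "nat => nat" and I :: "'k cox set" and n :: nat +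
 assumes zd: "zero_dimensional Sg u I"
begin

abbreviation V :: "'n toric_point set" where "V == Var Sg u I"

lemma V_subset: "V <= tvar Sg"
 by (auto simp: Var_def)

lemma V_closed: "closedin (zariski Sg) V"
 unfolding closedin_def topspace_zariski
proof (intro conjI V_subset)
 show "openin (zariski Sg) (tvar Sg - V)"
 proof (subst openin_subopen, rule ballI)
  fix ze assume "ze : tvar Sg - V"
  then obtain si g where s: "si : Sg" "ze : cpts Sg si" "g : chart_ideal u I si" "cval si g ze ~= 0" by (auto simp: Var_def)
  have "g : cring si" using s(3) by (simp add: chart_ideal_def)
  hence o: "openin (zariski Sg) (bopen si g)" by (rule open_basic[OF s(1)])
  have "bopen si g <= tvar Sg - V" using s(1,3) openin_subset[OF o] by (auto simp: topspace_zariski bopen_def Var_def)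
  thus "EX T. openin (zariski Sg) T & ze : T & T <= tvar Sg - V" using o s by (intro exI[of _ "bopen si g"]) (simp add: bopen_def)
 qed
qed

lemma irreducible_subset_V:
 assumes Z: "irreducible_closed (zariski Sg) Z" "Z <= V" and "xx : Z" "xx' : Z"
 shows "xx = xx'"
proof (rule ccontr)
 assume n: "xx ~= xx'"
 let ?C = "%i::nat. if i = 0 then {xx} else Z"
 have "A = {xx} | B = {xx}" if "{xx} = A Un B" for A B using that[symmetric] unfolding Un_singleton_iff by blast
 moreover have "xx : tvar Sg" using assms V_subset by blast
 ultimately have "irreducible_closed (zariski Sg) {xx}" using point_closed[of xx] by (simp add: irreducible_closed_def)
 hence "irreducible_chain (zariski Sg) V 1" unfolding irreducible_chain_def by (intro exI[of _ ?C]) (use assms n in auto)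
 thus False using zd by (auto simp: zero_dimensional_def has_dimension_def)
qed

lemma V_nonempty: "V ~= {}"
 using zd by (auto simp: zero_dimensional_def has_dimension_def irreducible_chain_def irreducible_closed_def)

text \<open>Infinitely many points would lie in one orbit. Functions vanishing at almost all of
  them, along an ultrafilter, form a prime ideal, whose zero set has an irreducible closure inside
  the subvariety and is therefore a single point \<open>xx\<close>. Almost all of the points then
  share with \<open>xx\<close> the values of finitely many monomials that determine a point of the
  orbit.\<close>

lemma V_finite: "finite V"
proof (rule ccontr)
 assume inf: "infinite V"
 define W where "W ta = {opt ta th | th. mchar UNIV th & opt ta th : V}" for ta
 have "V <= (UN ta:Sg. W ta)" using V_subset tvar_opt by (force simp: W_def)
 hence "infinite (UN ta:Sg. W ta)" using inf finite_subset by blast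
 then obtain ta where ta: "ta : Sg" "infinite (W ta)" using finite_fan by blast
 obtain F where F: "W ta : F" "!!A. A : F ==> A <= W ta" "!!A B. A : F ==> B : F ==> A Int B : F"
  "!!A B. A : F ==> A <= B ==> B <= W ta ==> B : F"
  "!!A B. A <= W ta ==> B <= W ta ==> A Un B : F ==> A : F | B : F" "!!A. A : F ==> infinite A" by (fact free_ultrafilter[OF ta(2)])
 have Wc: "w : cpts Sg ta" if "w : W ta" for w using that cpts_opt[OF ta(1)] ta(1) by (auto simp: W_def)
 define z where "z g = {w : W ta. cval ta g w = 0}" for g
 define p where "p = {g : cring ta. z g : F}"
 have pr: "g : p <-> g : cring ta & z g : F" for g by (simp add: p_def)
 have zero_val: "cval ta 0 w = 0" for w by (simp add: cval_def)
 have vadd: "cval ta (g + h) w = cval ta g w + cval ta h w" if gh: "g : cring ta" "h : cring ta" "w : W ta" for g h w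
 proof-
  obtain ga where ga: "!!g. g : cring ta ==> cval ta g w = mev ga g" using chart_character[OF Wc[OF gh(3)]] by blast
  have "g + h : cring ta" using gh(1,2) unfolding cring_monalg by (rule monalg_add)
  thus ?thesis using gh by (simp add: ga mev_add)
 qed
 have ideal: "alg_ideal (dsg ta) p" unfolding alg_ideal_def
 proof (intro conjI ballI)
  show "p <= monalg (dsg ta)" by (auto simp: p_def cring_monalg)
  show "0 : p" using F(1) by (simp add: p_def cring_monalg monalg_0 z_def zero_val)
  fix g h assume g: "g : p" and h: "h : p"
  have "z g Int z h <= z (g + h)" using g h vadd by (auto simp: z_def pr)
  moreover have "z g Int z h : F" "z (g + h) <= W ta" using F(3)[of "z g" "z h"] g h by (auto simp: pr z_def)
  ultimately have "z (g + h) : F" using F(4) by blast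
  thus "g + h : p" using g h by (auto simp: pr cring_monalg monalg_add)
 next
  fix g h assume g: "g : monalg (dsg ta)" and h: "h : p"
  have gr: "g : cring ta" "h : cring ta" using g h by (simp_all add: cring_monalg pr)
  have "z h <= z (g * h)" using cval_mult(1)[OF Wc gr] by (auto simp: z_def)
  moreover have "z h : F" "z (g * h) <= W ta" using h by (auto simp: pr z_def)
  ultimately have "z (g * h) : F" using F(4) by blast
  thus "g * h : p" using gr by (simp add: pr cring_monalg monalg_mult[OF submon_dual])
 qed
 have prime: "g * h ~: p" if "g : cring ta" "h : cring ta" "g ~: p" "h ~: p" for g h
 proof
  assume "g * h : p"
  moreover have "z (g * h) = z g Un z h" using cval_mult(1)[OF Wc that(1,2)] by (auto simp: z_def)
  ultimately have "z g : F | z h : F" using F(5)[of "z g" "z h"] by (simp add: pr z_def)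
  thus False using that by (simp add: pr)
 qed
 have "z 1 = {}" using cval_one[OF Wc] by (simp add: z_def)
 hence one: "1 ~: p" using F(6)[of "{}"] by (auto simp: pr)
 define Y where "Y = {xx : cpts Sg ta. ALL g:p. cval ta g xx = 0}"
 have NS: "EX xx:Y. cval ta g xx ~= 0" if g: "g : cring ta" "g ~: p" for g
 proof-
  have pow: "g ^ N : cring ta & g ^ N ~: p" for N
  proof (induction N)
   case 0 thus ?case using one one_cring by simp
  next
   case (Suc N)
   thus ?case using prime[of g "g ^ N"] g cval_mult(2) monalg_mult[OF submon_dual, of g ta "g ^ N"] by (simp add: cring_monalg)
  qed
  obtain ga where ga: "mchar (dsg ta) ga" "!!r. r : p ==> mev ga r = 0" "mev ga g ~= 0"
   using nullstellensatz[OF submon_dual countable_subset[OF subset_UNIV countable_int_vec] ideal, of g] g(1) pow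
   unfolding cring_monalg by blast
  obtain xx where "xx : cpts Sg ta" "!!g. g : cring ta ==> cval ta g xx = mev ga g" using chart_point_exists[OF ta(1) ga(1)] by blast
  thus ?thesis using ga(2,3) g(1) by (intro bexI[of _ xx]) (auto simp: Y_def pr)
 qed
 have YX: "Y <= tvar Sg" by (auto simp: Y_def cpts_def)
 let ?Z = "zariski Sg closure_of Y"
 have YZ: "Y <= ?Z" using closure_of_subset[of Y "zariski Sg"] YX by (simp add: topspace_zariski)
 have sub: "?Z <= A" if "closedin (zariski Sg) A" "Y <= A" for A using closure_of_minimal[OF that(2,1)] .
 have cover: "Y <= A | Y <= B" if A: "closedin (zariski Sg) A" and B: "closedin (zariski Sg) B" and AB: "Y <= A Un B" for A B
 proof (rule ccontr)
  assume "~ ?thesis"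
  then obtain xx xx' where x: "xx : Y" "xx ~: A" "xx' : Y" "xx' ~: B" by blast
  have op: "openin (zariski Sg) (tvar Sg - A)" "openin (zariski Sg) (tvar Sg - B)"
   using A B by (simp_all add: closedin_def topspace_zariski)
  obtain g where g: "g : cring ta" "xx : bopen ta g" "bopen ta g <= tvar Sg - A"
   using open_chart[OF op(1), of xx ta] x YX ta(1) by (auto simp: Y_def)
  obtain h where h: "h : cring ta" "xx' : bopen ta h" "bopen ta h <= tvar Sg - B"
   using open_chart[OF op(2), of xx' ta] x YX ta(1) by (auto simp: Y_def)
  have "g ~: p" "h ~: p" using g(2) h(2) x by (auto simp: Y_def bopen_def)
  hence gh: "g * h ~: p" "g * h : cring ta" using prime g(1) h(1) monalg_mult[OF submon_dual] by (auto simp: cring_monalg)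
  then obtain hh where e: "hh : Y" "cval ta (g * h) hh ~= 0" using NS by blast
  have ec: "hh : cpts Sg ta" using e(1) by (simp add: Y_def)
  have "hh : bopen ta g" "hh : bopen ta h" using e(2) ec cval_mult(1)[OF ec g(1) h(1)] by (auto simp: bopen_def)
  thus False using g(3) h(3) AB e(1) by blast
 qed
 have ne: "Y ~= {}" using NS[OF one_cring one] by blast
 have irr: "irreducible_closed (zariski Sg) ?Z" unfolding irreducible_closed_def
 proof (intro conjI allI impI)
  show "closedin (zariski Sg) ?Z" by simp
  show "?Z ~= {}" using ne YZ by blast
  fix A B assume AB: "closedin (zariski Sg) A & closedin (zariski Sg) B & ?Z = A Un B"
  hence "Y <= A | Y <= B" using cover YZ by simp
  thus "A = ?Z | B = ?Z" using sub[of A] sub[of B] AB by blast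
 qed
 have YV: "Y <= V"
 proof
  fix xx assume xi: "xx : Y"
  hence "xx : cpts Sg ta" by (simp add: Y_def)
  then obtain rh th where r: "rh : Sg" "mchar UNIV th" "xx = opt rh th" "ta : Sg" "rh <= ta" by (rule chart_pointE)
  have "mev (etac rh th) (fp j) = 0" if j: "j : J" for j
  proof-
   have "cval ta (dhom ta (fp j)) w = 0" if "w : W ta" for w
    using that cval_dhom[OF ta(1) _ ta(1) subset_refl fp_LR[OF j]] Var_opt[OF ta(1)] j by (auto simp: W_def)
   hence "z (dhom ta (fp j)) = W ta" by (auto simp: z_def)
   hence "dhom ta (fp j) : p" using F(1) dhom_cring[OF ta(1) LR_monalg[OF fp_LR[OF j]]] by (simp add: pr)
   hence "cval ta (dhom ta (fp j)) xx = 0" using xi by (simp add: Y_def)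
   thus ?thesis using cval_dhom[OF r(1,2,4,5) fp_LR[OF j]] mchar_inverse(2)[OF r(2)] r(3) by simp
  qed
  thus "xx : V" using Var_opt[OF r(1,2)] r(3) by simp
 qed
 obtain xx where xi: "xx : Y" using ne by blast
 have uniq: "xx' = xx" if "xx' : Y" for xx' by (rule irreducible_subset_V[OF irr sub[OF V_closed YV]]) (use that xi YZ in auto)
 \<comment> \<open>The monomial minus its value at \<open>xx\<close> vanishes on the zero set
   {\<open>xx\<close>} of the prime ideal, so by the Nullstellensatz it belongs to the
   ideal.\<close>
 have large: "{w : W ta. cval ta (msing m 1) w = cval ta (msing m 1) xx} : F" if m: "m : dsg ta" for m
 proof-
  let ?g = "msing m 1 - cst (cval ta (msing m 1) xx)"
  have "cval ta ?g xx = 0" using cval_shift(2)[OF m] xi by (simp add: Y_def)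
  hence "?g : p" using NS[OF cval_shift(1)[OF m]] uniq by metis
  hence "z ?g : F" by (simp add: pr)
  moreover have "z ?g = {w : W ta. cval ta (msing m 1) w = cval ta (msing m 1) xx}" using cval_shift(2)[OF m Wc] by (auto simp: z_def)
  ultimately show ?thesis by simp
 qed
 obtain E where E: "finite E" "E <= perp ta"
  "!!D. E <= D ==> 0 : D ==> (!!v w. v : D ==> w : D ==> v + w : D) ==> (!!v. v : D ==> - v : D) ==> perp ta <= D" by (fact perp_generated)
 have "{w : W ta. ALL m:A. cval ta (msing m 1) w = cval ta (msing m 1) xx} : F" if "finite A" "A <= perp ta" for A using that
 proof (induction A rule: finite_induct)
  case empty thus ?case using F(1) by simp
 next
  case (insert m A)
  have "{w : W ta. ALL m:insert m A. cval ta (msing m 1) w = cval ta (msing m 1) xx} =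
   {w : W ta. cval ta (msing m 1) w = cval ta (msing m 1) xx} Int
   {w : W ta. ALL m:A. cval ta (msing m 1) w = cval ta (msing m 1) xx}" by auto
  thus ?case using F(3)[OF large[of m]] insert perp_dual[OF ta(1)] by simp
 qed
 from this[OF E(1,2)] have "infinite {w : W ta. ALL m:E. cval ta (msing m 1) w = cval ta (msing m 1) xx}" by (rule F(6))
 moreover have "w = w'" if w: "w : W ta" "ALL m:E. cval ta (msing m 1) w = cval ta (msing m 1) xx"
  "w' : W ta" "ALL m:E. cval ta (msing m 1) w' = cval ta (msing m 1) xx" for w w'
 proof-
  obtain th where t: "w = opt ta th" "mchar UNIV th" using w(1) by (auto simp: W_def)
  obtain th' where t': "w' = opt ta th'" "mchar UNIV th'" using w(3) by (auto simp: W_def)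
  have val: "cval ta (msing m 1) (opt ta ph) = ph m" if "m : perp ta" for m ph
   using cval_opt[OF ta(1) subset_refl, of "msing m 1" ph] that perp_dual[OF ta(1) that] by (simp add: cring_def orbc_def)
  have "perp ta <= {m. th m = th' m}"
  proof (rule E(3))
   show "E <= {m. th m = th' m}"
   proof
    fix m assume m: "m : E"
    hence "m : perp ta" using E(2) by blast
    thus "m : {m. th m = th' m}" using bspec[OF w(2) m] bspec[OF w(4) m] val[of m] unfolding t(1) t'(1) mem_Collect_eq by metis
   qed
   show "0 : {m. th m = th' m}" using t(2) t'(2) by (simp add: mchar_def)
   show "v + w : {m. th m = th' m}" if "v : {m. th m = th' m}" "w : {m. th m = th' m}" for v w
    using that t(2) t'(2) by (simp add: mchar_def)
   show "- v : {m. th m = th' m}" if "v : {m. th m = th' m}" for v using that mchar_inverse[OF t(2), of v] mchar_inverse[OF t'(2), of v]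
    by (simp add: mult_left_cancel) (metis mult_left_cancel)
  qed
  thus ?thesis unfolding t(1) t'(1) by (intro opt_cong) blast
 qed
 ultimately show False by (rule infinite_singleton_contradiction)
qed

end

section \<open>Points of the subvariety and characters of the section ring\<close>

context ctfan
begin

text \<open>\<open>y\<close> is the last point of \<open>ta\<close> on the segment from \<open>x\<close> to \<open>u\<^sub>i\<close>.\<close>

lemma exit_face:
 assumes ta: "ta : Sg" and x: "x : rel_interior ta" and i: "i ~: crays ta"
 obtains ta' y s p where "ta' : Sg" "ta' <= ta" "y : ta'" "0 <= s" "s < 1"
  "y = (1 - s) \<cdot> x + s \<cdot> rv (u i)" "p : perp ta'" "pairing (u i) p ~= 0"
proof-
 let ?U = "rv (u i)"
 define q where "q s = (1 - s) \<cdot> x + s \<cdot> ?U" for s :: real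
 have xt: "x : ta" using x rel_interior_subset by blast
 define S where "S = {0..1} Int q -` ta"
 have "continuous_on {0..1} q" unfolding q_def by (intro continuous_intros)
 hence "closed S" unfolding S_def by (rule continuous_closed_preimage[OF _ closed_atLeastAtMost cone_closed[OF ta]])
 hence "compact ({0..1} Int S)" by (rule compact_Int_closed[OF compact_Icc])
 moreover have "{0..1} Int S = S" by (auto simp: S_def)
 ultimately have "compact S" by simp
 moreover have "0 : S" using xt by (simp add: S_def q_def)
 ultimately obtain s where s: "s : S" "!!t. t : S ==> t <= s" using compact_attains_sup[of S] by blast
 have s01: "0 <= s" "s <= 1" "q s : ta" using s(1) by (auto simp: S_def)
 have "s ~= 1" using s01(3) i by (auto simp: q_def crays_def)
 hence s1: "s < 1" using s01 by simp
 obtain ta' where ta': "ta' : Sg" "q s : rel_interior ta'" using relint_cone_exists by blast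
 have ys: "q s : ta'" using ta'(2) rel_interior_subset by blast
 have sub: "ta' <= ta"
 proof-
  have "ta' <= ta' Int ta" by (rule subset_of_face_of[OF inter_face[OF ta'(1) ta] subset_refl]) (use ta'(2) s01(3) ys in blast)
  thus ?thesis by blast
 qed
 \<comment> \<open>Otherwise the segment could be continued inside \<open>ta'\<close>, hence inside
   \<open>ta\<close>, beyond its last point.\<close>
 have nspan: "?U ~: span ta'"
 proof
  assume U: "?U : span ta'"
  have ah: "affine hull ta' = span ta'" using cone_0[OF ta'(1)] by (intro affine_hull_span_0 hull_inc)
  obtain e where e: "e > 0" "ball (q s) e Int span ta' <= ta'" using ta'(2) unfolding mem_rel_interior_ball ah by blast
  define ep where "ep = min 1 (e / 2 / (norm (?U - q s) + 1))"
  have n0: "norm (?U - q s) + 1 > 0" using norm_ge_zero[of "?U - q s"] by linarith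
  have ep: "0 < ep" "ep <= 1" using e(1) n0 by (simp_all add: ep_def)
  have "ep * (norm (?U - q s) + 1) <= e / 2 / (norm (?U - q s) + 1) * (norm (?U - q s) + 1)"
   using n0 by (intro mult_right_mono) (simp_all add: ep_def)
  also have "... = e / 2" using less_imp_neq[OF n0] by (metis nonzero_eq_divide_eq)
  finally have "ep * norm (?U - q s) + ep <= e / 2" by (simp add: distrib_left)
  hence "ep * norm (?U - q s) < e" using e(1) ep(1) by linarith
  hence "q s + ep \<cdot> (?U - q s) : ball (q s) e" using ep by (simp add: dist_norm)
  moreover have "q s + ep \<cdot> (?U - q s) : span ta'" using U span_base[OF ys] by (intro span_add span_scale span_diff)
  ultimately have m: "q s + ep \<cdot> (?U - q s) : ta" using e(2) sub by blast
  have "q s + ep \<cdot> (?U - q s) = q (s + ep * (1 - s))" by (simp add: q_def algebra_simps)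
  moreover have "s + ep * (1 - s) <= 1" using mult_right_mono[OF ep(2), of "1 - s"] less_imp_le[OF s1] by auto
  ultimately have "s + ep * (1 - s) : S" using m s01(1) s1 ep(1) by (simp add: S_def)
  hence "ep * (1 - s) <= 0" using s(2) by fastforce
  thus False using ep(1) s1 by (simp add: mult_le_0_iff)
 qed
 obtain z1 z2 where z: "z1 : span ta'" "!!w. w : span ta' ==> orthogonal z2 w" "?U = z1 + z2" by (fact orthogonal_subspace_decomp_exists)
 have zz: "w \<bullet> z2 = 0" if "w : span ta'" for w using z(2)[OF that] by (metis orthogonal_def inner_commute)
 have z2: "z2 ~= 0" using nspan z(1,3) by auto
 have "rv b \<bullet> z2 = 0" if "b : u ` crays ta'" for b
 proof-
  have "rv b : span ta'" using that by (auto simp: crays_def intro: span_base)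
  thus ?thesis by (rule zz)
 qed
 moreover have "?U \<bullet> z2 > 0" using zz[OF z(1)] z2 by (simp add: z(3) inner_add_left)
 ultimately obtain p where p: "ALL b:u ` crays ta'. pairing b p = 0" "ALL b:{u i}. pairing b p > 0"
  using integer_solution[of "u ` crays ta'" "{u i}" z2] by auto
 show ?thesis by (rule that[OF ta'(1) sub ys s01(1) s1 _ , of p]) (use p in "auto simp: q_def perp_def")
qed

end

context toric_system
begin

text \<open>Sums of exponents with nonzero value keep a nonzero value; adding a witness for every
  facet not containing all of them gives a point \<open>w0\<close> in the relative interior of the
  face where \<open>hh\<close> lives.\<close>

lemma face_point:
 assumes hh: "mchar L hh" "nonirr hh"
 obtains w0 where "w0 : L" "fst w0 > 0" "hh w0 ~= 0" "!!i w. ell i w0 = 0 ==> w : L ==> hh w ~= 0 ==> ell i w = 0"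
  "!!w. w : L ==> (!!i. ell i w0 = 0 ==> ell i w = 0) ==> hh w ~= 0"
proof-
 define K where "K = {i. EX w:L. hh w ~= 0 & ell i w ~= 0}"
 have "ALL i:K. EX w. w : L & hh w ~= 0 & ell i w ~= 0" by (auto simp: K_def)
 then obtain h where h: "!!i. i : K ==> h i : L & hh (h i) ~= 0 & ell i (h i) ~= 0" by metis
 obtain g where g: "g : Gs" "hh g ~= 0" using hh(2) by (auto simp: nonirr_def)
 have gL: "g : L" "fst g = 1" using g(1) Gs_L by (auto simp: Gs_def)
 have sums: "g + sum h A : L & hh (g + sum h A) ~= 0 & fst (g + sum h A) > 0 & (ALL i:A. ell i (g + sum h A) > 0)"
  if "finite A" "A <= K" for A using that
 proof (induction A rule: finite_induct)
  case empty thus ?case using g gL by simp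
 next
  case (insert a A)
  let ?w = "g + sum h A"
  have w: "?w : L" "hh ?w ~= 0" "fst ?w > 0" "ALL i:A. ell i ?w > 0" and a: "h a : L" "hh (h a) ~= 0" "ell a (h a) ~= 0"
   using insert h[of a] by auto
  have e: "g + sum h (insert a A) = ?w + h a" using insert by (simp add: algebra_simps)
  have "hh (?w + h a) ~= 0" using hh(1) w a by (simp add: mchar_def)
  moreover have "?w + h a : L" using submon_L w(1) a(1) by (simp add: submon_def)
  moreover have "fst (?w + h a) > 0" using w(3) deg_nonneg[OF a(1)] by simp
  moreover have "ell i (?w + h a) > 0" if i: "i : insert a A" for i
  proof-
   have nn: "ell i ?w >= 0" "ell i (h a) >= 0" using w(1) a(1) by (simp_all add: L_def)
   show ?thesis
   proof (cases "i = a")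
    case True
    hence "ell i (h a) ~= 0" using a(3) by simp
    thus ?thesis using nn unfolding ell_add[of i ?w] by linarith
   next
    case False
    hence "ell i ?w > 0" using i w(4) by blast
    thus ?thesis using nn unfolding ell_add[of i ?w] by linarith
   qed
  qed
  ultimately show ?case unfolding e by blast
 qed
 define w0 where "w0 = g + sum h K"
 have w0: "w0 : L" "hh w0 ~= 0" "fst w0 > 0" "!!i. i : K ==> ell i w0 > 0" using sums[of K] by (auto simp: w0_def)
 show ?thesis
 proof (rule that[OF w0(1,3,2)])
  show "ell i w = 0" if "ell i w0 = 0" "w : L" "hh w ~= 0" for i w using w0(4)[of i] that by (auto simp: K_def)
  show "hh w ~= 0" if "w : L" "!!i. ell i w0 = 0 ==> ell i w = 0" for w
   by (rule character_face[OF hh(1) that(1) w0(1,2)]) (simp add: rell_emb that(2))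
 qed
qed

lemma mev_scaled:
 assumes "!!w. w : L ==> hh' w = c ^ nat (fst w) * hh w" "r : LR m"
 shows "mev hh' r = c ^ nat m * mev hh r"
proof-
 have "lkp r w * hh' w = c ^ nat m * (lkp r w * hh w)" if "w : pkeys r" for w
 proof-
  have "w : L" "fst w = m" using assms(2) that by (auto simp: LR_def)
  thus ?thesis using assms(1)[of w] by simp
 qed
 thus ?thesis unfolding mev_def monext_def sum_distrib_left by (rule sum.cong[OF refl])
qed

end

context zero_dim_system
begin

text \<open>The subvariety avoids what the nef class contracts. If \<open>w0\<close> vanished on a
  further ray i, the one-parameter subgroup of \<open>u i\<close> would move the point, possibly in
  the larger orbit of a face \<open>ta'\<close>, through infinitely many points without affecting
  the equations.\<close>

lemma V_point_face:
 assumes ta: "ta : Sg" "mchar UNIV th" and V: "opt ta th : V"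
 obtains w0 where "w0 : L" "fst w0 > 0" "!!i. ell i w0 = 0 <-> i : crays ta"
proof-
 obtain w0 where w0: "w0 : L" "fst w0 > 0" "etac ta th w0 ~= 0"
  "!!i w. ell i w0 = 0 ==> w : L ==> etac ta th w ~= 0 ==> ell i w = 0"
  "!!w. w : L ==> (!!i. ell i w0 = 0 ==> ell i w = 0) ==> etac ta th w ~= 0"
  by (fact face_point[OF etac_character[OF ta] etac_nonirr[OF ta]])
 have "i : crays ta" if i0: "ell i w0 = 0" for i
 proof (rule ccontr)
  assume i: "i ~: crays ta"
  have "rel_interior ta ~= {}" using cone_0[OF ta(1)] rel_interior_eq_empty[OF cone_convex[OF ta(1)]] by auto
  then obtain x where x: "x : rel_interior ta" by blast
  obtain ta' y s p where e: "ta' : Sg" "ta' <= ta" "y : ta'" "0 <= s" "s < 1"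
   "y = (1 - s) \<cdot> x + s \<cdot> rv (u i)" "p : perp ta'" "pairing (u i) p ~= 0" by (fact exit_face[OF ta(1) x i])
  have v1: "(1, vtx ta) : L" using Gs_L ta(1) by (auto simp: Gs_def)
  have vi: "pairing (u i) (vtx ta) = - a $ i" using w0(4)[OF i0 v1] etac_vtx[OF ta] by (simp add: ell_def)
  have ui: "pairing (u i) (dk ta w) = ell i w" for w by (simp add: dk_def pairing_diff_right pairing_scale_right vi ell_def)
  \<comment> \<open>The point y is a mixture of an interior point of \<open>ta\<close> and
    \<open>u i\<close>. A section vanishing on \<open>ta'\<close> vanishes at y, and both terms are
    nonnegative, so it vanishes on all of \<open>ta\<close>.\<close>
  have same: "(ALL j:crays ta. ell j w = 0) <-> (ALL j:crays ta'. ell j w = 0)" if w: "w : L" for w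
  proof
   show "ALL j:crays ta. ell j w = 0 ==> ALL j:crays ta'. ell j w = 0" using crays_mono[OF e(2)] by blast
   assume z: "ALL j:crays ta'. ell j w = 0"
   let ?z = "rv (dk ta w)"
   have nn: "y' \<bullet> ?z >= 0" if "y' : ta" for y' using dk_dual[OF ta(1) w] that by (simp add: dsg_def)
   have uz: "rv (u j) \<bullet> ?z = real_of_int (ell j w)" if "j : crays ta" for j using that by (simp add: inner_rv pairing_dk[OF ta(1)])
   obtain l where l: "!!i. l i >= 0" "y = (SUM j:crays ta'. l j \<cdot> rv (u j))" using cone_generated[OF e(1,3)] by blast
   have "y \<bullet> ?z = (SUM j:crays ta'. l j * (rv (u j) \<bullet> ?z))" unfolding l(2) by (simp add: inner_sum_left)
   also have "... = 0" using z uz crays_mono[OF e(2)] by (intro sum.neutral) auto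
   finally have "(1 - s) * (x \<bullet> ?z) + s * real_of_int (ell i w) = 0" by (simp add: e(6) inner_add_left inner_rv ui)
   moreover have "s * real_of_int (ell i w) >= 0" using e(4) w by (simp add: L_def)
   ultimately have "(1 - s) * (x \<bullet> ?z) <= 0" by linarith
   hence "x \<bullet> ?z <= 0" using e(5) by (simp add: mult_le_0_iff)
   hence "rv (u j) \<bullet> ?z = 0" if "j : crays ta" for j using relint_zero[OF ta(1) x nn] that by (simp add: crays_def)
   thus "ALL j:crays ta. ell j w = 0" using uz by simp
  qed
  \<comment> \<open>Translates of the point by the elements of parameter exp(k) of the one-parameter
    subgroup of \<open>u i\<close>.\<close>
  define ph where "ph k m = th m * complex_of_real (exp (real k * real_of_int (pairing (u i) m)))" for k :: nat and m
  have ph: "mchar UNIV (ph k)" for k using ta(2) by (simp add: mchar_def ph_def pairing_add_right distrib_left exp_add)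
  have "opt ta' (ph k) : V" for k unfolding Var_opt[OF e(1) ph]
  proof
   fix j assume j: "j : J"
   define K where "K = th (int (d j) *s (vtx ta - vtx ta')) *
    complex_of_real (exp (real k * real_of_int (pairing (u i) (int (d j) *s (vtx ta - vtx ta')))))"
   have "etac ta' (ph k) w = K * etac ta th w" if "w : pkeys (fp j)" for w
   proof-
    have w: "w : L" "fst w = int (d j)" using that fp_LR[OF j] by (auto simp: LR_def)
    show ?thesis
    proof (cases "ALL j:crays ta. ell j w = 0")
     case True
     hence nz: "etac ta th w ~= 0" using etac_nonzero[OF ta] by blast
     have "pairing (u i) (dk ta w) = 0" using w0(4)[OF i0 w(1) nz] ui by simp
     moreover have "dk ta' w = dk ta w + int (d j) *s (vtx ta - vtx ta')" using w(2) by (simp add: dk_def vec_eq_iff algebra_simps)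
     ultimately have "ph k (dk ta' w) = K * th (dk ta w)" using ta(2) by (simp add: ph_def K_def pairing_add_right mchar_def)
     moreover have "dk ta' w : perp ta'" "dk ta w : perp ta" using True same[OF w(1)] dk_perp[OF e(1)] dk_perp[OF ta(1)] by blast+
     ultimately show ?thesis by (simp add: etac_def orbc_def)
    next
     case False
     hence "etac ta th w = 0" "etac ta' (ph k) w = 0" using etac_nonzero[OF ta] etac_nonzero[OF e(1) ph] same[OF w(1)] by blast+
     thus ?thesis by simp
    qed
   qed
   hence "mev (etac ta' (ph k)) (fp j) = K * mev (etac ta th) (fp j)" by (simp add: mev_def monext_def sum_distrib_left algebra_simps)
   thus "mev (etac ta' (ph k)) (fp j) = 0" using V Var_opt[OF ta] j by simp
  qed
  hence "range (%k. opt ta' (ph k)) <= V" by blast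
  hence "finite (range (%k. opt ta' (ph k)))" using V_finite finite_subset by blast
  moreover have "inj (%k. opt ta' (ph k))"
  proof (rule injI)
   fix k k' assume "opt ta' (ph k) = opt ta' (ph k')"
   hence "ph k p = ph k' p" using opt_eqD(2)[OF _ e(1,1)] e(7) by blast
   hence "exp (real k * real_of_int (pairing (u i) p)) = exp (real k' * real_of_int (pairing (u i) p))"
    using mchar_inverse(2)[OF ta(2), of p] by (simp add: ph_def)
   thus "k = k'" using e(8) by simp
  qed
  ultimately show False using finite_imageD[of "%k. opt ta' (ph k)" UNIV] by simp
 qed
 moreover have "ell i w0 = 0" if "i : crays ta" for i using w0(3) etac_nonzero[OF ta] that by blast
 ultimately show ?thesis using that w0(1,2) by blast
qed

text \<open>The rays of the cone are read off from the zeros of the character, by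
  \<open>V_point_face\<close>. Each m in \<open>perp ta\<close> is a quotient of two sections of
  equal degree that do not vanish at the point, so the scaling by c cancels.\<close>

lemma V_point_unique:
 assumes ta: "ta : Sg" "mchar UNIV th" "opt ta th : V"
  and ta': "ta' : Sg" "mchar UNIV th'" "opt ta' th' : V"
  and c: "c ~= 0" and e: "!!w. w : L ==> etac ta' th' w = c ^ nat (fst w) * etac ta th w"
 shows "opt ta th = opt ta' th'"
proof-
 obtain w0 where w0: "w0 : L" "fst w0 > 0" "!!i. ell i w0 = 0 <-> i : crays ta" by (fact V_point_face[OF ta])
 obtain w1 where w1: "w1 : L" "fst w1 > 0" "!!i. ell i w1 = 0 <-> i : crays ta'" by (fact V_point_face[OF ta'])
 have nz: "etac ta' th' w ~= 0 <-> etac ta th w ~= 0" if "w : L" for w using e[OF that] c by simp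
 have "etac ta th w0 ~= 0" using etac_nonzero[OF ta(1,2)] w0(3) by blast
 hence "crays ta' <= crays ta" using nz[OF w0(1)] etac_nonzero[OF ta'(1,2)] w0(3) by blast
 moreover have "etac ta' th' w1 ~= 0" using etac_nonzero[OF ta'(1,2)] w1(3) by blast
 hence "crays ta <= crays ta'" using nz[OF w1(1)] etac_nonzero[OF ta(1,2)] w1(3) by blast
 ultimately have eq: "ta = ta'" using cone_subset[OF ta(1) ta'(1)] cone_subset[OF ta'(1) ta(1)] by blast
 have "th m = th' m" if m: "m : perp ta" for m
 proof-
  define k where "k = nat (SUM i:UNIV. \<bar>pairing (u i) m\<bar>)"
  have L: "(0, m) + nmul k w0 : L" unfolding L_def
  proof safe
   fix i
   show "ell i ((0, m) + nmul k w0) >= 0"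
   proof (cases "i : crays ta")
    case True
    hence "ell i (0, m) = 0" "ell i w0 = 0" using m w0(3) by (simp_all add: ell_def perp_def)
    thus ?thesis by (simp add: ell_add ell_nmul)
   next
    case False
    hence "ell i w0 >= 1" using w0(1,3) unfolding L_def by (metis int_one_le_iff_zero_less mem_Collect_eq order_le_less)
    hence "int k * ell i w0 >= int k * 1" by (intro mult_left_mono) auto
    moreover have "int k >= \<bar>pairing (u i) m\<bar>" unfolding k_def
     using member_le_sum[of i UNIV "%i. \<bar>pairing (u i) m\<bar>"] by simp
    ultimately show ?thesis unfolding ell_add ell_nmul by (simp add: ell_def)
   qed
  qed
  have kL: "nmul k w0 : L" by (rule nmul_mem[OF submon_L w0(1)])
  have p0: "dk ta (nmul k w0) : perp ta" using w0(3) unfolding dk_perp[OF ta(1)] by (simp add: ell_nmul)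
  have dk0: "dk ta (0, m) = m" by (simp add: dk_def)
  have sp: "etac ta pp ((0, m) + nmul k w0) = pp m * etac ta pp (nmul k w0)" if "mchar UNIV pp" for pp
   using submon_perp[of ta] m p0 that by (simp add: etac_def dk_add dk0 orbc_def submon_def mchar_def)
  have "th' m * etac ta th' (nmul k w0) = c ^ nat (fst (nmul k w0)) * (th m * etac ta th (nmul k w0))"
   using e[OF L] unfolding eq[symmetric] sp[OF ta(2)] sp[OF ta'(2)] by simp
  also have "... = th m * etac ta th' (nmul k w0)" using e[OF kL] unfolding eq[symmetric] by simp
  finally have "th' m * etac ta th' (nmul k w0) = th m * etac ta th' (nmul k w0)" .
  moreover have "etac ta th' (nmul k w0) ~= 0" unfolding etac_def orbc_nonzero[OF ta'(2)] by (rule p0)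
  ultimately show ?thesis by simp
 qed
 thus ?thesis unfolding eq[symmetric] by (rule opt_cong)
qed

text \<open>Surjectivity of the map onto the points of Proj: the face supporting \<open>hh\<close>
  has a normal cone, and any cone of the fan meeting its relative interior carries an orbit over
  it.\<close>

lemma V_point_exists:
 assumes hh: "mchar L hh" "nonirr hh" and z: "!!j. j : J ==> mev hh (fp j) = 0"
 obtains ta th c where "ta : Sg" "mchar UNIV th" "opt ta th : V" "c ~= 0"
  "!!w. w : L ==> hh w = c ^ nat (fst w) * etac ta th w"
proof-
 obtain w0 where w0: "w0 : L" "fst w0 > 0" "hh w0 ~= 0"
  "!!i w. ell i w0 = 0 ==> w : L ==> hh w ~= 0 ==> ell i w = 0"
  "!!w. w : L ==> (!!i. ell i w0 = 0 ==> ell i w = 0) ==> hh w ~= 0" by (fact face_point[OF hh])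
 define Z where "Z = {i. ell i w0 = 0}"
 \<comment> \<open>A point in the relative interior of the cone generated by the normals of the
   facets through the face.\<close>
 define x where "x = (SUM i:Z. rv (u i))"
 obtain ta where ta: "ta : Sg" "x : rel_interior ta" using relint_cone_exists by blast
 have xt: "x : ta" using ta(2) rel_interior_subset by blast
 obtain g where g: "g : Gs" "hh g ~= 0" using hh(2) by (auto simp: nonirr_def)
 have gL: "g : L" "fst g = 1" using g(1) Gs_L by (auto simp: Gs_def)
 have gZ: "ell i g = 0" if "i : Z" for i using w0(4)[OF _ gL(1) g(2)] that by (simp add: Z_def)
 have v1: "(1, vtx ta) : L" using Gs_L ta(1) by (auto simp: Gs_def)
 have xr: "x \<bullet> rv m = real_of_int (SUM i:Z. pairing (u i) m)" for m by (simp add: x_def inner_sum_left inner_rv)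
 \<comment> \<open>On the polytope \<open>vtx ta\<close> minimizes the pairing with x, and g shows
   that the minimum is attained exactly on the facets in \<open>Z\<close>.\<close>
 have vZ: "ell i (1, vtx ta) = 0" if i: "i : Z" for i
 proof-
  have "dk ta g : dsg ta" by (rule dk_dual[OF ta(1) gL(1)])
  hence "x \<bullet> rv (dk ta g) >= 0" using xt by (simp add: dsg_def)
  hence "(SUM i:Z. pairing (u i) (dk ta g)) >= 0" unfolding xr by (simp only: of_int_0_le_iff)
  also have "(SUM i:Z. pairing (u i) (dk ta g)) = - (SUM i:Z. ell i (1, vtx ta))" unfolding sum_negf[symmetric]
  proof (rule sum.cong[OF refl])
   fix i assume "i : Z"
   thus "pairing (u i) (dk ta g) = - ell i (1, vtx ta)"
    using gZ[of i] gL(2) by (simp add: dk_def pairing_diff_right pairing_scale_right ell_def)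
  qed
  finally have "(SUM i:Z. ell i (1, vtx ta)) <= 0" by simp
  moreover have nn: "!!i. i : Z ==> ell i (1, vtx ta) >= 0" using v1 by (simp add: L_def)
  ultimately have "(SUM i:Z. ell i (1, vtx ta)) = 0" using sum_nonneg[of Z "%i. ell i (1, vtx ta)"] by simp
  thus ?thesis using sum_nonneg_eq_0_iff[of Z "%i. ell i (1, vtx ta)"] nn i by simp
 qed
 have same: "(ALL i:Z. ell i w = 0) <-> (ALL j:crays ta. ell j w = 0)" if w: "w : L" for w
 proof-
  let ?z = "rv (dk ta w)"
  have nn: "y \<bullet> ?z >= 0" if "y : ta" for y using dk_dual[OF ta(1) w] that by (simp add: dsg_def)
  have "pairing (u i) (dk ta w) = ell i w" if "i : Z" for i
   using vZ[OF that] by (simp add: dk_def pairing_diff_right pairing_scale_right ell_def algebra_simps add_eq_0_iff)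
  hence xz: "x \<bullet> ?z = real_of_int (SUM i:Z. ell i w)" unfolding xr by simp
  have sz: "(SUM i:Z. ell i w) = 0 <-> (ALL i:Z. ell i w = 0)" using w by (intro sum_nonneg_eq_0_iff) (auto simp: L_def)
  have "x \<bullet> ?z = 0 <-> (ALL j:crays ta. ell j w = 0)"
  proof
   assume "x \<bullet> ?z = 0"
   hence "rv (u j) \<bullet> ?z = 0" if "j : crays ta" for j using relint_zero[OF ta nn] that by (simp add: crays_def)
   thus "ALL j:crays ta. ell j w = 0" by (simp add: inner_rv pairing_dk[OF ta(1)])
  next
   assume j: "ALL j:crays ta. ell j w = 0"
   obtain l where l: "!!i. l i >= 0" "x = (SUM j:crays ta. l j \<cdot> rv (u j))" using cone_generated[OF ta(1) xt] by blast
   show "x \<bullet> ?z = 0" unfolding l(2) using j by (simp add: inner_sum_left inner_rv pairing_dk[OF ta(1)])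
  qed
  thus ?thesis unfolding xz of_int_eq_0_iff using sz by blast
 qed
 have nz: "hh w ~= 0 <-> (ALL j:crays ta. ell j w = 0)" if w: "w : L" for w
  unfolding same[OF w, symmetric] using w0(4)[OF _ w] w0(5)[OF w] by (auto simp: Z_def)
 \<comment> \<open>The value at the trivializing section; dividing by its powers makes the character
   depend on \<open>dk ta w\<close> only.\<close>
 define c where "c = hh (1, vtx ta)"
 have c0: "c ~= 0" unfolding c_def nz[OF v1] same[OF v1, symmetric] using vZ by blast
 define T where "T = {w : L. hh w ~= 0}"
 define ph where "ph w = hh w / c ^ nat (fst w)" for w
 have mul: "hh (v + w) = hh v * hh w" if "v : L" "w : L" for v w using hh(1) that by (simp add: mchar_def)
 have ph_mult: "ph (v + w) = ph v * ph w" if "v : L" "w : L" for v w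
  using mul[OF that] deg_nonneg[OF that(1)] deg_nonneg[OF that(2)] by (simp add: ph_def nat_add_distrib power_add)
 have le: "ph w = ph w'" if w: "w : L" "w' : L" "dk ta w = dk ta w'" "fst w >= fst w'" for w w'
 proof-
  let ?k = "nat (fst w - fst w')"
  have nm: "nmul k (1 :: int, vtx ta) = (int k, int k *s vtx ta)" for k
   by (induction k) (simp_all add: nmul_Suc vec_eq_iff algebra_simps zero_prod_def)
  have wv: "w = w' + nmul ?k (1, vtx ta)" unfolding nm using w(3,4) by (simp add: prod_eq_iff dk_def vec_eq_iff algebra_simps)
  have kL: "nmul ?k (1, vtx ta) : L" by (rule nmul_mem[OF submon_L v1])
  have v1: "ph (nmul ?k (1, vtx ta)) = 1" using character_nmul[OF hh(1) v1, of ?k] nm[of ?k] c0 by (simp add: ph_def c_def)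
  have "ph w = ph (w' + nmul ?k (1, vtx ta))" by (rule arg_cong[OF wv])
  thus ?thesis unfolding ph_mult[OF w(2) kL] v1 by simp
 qed
 have wd: "ph w = ph w'" if w: "w : L" "w' : L" "dk ta w = dk ta w'" for w w'
 proof (cases "fst w >= fst w'")
  case False
  hence "fst w' >= fst w" by simp
  thus ?thesis using le[OF w(2,1) w(3)[symmetric]] by simp
 qed (rule le[OF w])
 define ga where "ga p = ph (SOME w. w : T & dk ta w = p)" for p
 have ga: "ga (dk ta w) = ph w" if "w : T" for w
 proof-
  have "(SOME w'. w' : T & dk ta w' = dk ta w) : T & dk ta (SOME w'. w' : T & dk ta w' = dk ta w) = dk ta w"
   by (rule someI[of _ w]) (simp add: that)
  thus ?thesis unfolding ga_def using that by (intro wd) (auto simp: T_def)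
 qed
 have T: "0 : T" "!!v w. v : T ==> w : T ==> v + w : T" using hh(1) submon_L by (auto simp: T_def mchar_def submon_def)
 have sub: "submon (dk ta ` T)" unfolding submon_def using T by (auto simp: dk_add[symmetric] intro: image_eqI[of _ _ 0] simp: dk_0)
 have ch: "mchar (dk ta ` T) ga" unfolding mchar_def
 proof (intro conjI ballI)
  show "ga 0 = 1" using ga[OF T(1)] hh(1) by (simp add: dk_0 ph_def mchar_def)
  fix p q assume "p : dk ta ` T" "q : dk ta ` T"
  then obtain v w where v: "v : T" "w : T" "p = dk ta v" "q = dk ta w" by blast
  thus "ga (p + q) = ga p * ga q" using ga[OF T(2)[OF v(1,2)]] ga[OF v(1)] ga[OF v(2)] ph_mult[of v w] by (simp add: dk_add T_def)
 qed
 have nonz: "ga p ~= 0" if "p : dk ta ` T" for p using that ga c0 by (auto simp: ph_def T_def)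
 obtain th where th: "mchar UNIV th" "!!p. p : dk ta ` T ==> th p = ga p"
  using character_extension[OF sub ch nonz countable_int_vec] by blast
 have eq: "hh w = c ^ nat (fst w) * etac ta th w" if w: "w : L" for w
 proof (cases "hh w = 0")
  case True
  hence "etac ta th w = 0" using nz[OF w] etac_nonzero[OF ta(1) th(1)] by blast
  thus ?thesis using True by simp
 next
  case False
  hence "w : T" using w by (simp add: T_def)
  hence "th (dk ta w) = ph w" using th(2) ga by simp
  moreover have "dk ta w : perp ta" using False nz[OF w] dk_perp[OF ta(1)] by blast
  ultimately show ?thesis using c0 by (simp add: etac_def orbc_def ph_def)
 qed
 have "opt ta th : V" unfolding Var_opt[OF ta(1) th(1)]
 proof
  fix j assume j: "j : J"
  show "mev (etac ta th) (fp j) = 0" using mev_scaled[OF eq fp_LR[OF j]] z[OF j] c0 by simp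
 qed
 thus ?thesis using that[OF ta(1) th(1) _ c0 eq] by blast
qed

end

declare One_nat_def [simp del]

section \<open>Decomposition of the quotient ring along the points\<close>

context nonneg_graded
begin

lemma gid_cong: "(!!j. j : A ==> a j = b j & dg j = dg' j) ==> gid A a dg m = gid A b dg' m"
proof-
 assume e: "!!j. j : A ==> a j = b j & dg j = dg' j"
 have "(SUM j:A. t j * a j) = (SUM j:A. t j * b j)" for t using e by (intro sum.cong) auto
 moreover have "(ALL j:A. t j : R (m - dg j)) <-> (ALL j:A. t j : R (m - dg' j))" for t using e by auto
 ultimately show ?thesis by (simp add: gid_def)
qed

end

context zero_dim_system
begin

abbreviation X :: "'n toric_point set" where "X == tvar Sg"

definition eta :: "'n toric_point => int \<times> (int ^ 'n) => complex" where
 "eta ze = (SOME hh. EX ta th. ta : Sg & mchar UNIV th & ze = opt ta th & hh = etac ta th)"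

abbreviation ev :: "'n toric_point => ((int \<times> (int ^ 'n)) \<Rightarrow>\<^sub>0 complex) => complex" where
 "ev ze == mev (eta ze)"

lemma eta_opt:
 assumes "ta : Sg" "mchar UNIV th"
 shows "eta (opt ta th) = etac ta th"
 unfolding eta_def
proof (rule some_equality)
 show "EX ta' th'. ta' : Sg & mchar UNIV th' & opt ta th = opt ta' th' & etac ta th = etac ta' th'" using assms by blast
 fix hh assume "EX ta' th'. ta' : Sg & mchar UNIV th' & opt ta th = opt ta' th' & hh = etac ta' th'"
 then obtain ta' th' where t: "ta' : Sg" "opt ta th = opt ta' th'" "hh = etac ta' th'" by blast
 have "ta' = ta" "!!m. m : perp ta ==> th' m = th m" using opt_eqD(1)[OF t(2) assms(1) t(1)] opt_eqD(2)[OF t(2) assms(1) t(1)] by auto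
 thus "hh = etac ta th" using t(3) by (auto simp: etac_def orbc_def)
qed

lemma pointE:
 assumes "ze : X"
 obtains ta th where "ta : Sg" "mchar UNIV th" "ze = opt ta th" "eta ze = etac ta th"
proof-
 obtain ta th where "ta : Sg" "mchar UNIV th" "ze = opt ta th" using assms tvar_opt by blast
 thus ?thesis using that eta_opt by blast
qed

lemma eta_character: "ze : X ==> mchar L (eta ze)"
 by (erule pointE) (simp add: etac_character)

lemma eta_nonirr: "ze : X ==> nonirr (eta ze)"
 by (erule pointE) (simp add: etac_nonirr)

lemma ev_mult: "ze : X ==> r : LR l ==> s : LR m ==> ev ze (r * s) = ev ze r * ev ze s"
 by (rule mev_mult[OF eta_character LR_monalg LR_monalg])

lemma ev_power: "ze : X ==> r : LR l ==> ev ze (r ^ k) = ev ze r ^ k"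
 by (rule mev_power[OF eta_character submon_L LR_monalg])

lemma ev_one: "ze : X ==> ev ze 1 = 1"
 by (rule mev_one) (use eta_character in "simp add: mchar_def")

lemma V_iff: "ze : V <-> ze : X & (ALL j:J. ev ze (fp j) = 0)"
proof (cases "ze : X")
 case True
 then obtain ta th where t: "ta : Sg" "mchar UNIV th" "ze = opt ta th" "eta ze = etac ta th" by (rule pointE)
 show ?thesis using Var_opt[OF t(1,2)] True t(3,4) by simp
qed (use V_subset in blast)

lemma V_X: "ze : V ==> ze : X" using V_subset by blast

lemma eta_exists:
 assumes "mchar L hh" "nonirr hh" "!!j. j : J ==> mev hh (fp j) = 0"
 obtains ze c where "ze : V" "c ~= 0" "!!r m. r : LR m ==> mev hh r = c ^ nat m * ev ze r"
proof-
 obtain ta th c where t: "ta : Sg" "mchar UNIV th" "opt ta th : V" "c ~= 0"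
  "!!w. w : L ==> hh w = c ^ nat (fst w) * etac ta th w" using V_point_exists[OF assms] by blast
 have "mev hh r = c ^ nat m * ev (opt ta th) r" if "r : LR m" for r m using mev_scaled[OF t(5) that] eta_opt[OF t(1,2)] by simp
 thus ?thesis using that t(3,4) by blast
qed

lemma eta_unique:
 assumes "ze : V" "ze' : V" "c ~= 0" and e: "!!w. w : L ==> eta ze' w = c ^ nat (fst w) * eta ze w"
 shows "ze = ze'"
proof-
 obtain ta th where t: "ta : Sg" "mchar UNIV th" "ze = opt ta th" "eta ze = etac ta th" by (rule pointE[OF V_X[OF assms(1)]])
 obtain ta' th' where t': "ta' : Sg" "mchar UNIV th'" "ze' = opt ta' th'" "eta ze' = etac ta' th'" by (rule pointE[OF V_X[OF assms(2)]])
 have "opt ta th : V" "opt ta' th' : V" using assms(1,2) t(3) t'(3) by simp_all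
 thus ?thesis unfolding t(3) t'(3) by (rule V_point_unique[OF t(1,2) _ t'(1,2) _ assms(3)]) (rule e[unfolded t(4) t'(4)])
qed

lemma generator_nonzero:
 assumes "ze : X"
 obtains g where "g : Gs" "g : L" "fst g = 1" "eta ze g ~= 0"
proof-
 obtain g where "g : Gs" "eta ze g ~= 0" using eta_nonirr[OF assms] by (auto simp: nonirr_def)
 moreover have "g : L" "fst g = 1" using `g : Gs` Gs_L by (auto simp: Gs_def)
 ultimately show ?thesis using that by blast
qed

text \<open>If both points are nonzero at a common generator g, they differ on some w after scaling
  at g. The binomial in \<open>w\<close> and the multiple of g of the same degree, normalized to
  vanish at the second point, separates them.\<close>

lemma separate:
 assumes z: "ze : V" "ze' : V" "ze ~= ze'"
 shows "EX e>0. EX s:LR e. ev ze s ~= 0 & ev ze' s = 0"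
proof-
 obtain g where g: "g : Gs" "g : L" "fst g = 1" "eta ze g ~= 0" by (rule generator_nonzero[OF V_X[OF z(1)]])
 show ?thesis
 proof (cases "eta ze' g = 0")
  case True
  thus ?thesis using g LR_single[OF g(2,3)] by (intro exI[of _ 1] conjI bexI[of _ "msing g 1"]) simp_all
 next
  case False
  define c where "c = eta ze' g / eta ze g"
  have c: "c ~= 0" using False g(4) by (simp add: c_def)
  have "EX w:L. eta ze' w ~= c ^ nat (fst w) * eta ze w" using eta_unique[OF z(1,2) c] z(3) by blast
  then obtain w where w: "w : L" "eta ze' w ~= c ^ nat (fst w) * eta ze w" by blast
  have c0: "eta ze 0 = 1" "eta ze' 0 = 1" using eta_character[OF V_X[OF z(1)]] eta_character[OF V_X[OF z(2)]] by (simp_all add: mchar_def)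
  have "fst w ~= 0"
  proof
   assume "fst w = 0"
   hence "w = 0" using L_deg_0 w(1) by blast
   thus False using w(2) c0 by simp
  qed
  hence pos: "fst w > 0" using deg_nonneg[OF w(1)] by simp
  define k where "k = nat (fst w)"
  have kg: "nmul k g : L" "fst (nmul k g) = fst w" using nmul_mem[OF submon_L g(2)] deg_nmul[of k g] g(3) pos by (simp_all add: k_def)
  define s where "s = msing (nmul k g) (eta ze' w) - msing w (eta ze' g ^ k)"
  have sL: "s : LR (fst w)" unfolding s_def using kg w(1) by (intro LR.R_diff LR_single) auto
  have pg: "eta ze (nmul k g) = eta ze g ^ k" "eta ze' (nmul k g) = eta ze' g ^ k"
   using character_nmul[OF eta_character[OF V_X[OF z(1)]] g(2)]
    character_nmul[OF eta_character[OF V_X[OF z(2)]] g(2)] by auto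
  have "ev ze' s = 0" by (simp add: s_def mev_diff pg)
  moreover have "ev ze s ~= 0"
  proof
   assume "ev ze s = 0"
   hence "eta ze' w * eta ze g ^ k = eta ze' g ^ k * eta ze w" by (simp add: s_def mev_diff pg)
   hence "eta ze' w = c ^ k * eta ze w" using g(4) by (simp add: c_def power_divide field_simps)
   thus False using w(2) by (simp add: k_def)
  qed
  ultimately show ?thesis using sL pos by blast
 qed
qed

lemma separator:
 assumes z: "ze : V"
 shows "EX e>0. EX s:LR e. ev ze s ~= 0 & (ALL ze':V - {ze}. ev ze' s = 0)"
proof-
 have "EX e>0. EX s:LR e. ev ze s ~= 0 & (ALL ze':A. ev ze' s = 0)" if "finite A" "A <= V - {ze}" for A using that
 proof (induction A rule: finite_induct)
  case empty
  obtain g where g: "g : Gs" "g : L" "fst g = 1" "eta ze g ~= 0" by (rule generator_nonzero[OF V_X[OF z]])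
  thus ?case by (intro exI[of _ 1] conjI bexI[of _ "msing g 1"] LR_single) simp_all
 next
  case (insert xx A)
  then obtain e s where s: "e > 0" "s : LR e" "ev ze s ~= 0" "ALL ze':A. ev ze' s = 0" by blast
  obtain e' s' where s': "e' > 0" "s' : LR e'" "ev ze s' ~= 0" "ev xx s' = 0" using separate[of ze xx] insert.prems z by blast
  have "ev ze' (s * s') = ev ze' s * ev ze' s'" if "ze' : V" for ze' by (rule ev_mult[OF V_X[OF that] s(2) s'(2)])
  hence "ev ze (s * s') ~= 0 & (ALL ze':insert xx A. ev ze' (s * s') = 0)" using s s' z insert.prems by auto
  moreover have "s * s' : LR (e + e')" using s(2) s'(2) by (rule LR.R_mult)
  ultimately show ?case using s(1) s'(1) by (intro exI[of _ "e + e'"]) auto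
 qed
 from this[OF finite_Diff[OF V_finite] subset_refl] show ?thesis .
qed

text \<open>Points are handled one at a time; the coefficient of a new monomial avoids finitely many
  values.\<close>

lemma generic_section: "EX f0:LR 1. ALL ze:V. ev ze f0 ~= 0"
proof-
 have "EX f0:LR 1. ALL ze:A. ev ze f0 ~= 0" if "finite A" "A <= V" for A using that
 proof (induction A rule: finite_induct)
  case empty thus ?case using LR.R_zero by blast
 next
  case (insert xx A)
  then obtain h where h: "h : LR 1" "ALL ze:A. ev ze h ~= 0" by blast
  have xX: "xx : X" using insert.prems V_X by blast
  obtain g where g: "g : Gs" "g : L" "fst g = 1" "eta xx g ~= 0" by (rule generator_nonzero[OF xX])
  have "finite ((%ze. - ev ze h / eta ze g) ` insert xx A)" using insert.hyps(1) by simp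
  then obtain t where t: "t ~: (%ze. - ev ze h / eta ze g) ` insert xx A" using ex_new_if_finite[OF infinite_UNIV_char_0] by blast
  have e: "ev ze (h + msing g t) = ev ze h + t * eta ze g" for ze by (simp add: mev_add)
  have "ev ze (h + msing g t) ~= 0" if ze: "ze : insert xx A" for ze
  proof (cases "eta ze g = 0")
   case True
   hence "ze : A" using ze g(4) by blast
   thus ?thesis using h(2) True by (simp add: e)
  next
   case False
   have "t ~= - ev ze h / eta ze g" using t ze by blast
   thus ?thesis using False by (simp add: e field_simps add_eq_0_iff)
  qed
  moreover have "h + msing g t : LR 1" using h(1) g by (intro LR.R_add LR_single)
  ultimately show ?case by blast
 qed
 from this[OF V_finite subset_refl] show ?thesis .
qed

end

section \<open>Local ideals at the points and the decomposition of the quotient\<close>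

locale generic_system = zero_dim_system Sg u a f d I n
 for Sg :: "(real ^ 'n) set set" and u :: "'k::finite => int ^ 'n" and a :: "int ^ 'k"
  and f :: "nat => 'k cox" and d :: "nat => nat" and I :: "'k cox set" and n :: nat +
 fixes f0 :: "(int \<times> (int ^ 'n)) \<Rightarrow>\<^sub>0 complex"
 assumes f0: "f0 : LR 1" "!!ze. ze : V ==> ev ze f0 ~= 0"
begin

definition F where "F j = (if j = 0 then f0 else fp j)" for j :: nat
definition dg where "dg j = (if j = 0 then 1 else d j)" for j :: nat

sublocale ps: parameter_system L fst emb Gs "UNIV :: 'k set" rell fst F dg n
proof
 show "countable (UNIV :: (int \<times> (int ^ 'n)) set)" by (rule countable_lattice)
 show "DIM(real \<times> (real ^ 'n)) = Suc n" by (simp add: n)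
 show "F j : LR (int (dg j))" if "j <= n" for j using f0(1) fp_LR[of j] that by (auto simp: F_def dg_def)
 show "dg 0 = 1" by (simp add: dg_def)
 show "EX j<=n. mev hh (F j) ~= 0" if hh: "mchar L hh" "nonirr hh" for hh
 proof (rule ccontr)
  assume z: "~ ?thesis"
  hence "mev hh (fp j) = 0" if "j : J" for j using that by (force simp: F_def)
  then obtain ze c where "ze : V" "c ~= 0" "!!r m. r : LR m ==> mev hh r = c ^ nat m * ev ze r" using eta_exists[OF hh] by blast
  hence "mev hh (F 0) ~= 0" using f0 by (simp add: F_def)
  thus False using z by blast
 qed
 obtain ze where ze: "ze : V" using V_nonempty by blast
 have "ALL j:{1..n}. ev ze (F j) = 0" using ze V_iff by (auto simp: F_def)
 thus "EX hh. mchar L hh & nonirr hh & (ALL j:{1..n}. mev hh (F j) = 0)"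
  using eta_character[OF V_X[OF ze]] eta_nonirr[OF V_X[OF ze]] by blast
qed

lemma Fid_Fi: "ps.Fid n m = Fi m"
 by (rule LR.gid_cong) (simp add: F_def dg_def)

lemma f0_power: "f0 ^ k : LR (int k)"
 using LR.R_power[OF f0(1), of k] by simp

lemma Fi_regular: "r : LR m ==> f0 ^ k * r : Fi (m + int k) ==> r : Fi m"
 using ps.regular_0_power[of r m k] by (simp add: Fid_Fi F_def)

lemma Fi_subset: "Fi m <= LR m"
 using ps.Fid_subset[of n m] by (simp add: Fid_Fi)

lemma Fi_subspace: "pv.subspace (Fi m)"
 using ps.Fid_subspace[of n m] by (simp add: Fid_Fi)

lemma Fi_vanishes: "r : Fi m ==> ze : V ==> ev ze r = 0"
proof-
 assume "r : Fi m" and z: "ze : V"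
 then obtain t where t: "!!j. j : J ==> t j : LR (m - int (d j))" "r = (SUM j:J. t j * fp j)" unfolding LR.gid_def by blast
 show ?thesis unfolding t(2) mev_sum using ev_mult[OF V_X[OF z] t(1) fp_LR] z V_iff by (intro sum.neutral) simp
qed

lemma nullstellensatz_V:
 fixes A :: "'x set" and s :: "'x => (int \<times> (int ^ 'n)) \<Rightarrow>\<^sub>0 complex"
 assumes A: "finite A" "ALL x:A. s x : LR (e x)" and h: "h : LR e0" "e0 > 0"
  and nz: "ALL ze:V. (ALL x:A. ev ze (s x) = 0) --> ev ze h = 0"
 shows "EX N t. (ALL x:A. t x : LR (int N * e0 - e x)) & h ^ N - (SUM x:A. t x * s x) : Fi (int N * e0)"
proof-
 let ?B = "J <+> A"
 let ?h = "case_sum fp s" and ?e = "case_sum (%j. int (d j)) e"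
 have "finite ?B" using A(1) by simp
 moreover have "?h j : LR (?e j)" if "j : ?B" for j using that fp_LR A(2) by (auto split: sum.splits)
 moreover have "mev hh h = 0" if hh: "mchar L hh" "nonirr hh"
  and z: "!!j. j : ?B ==> mev hh (?h j) = 0" for hh
 proof-
  have "mev hh (fp j) = 0" if "j : J" for j using z[OF InlI[OF that]] by simp
  then obtain ze c where zc: "ze : V" "c ~= 0" "!!r m. r : LR m ==> mev hh r = c ^ nat m * ev ze r" using eta_exists[OF hh] by blast
  have "ev ze (s x) = 0" if "x : A" for x using z[OF InrI[OF that]] zc(2) zc(3)[OF bspec[OF A(2) that]] by simp
  thus ?thesis using bspec[OF nz zc(1)] zc(3)[OF h(1)] by simp
 qed
 ultimately obtain N where "h ^ N : LR.gid ?B ?h ?e (int N * e0)"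
  using graded_nullstellensatz[OF countable_lattice, of ?B ?h ?e h e0] h by blast
 then obtain t where t: "!!j. j : ?B ==> t j : LR (int N * e0 - ?e j)" "h ^ N = (SUM j:?B. t j * ?h j)" unfolding LR.gid_def by blast
 have tx: "t (Inr x) : LR (int N * e0 - e x)" if "x : A" for x using t(1)[OF InrI[OF that]] by simp
 have tj: "t (Inl j) : LR (int N * e0 - int (d j))" if "j : J" for j using t(1)[OF InlI[OF that]] by simp
 have "(SUM j:?B. t j * ?h j) = (SUM j:J. t (Inl j) * fp j) + (SUM x:A. t (Inr x) * s x)" using A(1) by (simp add: sum.Plus)
 hence "h ^ N - (SUM x:A. t (Inr x) * s x) = (SUM j:J. t (Inl j) * fp j)" using t(2) by simp
 moreover have "(SUM j:J. t (Inl j) * fp j) : Fi (int N * e0)"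
  unfolding LR.gid_def using tj by (intro CollectI exI[of _ "%j. t (Inl j)"]) simp
 ultimately show ?thesis using tx by (intro exI[of _ N] exI[of _ "%x. t (Inr x)"] conjI ballI) simp_all
qed

text \<open>The part of degree \<open>m\<close> of the stalk of the ideal at \<open>ze\<close>, by clearing denominators that do not vanish there.\<close>

definition Q :: "'n toric_point => int => ((int \<times> (int ^ 'n)) \<Rightarrow>\<^sub>0 complex) set" where
 "Q ze m = {r : LR m. EX e. EX s:LR e. ev ze s ~= 0 & s * r : Fi (e + m)}"

lemma Q_subset: "Q ze m <= LR m" by (auto simp: Q_def)

lemma QI: "r : LR m ==> s : LR e ==> ev ze s ~= 0 ==> s * r : Fi (e + m) ==> r : Q ze m"
 by (auto simp: Q_def)

lemma Fi_Q: "ze : X ==> r : Fi m ==> r : Q ze m"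
 using Fi_subset[of m] by (intro QI[of _ _ 1 0]) (auto simp: LR.R_one ev_one)

lemma Q_mult:
 assumes "t : LR l" "r : Q ze m" "k = l + m"
 shows "t * r : Q ze k"
proof-
 obtain e s where s: "s : LR e" "ev ze s ~= 0" "s * r : Fi (e + m)" "r : LR m" using assms(2) by (auto simp: Q_def)
 have "t * (s * r) : Fi (e + k)" using LR.gid_mult'[OF assms(1) s(3), of "e + k"] assms(3) by simp
 hence "s * (t * r) : Fi (e + k)" by (simp add: mult.left_commute)
 thus ?thesis by (rule QI[OF LR.R_mult'[OF assms(1) s(4) assms(3)] s(1,2)])
qed

lemma Q_add:
 assumes z: "ze : X" and r: "r : Q ze m" "r' : Q ze m"
 shows "r + r' : Q ze m"
proof-
 obtain e s where s: "s : LR e" "ev ze s ~= 0" "s * r : Fi (e + m)" "r : LR m" using r(1) by (auto simp: Q_def)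
 obtain e' s' where s': "s' : LR e'" "ev ze s' ~= 0" "s' * r' : Fi (e' + m)" "r' : LR m" using r(2) by (auto simp: Q_def)
 have "s' * (s * r) : Fi (e + e' + m)" "s * (s' * r') : Fi (e + e' + m)"
  using LR.gid_mult'[OF s'(1) s(3), of "e + e' + m"] LR.gid_mult'[OF s(1) s'(3), of "e + e' + m"] by simp_all
 hence "s' * (s * r) + s * (s' * r') : Fi (e + e' + m)" by (rule LR.gid_add)
 moreover have "s' * (s * r) + s * (s' * r') = (s * s') * (r + r')" by (simp add: algebra_simps)
 moreover have "ev ze (s * s') ~= 0" using ev_mult[OF z s(1) s'(1)] s(2) s'(2) by simp
 ultimately show ?thesis using s(1,4) s'(1,4) by (intro QI[of _ _ "s * s'" "e + e'"]) (auto intro: LR.R_mult LR.R_add)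
qed

lemma Q_subspace: "ze : X ==> pv.subspace (Q ze m)"
 unfolding pv.subspace_def using Q_add Fi_Q[OF _ LR.gid_0] Q_mult[OF ps.cst_LR, of _ ze m m] by (auto simp: pscale_cst)

lemma Q_unit:
 assumes z: "ze : X" and t: "t : LR l" "ev ze t ~= 0" and r: "r : LR m" "t * r : Q ze k" and k: "k = l + m"
 shows "r : Q ze m"
proof-
 obtain e s where s: "s : LR e" "ev ze s ~= 0" "s * (t * r) : Fi (e + (l + m))" using r(2) k by (auto simp: Q_def)
 show ?thesis using s(3) ev_mult[OF z s(1) t(1)] s(2) t(2) by (intro QI[OF r(1) LR.R_mult[OF s(1) t(1)]]) (simp_all add: algebra_simps)
qed

text \<open>The multipliers at the various points have no common zero on the subvariety, so modulo
  the equations they generate a power of \<open>f0\<close>. That power times r lies in the ideal,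
  and \<open>f0\<close> is regular.\<close>

lemma Q_inter:
 assumes r: "r : LR m" "!!ze. ze : V ==> r : Q ze m"
 shows "r : Fi m"
proof-
 have "ALL ze:V. EX e s. s : LR e & ev ze s ~= 0 & s * r : Fi (e + m)" using r(2) unfolding Q_def by blast
 then obtain e s where s: "!!ze. ze : V ==> s ze : LR (e ze) & ev ze (s ze) ~= 0 & s ze * r : Fi (e ze + m)" by metis
 have "ALL ze:V. s ze : LR (e ze)" "ALL ze:V. (ALL x:V. ev ze (s x) = 0) --> ev ze f0 = 0" using s by blast+
 from nullstellensatz_V[OF V_finite this(1) f0(1) zero_less_one this(2)]
 obtain N t where t: "ALL ze:V. t ze : LR (int N * 1 - e ze)" "f0 ^ N - (SUM ze:V. t ze * s ze) : Fi (int N * 1)" by (elim exE conjE)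
 have 1: "r * (f0 ^ N - (SUM ze:V. t ze * s ze)) : Fi (m + int N)" by (rule LR.gid_mult'[OF r(1) t(2)]) simp
 have 2: "(SUM ze:V. t ze * (s ze * r)) : Fi (m + int N)"
 proof (rule LR.gid_sum)
  fix ze assume z: "ze : V"
  show "t ze * (s ze * r) : Fi (m + int N)" by (rule LR.gid_mult'[OF bspec[OF t(1) z]]) (use s[OF z] in auto)
 qed
 have "r * (f0 ^ N - (SUM ze:V. t ze * s ze)) + (SUM ze:V. t ze * (s ze * r)) = f0 ^ N * r"
  by (simp add: right_diff_distrib sum_distrib_left mult.commute mult.left_commute)
 hence "f0 ^ N * r : Fi (m + int N)" using LR.gid_add[OF 1 2] by simp
 thus ?thesis by (rule Fi_regular[OF r(1)])
qed

abbreviation cdg :: int where "cdg == int (codegree (polytope_of u a))"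

lemma hf_constant':
 assumes "(SUM j=1..n. int (d j)) - cdg < m" "m <= m'"
 shows "ps.hf n m' = ps.hf n m"
proof-
 have 1: "cdg <= fst w" if "!!i. i : (UNIV :: 'k set) ==> 0 < rell i (emb w)" for w
  using that by (intro interior_degree) (simp add: rell_emb)
 have "(SUM j=1..n. int (dg j)) = (SUM j=1..n. int (d j))" by (rule sum.cong) (auto simp: dg_def)
 hence 2: "(SUM j=1..n. int (dg j)) - cdg < m" using assms(1) by simp
 show ?thesis using ps.hf_constant[OF 1 2 assms(2)] by simp
qed

text \<open>Multiplication by a power of \<open>f0\<close> is injective modulo the equations, and
  above the bound source and target have the same dimension.\<close>

lemma f0_surjective:
 assumes m: "(SUM j=1..n. int (d j)) - cdg < m" and r: "r : LR (m + int k)"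
 obtains r' where "r' : LR m" "r - f0 ^ k * r' : Fi (m + int k)"
proof-
 define U where "U = {f0 ^ k * x + y | x y. x : LR m & y : Fi (m + int k)}"
 have UL: "U <= LR (m + int k)"
  using LR.R_mult'[OF f0_power, of _ m "m + int k" k] Fi_subset[of "m + int k"] by (auto simp: U_def intro!: LR.R_add)
 have Usub: "pv.subspace U" unfolding pv.subspace_def
 proof (intro conjI ballI allI)
  have "0 : LR m" "0 : Fi (m + int k)" by (rule LR.R_zero LR.gid_0)+
  thus "0 : U" unfolding U_def by (intro CollectI exI[of _ 0]) simp
  fix x y assume "x : U" "y : U"
  then obtain v w v' w' where "x = f0 ^ k * v + w" "y = f0 ^ k * v' + w'" "v : LR m" "v' : LR m"
   "w : Fi (m + int k)" "w' : Fi (m + int k)" by (auto simp: U_def)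
  thus "x + y : U" unfolding U_def by (intro CollectI exI[of _ "v + v'"] exI[of _ "w + w'"]) (simp add: algebra_simps LR.R_add LR.gid_add)
 next
  fix c x assume "x : U"
  then obtain v w where "x = f0 ^ k * v + w" "v : LR m" "w : Fi (m + int k)" by (auto simp: U_def)
  thus "pscale c x : U" unfolding U_def using pv.subspace_scale[OF ps.LR_subspace] pv.subspace_scale[OF Fi_subspace]
   by (intro CollectI exI[of _ "pscale c v"] exI[of _ "pscale c w"]) (simp add: pv.scale_right_distrib pscale_mult)
 qed
 have FU: "Fi (m + int k) <= U"
 proof
  fix y assume "y : Fi (m + int k)"
  thus "y : U" unfolding U_def using LR.R_zero[of m] by (intro CollectI exI[of _ 0] exI[of _ y]) simp
 qed
 obtain B where B: "pv.qbasis (LR m) (ps.Fid n m) B" "ps.hf n m = int (card B)" by (rule ps.hf_basis)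
 have add: "f0 ^ k * (x + y) = f0 ^ k * x + f0 ^ k * y" for x y by (simp add: distrib_left)
 have scale: "f0 ^ k * pscale c x = pscale c (f0 ^ k * x)" for c x by (simp add: pscale_mult)
 have mem: "f0 ^ k * v : U" if "v : LR m" for v unfolding U_def using LR.gid_0 that by (intro CollectI exI[of _ v] exI[of _ 0]) simp
 have iff: "f0 ^ k * v : Fi (m + int k) <-> v : ps.Fid n m" if "v : LR m" for v
  unfolding Fid_Fi using Fi_regular[OF that] LR.gid_mult'[OF f0_power[of k], of v J fp "%j. int (d j)" m "m + int k"] by auto
 have surj: "EX v:LR m. v' - f0 ^ k * v : Fi (m + int k)" if "v' : U" for v'
 proof-
  obtain x y where "v' = f0 ^ k * x + y" "x : LR m" "y : Fi (m + int k)" using `v' : U` unfolding U_def by blast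
  thus ?thesis by (intro bexI[of _ x]) simp_all
 qed
 note q2 = qbasis_transfer[of pscale pscale, OF pv.qspace_axioms pv.qspace_axioms Fi_subspace B(1) add scale mem ps.LR_subspace iff surj]
 obtain B1 where B1: "pv.qbasis (LR (m + int k)) U B1" using ps.sub_qbasis_exists[OF subset_refl Usub] by blast
 note tr = pv.qbasis_trans[OF Fi_subspace Usub FU B1 q2(1) UL]
 have "ps.hf n (m + int k) = int (card (B1 Un (*) (f0 ^ k) ` B))" by (rule ps.hf_eq) (simp add: Fid_Fi tr(1))
 also have "card (B1 Un (*) (f0 ^ k) ` B) = card B1 + card B" using tr B1 q2 by (subst card_Un_disjoint) (auto simp: pv.qbasis_def)
 finally have "card B1 = 0" using hf_constant'[OF m, of "m + int k"] B(2) by simp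
 hence "B1 = {}" using B1 by (simp add: pv.qbasis_def)
 hence "r : U" using B1 r by (simp add: pv.qbasis_def pv.qspans_def)
 then obtain x y where "r = f0 ^ k * x + y" "x : LR m" "y : Fi (m + int k)" by (auto simp: U_def)
 thus ?thesis using that[of x] by simp
qed

text \<open>Powers of separators act as a partition of unity: b_ze lies in the local ideals of all
  other points, and the b_ze generate a power \<open>f0 ^ K\<close>. In large degrees r is divisible
  by that power modulo the equations.\<close>

lemma decomposition:
 "EX m1. (SUM j=1..n. int (d j)) - cdg < m1 & (ALL m>=m1. ALL r:LR m. EX h. (ALL ze:V. h ze : LR m) &
   (ALL ze:V. ALL ze':V - {ze}. h ze : Q ze' m) & r - (SUM ze:V. h ze) : Fi m)"
proof-
 have "ALL ze:V. EX e s. e > 0 & s : LR e & ev ze s ~= 0 & (ALL ze':V - {ze}. ev ze' s = 0)" using separator by blast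
 then obtain e s where s: "!!ze. ze : V ==> e ze > 0 & s ze : LR (e ze) & ev ze (s ze) ~= 0 & (ALL ze':V - {ze}. ev ze' (s ze) = 0)"
  by metis
 \<comment> \<open>The product of the two separators vanishes on the whole subvariety, so it is
   nilpotent modulo the equations; the factor \<open>s ze'\<close> is invertible at
   \<open>ze'\<close>.\<close>
 have "EX N. s ze ^ N : Q ze' (int N * e ze)" if z: "ze : V" "ze' : V - {ze}" for ze ze'
 proof-
  have sz: "s ze : LR (e ze)" "s ze' : LR (e ze')" "e ze > 0" "e ze' > 0" "ev ze' (s ze') ~= 0" using s z by auto
  have "ev xx (s ze * s ze') = 0" if x: "xx : V" for xx
  proof (cases "xx = ze")
   case True
   hence "ev xx (s ze') = 0" using s[of ze'] z by auto
   thus ?thesis using ev_mult[OF V_X[OF x] sz(1,2)] by simp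
  next
   case False
   hence "ev xx (s ze) = 0" using s[OF z(1)] x by auto
   thus ?thesis using ev_mult[OF V_X[OF x] sz(1,2)] by simp
  qed
  moreover have e0: "ALL x:({}::nat set). 0 : LR 0" by blast
  ultimately have "ALL xx:V. (ALL x:({}::nat set). ev xx 0 = 0) --> ev xx (s ze * s ze') = 0" by blast
  from nullstellensatz_V[OF finite.emptyI e0 LR.R_mult[OF sz(1,2)] add_pos_pos[OF sz(3,4)] this]
  obtain N where N: "(s ze * s ze') ^ N : Fi (int N * (e ze + e ze'))" by auto
  have "s ze' ^ N * s ze ^ N : Fi (int N * e ze' + int N * e ze)" using N by (simp add: power_mult_distrib algebra_simps)
  hence "s ze ^ N : Q ze' (int N * e ze)"
   using ev_power[OF V_X sz(2)] z(2) sz(5) by (intro QI[OF _ LR.R_power[OF sz(2)]] LR.R_power[OF sz(1)]) auto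
  thus ?thesis ..
 qed
 then obtain N where N: "!!ze ze'. ze : V ==> ze' : V - {ze} ==> s ze ^ N ze ze' : Q ze' (int (N ze ze') * e ze)" by metis
 define M where "M = (SUM ze:V. SUM ze':V. N ze ze')"
 define b where "b ze = s ze ^ M" for ze
 have bQ: "b ze : Q ze' (int M * e ze)" if z: "ze : V" "ze' : V - {ze}" for ze ze'
 proof-
  have "N ze ze' <= (SUM ze':V. N ze ze')" using z V_finite by (intro member_le_sum) auto
  also have "... <= M" unfolding M_def using z V_finite by (intro member_le_sum[of ze V "%ze. SUM ze':V. N ze ze'"]) auto
  finally have le: "N ze ze' <= M" .
  hence "b ze = s ze ^ (M - N ze ze') * s ze ^ N ze ze'" by (simp add: b_def flip: power_add)
  moreover have "s ze ^ (M - N ze ze') : LR (int (M - N ze ze') * e ze)" using s[OF z(1)] by (intro LR.R_power) auto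
  moreover have "int M * e ze = int (M - N ze ze') * e ze + int (N ze ze') * e ze" using le by (simp add: of_nat_diff left_diff_distrib)
  ultimately show ?thesis using Q_mult[OF _ N[OF z]] by simp
 qed
 have bL: "b ze : LR (int M * e ze)" if "ze : V" for ze unfolding b_def using s[OF that] by (intro LR.R_power) auto
 have bnz: "ev ze (b ze) ~= 0" if "ze : V" for ze
 proof-
  have "ev ze (b ze) = ev ze (s ze) ^ M" unfolding b_def by (rule ev_power[OF V_X[OF that], of _ "e ze"]) (use s[OF that] in blast)
  thus ?thesis using s[OF that] by simp
 qed
 have "ALL ze:V. b ze : LR (int M * e ze)" "ALL ze:V. (ALL x:V. ev ze (b x) = 0) --> ev ze f0 = 0" using bL bnz by blast+
 from nullstellensatz_V[OF V_finite this(1) f0(1) zero_less_one this(2)]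
 obtain K t where t: "ALL ze:V. t ze : LR (int K * 1 - int M * e ze)" "f0 ^ K - (SUM ze:V. t ze * b ze) : Fi (int K * 1)"
  by (elim exE conjE)
 \<comment> \<open>The least degree above the bound; adding K leaves room for the division by
   \<open>f0 ^ K\<close>.\<close>
 define m0 where "m0 = (SUM j=1..n. int (d j)) - cdg + 1"
 show ?thesis
 proof (intro exI[of _ "m0 + int K"] conjI allI impI ballI)
  show "(SUM j=1..n. int (d j)) - cdg < m0 + int K" by (simp add: m0_def)
  fix m r assume m: "m >= m0 + int K" and r: "r : LR m"
  have "r : LR (m - int K + int K)" "(SUM j=1..n. int (d j)) - cdg < m - int K" using r m by (simp_all add: m0_def)
  then obtain r' where r': "r' : LR (m - int K)" "r - f0 ^ K * r' : Fi m" using f0_surjective[of "m - int K" r K] by auto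
  define h where "h ze = t ze * b ze * r'" for ze
  have tr: "t ze * r' : LR (m - int M * e ze)" if "ze : V" for ze by (rule LR.R_mult'[OF bspec[OF t(1) that] r'(1)]) simp
  have h: "h ze = (t ze * r') * b ze" for ze by (simp add: h_def ac_simps)
  have e1: "r - (SUM ze:V. h ze) = (r - f0 ^ K * r') + r' * (f0 ^ K - (SUM ze:V. t ze * b ze))"
   by (simp add: h_def algebra_simps sum_distrib_left)
  have "r' * (f0 ^ K - (SUM ze:V. t ze * b ze)) : Fi m" by (rule LR.gid_mult'[OF r'(1) t(2)]) simp
  hence A: "r - (SUM ze:V. h ze) : Fi m" unfolding e1 by (rule LR.gid_add[OF r'(2)])
  have B: "ALL ze:V. h ze : LR m" unfolding h by (intro ballI LR.R_mult'[OF tr bL]) simp_all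
  have C: "ALL ze:V. ALL ze':V - {ze}. h ze : Q ze' m" unfolding h by (intro ballI Q_mult[OF tr bQ]) simp_all
  show "EX h. (ALL ze:V. h ze : LR m) & (ALL ze:V. ALL ze':V - {ze}. h ze : Q ze' m) & r - (SUM ze:V. h ze) : Fi m"
   by (intro exI[of _ h] conjI A B C)
 qed
qed

text \<open>The Chinese remainder theorem, adding one point at a time.\<close>

lemma hf_sum:
 "EX m1. (SUM j=1..n. int (d j)) - cdg < m1 & (ALL m>=m1. ALL C. (ALL ze:V. pv.qbasis (LR m) (Q ze m) (C ze)) -->
   ps.hf n m = (SUM ze:V. int (card (C ze))))"
proof-
 obtain m1 where m1: "(SUM j=1..n. int (d j)) - cdg < m1" "ALL m>=m1. ALL r:LR m. EX h. (ALL ze:V. h ze : LR m) &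
   (ALL ze:V. ALL ze':V - {ze}. h ze : Q ze' m) & r - (SUM ze:V. h ze) : Fi m" using decomposition by (elim exE conjE)
 show ?thesis
 proof (intro exI[of _ m1] conjI allI impI m1(1))
  fix m C assume m: "m >= m1" and C: "ALL ze:V. pv.qbasis (LR m) (Q ze m) (C ze)"
  define W where "W S = {r : LR m. ALL ze:S. r : Q ze m}" for S
  have Wsub: "pv.subspace (W S)" if "S <= V" for S
   using ps.LR_subspace[of m] Q_subspace[OF V_X, of _ m] that unfolding pv.subspace_def W_def by (auto simp: subset_iff)
  have all: "EX B. pv.qbasis (LR m) (W S) B & card B = (SUM ze:S. card (C ze))" if "finite S" "S <= V" for S using that
  proof (induction S rule: finite_induct)
   case empty
   have "pv.qbasis (LR m) (W {}) {}" by (simp add: pv.qbasis_def pv.qspans_def pv.qindep_def W_def)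
   thus ?case by (intro exI[of _ "{}"]) simp
  next
   case (insert xx S)
   then obtain B where B: "pv.qbasis (LR m) (W S) B" "card B = (SUM ze:S. card (C ze))" by blast
   have xV: "xx : V" and SV: "S <= V" using insert.prems by auto
   have WL: "W S <= LR m" by (auto simp: W_def)
   have ins: "W (insert xx S) = W S Int Q xx m" by (auto simp: W_def)
   obtain D where D: "pv.qbasis (W S) (W (insert xx S)) D" using ps.sub_qbasis_exists[OF WL Wsub[OF insert.prems]] by blast
   \<comment> \<open>The two ideals are comaximal in this degree: the summand of r at
     \<open>xx\<close> lies in all the other local ideals.\<close>
   have sumW: "EX x:W S. r - x : Q xx m" if r: "r : LR m" for r
   proof-
    obtain h where h: "ALL ze:V. h ze : LR m" "ALL ze:V. ALL ze':V - {ze}. h ze : Q ze' m"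
     "r - (SUM ze:V. h ze) : Fi m" using m1(2)[rule_format, OF m r] by (elim exE conjE)
    have "h xx : Q ze m" if "ze : S" for ze using bspec[OF h(2) xV] that SV insert.hyps(2) by blast
    hence "h xx : W S" using bspec[OF h(1) xV] by (simp add: W_def)
    moreover have "(SUM ze:V - {xx}. h ze) : Q xx m" by (rule pv.subspace_sum[OF Q_subspace[OF V_X[OF xV]]]) (use h(2) xV in blast)
    hence "(r - (SUM ze:V. h ze)) + (SUM ze:V - {xx}. h ze) : Q xx m" by (rule Q_add[OF V_X[OF xV] Fi_Q[OF V_X[OF xV] h(3)]])
    moreover have "(r - (SUM ze:V. h ze)) + (SUM ze:V - {xx}. h ze) = r - h xx" using sum.remove[OF V_finite xV, of h] by simp
    ultimately show ?thesis by (intro bexI[of _ "h xx"]) simp_all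
   qed
   have i1: "v : Q xx m <-> v : W (insert xx S)" if "v : W S" for v unfolding ins using that by simp
   have i2: "v : LR m" if "v : W S" for v using that WL by blast
   note DQ = qbasis_transfer(1)[of pscale pscale, OF pv.qspace_axioms pv.qspace_axioms Q_subspace[OF V_X[OF xV]] D
    refl refl i2 Wsub[OF SV] i1 sumW, unfolded image_ident]
   have cD: "card D = card (C xx)" by (rule pv.qbasis_card_unique[OF Q_subspace[OF V_X[OF xV]] DQ bspec[OF C xV]])
   note tr = pv.qbasis_trans[OF Wsub[OF insert.prems] Wsub[OF SV] _ B(1) D WL]
   have "W (insert xx S) <= W S" by (auto simp: W_def)
   note tr = tr[OF this]
   have "card (B Un D) = card B + card D" using tr B(1) D by (intro card_Un_disjoint) (auto simp: pv.qbasis_def)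
   thus ?case using tr(1) B(2) cD insert.hyps by (intro exI[of _ "B Un D"]) simp
  qed
  from all[OF V_finite subset_refl]
  obtain B where B: "pv.qbasis (LR m) (W V) B" "card B = (SUM ze:V. card (C ze))" by (elim exE conjE)
  have "W V = Fi m"
  proof
   show "W V <= Fi m" using Q_inter[of _ m] by (simp add: W_def subset_iff)
   show "Fi m <= W V" using Fi_subset[of m] Fi_Q[OF V_X, of _ _ m] by (simp add: W_def subset_iff)
  qed
  thus "ps.hf n m = (SUM ze:V. int (card (C ze)))" using ps.hf_eq[of m n B] B by (simp add: Fid_Fi)
 qed
qed

end

section \<open>Germs as fractions of homogeneous elements\<close>

lemma (in qspace) qspans_mono: "qspans W V C ==> W <= U ==> qspans U V C"
 unfolding qspans_def by blast

text \<open>An injective map between quotients of equal finite dimension; a basis of the cokernel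
  would be empty.\<close>

lemma qbasis_surj:
 fixes s :: "complex => 'b::ab_group_add => 'b"
 assumes q: "qspace s" and W': "module.subspace s W'" "W' <= V'" and V': "module.subspace s V'"
  and C: "qspace.qbasis s V W C" and C': "qspace.qbasis s V' W' C'" "card C' = card C"
  and ph: "!!x y. ph (x + y) = ph x + ph y" "!!c x. ph (s c x) = s c (ph x)"
  and V: "!!v. v : V ==> ph v : V'" "module.subspace s V"
  and iff: "!!v. v : V ==> ph v : W' <-> v : W" and y: "y : V'"
 shows "EX v:V. y - ph v : W'"
proof-
 interpret qspace s by (rule q)
 define U where "U = {ph x + z | x z. x : V & z : W'}"
 have UV: "U <= V'" using V(1) W'(2) subspace_add[OF V'] by (auto simp: U_def)
 have ph0: "ph 0 = 0" using ph(2)[of 0 0] by simp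
 have Usub: "subspace U" unfolding subspace_def
 proof (intro conjI ballI allI)
  show "0 : U" unfolding U_def using subspace_0[OF V(2)] subspace_0[OF W'(1)] ph0 by (intro CollectI exI[of _ 0]) simp
  fix x y assume "x : U" "y : U"
  then obtain v w v' w' where "x = ph v + w" "y = ph v' + w'" "v : V" "v' : V" "w : W'" "w' : W'" by (auto simp: U_def)
  thus "x + y : U" unfolding U_def using subspace_add[OF V(2)] subspace_add[OF W'(1)]
   by (intro CollectI exI[of _ "v + v'"] exI[of _ "w + w'"]) (simp add: ph(1) algebra_simps)
 next
  fix c x assume "x : U"
  then obtain v w where "x = ph v + w" "v : V" "w : W'" by (auto simp: U_def)
  thus "s c x : U" unfolding U_def using subspace_scale[OF V(2)] subspace_scale[OF W'(1)]
   by (intro CollectI exI[of _ "s c v"] exI[of _ "s c w"]) (simp add: ph(2) scale_right_distrib)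
 qed
 have WU: "W' <= U"
 proof
  fix z assume "z : W'"
  thus "z : U" unfolding U_def using subspace_0[OF V(2)] ph0 by (intro CollectI exI[of _ 0] exI[of _ z]) simp
 qed
 have mem: "ph v : U" if "v : V" for v unfolding U_def using subspace_0[OF W'(1)] that by (intro CollectI exI[of _ v] exI[of _ 0]) simp
 have surj: "EX v:V. v' - ph v : W'" if "v' : U" for v'
 proof-
  obtain x z where "v' = ph x + z" "x : V" "z : W'" using `v' : U` unfolding U_def by blast
  thus ?thesis by (intro bexI[of _ x]) simp_all
 qed
 note t2 = qbasis_transfer[OF q q W'(1) C ph mem V(2) iff surj]
 have "finite C'" "qspans U V' C'" using C'(1) qspans_mono[OF _ WU] by (auto simp: qbasis_def)
 then obtain B where B: "qbasis V' U B" using qbasis_finite_spans[OF Usub] by blast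
 note tr = qbasis_trans[OF W'(1) Usub WU B t2(1) UV]
 have "card C' = card (B Un ph ` C)" by (rule qbasis_card_unique[OF W'(1) C'(1) tr(1)])
 also have "... = card B + card C" using tr(2) B t2 by (subst card_Un_disjoint) (auto simp: qbasis_def)
 finally have "B = {}" using C'(2) B by (simp add: qbasis_def)
 hence "y : U" using B y by (simp add: qbasis_def qspans_def)
 thus ?thesis by (rule surj)
qed

text \<open>A polynomial vanishing at all bases but one isolates the coefficient of that
  one.\<close>

lemma exponential_independence:
 fixes a :: "'w => complex" and x :: "'w => complex"
 assumes A: "finite A" "inj_on x A" and z: "!!k. (SUM w:A. a w * x w ^ k) = 0" and v: "v : A"
 shows "a v = 0"
proof-
 define q where "q = (PROD w:A - {v}. [:- x w, 1:])"
 have q: "poly q (x w) = (PROD w':A - {v}. x w - x w')" for w by (simp add: q_def poly_prod)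
 have "(SUM w:A. a w * poly q (x w)) = (SUM w:A. SUM k<=degree q. coeff q k * (a w * x w ^ k))"
  by (simp add: poly_altdef sum_distrib_left algebra_simps)
 also have "... = (SUM k<=degree q. coeff q k * (SUM w:A. a w * x w ^ k))" by (subst sum.swap) (simp add: sum_distrib_left)
 finally have "(SUM w:A. a w * poly q (x w)) = 0" by (simp add: z)
 moreover have "poly q (x w) = 0" if "w : A - {v}" for w unfolding q using that A(1) by (intro prod_zero) auto
 hence "(SUM w:A - {v}. a w * poly q (x w)) = 0" by (intro sum.neutral) simp
 ultimately have "a v * poly q (x v) = 0" using sum.remove[OF A(1) v, of "%w. a w * poly q (x w)"] by simp
 moreover have "poly q (x v) ~= 0" unfolding q using A v by (auto simp: inj_on_def)
 ultimately show ?thesis by simp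
qed

lemma separating_vector:
 fixes S :: "'e::euclidean_space set"
 assumes "finite S" "0 ~: S"
 obtains c where "!!v. v : S ==> v \<bullet> c ~= 0"
proof-
 have "negligible (UN v:S. {c. v \<bullet> c = 0})" using assms by (intro negligible_Union) (auto intro: negligible_hyperplane)
 hence "(UN v:S. {c. v \<bullet> c = 0}) ~= UNIV" using non_negligible_UNIV by metis
 thus ?thesis using that by auto
qed

context zero_dim_system
begin

text \<open>Points of the torus suffice: along a generic one-parameter subgroup distinct exponents
  have distinct exponentials, which are linearly independent.\<close>

lemma vanishes_everywhere:
 assumes D: "D : LR m" and z: "!!xx. xx : X ==> ev xx D = 0"
 shows "D = 0"
proof-
 obtain ta where ta: "ta : Sg" "0 : rel_interior ta" using relint_cone_exists by blast
 have t0: "crays ta = {}"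
 proof (rule ccontr)
  assume "crays ta ~= {}"
  then obtain i where "rv (u i) : ta" by (auto simp: crays_def)
  moreover have "x = 0" if x: "x : ta" for x
  proof-
   obtain e where e: "e > 1" "(1 - e) \<cdot> x + e \<cdot> 0 : ta"
    using convex_rel_interior_iff[OF cone_convex[OF ta(1)], of 0] ta x by (metis empty_iff)
   have "(1 / (e - 1)) \<cdot> ((1 - e) \<cdot> x + e \<cdot> 0) : ta" by (rule cone_scale[OF ta(1) e(2)]) (use e(1) in simp)
   moreover have "(1 / (e - 1)) * (1 - e) = - 1" using e(1) by (simp add: field_simps)
   ultimately have "- x : ta" by simp
   thus ?thesis using cone_antisym[OF ta(1) x] by blast
  qed
  ultimately have "rv (u i) = 0" by blast
  thus False using u_nonzero[of i] by simp
 qed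
 have perp: "perp ta = UNIV" by (auto simp: perp_def t0)
 let ?K = "pkeys D"
 have K: "fst w = m" if "w : ?K" for w using D that by (auto simp: LR_def)
 define S where "S = (%(w, w'). rv (snd w - snd w')) ` (?K \<times> ?K) - {0}"
 obtain c where c: "!!v. v : S ==> v \<bullet> c ~= 0" by (rule separating_vector[of S]) (auto simp: S_def)
 define x where "x w = complex_of_real (exp (rv (snd w) \<bullet> c))" for w :: "int \<times> (int ^ 'n)"
 have "inj_on x ?K"
 proof (rule inj_onI)
  fix w w' assume w: "w : ?K" "w' : ?K" "x w = x w'"
  hence "rv (snd w - snd w') \<bullet> c = 0" by (simp add: x_def rv_diff inner_diff_left)
  hence "rv (snd w - snd w') ~: S" using c by blast
  hence "rv (snd w - snd w') = 0" using w(1,2) by (force simp: S_def)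
  thus "w = w'" using K[OF w(1)] K[OF w(2)] by (simp add: prod_eq_iff)
 qed
 moreover have "(SUM w:?K. lkp D w * x w ^ k) = 0" for k
 proof-
  define th where "th p = complex_of_real (exp (real k * (rv p \<bullet> c)))" for p :: "int ^ 'n"
  have th: "mchar UNIV th" by (simp add: mchar_def th_def rv_add inner_add_left distrib_left exp_add)
  have "x w ^ k = th (m *s vtx ta) * etac ta th w" if "w : ?K" for w
  proof-
   have "snd w = m *s vtx ta + dk ta w" using K[OF that] by (simp add: dk_def)
   hence "th (snd w) = th (m *s vtx ta) * th (dk ta w)" using th by (metis UNIV_I mchar_def)
   moreover have "x w ^ k = th (snd w)" by (simp add: x_def th_def exp_of_nat_mult flip: of_real_power)
   ultimately show ?thesis by (simp add: etac_def orbc_def perp)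
  qed
  hence "(SUM w:?K. lkp D w * x w ^ k) = (SUM w:?K. th (m *s vtx ta) * (lkp D w * etac ta th w))" by (intro sum.cong) simp_all
  also have "... = th (m *s vtx ta) * ev (opt ta th) D" by (simp add: eta_opt[OF ta(1) th] mev_def monext_def sum_distrib_left)
  also have "... = 0" using z[of "opt ta th"] tvar_opt ta(1) th by auto
  finally show ?thesis .
 qed
 ultimately have "lkp D w = 0" for w using exponential_independence[of ?K x "lkp D" w] by (cases "w : ?K") (simp_all add: in_keys_iff)
 thus ?thesis by (intro poly_mapping_eqI) simp
qed

lemma cval_ev:
 assumes si: "si : Sg" and xx: "xx : cpts Sg si"
 obtains ka where "!!m. ka m ~= 0" "!!m r. r : LR m ==> cval si (dhom si r) xx = ka m * ev xx r"
proof-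
 obtain rh th where t: "rh : Sg" "mchar UNIV th" "xx = opt rh th" "si : Sg" "rh <= si" by (rule chart_pointE[OF xx])
 have v: "cval si (dhom si r) xx = th (m *s (vtx rh - vtx si)) * ev xx r" if "r : LR m" for m r
  using cval_dhom[OF t(1,2) si t(5) that] eta_opt[OF t(1,2)] t(3) by simp
 show ?thesis by (rule that[of "%m. th (m *s (vtx rh - vtx si))"]) (use v mchar_inverse(2)[OF t(2)] in auto)
qed

text \<open>Germs written with global sections of one degree instead of chart functions. This brings
  the local ring into contact with the graded pieces.\<close>

definition fracs :: "'n toric_point => (int => ((int \<times> (int ^ 'n)) \<Rightarrow>\<^sub>0 complex) set) => ('n toric_point => complex) set" where
 "fracs ze P = {h. EX e. EX A:P e. EX B:LR e. ev ze B ~= 0 & (ALL xx:X. ev xx B ~= 0 --> h xx = ev xx A / ev xx B)}"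

lemma fractionsI:
 "A : P e ==> B : LR e ==> ev ze B ~= 0 ==> (!!xx. xx : X ==> ev xx B ~= 0 ==> h xx = ev xx A / ev xx B) ==> h : fracs ze P"
 unfolding fracs_def by blast

lemma fraction_germ:
 assumes ze: "ze : X" and h: "h : fracs ze P"
  and PL: "!!e. P e <= LR e" and dP: "!!si A e. si : Sg ==> A : P e ==> dhom si A : R si"
 shows "h : germs Sg ze R"
proof-
 obtain e A B where AB: "A : P e" "B : LR e" "ev ze B ~= 0" "ALL xx:X. ev xx B ~= 0 --> h xx = ev xx A / ev xx B"
  using h unfolding fracs_def by blast
 obtain ta th where t: "ta : Sg" "mchar UNIV th" "ze = opt ta th" "eta ze = etac ta th" by (rule pointE[OF ze])
 have zt: "ze : cpts Sg ta" using cpts_opt[OF t(1,2)] t(1,3) by simp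
 have AL: "A : LR e" using AB(1) PL by blast
 have "cval ta (dhom ta B) ze ~= 0" by (rule cval_ev[OF t(1) zt]) (use AB(2,3) in simp)
 moreover have "h xx = cval ta (dhom ta A) xx / cval ta (dhom ta B) xx" if x: "xx : cpts Sg ta" "cval ta (dhom ta B) xx ~= 0" for xx
 proof-
  obtain ka where ka: "!!m. ka m ~= 0" "!!m r. r : LR m ==> cval ta (dhom ta r) xx = ka m * ev xx r" by (fact cval_ev[OF t(1) x(1)])
  have "xx : X" using x(1) by (simp add: cpts_def)
  moreover have "ev xx B ~= 0" using x(2) ka(2)[OF AB(2)] by auto
  ultimately show ?thesis using AB(4) ka(1)[of e] by (simp add: ka(2)[OF AB(2)] ka(2)[OF AL])
 qed
 moreover have "dhom ta B : cring ta" by (rule dhom_cring[OF t(1) LR_monalg[OF AB(2)]])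
 moreover have "dhom ta A : R ta" by (rule dP[OF t(1) AB(1)])
 ultimately show ?thesis unfolding germs_def using t(1) zt by blast
qed

lemma dhom_chart_ideal:
 assumes si: "si : Sg" and A: "A : Fi e"
 shows "dhom si A : chart_ideal u I si"
proof-
 obtain t where t: "!!j. j : J ==> t j : LR (e - int (d j))" "A = (SUM j:J. t j * fp j)" using A unfolding LR.gid_def by blast
 have "dhom si A = (SUM j:J. dhom si (t j) * dhom si (fp j))" unfolding t(2) by (simp add: monmap_sum monmap_mult[OF additive_dk])
 thus ?thesis unfolding chart_ideal_iff[OF si] using dhom_cring[OF si LR_monalg[OF t(1)]] by (intro exI[of _ "%j. dhom si (t j)"]) simp
qed

lemma large_multiple:
 assumes w0: "w0 : L" "!!i. ell i w0 = 0 <-> i : crays ta"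
  and S: "finite S" "!!v i. v : S ==> i : crays ta ==> ell i v >= 0"
 obtains k where "!!v. v : S ==> nmul k w0 + v : L"
proof-
 define k where "k = nat (SUM v:S. SUM i:UNIV. \<bar>ell i v\<bar>)"
 have "nmul k w0 + v : L" if v: "v : S" for v unfolding L_def
 proof safe
  fix i
  show "ell i (nmul k w0 + v) >= 0"
  proof (cases "i : crays ta")
   case True
   hence "ell i w0 = 0" using w0(2) by blast
   thus ?thesis using S(2)[OF v True] by (simp add: ell_add ell_nmul)
  next
   case False
   hence "ell i w0 ~= 0" "ell i w0 >= 0" using w0 by (auto simp: L_def)
   hence "int k * ell i w0 >= int k * 1" by (intro mult_left_mono) auto
   moreover have "\<bar>ell i v\<bar> <= (SUM i:UNIV. \<bar>ell i v\<bar>)" by (rule member_le_sum) auto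
   moreover have "(SUM i:UNIV. \<bar>ell i v\<bar>) <= (SUM v:S. SUM i:UNIV. \<bar>ell i v\<bar>)"
    by (rule member_le_sum[OF v]) (use S(1) in "auto intro: sum_nonneg")
   ultimately have "\<bar>ell i v\<bar> <= int k" "int k <= int k * ell i w0" unfolding k_def by linarith+
   thus ?thesis unfolding ell_add ell_nmul by linarith
  qed
 qed
 thus ?thesis using that by blast
qed

abbreviation deg0 :: "((int ^ 'n) \<Rightarrow>\<^sub>0 complex) => (int \<times> (int ^ 'n)) \<Rightarrow>\<^sub>0 complex" where
 "deg0 == monmap (Pair 0)"

lemma additive_Pair0: "additive_map (Pair (0::int) :: int ^ 'n => _)"
 by (simp add: additive_map_def zero_prod_def)

lemma ev_shifted:
 assumes xx: "xx : cpts Sg si" and w0: "w0 : L" "eta xx w0 ~= 0" and g: "g : cring si"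
 shows "ev xx (msing (nmul k w0) 1 * deg0 g) = eta xx w0 ^ k * cval si g xx"
proof-
 obtain rh th where t: "rh : Sg" "mchar UNIV th" "xx = opt rh th" "si : Sg" "rh <= si" by (rule chart_pointE[OF xx])
 have et: "eta xx = etac rh th" using eta_opt[OF t(1,2)] t(3) by simp
 have kp: "dk rh (nmul k w0) : perp rh" using w0(2) unfolding et dk_perp[OF t(1)] etac_nonzero[OF t(1,2)] by (simp add: ell_nmul)
 have kv: "etac rh th (nmul k w0) = eta xx w0 ^ k" unfolding et by (rule character_nmul[OF etac_character[OF t(1,2)] w0(1)])
 have "etac rh th (nmul k w0 + (0, p)) = eta xx w0 ^ k * orbc rh th p" if "p : pkeys g" for p
 proof-
  have p: "p : dsg rh" using g that dual_mono[OF t(5)] by (auto simp: cring_def)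
  have "dk rh (nmul k w0 + (0, p)) = dk rh (nmul k w0) + p" by (simp add: dk_def dk_add)
  hence "etac rh th (nmul k w0 + (0, p)) = orbc rh th (dk rh (nmul k w0)) * orbc rh th p"
   using orbc_character[OF t(1,2)] perp_dual[OF t(1) kp] p by (simp add: etac_def mchar_def)
  thus ?thesis using kv by (simp add: etac_def)
 qed
 hence "(SUM p:pkeys g. lkp g p * etac rh th (nmul k w0 + (0, p))) = eta xx w0 ^ k * mev (orbc rh th) g"
  by (simp add: mev_def monext_def sum_distrib_left algebra_simps)
 moreover have "msing (nmul k w0) 1 * deg0 g = (SUM p:pkeys g. msing (nmul k w0 + (0, p)) (lkp g p))"
  by (simp add: monmap_def monext_def sum_distrib_left mult_single)
 ultimately have "ev xx (msing (nmul k w0) 1 * deg0 g) = eta xx w0 ^ k * mev (orbc rh th) g" by (simp add: mev_sum et)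
 thus ?thesis unfolding t(3) cval_opt[OF t(4,5) g] .
qed

text \<open>Multiplication by powers of \<open>w0\<close>, a section that is nonzero at the point
  and vanishes outside the chart, extends chart functions to sections of one degree without changing
  their quotient.\<close>

lemma germ_fraction:
 assumes ze: "ze : V" "ze : cpts Sg si" and si: "si : Sg" and g: "g : cring si" and s: "s : cring si" "cval si s ze ~= 0"
  and h: "!!xx. xx : cpts Sg si ==> cval si s xx ~= 0 ==> h xx = cval si g xx / cval si s xx"
 shows "h : fracs ze LR" "g : chart_ideal u I si ==> h : fracs ze (%e. Fi e)"
proof-
 obtain ta th where t: "ta : Sg" "mchar UNIV th" "ze = opt ta th" "si : Sg" "ta <= si" by (rule chart_pointE[OF ze(2)])
 obtain w0 where w0: "w0 : L" "fst w0 > 0" "!!i. ell i w0 = 0 <-> i : crays ta" using V_point_face[OF t(1,2)] ze(1) t(3) by blast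
 have zw: "eta ze w0 ~= 0" using w0(3) etac_nonzero[OF t(1,2)] eta_opt[OF t(1,2)] t(3) by simp
 have near: "xx : cpts Sg si" if x: "xx : X" "eta xx w0 ~= 0" for xx
 proof-
  obtain rh ph where r: "rh : Sg" "mchar UNIV ph" "xx = opt rh ph" "eta xx = etac rh ph" by (rule pointE[OF x(1)])
  have "crays rh <= crays ta" using x(2) w0(3) unfolding r(4) etac_nonzero[OF r(1,2)] by blast
  hence "rh <= si" using cone_subset[OF r(1) t(1)] t(5) by blast
  thus ?thesis using cpts_opt[OF r(1,2)] si r(3) by simp
 qed
 have dual: "pairing (u i) p >= 0" if "p : dsg si" "i : crays ta" for p i using that crays_mono[OF t(5)] by (auto simp: dsg_iff[OF si])
 define bb where "bb j = (int (d j), int (d j) *s vtx si)" for j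
 have bb: "ell i (bb j) = 0" if "i : crays ta" for i j
  using vtx(2)[OF si, of i] that crays_mono[OF t(5)] by (auto simp: bb_def ell_def pairing_scale_right)
 have main: "EX e. EX A:LR e. EX B:LR e. ev ze B ~= 0 & (ALL xx:X. ev xx B ~= 0 --> h xx = ev xx A / ev xx B) &
   (g = (SUM j:J. q j * dhom si (fp j)) --> A : Fi e)" if q: "!!j. j : J ==> q j : cring si" for q
 proof-
  \<comment> \<open>All exponents that have to become effective: those of numerator and denominator,
    and those of the coefficients after division by the local generators of the equations.\<close>
  define S where "S = Pair 0 ` pkeys g Un Pair 0 ` pkeys s Un (UN j:J. (%p. (0, p) - bb j) ` pkeys (q j))"
  have "finite S" by (simp add: S_def)
  moreover have "ell i v >= 0" if v: "v : S" "i : crays ta" for v i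
  proof-
   have e0: "ell i (0, p) = pairing (u i) p" for p by (simp add: ell_def)
   from v(1) consider p where "v = (0, p)" "p : dsg si" | j p where "v = (0, p) - bb j" "p : dsg si"
    using g s(1) q unfolding S_def cring_def by blast
   thus ?thesis by cases (use dual[OF _ v(2)] bb[OF v(2)] in "auto simp: e0 ell_diff")
  qed
  ultimately obtain k where k: "!!v. v : S ==> nmul k w0 + v : L" using large_multiple[OF w0(1,3)] by blast
  let ?m = "int k * fst w0"
  have dm: "fst (nmul k w0) = ?m" by (rule deg_nmul)
  have hL: "msing (nmul k w0) 1 * deg0 r : LR ?m" if "Pair 0 ` pkeys r <= S" for r
  proof-
   have "msing (nmul k w0) 1 * deg0 r = (SUM p:pkeys r. msing (nmul k w0 + (0, p)) (lkp r p))"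
    by (simp add: monmap_def monext_def sum_distrib_left mult_single)
   also have "... : LR ?m" by (intro LR.R_sum LR_single k) (use that dm in auto)
   finally show ?thesis .
  qed
  have w1: "msing w0 1 : LR (fst w0)" by (rule LR_single[OF w0(1) refl])
  \<comment> \<open>The separate factor \<open>w0\<close> ensures vanishing outside the chart even
    when k is 0.\<close>
  define A where "A = msing w0 1 * (msing (nmul k w0) 1 * deg0 g)"
  define B where "B = msing w0 1 * (msing (nmul k w0) 1 * deg0 s)"
  have L: "msing (nmul k w0) 1 * deg0 g : LR ?m" "msing (nmul k w0) 1 * deg0 s : LR ?m" by (intro hL; auto simp: S_def)+
  have AB: "A : LR (fst w0 + ?m)" "B : LR (fst w0 + ?m)" unfolding A_def B_def by (intro LR.R_mult w1 L)+
  have evA: "ev xx A = eta xx w0 * (eta xx w0 ^ k * cval si g xx)"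
   and evB: "ev xx B = eta xx w0 * (eta xx w0 ^ k * cval si s xx)" if x: "xx : X" "eta xx w0 ~= 0" for xx
   using ev_mult[OF x(1) w1 L(1)] ev_mult[OF x(1) w1 L(2)] ev_shifted[OF near[OF x] w0(1) x(2) g, of k]
    ev_shifted[OF near[OF x] w0(1) x(2) s(1), of k] by (simp_all add: A_def B_def)
  have "ev ze B ~= 0" using evB[OF V_X[OF ze(1)] zw] zw s(2) by simp
  moreover have "h xx = ev xx A / ev xx B" if x: "xx : X" "ev xx B ~= 0" for xx
  proof-
   have n: "eta xx w0 ~= 0" using x(2) ev_mult[OF x(1) w1 L(2)] by (auto simp: B_def)
   hence "cval si s xx ~= 0" using evB[OF x(1) n] x(2) by auto
   thus ?thesis using h[OF near[OF x(1) n]] n by (simp add: evA[OF x(1) n] evB[OF x(1) n])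
  qed
  moreover have "A : Fi (fst w0 + ?m)" if gq: "g = (SUM j:J. q j * dhom si (fp j))"
  proof-
   have dj: "deg0 (dhom si (fp j)) = msing (- bb j) 1 * fp j" if j: "j : J" for j
   proof-
    have "deg0 (dhom si (fp j)) = msing (- bb j) 1 * monmap id (fp j)" unfolding monmap_compose
    proof (rule monmap_shift)
     fix w assume "w : pkeys (fp j)"
     hence "fst w = int (d j)" using fp_LR[OF j] by (auto simp: LR_def)
     thus "(Pair 0 \<circ> dk si) w = - bb j + id w" by (simp add: bb_def dk_def prod_eq_iff)
    qed
    also have "monmap id (fp j) = fp j" using pm_sum_single[of "fp j"] by (simp add: monmap_def monext_def)
    finally show ?thesis .
   qed
   have "msing (nmul k w0) 1 * deg0 g = (SUM j:J. (msing (nmul k w0 - bb j) 1 * deg0 (q j)) * fp j)"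
   proof-
    have "msing (nmul k w0) 1 * deg0 g = (SUM j:J. msing (nmul k w0) 1 * (deg0 (q j) * (msing (- bb j) 1 * fp j)))"
     unfolding gq monmap_sum monmap_mult[OF additive_Pair0] sum_distrib_left by (intro sum.cong refl) (simp only: dj)
    also have "... = (SUM j:J. (msing (nmul k w0) 1 * msing (- bb j) 1) * deg0 (q j) * fp j)" by (simp only: ac_simps)
    finally show ?thesis by (simp add: mult_single)
   qed
   moreover have "msing (nmul k w0 - bb j) 1 * deg0 (q j) : LR (?m - int (d j))" if j: "j : J" for j
   proof-
    have "msing (nmul k w0 - bb j) 1 * deg0 (q j) = (SUM p:pkeys (q j). msing (nmul k w0 + ((0, p) - bb j)) (lkp (q j) p))"
     by (simp add: monmap_def monext_def sum_distrib_left mult_single algebra_simps)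
    also have "... : LR (?m - int (d j))"
    proof (intro LR.R_sum LR_single k)
     fix p assume "p : pkeys (q j)"
     thus "(0, p) - bb j : S" using j by (auto simp: S_def)
     show "fst (nmul k w0 + ((0, p) - bb j)) = ?m - int (d j)" using dm by (simp add: bb_def)
    qed
    finally show ?thesis .
   qed
   ultimately have "msing (nmul k w0) 1 * deg0 g : Fi ?m"
    unfolding LR.gid_def by (intro CollectI exI[of _ "%j. msing (nmul k w0 - bb j) 1 * deg0 (q j)"]) simp
   thus ?thesis unfolding A_def by (rule LR.gid_mult[OF w1])
  qed
  ultimately show ?thesis using AB by blast
 qed
 from main[of "%_. 1", OF one_cring] show "h : fracs ze LR" unfolding fracs_def by blast
 assume "g : chart_ideal u I si"
 then obtain q where q: "!!j. j : J ==> q j : cring si" "g = (SUM j:J. q j * dhom si (fp j))" using chart_ideal_iff[OF si] by blast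
 from main[of q, OF q(1)] q(2) show "h : fracs ze (%e. Fi e)" unfolding fracs_def by blast
qed

lemma germs_cring: "ze : V ==> germs Sg ze cring = fracs ze LR"
proof
 assume z: "ze : V"
 show "germs Sg ze cring <= fracs ze LR" unfolding germs_def using germ_fraction(1)[OF z] by blast
 show "fracs ze LR <= germs Sg ze cring" by (rule subsetI, rule fraction_germ[OF V_X[OF z]]) (auto intro: dhom_cring LR_monalg)
qed

lemma germs_chart_ideal:
 assumes z: "ze : V" and FL: "!!e. Fi e <= LR e"
 shows "germs Sg ze (chart_ideal u I) = fracs ze (%e. Fi e)"
proof
 show "germs Sg ze (chart_ideal u I) <= fracs ze (%e. Fi e)"
 proof
  fix h assume "h : germs Sg ze (chart_ideal u I)"
  then obtain si g s where s: "si : Sg" "ze : cpts Sg si" "g : chart_ideal u I si" "s : cring si"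
   "cval si s ze ~= 0"
   and h: "ALL xx:cpts Sg si. cval si s xx ~= 0 --> h xx = cval si g xx / cval si s xx" unfolding germs_def by blast
  have "g : cring si" using s(3) by (simp add: chart_ideal_def)
  thus "h : fracs ze (%e. Fi e)" by (rule germ_fraction(2)[OF z s(2,1) _ s(4,5) _ s(3)]) (use h in blast)
 qed
 show "fracs ze (%e. Fi e) <= germs Sg ze (chart_ideal u I)"
 proof
  fix h assume h: "h : fracs ze (%e. Fi e)"
  show "h : germs Sg ze (chart_ideal u I)" by (rule fraction_germ[OF V_X[OF z] h FL]) (rule dhom_chart_ideal)
 qed
qed

end

section \<open>Multiplicities as dimensions of graded quotients\<close>

interpretation fv: qspace "%c h xx. c * h xx :: complex" by unfold_locales (simp_all add: fun_eq_iff algebra_simps plus_fun_def)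

context generic_system
begin

lemma fracs_subspace:
 assumes z: "ze : X"
 shows "fv.subspace (fracs ze (%e. Fi e))"
 unfolding fv.subspace_def
proof (intro conjI ballI allI)
 have "0 : Fi 0" "(1 :: (int \<times> (int ^ 'n)) \<Rightarrow>\<^sub>0 complex) : LR 0" by (rule LR.gid_0 LR.R_one)+
 thus "0 : fracs ze (%e. Fi e)" by (rule fractionsI) (use ev_one[OF z] in simp_all)
 fix h h' assume "h : fracs ze (%e. Fi e)" "h' : fracs ze (%e. Fi e)"
 then obtain e A B e' A' B' where A: "A : Fi e" "B : LR e" "ev ze B ~= 0" "ALL xx:X. ev xx B ~= 0 --> h xx = ev xx A / ev xx B"
  and A': "A' : Fi e'" "B' : LR e'" "ev ze B' ~= 0" "ALL xx:X. ev xx B' ~= 0 --> h' xx = ev xx A' / ev xx B'" unfolding fracs_def by blast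
 have AL: "A : LR e" "A' : LR e'" using A(1) A'(1) Fi_subset by blast+
 show "h + h' : fracs ze (%e. Fi e)"
 proof (rule fractionsI[of _ _ "e + e'" "B * B'"])
  show "B' * A + B * A' : Fi (e + e')" by (intro LR.gid_add LR.gid_mult'[OF A'(2) A(1)] LR.gid_mult'[OF A(2) A'(1)]) simp_all
  show "B * B' : LR (e + e')" by (rule LR.R_mult[OF A(2) A'(2)])
  show "ev ze (B * B') ~= 0" using ev_mult[OF z A(2) A'(2)] A(3) A'(3) by simp
  fix xx assume x: "xx : X" "ev xx (B * B') ~= 0"
  hence "ev xx B ~= 0" "ev xx B' ~= 0" using ev_mult[OF x(1) A(2) A'(2)] by auto
  moreover from this have "(h + h') xx = ev xx A / ev xx B + ev xx A' / ev xx B'" using A(4) A'(4) x(1) by (simp add: plus_fun_def)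
  ultimately have "(h + h') xx = (ev xx B' * ev xx A + ev xx B * ev xx A') / (ev xx B * ev xx B')" by (simp add: field_simps)
  thus "(h + h') xx = ev xx (B' * A + B * A') / ev xx (B * B')"
   by (simp add: mev_add ev_mult[OF x(1) A(2) A'(2)] ev_mult[OF x(1) A'(2) AL(1)] ev_mult[OF x(1) A(2) AL(2)])
 qed
next
 fix c h assume "h : fracs ze (%e. Fi e)"
 then obtain e A B where A: "A : Fi e" "B : LR e" "ev ze B ~= 0" "ALL xx:X. ev xx B ~= 0 --> h xx = ev xx A / ev xx B"
  unfolding fracs_def by blast
 have AL: "A : LR e" using A(1) Fi_subset by blast
 show "(%xx. c * h xx) : fracs ze (%e. Fi e)"
 proof (rule fractionsI[OF _ A(2,3)])
  show "cst c * A : Fi e" by (rule LR.gid_mult'[OF ps.cst_LR A(1)]) simp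
  fix xx assume x: "xx : X" "ev xx B ~= 0"
  have "ev xx (cst c) = c" using eta_character[OF x(1)] by (simp add: mchar_def)
  thus "c * h xx = ev xx (cst c * A) / ev xx B" using A(4) x ev_mult[OF x(1) ps.cst_LR AL] by simp
 qed
qed

text \<open>Multiplication by B is injective modulo the local ideals because B is invertible at the
  point. The same degree shift by a power of \<open>f0\<close> is bijective, so the dimensions
  agree.\<close>

lemma Q_mult_surjective:
 assumes z: "ze : V" and B: "B : LR e" "ev ze B ~= 0"
  and m: "(SUM j=1..n. int (d j)) - cdg < m" and y: "y : LR (m + e)"
 shows "EX v:LR m. y - B * v : Q ze (m + e)"
proof-
 have "e >= 0" using B LR.R_neg[of e] by (cases "e < 0") auto
 then obtain k where k: "e = int k" using nonneg_int_cases by blast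
 obtain C where C: "pv.qbasis (LR m) (Q ze m) C" using ps.sub_qbasis_exists[OF subset_refl Q_subspace[OF V_X[OF z]]] by blast
 have add: "b * (x + y) = b * x + b * y" and scale: "b * pscale c x = pscale c (b * x)"
  for b x y :: "(int \<times> (int ^ 'n)) \<Rightarrow>\<^sub>0 complex" and c by (simp_all add: distrib_left pscale_mult)
 have mem: "b * v : LR (m + e)" if "b : LR e" "v : LR m" for b v by (rule LR.R_mult'[OF that]) simp
 have iff: "b * v : Q ze (m + e) <-> v : Q ze m" if b: "b : LR e" "ev ze b ~= 0" and v: "v : LR m" for b v
  using Q_unit[OF V_X[OF z] b v] Q_mult[OF b(1), of v ze m "m + e"] by (auto simp: add.commute)
 have f: "f0 ^ k : LR e" "ev ze (f0 ^ k) ~= 0" using f0_power[of k] ev_power[OF V_X[OF z] f0(1), of k] f0(2)[OF z] by (simp_all add: k)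
 have surj: "EX v:LR m. v' - f0 ^ k * v : Q ze (m + e)" if v: "v' : LR (m + e)" for v'
 proof-
  obtain r where "r : LR m" "v' - f0 ^ k * r : Fi (m + e)" using f0_surjective[OF m, of v' k] v unfolding k by blast
  thus ?thesis using Fi_Q[OF V_X[OF z]] by (intro bexI[of _ r])
 qed
 note C' = qbasis_transfer[of pscale pscale, OF pv.qspace_axioms pv.qspace_axioms Q_subspace[OF V_X[OF z]] C
  add scale mem[OF f(1)] ps.LR_subspace iff[OF f] surj]
 show ?thesis by (rule qbasis_surj[OF pv.qspace_axioms Q_subspace[OF V_X[OF z]] Q_subset ps.LR_subspace C C'
   add scale mem[OF B(1)] ps.LR_subspace iff[OF B] y])
qed

text \<open>Division by \<open>f0 ^ k\<close> maps the degree k piece onto the local ring of the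
  subscheme, with the degree k piece of the local ideal as kernel.\<close>

lemma multiplicity_eq:
 assumes z: "ze : V" and m: "(SUM j=1..n. int (d j)) - cdg < int k" and C: "pv.qbasis (LR (int k)) (Q ze (int k)) C"
 shows "multiplicity_at Sg u I ze = enat (card C)"
proof-
 note zX = V_X[OF z]
 define ph where "ph r = (%xx. ev xx r / ev xx (f0 ^ k))" for r
 have fk: "f0 ^ k : LR (int k)" "ev ze (f0 ^ k) ~= 0" using f0_power[of k] ev_power[OF zX f0(1), of k] f0(2)[OF z] by simp_all
 have add: "ph (r + s) = ph r + ph s" for r s by (simp add: ph_def fun_eq_iff plus_fun_def mev_add add_divide_distrib)
 have scale: "ph (pscale c r) = (%xx. c * ph r xx)" for c r
 proof-
  have "ev xx (pscale c r) = c * ev xx r" for xx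
  proof-
   have "pkeys (pscale c r) <= pkeys r" by (auto simp: in_keys_iff lookup_pscale)
   hence "ev xx (pscale c r) = (SUM w:pkeys r. lkp (pscale c r) w * eta xx w)" by (subst mev_superset[of "pkeys r"]) auto
   thus ?thesis by (simp add: lookup_pscale mev_def monext_def sum_distrib_left algebra_simps)
  qed
  thus ?thesis by (simp add: ph_def fun_eq_iff)
 qed
 have mem: "ph r : fracs ze LR" if "r : LR (int k)" for r using that fk by (intro fractionsI) (simp_all add: ph_def)
 have iff: "ph r : fracs ze (%e. Fi e) <-> r : Q ze (int k)" if r: "r : LR (int k)" for r
 proof
  assume "ph r : fracs ze (%e. Fi e)"
  then obtain e A B where A: "A : Fi e" "B : LR e" "ev ze B ~= 0" "ALL xx:X. ev xx B ~= 0 --> ph r xx = ev xx A / ev xx B"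
   unfolding fracs_def by blast
  have AL: "A : LR e" using A(1) Fi_subset by blast
  define E where "E = r * B - A * f0 ^ k"
  have EL: "E : LR (int k + e)" unfolding E_def by (intro LR.R_diff LR.R_mult[OF r A(2)] LR.R_mult'[OF AL fk(1)]) simp
  \<comment> \<open>The equality of fractions holds only where both denominators are nonzero; the
    factor s makes the cross difference vanish everywhere.\<close>
  define s where "s = B * f0 ^ k"
  have sL: "s : LR (e + int k)" unfolding s_def by (rule LR.R_mult[OF A(2) fk(1)])
  have "s * E = 0"
  proof (rule vanishes_everywhere[OF LR.R_mult[OF sL EL]])
   fix xx assume x: "xx : X"
   have "ev xx s = ev xx B * ev xx (f0 ^ k)" unfolding s_def by (rule ev_mult[OF x A(2) fk(1)])
   moreover have "ev xx E = ev xx r * ev xx B - ev xx A * ev xx (f0 ^ k)"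
    unfolding E_def mev_diff by (simp add: ev_mult[OF x r A(2)] ev_mult[OF x AL fk(1)])
   moreover have "ev xx r / ev xx (f0 ^ k) = ev xx A / ev xx B" if "ev xx B ~= 0" using A(4) x that by (simp add: ph_def)
   ultimately have "ev xx s * ev xx E = 0" by (cases "ev xx B = 0"; cases "ev xx (f0 ^ k) = 0") (auto simp: field_simps)
   thus "ev xx (s * E) = 0" using ev_mult[OF x sL EL] by simp
  qed
  hence e: "(s * B) * r = (s * f0 ^ k) * A" by (simp add: E_def algebra_simps)
  have "(s * B) * r : Fi ((e + int k + e) + int k)" unfolding e by (rule LR.gid_mult'[OF LR.R_mult[OF sL fk(1)] A(1)]) simp
  moreover have "ev ze (s * B) ~= 0" using ev_mult[OF zX sL A(2)] ev_mult[OF zX A(2) fk(1)] A(3) fk(2) by (simp add: s_def)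
  ultimately show "r : Q ze (int k)" by (intro QI[OF r LR.R_mult[OF sL A(2)]])
 next
  assume "r : Q ze (int k)"
  then obtain e t where t: "t : LR e" "ev ze t ~= 0" "t * r : Fi (e + int k)" by (auto simp: Q_def)
  show "ph r : fracs ze (%e. Fi e)"
  proof (rule fractionsI[where P = "%e. Fi e" and e = "e + int k", OF t(3) LR.R_mult[OF t(1) fk(1)]])
   show "ev ze (t * f0 ^ k) ~= 0" using ev_mult[OF zX t(1) fk(1)] t(2) fk(2) by simp
   fix xx assume x: "xx : X" "ev xx (t * f0 ^ k) ~= 0"
   thus "ph r xx = ev xx (t * r) / ev xx (t * f0 ^ k)" using ev_mult[OF x(1) t(1) fk(1)] ev_mult[OF x(1) t(1) r] by (auto simp: ph_def)
  qed
 qed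
 have surj: "EX r:LR (int k). h - ph r : fracs ze (%e. Fi e)" if h: "h : fracs ze LR" for h
 proof-
  obtain e A B where A: "A : LR e" "B : LR e" "ev ze B ~= 0" "ALL xx:X. ev xx B ~= 0 --> h xx = ev xx A / ev xx B"
   using h unfolding fracs_def by blast
  have "A * f0 ^ k : LR (int k + e)" by (rule LR.R_mult'[OF A(1) fk(1)]) simp
  then obtain r where r: "r : LR (int k)" "A * f0 ^ k - B * r : Q ze (int k + e)" using Q_mult_surjective[OF z A(2,3) m] by blast
  obtain e' t where t: "t : LR e'" "ev ze t ~= 0" "t * (A * f0 ^ k - B * r) : Fi (e' + (int k + e))" using r(2) by (auto simp: Q_def)
  have N: "A * f0 ^ k - B * r : LR (int k + e)" using r(2) Q_subset by blast
  have D: "B * f0 ^ k : LR (int k + e)" by (rule LR.R_mult'[OF A(2) fk(1)]) simp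
  have "h - ph r : fracs ze (%e. Fi e)"
  proof (rule fractionsI[where P = "%e. Fi e" and e = "e' + (int k + e)", OF t(3) LR.R_mult[OF t(1) D]])
   show "ev ze (t * (B * f0 ^ k)) ~= 0" using ev_mult[OF zX t(1) D] ev_mult[OF zX A(2) fk(1)] t(2) A(3) fk(2) by simp
   fix xx assume x: "xx : X" "ev xx (t * (B * f0 ^ k)) ~= 0"
   have e1: "ev xx (t * (B * f0 ^ k)) = ev xx t * (ev xx B * ev xx (f0 ^ k))"
    using ev_mult[OF x(1) t(1) D] ev_mult[OF x(1) A(2) fk(1)] by simp
   have e2: "ev xx (t * (A * f0 ^ k - B * r)) = ev xx t * (ev xx A * ev xx (f0 ^ k) - ev xx B * ev xx r)"
    using ev_mult[OF x(1) t(1) N] ev_mult[OF x(1) A(1) fk(1)] ev_mult[OF x(1) A(2) r(1)] by (simp add: mev_diff)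
   have nz: "ev xx t ~= 0" "ev xx B ~= 0" "ev xx (f0 ^ k) ~= 0" using x(2) unfolding e1 by auto
   show "(h - ph r) xx = ev xx (t * (A * f0 ^ k - B * r)) / ev xx (t * (B * f0 ^ k))"
    unfolding e1 e2 using nz A(4) x(1) by (simp add: ph_def fun_diff_def field_simps)
  qed
  thus ?thesis using r(1) by blast
 qed
 note q = qbasis_transfer[of pscale "%c h xx. c * h xx", OF pv.qspace_axioms fv.qspace_axioms fracs_subspace[OF zX] C
  add scale mem ps.LR_subspace iff surj]
 show ?thesis using fv.quotient_dim_qbasis[OF fracs_subspace[OF zX] q(1)] q(2)
  by (simp add: multiplicity_at_def germs_cring[OF z] germs_chart_ideal[OF z Fi_subset])
qed

text \<open>The value of the Hilbert function is transported to a degree large enough for the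
  decomposition, where it is the sum of the multiplicities. It is positive because the subvariety
  has a point, whereas negative degrees contribute 0; hence m >= 0.\<close>

lemma degree_eq:
 assumes m: "(SUM j=1..n. int (d j)) - cdg < m"
 shows "scheme_degree Sg u I = enat (nat (ps.hf n m))" "m >= 0"
proof-
 obtain m1 where m1: "(SUM j=1..n. int (d j)) - cdg < m1" "ALL m>=m1. ALL C. (ALL ze:V. pv.qbasis (LR m) (Q ze m) (C ze)) -->
   ps.hf n m = (SUM ze:V. int (card (C ze)))" using hf_sum by (elim exE conjE)
 define k where "k = nat (max m m1)"
 have k: "int k >= m1" "int k >= m" unfolding k_def by linarith+
 have "ALL ze:V. EX C. pv.qbasis (LR (int k)) (Q ze (int k)) C" using ps.sub_qbasis_exists[OF subset_refl Q_subspace[OF V_X]] by blast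
 then obtain C where C: "ALL ze:V. pv.qbasis (LR (int k)) (Q ze (int k)) (C ze)" by (rule bchoice[THEN exE])
 have hk: "ps.hf n m = (SUM ze:V. int (card (C ze)))" using m1(2)[rule_format, OF k(1) bspec[OF C]] hf_constant'[OF m k(2)] by simp
 have "scheme_degree Sg u I = (SUM ze:V. enat (card (C ze)))"
  unfolding scheme_degree_def using C m1(1) k(1) by (intro sum.cong refl multiplicity_eq[of _ k]) auto
 also have "(SUM ze:W. enat (card (C ze))) = enat (SUM ze:W. card (C ze))" for W
  by (induction W rule: infinite_finite_induct) (simp_all add: zero_enat_def)
 finally show "scheme_degree Sg u I = enat (nat (ps.hf n m))" using hk by (simp add: nat_int flip: of_nat_sum)
 obtain ze where z: "ze : V" using V_nonempty by blast
 have "C ze ~= {}"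
 proof
  assume "C ze = {}"
  hence "f0 ^ k : Q ze (int k)" using bspec[OF C z] f0_power[of k] by (simp add: pv.qbasis_def pv.qspans_def)
  then obtain e s where s: "s : LR e" "ev ze s ~= 0" "s * f0 ^ k : Fi (e + int k)" by (auto simp: Q_def)
  hence "ev ze (s * f0 ^ k) = 0" using Fi_vanishes z by blast
  thus False using ev_mult[OF V_X[OF z] s(1) f0_power] ev_power[OF V_X[OF z] f0(1), of k] f0(2)[OF z] s(2) by simp
 qed
 hence "card (C ze) > 0" using bspec[OF C z] by (simp add: pv.qbasis_def card_gt_0_iff)
 hence pos: "ps.hf n m > 0" unfolding hk using z V_finite by (intro sum_pos2[of _ ze]) auto
 show "m >= 0"
 proof (rule ccontr)
  assume "~ m >= 0"
  hence "LR m = {0}" by (intro LR.R_neg) simp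
  hence "pv.qbasis (LR m) (ps.Fid n m) {}" using pv.subspace_0[OF ps.Fid_subspace] by (simp add: pv.qbasis_def pv.qspans_def pv.qindep_def)
  thus False using ps.hf_eq pos by fastforce
 qed
qed

end

section \<open>Regularity\<close>

lemma torus_divisors_simps [simp]:
 "carrier torus_divisors = UNIV" "v \<otimes>\<^bsub>torus_divisors\<^esub> w = v + w" "\<one>\<^bsub>torus_divisors\<^esub> = 0"
 by (simp_all add: torus_divisors_def)

lemma torus_divisors_group: "comm_group torus_divisors"
 by (rule comm_groupI) (auto simp: algebra_simps intro: exI[of _ "- x" for x])

lemma torus_divisors_inv: "inv\<^bsub>torus_divisors\<^esub> v = - v"
proof-
 interpret comm_group torus_divisors by (rule torus_divisors_group)
 show ?thesis by (rule inv_equality) simp_all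
qed

lemma torus_divisors_nat_pow: "v [^]\<^bsub>torus_divisors\<^esub> (k :: nat) = int k *s v"
proof-
 interpret comm_group torus_divisors by (rule torus_divisors_group)
 show ?thesis by (induction k) (simp_all add: vec_eq_iff algebra_simps)
qed

lemma torus_divisors_int_pow: "v [^]\<^bsub>torus_divisors\<^esub> (k :: int) = k *s v"
proof-
 interpret comm_group torus_divisors by (rule torus_divisors_group)
 show ?thesis by (simp add: int_pow_def2 torus_divisors_nat_pow torus_divisors_inv vec_eq_iff)
qed

lemma divisor_class_hom: "group_hom torus_divisors (Cl u) (divisor_class u)"
proof-
 interpret comm_group torus_divisors by (rule torus_divisors_group)
 have add: "cdiv u (v + w) = cdiv u v + cdiv u w" for v w using additive_cdiv[of u] by (simp add: additive_map_def)
 have neg: "cdiv u (- v) = - cdiv u v" for v by (simp add: cdiv_def vec_eq_iff pairing_minus_right)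
 have "subgroup (range (cdiv u)) torus_divisors" by (rule subgroupI) (auto simp: torus_divisors_inv simp flip: add neg)
 then interpret N: normal "range (cdiv u)" torus_divisors by (rule normal_iff_subgroup[THEN iffD2])
 have "divisor_class u = (%a. range (cdiv u) #>\<^bsub>torus_divisors\<^esub> a)" by (simp add: fun_eq_iff divisor_class_def)
 thus ?thesis using N.factorgroup_is_group N.r_coset_hom_Mod by (simp add: group_hom_def group_hom_axioms_def Cl_def is_group)
qed

lemma divisor_class_carrier: "divisor_class u v : carrier (Cl u)"
 using group_hom.hom_closed[OF divisor_class_hom] by simp

lemma divisor_class_nat_pow: "divisor_class u v [^]\<^bsub>Cl u\<^esub> (k :: nat) = divisor_class u (int k *s v)"
 using group_hom.hom_nat_pow[OF divisor_class_hom, of v u k] by (simp add: torus_divisors_nat_pow)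

lemma divisor_class_int_pow: "divisor_class u v [^]\<^bsub>Cl u\<^esub> (k :: int) = divisor_class u (k *s v)"
 using group_hom.hom_int_pow[OF divisor_class_hom, of v u k] by (simp add: torus_divisors_int_pow)

lemma divisor_class_mult: "divisor_class u v \<otimes>\<^bsub>Cl u\<^esub> divisor_class u w = divisor_class u (v + w)"
 using group_hom.hom_mult[OF divisor_class_hom, of v w u] by simp

context generic_system
begin

abbreviation piece :: "int => 'k cox set" where "piece m == cox_piece (divisor_class u (m *s a))"

lemma I_add: "g : I ==> h : I ==> g + h : I" and I_mult: "g : I ==> k * g : I" and I_0: "0 : I"
 unfolding I ideal_gen_def
 by (rule module.span_add[OF module_mult] module.span_scale[OF module_mult] module.span_zero[OF module_mult]; assumption)+

lemma piece_dimension: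
 assumes m: "(SUM j=1..n. int (d j)) - cdg < m"
 shows "quotient_dim pscale (piece m) (I Int piece m) = scheme_degree Sg u I"
proof-
 obtain B where B: "pv.qbasis (LR m) (ps.Fid n m) B" "ps.hf n m = int (card B)" by (rule ps.hf_basis)
 have W: "pv.subspace (I Int piece m)" unfolding pv.subspace_def
 proof (intro conjI ballI allI)
  show "0 : I Int piece m" using I_0 by (simp add: cox_piece_def)
  fix x y assume "x : I Int piece m" "y : I Int piece m"
  thus "x + y : I Int piece m" using I_add keys_add[of x y] by (auto simp: cox_piece_def subset_iff)
 next
  fix c x assume x: "x : I Int piece m"
  have "pkeys (pscale c x) <= pkeys x" by (auto simp: in_keys_iff lookup_pscale)
  moreover have "pscale c x : I" using I_mult x by (simp add: pscale_cst)
  ultimately show "pscale c x : I Int piece m" using x by (auto simp: cox_piece_def)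
 qed
 have add: "co (x + y) = co x + co y" for x y by (simp add: co_def monmap_add)
 have iff: "co r : I Int piece m <-> r : ps.Fid n m" if "r : LR m" for r
  using ideal_piece[OF co_piece[OF that]] co_piece[OF that] dh_co[OF LR_monalg[OF that]] by (simp add: Fid_Fi)
 have surj: "EX r:LR m. g - co r : I Int piece m" if "g : piece m" for g
  using that I_0 by (intro bexI[of _ "dh g"] dh_LR) (simp_all add: co_dh cox_piece_def)
 note q = qbasis_transfer[of pscale pscale, OF pv.qspace_axioms pv.qspace_axioms W B(1) add co_pscale co_piece
  ps.LR_subspace iff surj]
 show ?thesis using pv.quotient_dim_qbasis[OF W q(1)] q(2) degree_eq(1)[OF m] B(2) by simp
qed

text \<open>At a point in the orbit of \<open>ta\<close>, the section \<open>w0\<close> involves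
  exactly the variables outside \<open>ta\<close>, so its l-th power is divisible by
  \<open>x_hat u ta ^ l\<close> and carries g into the ideal. It does not vanish at the point, so g
  lies in every local ideal.\<close>

lemma saturated:
 assumes g: "g : piece m" and s: "g : saturation I (irrelevant_ideal Sg u)"
 shows "g : I"
proof-
 obtain l where l: "!!b. b : ideal_power (irrelevant_ideal Sg u) l ==> g * b : I" using s by (auto simp: saturation_def)
 have xl: "x_hat u ta ^ k : ideal_power (irrelevant_ideal Sg u) k" if "ta : Sg" for ta k
 proof (induction k)
  case (Suc k)
  have "x_hat u ta : irrelevant_ideal Sg u" unfolding irrelevant_ideal_def ideal_gen_def
   using that by (intro module.span_base[OF module_mult]) simp
  thus ?case using Suc unfolding ideal_power.simps ideal_gen_def by (intro module.span_base[OF module_mult]) auto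
 qed simp
 have "dh g : Q ze m" if z: "ze : V" for ze
 proof-
  obtain ta th where t: "ta : Sg" "mchar UNIV th" "ze = opt ta th" "eta ze = etac ta th" by (rule pointE[OF V_X[OF z]])
  obtain w0 where w0: "w0 : L" "fst w0 > 0" "!!i. ell i w0 = 0 <-> i : crays ta" using V_point_face[OF t(1,2)] z t(3) by blast
  let ?w = "nmul l w0"
  define s where "s = msing ?w (1::complex)"
  have wL: "?w : L" by (rule nmul_mem[OF submon_L w0(1)])
  have sL: "s : LR (fst ?w)" unfolding s_def by (rule LR_single[OF wL refl])
  have "eta ze ?w ~= 0" unfolding t(4) etac_nonzero[OF t(1,2)] using w0(3) by (simp add: ell_nmul)
  hence nz: "ev ze s ~= 0" by (simp add: s_def)
  have "co (s * dh g) = co s * g" by (rule laur_inj) (simp add: laur_mult co_laur monalg_mult[OF submon_L]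
    LR_monalg[OF sL] LR_monalg[OF dh_LR[OF g]] cox_piece_laur[OF g] monmap_mult[OF additive_iota])
  moreover have "co s = monmap cnat (msing (iota ?w - nmul l (vec_lambda (%i. if i : crays ta then 0 else 1))) 1) * x_hat u ta ^ l"
  proof (rule laur_inj)
   let ?x = "vec_lambda (%i. if i : crays ta then 0 else 1) :: int ^ 'k"
   have nx: "nmul l ?x $ i = (if i : crays ta then 0 else int l)" for i by (induction l) (simp_all add: nmul_Suc)
   have "laur (x_hat u ta ^ l) = laur (x_hat u ta) ^ l" unfolding laur_monmap by (rule monmap_power[OF additive_cint])
   hence x: "laur (x_hat u ta ^ l) = msing (nmul l ?x) 1" by (simp add: x_hat_laurent msing_power)
   have "int l * 1 <= int l * ell i w0" if "i ~: crays ta" for i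
   proof-
    have "ell i w0 ~= 0" "ell i w0 >= 0" using that w0 by (auto simp: L_def)
    thus ?thesis by (intro mult_left_mono) auto
   qed
   hence "laur (monmap cnat (msing (iota ?w - nmul l ?x) 1)) = msing (iota ?w - nmul l ?x) 1"
    using w0(1) by (intro laur_surj) (auto simp: nx ell_nmul L_def split: if_splits)
   moreover have cs: "laur (co s) = msing (iota ?w) 1" unfolding co_laur[OF LR_monalg[OF sL]] by (simp add: s_def monmap_single)
   ultimately show "laur (co s) = laur (monmap cnat (msing (iota ?w - nmul l ?x) 1) * x_hat u ta ^ l)"
    by (simp add: laur_mult x mult_single)
  qed
  ultimately have "co (s * dh g) = monmap cnat (msing (iota ?w - nmul l (vec_lambda (%i. if i : crays ta then 0 else 1))) 1) * (g * x_hat u ta ^ l)"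
   by (simp only: ac_simps)
  hence "co (s * dh g) : I" using I_mult[OF l[OF xl[OF t(1)]]] by simp
  moreover have sg: "s * dh g : LR (fst ?w + m)" by (rule LR.R_mult[OF sL dh_LR[OF g]])
  ultimately have "s * dh g : Fi (fst ?w + m)" using ideal_piece[OF co_piece[OF sg]] dh_co[OF LR_monalg[OF sg]] by simp
  thus ?thesis by (rule QI[OF dh_LR[OF g] sL nz])
 qed
 hence "dh g : Fi m" by (rule Q_inter[OF dh_LR[OF g]])
 thus ?thesis using ideal_piece[OF g] by simp
qed

text \<open>The m-th power of the section \<open>vtx ta\<close> has exponent 0 at the rays of
  \<open>ta\<close>, and all other Cox coordinates of the point are nonzero. For m >= 0 its
  exponents are nonnegative.\<close>

lemma basepoint_free:
 assumes "m >= 0"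
 shows "basepoint_free_on Sg u I (divisor_class u (m *s a))"
 unfolding basepoint_free_on_def
proof
 fix ze assume "ze : V"
 then obtain ta th where t: "ta : Sg" "mchar UNIV th" "ze = opt ta th" "eta ze = etac ta th" using pointE V_X by metis
 let ?w = "(m, m *s vtx ta)"
 have ell: "ell i ?w = m * (pairing (u i) (vtx ta) + a $ i)" for i by (simp add: ell_def pairing_scale_right algebra_simps)
 have wL: "?w : L" using assms vtx(1)[OF t(1)] by (simp add: L_def ell)
 let ?f = "co (msing ?w 1)"
 have "?f : piece m" by (rule co_piece[OF LR_single[OF wL]]) simp
 moreover have "ze ~: Var_section Sg u ?f"
 proof
  assume "ze : Var_section Sg u ?f"
  then obtain x where x: "cox_quotient Sg u x = ze" "cox_eval ?f x = 0" by (auto simp: Var_section_def)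
  have "(x $ i) ^ (cnat (iota ?w) $ i) ~= 0" for i
  proof (cases "i : crays ta")
   case True
   thus ?thesis using vtx(2)[OF t(1) True] by (simp add: cnat_def ell)
  next
   case False
   thus ?thesis using cox_quotient_nonzero[OF t(1) _ False, of x th] x(1) t(3) by simp
  qed
  hence "cox_eval ?f x ~= 0" by (simp add: co_def monmap_single cox_eval_def)
  thus False using x(2) by simp
 qed
 ultimately show "~ basepoint Sg u (divisor_class u (m *s a)) ze" by (auto simp: basepoint_def)
qed

theorem multiple_in_Reg:
 assumes m: "(SUM j=1..n. int (d j)) - cdg < m"
 shows "divisor_class u (m *s a) : Reg Sg u I"
proof-
 have "g : saturation I (irrelevant_ideal Sg u)" if "g : I" for g
  unfolding saturation_def using I_mult[OF that] by (auto simp: mult.commute intro: exI[of _ 0])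
 hence "I Int piece m = saturation I (irrelevant_ideal Sg u) Int piece m" using saturated[of _ m] by blast
 thus ?thesis unfolding Reg_def using divisor_class_carrier piece_dimension[OF m] basepoint_free[OF degree_eq(2)[OF m]] by blast
qed

end

theorem theorem4p5:
  fixes \<Sigma> :: "(real ^ 'n) set set"
    and u :: "'k::finite \<Rightarrow> int ^ 'n"
    and a :: "int ^ 'k"
    and \<alpha>\<^sub>0 :: "(int ^ 'k) set"
    and P :: "(real ^ 'n) set"
    and d :: "nat \<Rightarrow> nat"
    and f :: "nat \<Rightarrow> 'k cox"
    and I :: "'k cox set"
    and c :: nat
  assumes "complete_fan \<Sigma>"
    and "ray_generators \<Sigma> u"
    and "\<alpha>\<^sub>0 = divisor_class u a"
    and "\<alpha>\<^sub>0 \<in> Pic_nef \<Sigma> u"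
    and "P = polytope_of u a"
    and "aff_dim P = int CARD('n)"
    and "\<And>j. j \<in> {1..CARD('n)} \<Longrightarrow> f j \<in> cox_piece (\<alpha>\<^sub>0 [^]\<^bsub>Cl u\<^esub> d j)"
    and "I = ideal_gen (f ` {1..CARD('n)})"
    and "complete_intersection \<Sigma> u I"
    and "zero_dimensional \<Sigma> u I"
    and "c = codegree P"
  shows "(\<forall>t::int. t < int c \<longrightarrow>
            \<alpha>\<^sub>0 [^]\<^bsub>Cl u\<^esub> ((\<Sum>j=1..CARD('n). int (d j)) - t) \<in> Reg \<Sigma> u I) \<and>
         regularity_pair \<Sigma> u I
           (\<alpha>\<^sub>0 [^]\<^bsub>Cl u\<^esub> ((\<Sum>j=1..CARD('n). int (d j)) - (int c - 1))) \<alpha>\<^sub>0"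
proof-
 interpret zs: zero_dim_system \<Sigma> u a f d I "CARD('n)"
 proof
  show "complete_fan \<Sigma>" "ray_generators \<Sigma> u" "zero_dimensional \<Sigma> u I" by fact+
  show "divisor_class u a : Pic_nef \<Sigma> u" using assms(3,4) by simp
  show "aff_dim (polytope_of u a) = int CARD('n)" using assms(5,6) by simp
  show "f j : cox_piece (divisor_class u (int (d j) *s a))" if "j : {1..CARD('n)}" for j
   using assms(7)[OF that] by (simp add: assms(3) divisor_class_nat_pow)
  show "I = ideal_gen (f ` {1..CARD('n)})" by fact
 qed (rule refl)
 obtain f0 where "f0 : zs.LR 1" "ALL \<zeta>:Var \<Sigma> u I. zs.ev \<zeta> f0 ~= 0" using zs.generic_section by blast
 then interpret gs: generic_system \<Sigma> u a f d I "CARD('n)" f0 by unfold_locales auto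
 let ?D = "SUM j=1..CARD('n). int (d j)"
 have c: "gs.cdg = int c" using assms(5,11) by simp
 \<comment> \<open>The multiples with t < c are those with m above the sum of the \<open>d j\<close>
   minus c; the two members of the pair are the cases t = c - 1 and t = c - 2.\<close>
 have R: "divisor_class u (m *s a) : Reg \<Sigma> u I" if "?D - int c < m" for m using gs.multiple_in_Reg[of m] that c by simp
 have "divisor_class u ((?D - (int c - 1)) *s a) \<otimes>\<^bsub>Cl u\<^esub> divisor_class u a = divisor_class u ((?D - (int c - 1) + 1) *s a)"
  unfolding divisor_class_mult by (rule arg_cong[of _ _ "divisor_class u"]) (simp add: vec_eq_iff algebra_simps)
 moreover have "basepoint_free_on \<Sigma> u I (divisor_class u a)" using gs.basepoint_free[of 1] by simp
 ultimately have rp: "regularity_pair \<Sigma> u I (divisor_class u ((?D - (int c - 1)) *s a)) (divisor_class u a)"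
  using R[of "?D - (int c - 1)"] R[of "?D - (int c - 1) + 1"] by (simp add: regularity_pair_def divisor_class_carrier)
 show ?thesis unfolding assms(3) divisor_class_int_pow by (intro conjI allI impI R rp) linarith
qed

end
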